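(* Let $\mathcal{X}_{+},\mathcal{X}_{-}$ be real normed spaces and $\theta_{\pm}:\mathcal{M}(S)\to\mathcal{X}_{\pm}$ two linear $\sigma$-normal maps. Let $g_{-}:\mathcal{X}_{-}\to\mathbb{R}$ be continuous and convex, such that there is $R_{0}\in\mathbb{R}^{+}$ for which $\{x\in\mathcal{X}_{-}^{\ast}:\Vert x\Vert_{\mathrm{op}}\le R,\ g_{-}^{\ast}(x)<\infty\}$ is nonempty and weak$^{\ast}$-closed for all $R\in[R_{0},\infty)$, and such that $g_{-}^{\ast}$ has minimal linear growth $\Vert\theta_{-}\Vert_{\mathrm{op}}$. Let $g_{+}:\mathcal{X}_{+}\to\mathbb{R}$ be continuous, convex and bounded on bounded sets, such that $g_{+}^{\ast}(\mathcal{X}_{+}^{\ast})\subseteq\mathbb{R}$ and $g_{+}^{\ast}$ has minimal linear growth $\Vert\theta_{+}\Vert_{\mathrm{op}}$. Then $$\mathrm{co}(E_{P}\cap\mathcal{P}_{\mathrm{erg}}(T))\subseteq M_{\mathfrak{F}^{\flat}}\subseteq\overline{\mathrm{co}}(E_{P})=E_{\mathfrak{F}^{\flat}},$$ and if the pair $(\theta_{-},\theta_{+})$ is additionally Hölder-type, then $E_{\mathfrak{F}^{\flat}}=M_{\mathfrak{F}^{\flat}}$.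
   Context: Symbolic setting: $(\Omega,d)$ is a compact metric space with $\max d(\Omega\times\Omega)=1$; $\mathrm{m}$ is a fixed Borel probability measure on $\Omega$ with support $\Omega$; $\Sigma=\Omega^{\mathbb{N}}$ with the product topology, metrized by $d_{\eta}(\sigma,\sigma')=(1-\eta)\sum_{n\ge1}\eta^{n-1}d(\omega_{n},\omega_{n}')$ for a fixed $\eta\in(0,1)$; $C(\Sigma)$ is the Banach space of real continuous functions with the sup norm, $C^{\alpha}(\Sigma)$ the $\alpha$-Hölder functions with respect to $d_{\eta}$; $T$ is the shift $T(\omega_{1},\omega_{2},\dots)=(\omega_{2},\omega_{3},\dots)$. $\mathcal{P}\subseteq C(\Sigma)^{\ast}$ is the set of Borel probability measures on $\Sigma$, $\mathcal{P}(T)$ the convex weak$^{\ast}$-compact metrizable set of $T$-invariant ones, $\mathcal{P}_{\mathrm{erg}}(T)$ the ergodic ones (the extreme points of $\mathcal{P}(T)$); $\mathrm{co}$ is the convex hull and $\overline{\mathrm{co}}$ the weak$^{\ast}$-closed convex hull; $\mu(\varphi)=\int\varphi\,\mathrm{d}\mu$. Each $\mu\in\mathcal{P}(T)$ has a unique Choquet measure $\xi_{\mu}$: the Borel probability measure on $\mathcal{P}(T)$ with $\xi_{\mu}(\mathcal{P}_{\mathrm{erg}}(T))=1$ and barycenter $\mu$. $S=\{\varphi\in C(\Sigma):\Vert\varphi\Vert_{\infty}\le1\}$ with the sup-norm metric; $\mathcal{M}(S)$ is the Banach space of bounded real Borel-measurable functions on $S$ with the sup norm; $\mu_{S}\in\mathcal{M}(S)$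 is $\mu_{S}(\varphi)=\mu(\varphi)$. A map $\theta$ from $\mathcal{M}(S)$ into a normed space is $\sigma$-normal if $\theta(f_{n})\to\theta(f)$ in norm for every bounded sequence $(f_{n})\subseteq\mathcal{M}(S)$ converging point-wise to $f\in\mathcal{M}(S)$. Hölder-type: for each $y_{\pm}\in\mathcal{X}_{\pm}^{\ast}$ there is a unique $\Theta_{y_{-},y_{+}}\in C(\Sigma)$ with $y_{+}(\theta_{+}(\mu_{S}))-y_{-}(\theta_{-}(\mu_{S}))=\mu(\Theta_{y_{-},y_{+}})$ for all $\mu\in\mathcal{P}$. The pair $(\theta_{-},\theta_{+})$ is Hölder-type if for all $y_{\pm}$ there is $\alpha=\alpha_{y_{-},y_{+}}\in(0,1]$ with $\Theta_{y_{-},y_{+}}\in C^{\alpha}(\Sigma)$. Entropy: for $\varphi\in C(\Sigma)$, $\mathcal{L}_{0}^{\mathrm{m}}\varphi(\sigma)=\int_{\Omega}\varphi(\omega_{0}\sigma)\,\mathrm{m}(\mathrm{d}\omega_{0})$, where $\omega_{0}\sigma=(\omega_{0},\omega_{1},\dots)$ for $\sigma=(\omega_{1},\omega_{2},\dots)$; for $\mu\in\mathcal{P}(T)$, $h(\mu)=\inf_{\varphi}\int_{\Sigma}\ln(\mathcal{L}_{0}^{\mathrm{m}}\varphi(\sigma)/\varphi(\sigma))\,\mu(\mathrm{d}\sigma)\in[-\infty,0]$, infimum over strictly positive $\varphi\in C(\Sigma)$. Functionals on $\mathcal{P}(T)$: $P(\mu)=h(\mu)-g_{-}(\theta_{-}(\mu_{S}))+g_{+}(\theta_{+}(\mu_{S}))$;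 $\mathfrak{F}^{\flat}(\mu)=\int_{\mathcal{P}_{\mathrm{erg}}(T)}g_{+}(\theta_{+}(\nu_{S}))\,\xi_{\mu}(\mathrm{d}\nu)-\int_{\mathcal{P}_{\mathrm{erg}}(T)}g_{-}(\theta_{-}(\nu_{S}))\,\xi_{\mu}(\mathrm{d}\nu)+h(\mu)$. For $\Phi\in\{P,\mathfrak{F}^{\flat}\}$: $M_{\Phi}=\{\mu\in\mathcal{P}(T):\Phi(\mu)=\sup\Phi(\mathcal{P}(T))\}$ and $E_{\Phi}=\{\mu\in\mathcal{P}(T):\exists(\mu_{n})\subseteq\mathcal{P}(T)$ with $\mu_{n}\to\mu$ weak$^{\ast}$ and $\Phi(\mu_{n})\to\sup\Phi(\mathcal{P}(T))\}$. Convex analysis: $\mathbb{R}^{+}=(0,\infty)$. Duals carry the weak$^{\ast}$ topology; $\Vert\cdot\Vert_{\mathrm{op}}$ is the operator norm; $B(0,R)=\{y\in\mathcal{X}^{\ast}:\Vert y\Vert_{\mathrm{op}}\le R\}$. $g^{\ast}(x)=\sup_{y\in\mathcal{X}}\{x(y)-g(y)\}$ for $x\in\mathcal{X}^{\ast}$; $g^{\ast}$ has minimal linear growth $\lambda$ if $\lim_{R\to\infty}\sup_{y\in\mathcal{X}^{\ast}\setminus B(0,R)}\{\lambda\Vert y\Vert_{\mathrm{op}}-g^{\ast}(y)\}=-\infty$. *)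

theory Defs
  imports "HOL-Probability.Probability"
begin

section \<open>Closed unit balls and bounded Borel functions\<close>

typedef (overloaded) 'v unit_ball = "cball (0 :: 'v::real_normed_vector) 1"
  morphisms ball_vec Abs_unit_ball
  by (rule exI[of _ 0]) simp

instantiation unit_ball :: (real_normed_vector) metric_space
begin

definition dist_unit_ball :: "'a unit_ball \<Rightarrow> 'a unit_ball \<Rightarrow> real"
  where "dist_unit_ball x y = dist (ball_vec x) (ball_vec y)"

definition uniformity_unit_ball :: "('a unit_ball \<times> 'a unit_ball) filter"
  where "uniformity_unit_ball = (INF e\<in>{0 <..}. principal {(x, y). dist x y < e})"

definition open_unit_ball :: "'a unit_ball set \<Rightarrow> bool"
  where "open_unit_ball U = (\<forall>x\<in>U. \<forall>\<^sub>F (x', y) in uniformity. x' = x \<longrightarrow> y \<in> U)"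

instance
  by standard
    (auto simp: dist_unit_ball_def ball_vec_inject dist_triangle2
      uniformity_unit_ball_def open_unit_ball_def)

end

typedef (overloaded) 's bmeas =
  "{f :: 's::topological_space \<Rightarrow> real. f \<in> borel_measurable borel \<and> bounded (range f)}"
  morphisms apply_bmeas Bmeas
  by (rule exI[of _ "\<lambda>_. 0"]) auto

setup_lifting type_definition_bmeas

lemma bmeas_eqI: "(\<And>x. apply_bmeas f x = apply_bmeas g x) \<Longrightarrow> f = g"
  by (simp add: apply_bmeas_inject[symmetric] fun_eq_iff)

lemma bdd_above_bmeas: "bdd_above (range (\<lambda>x. \<bar>apply_bmeas f x\<bar>))"
proof -
  have "bounded (range (apply_bmeas f))"
    using apply_bmeas[of f] by simp
  then obtain B where "\<And>x. \<bar>apply_bmeas f x\<bar> \<le> B"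
    by (auto simp: bounded_iff)
  then show ?thesis
    by (auto intro!: bdd_aboveI2)
qed

instantiation bmeas :: (topological_space) real_normed_vector
begin

lift_definition zero_bmeas :: "'a bmeas" is "\<lambda>_. 0"
  by auto

lift_definition plus_bmeas :: "'a bmeas \<Rightarrow> 'a bmeas \<Rightarrow> 'a bmeas" is "\<lambda>f g x. f x + g x"
  by (auto intro: bounded_plus_comp)

lift_definition uminus_bmeas :: "'a bmeas \<Rightarrow> 'a bmeas" is "\<lambda>f x. - f x"
  by auto

lift_definition minus_bmeas :: "'a bmeas \<Rightarrow> 'a bmeas \<Rightarrow> 'a bmeas" is "\<lambda>f g x. f x - g x"
  by (auto intro: bounded_minus_comp)

lift_definition scaleR_bmeas :: "real \<Rightarrow> 'a bmeas \<Rightarrow> 'a bmeas" is "\<lambda>r f x. r * f x"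
  using bounded_scaleR_comp by fastforce

definition norm_bmeas :: "'a bmeas \<Rightarrow> real"
  where "norm_bmeas f = (SUP x. \<bar>apply_bmeas f x\<bar>)"

definition dist_bmeas :: "'a bmeas \<Rightarrow> 'a bmeas \<Rightarrow> real"
  where "dist_bmeas f g = norm (f - g)"

definition sgn_bmeas :: "'a bmeas \<Rightarrow> 'a bmeas"
  where "sgn_bmeas f = inverse (norm f) *\<^sub>R f"

definition uniformity_bmeas :: "('a bmeas \<times> 'a bmeas) filter"
  where "uniformity_bmeas = (INF e\<in>{0 <..}. principal {(x, y). dist x y < e})"

definition open_bmeas :: "'a bmeas set \<Rightarrow> bool"
  where "open_bmeas U = (\<forall>x\<in>U. \<forall>\<^sub>F (x', y) in uniformity. x' = x \<longrightarrow> y \<in> U)"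

lemma abs_apply_bmeas_le_norm: "\<bar>apply_bmeas f x\<bar> \<le> norm f"
  unfolding norm_bmeas_def by (rule cSUP_upper[OF _ bdd_above_bmeas]) simp

instance
proof
  fix f g :: "'a bmeas" and r :: real
  show "(norm f = 0) = (f = 0)"
  proof
    assume "norm f = 0"
    then have "apply_bmeas f x = 0" for x
      using abs_apply_bmeas_le_norm[of f x] by simp
    then show "f = 0"
      by (intro bmeas_eqI) (simp add: zero_bmeas.rep_eq)
  qed (simp add: norm_bmeas_def zero_bmeas.rep_eq)
  show "norm (f + g) \<le> norm f + norm g"
    unfolding norm_bmeas_def[of "f + g"]
  proof (rule cSUP_least)
    fix x
    show "\<bar>apply_bmeas (f + g) x\<bar> \<le> norm f + norm g"
      using abs_apply_bmeas_le_norm[of f x] abs_apply_bmeas_le_norm[of g x]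
      by (simp add: plus_bmeas.rep_eq)
  qed simp
  have le: "norm (r *\<^sub>R f) \<le> \<bar>r\<bar> * norm f" for r and f :: "'a bmeas"
    unfolding norm_bmeas_def[of "r *\<^sub>R f"]
    by (rule cSUP_least)
      (simp_all add: scaleR_bmeas.rep_eq abs_mult mult_left_mono abs_apply_bmeas_le_norm)
  show "norm (r *\<^sub>R f) = \<bar>r\<bar> * norm f"
  proof (cases "r = 0")
    case True
    then show ?thesis
      by (simp add: norm_bmeas_def scaleR_bmeas.rep_eq)
  next
    case False
    have "f = inverse r *\<^sub>R (r *\<^sub>R f)"
      using False by (intro bmeas_eqI) (simp add: scaleR_bmeas.rep_eq)
    then have "norm f \<le> \<bar>inverse r\<bar> * norm (r *\<^sub>R f)"
      using le[of "inverse r" "r *\<^sub>R f"] by simp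
    then have "\<bar>r\<bar> * norm f \<le> norm (r *\<^sub>R f)"
      using False by (simp add: field_simps abs_inverse)
    then show ?thesis
      using le[of r f] by simp
  qed
qed (auto intro!: bmeas_eqI simp: dist_bmeas_def sgn_bmeas_def uniformity_bmeas_def
    open_bmeas_def zero_bmeas.rep_eq plus_bmeas.rep_eq uminus_bmeas.rep_eq
    minus_bmeas.rep_eq scaleR_bmeas.rep_eq algebra_simps)

end


section \<open>Convex analysis on dual spaces\<close>

text \<open>Pointwise convergence on a normed space, i.e. the strong operator topology for
  scalar-valued operators, is the weak* topology of its dual.\<close>

abbreviation weak_star :: "('x::real_normed_vector \<Rightarrow>\<^sub>L real) topology"
  where "weak_star \<equiv> strong_operator_topology"

definition conjugate :: "('x::real_normed_vector \<Rightarrow> real) \<Rightarrow> ('x \<Rightarrow>\<^sub>L real) \<Rightarrow> ereal"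
  where "conjugate g x = (SUP y. ereal (blinfun_apply x y - g y))"

text \<open>The supremum over the empty set is \<open>-\<infinity>\<close>, which matters only if the space is trivial.\<close>

definition minimal_linear_growth :: "real \<Rightarrow> (('x::real_normed_vector \<Rightarrow>\<^sub>L real) \<Rightarrow> ereal) \<Rightarrow> bool"
  where "minimal_linear_growth c G \<longleftrightarrow>
    ((\<lambda>R::real. SUP y\<in>UNIV - cball 0 R. ereal (c * norm y) - G y) \<longlongrightarrow> - \<infinity>) at_top"


section \<open>Shift-invariant probability measures\<close>

text \<open>\<open>\<Sigma>\<close> is the type \<open>nat \<Rightarrow> 'a\<close> with its product topology; sequences are indexed from \<open>0\<close>.
  Probability measures are the functionals on \<open>C(\<Sigma>)\<close> that they induce.\<close>

type_synonym 'a CSigma = "(nat \<Rightarrow> 'a) \<Rightarrow>\<^sub>C real"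

type_synonym 'a CSigma_dual = "'a CSigma \<Rightarrow>\<^sub>L real"

type_synonym 'a MS = "'a CSigma unit_ball bmeas"

definition shift :: "(nat \<Rightarrow> 'a) \<Rightarrow> nat \<Rightarrow> 'a"
  where "shift \<sigma> = (\<lambda>n. \<sigma> (Suc n))"

definition represents :: "(nat \<Rightarrow> 'a::metric_space) measure \<Rightarrow> 'a CSigma_dual \<Rightarrow> bool"
  where "represents M \<mu> \<longleftrightarrow> prob_space M \<and> sets M = sets borel \<and>
    (\<forall>\<phi>. blinfun_apply \<mu> \<phi> = (\<integral>\<sigma>. apply_bcontfun \<phi> \<sigma> \<partial>M))"

definition prob_functionals :: "'a::metric_space CSigma_dual set"
  where "prob_functionals = {\<mu>. \<exists>M. represents M \<mu>}"

definition repr_measure :: "'a::metric_space CSigma_dual \<Rightarrow> (nat \<Rightarrow> 'a) measure"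
  where "repr_measure \<mu> = (THE M. represents M \<mu>)"

lemma represents_unique:
  fixes \<mu> :: "'a::metric_space CSigma_dual"
  assumes M: "represents M \<mu>" and N: "represents N \<mu>"
  shows "M = N"
proof -
  have sM: "sets M = sets borel" and sN: "sets N = sets borel"
    and pM: "prob_space M" and pN: "prob_space N"
    using M N by (auto simp: represents_def)
  interpret M: prob_space M by (rule pM)
  interpret N: prob_space N by (rule pN)
  have eq_closed: "emeasure M C = emeasure N C" if C: "closed C" for C
  proof (cases "C = {}")
    case False
    define f where "f k \<sigma> = max 0 (1 - real k * infdist \<sigma> C)" for k and \<sigma> :: "nat \<Rightarrow> 'a"
    have cont: "continuous_on UNIV (f k)" for k
      unfolding f_def by (intro continuous_intros)
    have f01: "norm (f k \<sigma>) \<le> 1" for k \<sigma>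
      by (auto simp: f_def infdist_nonneg)
    have "f k \<in> bcontfun" for k
      using cont f01 by (auto simp: bcontfun_def bounded_iff)
    then have eq_int: "(\<integral>\<sigma>. f k \<sigma> \<partial>M) = (\<integral>\<sigma>. f k \<sigma> \<partial>N)" for k
      using M N by (metis Bcontfun_inverse represents_def)
    have lim: "(\<lambda>k. f k \<sigma>) \<longlonglongrightarrow> indicator C \<sigma>" for \<sigma>
    proof (cases "\<sigma> \<in> C")
      case True
      then show ?thesis by (simp add: f_def)
    next
      case out: False
      then have pos: "infdist \<sigma> C > 0"
        using C False by (metis infdist_nonneg in_closed_iff_infdist_zero order_le_less)
      obtain K where K: "real K * infdist \<sigma> C > 1"
        using reals_Archimedean3[OF pos] by blast
      have "f k \<sigma> = 0" if "k \<ge> K" for k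
      proof -
        have "real K * infdist \<sigma> C \<le> real k * infdist \<sigma> C"
          using that pos by (intro mult_right_mono) auto
        then show ?thesis using K by (simp add: f_def)
      qed
      then have "eventually (\<lambda>k. f k \<sigma> = 0) sequentially"
        by (auto simp: eventually_sequentially)
      then show ?thesis
        using out by (simp add: tendsto_eventually)
    qed
    have meas: "f k \<in> borel_measurable borel" for k
      using cont by (rule borel_measurable_continuous_onI)
    have int_lim: "(\<lambda>k. \<integral>\<sigma>. f k \<sigma> \<partial>L) \<longlonglongrightarrow> measure L C"
      if L: "prob_space L" "sets L = sets borel" for L
    proof -
      interpret L: prob_space L by (rule L(1))
      have bor: "C \<in> sets L" using C L(2) by simp
      have "(\<lambda>k. \<integral>\<sigma>. f k \<sigma> \<partial>L) \<longlonglongrightarrow> (\<integral>\<sigma>. indicator C \<sigma> \<partial>L)"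
      proof (rule integral_dominated_convergence[where w = "\<lambda>_. 1"])
        show "f k \<in> borel_measurable L" for k
          using meas L(2) by (simp cong: measurable_cong_sets)
      qed (use lim f01 bor in auto)
      then show ?thesis using bor by simp
    qed
    have "measure M C = measure N C"
      using LIMSEQ_unique int_lim[OF pM sM] int_lim[OF pN sN] eq_int by fastforce
    then show ?thesis
      by (simp add: M.emeasure_eq_measure N.emeasure_eq_measure)
  qed simp
  show ?thesis
  proof (rule measure_eqI_generator_eq[where E = "{C. closed C}" and \<Omega> = UNIV
        and A = "\<lambda>_. UNIV"])
    show "Int_stable {C :: (nat \<Rightarrow> 'a) set. closed C}"
      by (auto simp: Int_stable_def)
    show "sets M = sigma_sets UNIV {C. closed C}" "sets N = sigma_sets UNIV {C. closed C}"
      using sM sN by (simp_all add: borel_eq_closed)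
    show "emeasure M UNIV \<noteq> \<infinity>" for i :: nat
      by simp
  qed (use eq_closed in auto)
qed

lemma represents_repr_measure:
  assumes "\<mu> \<in> prob_functionals"
  shows "represents (repr_measure \<mu>) \<mu>"
proof -
  obtain M where M: "represents M \<mu>"
    using assms by (auto simp: prob_functionals_def)
  then have "repr_measure \<mu> = M"
    unfolding repr_measure_def using represents_unique by (intro the_equality)
  with M show ?thesis by simp
qed

definition invariant_functionals :: "'a::metric_space CSigma_dual set"
  where "invariant_functionals =
    {\<mu> \<in> prob_functionals. distr (repr_measure \<mu>) borel shift = repr_measure \<mu>}"

definition ergodic_functionals :: "'a::metric_space CSigma_dual set"
  where "ergodic_functionals = {\<mu> \<in> invariant_functionals. \<forall>A\<in>sets borel. shift -` A = A \<longrightarrow>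
    measure (repr_measure \<mu>) A = 0 \<or> measure (repr_measure \<mu>) A = 1}"

definition borel_of_topology :: "'b topology \<Rightarrow> 'b measure"
  where "borel_of_topology X = sigma (topspace X) {U. openin X U}"

text \<open>The barycenter is tested on the weak*-continuous linear functionals, i.e. on the
  evaluations at elements of \<open>C(\<Sigma>)\<close>.\<close>

definition is_choquet_measure ::
    "'a::metric_space CSigma_dual \<Rightarrow> 'a CSigma_dual measure \<Rightarrow> bool"
  where "is_choquet_measure \<mu> \<xi> \<longleftrightarrow> prob_space \<xi> \<and>
    space \<xi> = invariant_functionals \<and>
    sets \<xi> = sets (borel_of_topology (subtopology weak_star invariant_functionals)) \<and>
    emeasure \<xi> ergodic_functionals = 1 \<and>
    (\<forall>\<phi>. blinfun_apply \<mu> \<phi> = (\<integral>\<nu>. blinfun_apply \<nu> \<phi> \<partial>\<xi>))"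

definition choquet_measure :: "'a::metric_space CSigma_dual \<Rightarrow> 'a CSigma_dual measure"
  where "choquet_measure \<mu> = (THE \<xi>. is_choquet_measure \<mu> \<xi>)"

definition transfer_op ::
    "'a::metric_space measure \<Rightarrow> 'a CSigma \<Rightarrow> (nat \<Rightarrow> 'a) \<Rightarrow> real"
  where "transfer_op m \<phi> \<sigma> = (\<integral>\<omega>. apply_bcontfun \<phi> (case_nat \<omega> \<sigma>) \<partial>m)"

definition entropy_fn :: "'a::metric_space measure \<Rightarrow> 'a CSigma_dual \<Rightarrow> ereal"
  where "entropy_fn m \<mu> = (INF \<phi>\<in>{\<phi>. \<forall>\<sigma>. apply_bcontfun \<phi> \<sigma> > 0}.
    ereal (\<integral>\<sigma>. ln (transfer_op m \<phi> \<sigma> / apply_bcontfun \<phi> \<sigma>) \<partial>repr_measure \<mu>))"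


section \<open>Self-interactions and the two variational functionals\<close>

definition to_MS :: "'a::metric_space CSigma_dual \<Rightarrow> 'a MS"
  where "to_MS \<mu> = Bmeas (\<lambda>\<phi>. blinfun_apply \<mu> (ball_vec \<phi>))"

lemma apply_to_MS: "apply_bmeas (to_MS \<mu>) \<phi> = blinfun_apply \<mu> (ball_vec \<phi>)"
proof -
  have "1-lipschitz_on UNIV (ball_vec :: 'a CSigma unit_ball \<Rightarrow> _)"
    by (auto intro!: lipschitz_onI simp: dist_unit_ball_def)
  then have cont: "continuous_on UNIV (\<lambda>\<phi>. blinfun_apply \<mu> (ball_vec \<phi>))"
    by (intro continuous_intros) (rule lipschitz_on_continuous_on)
  have "norm (blinfun_apply \<mu> (ball_vec \<phi>)) \<le> norm \<mu>" for \<phi>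
    using norm_blinfun[of \<mu> "ball_vec \<phi>"] ball_vec[of \<phi>]
    by (auto intro: order_trans[OF _ mult_left_le])
  then have "bounded (range (\<lambda>\<phi>. blinfun_apply \<mu> (ball_vec \<phi>)))"
    by (auto simp: bounded_iff)
  with cont show ?thesis
    by (simp add: to_MS_def Bmeas_inverse borel_measurable_continuous_onI)
qed

definition sigma_normal :: "('s::topological_space bmeas \<Rightarrow> 'x::real_normed_vector) \<Rightarrow> bool"
  where "sigma_normal \<theta> \<longleftrightarrow> (\<forall>f l. bounded (range f) \<longrightarrow>
    (\<forall>s. (\<lambda>n. apply_bmeas (f n) s) \<longlonglongrightarrow> apply_bmeas l s) \<longrightarrow> (\<lambda>n. \<theta> (f n)) \<longlonglongrightarrow> \<theta> l)"

definition d_eta :: "real \<Rightarrow> (nat \<Rightarrow> 'a::metric_space) \<Rightarrow> (nat \<Rightarrow> 'a) \<Rightarrow> real"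
  where "d_eta \<eta> \<sigma> \<sigma>' = (1 - \<eta>) * (\<Sum>n. \<eta> ^ n * dist (\<sigma> n) (\<sigma>' n))"

definition holder_functions :: "real \<Rightarrow> real \<Rightarrow> 'a::metric_space CSigma set"
  where "holder_functions \<eta> \<alpha> = {\<phi>. \<exists>C. \<forall>\<sigma> \<sigma>'.
    \<bar>apply_bcontfun \<phi> \<sigma> - apply_bcontfun \<phi> \<sigma>'\<bar> \<le> C * d_eta \<eta> \<sigma> \<sigma>' powr \<alpha>}"

definition Theta ::
    "('a::metric_space MS \<Rightarrow> 'x::real_normed_vector) \<Rightarrow> ('a MS \<Rightarrow> 'y::real_normed_vector) \<Rightarrow>
      ('x \<Rightarrow>\<^sub>L real) \<Rightarrow> ('y \<Rightarrow>\<^sub>L real) \<Rightarrow> 'a CSigma"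
  where "Theta \<theta>m \<theta>p ym yp = (THE \<Theta>. \<forall>\<mu>\<in>prob_functionals.
    blinfun_apply yp (\<theta>p (to_MS \<mu>)) - blinfun_apply ym (\<theta>m (to_MS \<mu>)) = blinfun_apply \<mu> \<Theta>)"

definition holder_type ::
    "real \<Rightarrow> ('a::metric_space MS \<Rightarrow> 'x::real_normed_vector) \<Rightarrow>
      ('a MS \<Rightarrow> 'y::real_normed_vector) \<Rightarrow> bool"
  where "holder_type \<eta> \<theta>m \<theta>p \<longleftrightarrow>
    (\<forall>ym yp. \<exists>\<alpha>\<in>{0<..1}. Theta \<theta>m \<theta>p ym yp \<in> holder_functions \<eta> \<alpha>)"

definition pressure_fn ::
    "'a::metric_space measure \<Rightarrow> ('a MS \<Rightarrow> 'x::real_normed_vector) \<Rightarrow>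
      ('a MS \<Rightarrow> 'y::real_normed_vector) \<Rightarrow> ('x \<Rightarrow> real) \<Rightarrow> ('y \<Rightarrow> real) \<Rightarrow>
      'a CSigma_dual \<Rightarrow> ereal"
  where "pressure_fn m \<theta>m \<theta>p gm gp \<mu> =
    entropy_fn m \<mu> - ereal (gm (\<theta>m (to_MS \<mu>))) + ereal (gp (\<theta>p (to_MS \<mu>)))"

definition F_flat ::
    "'a::metric_space measure \<Rightarrow> ('a MS \<Rightarrow> 'x::real_normed_vector) \<Rightarrow>
      ('a MS \<Rightarrow> 'y::real_normed_vector) \<Rightarrow> ('x \<Rightarrow> real) \<Rightarrow> ('y \<Rightarrow> real) \<Rightarrow>
      'a CSigma_dual \<Rightarrow> ereal"
  where "F_flat m \<theta>m \<theta>p gm gp \<mu> =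
    ereal (LINT \<nu>:ergodic_functionals|choquet_measure \<mu>. gp (\<theta>p (to_MS \<nu>)))
    - ereal (LINT \<nu>:ergodic_functionals|choquet_measure \<mu>. gm (\<theta>m (to_MS \<nu>)))
    + entropy_fn m \<mu>"

definition maximizers :: "('a::metric_space CSigma_dual \<Rightarrow> ereal) \<Rightarrow> 'a CSigma_dual set"
  where "maximizers \<Phi> =
    {\<mu> \<in> invariant_functionals. \<Phi> \<mu> = Sup (\<Phi> ` invariant_functionals)}"

definition generalized_maximizers ::
    "('a::metric_space CSigma_dual \<Rightarrow> ereal) \<Rightarrow> 'a CSigma_dual set"
  where "generalized_maximizers \<Phi> =
    {\<mu> \<in> invariant_functionals. \<exists>u. (\<forall>n. u n \<in> invariant_functionals) \<and>
      limitin weak_star u \<mu> sequentially \<and>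
      (\<lambda>n. \<Phi> (u n)) \<longlonglongrightarrow> Sup (\<Phi> ` invariant_functionals)}"

end

theory Submission
  imports Defs
begin

text \<open>Write \<open>f \<nu>\<close> for the interaction part of the pressure; it is weak*-continuous. The entropy
  is upper semicontinuous, so the maximisers of \<open>P = h + f\<close> form a compact set, which contains
  all generalized maximisers. The entropy of \<open>\<mu>\<close> is at most the integral of the entropy over the
  ergodic components of \<open>\<mu>\<close>: finitely many test functions in its definition can be glued along
  invariant sets. Hence the flat functional at \<open>\<mu>\<close> is at most the average of \<open>P\<close> over the components, and
  \<open>\<mu>\<close> maximises it if and only if almost every component maximises \<open>P\<close>. Density of ergodic
  measures with no smaller entropy, obtained by maximising the entropy minus a quadratic penalty
  and identifying the maximiser with the unique, mixing g-measure of a Hoelder potential, shows that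
  both suprema agree, and a separation argument identifies the generalized maximisers with
  the closed convex hull. In the Hoelder case a subgradient of \<open>g\<^sub>+\<close> and a sandwich theorem turn
  every maximiser of \<open>P\<close> into an equilibrium state of a Hoelder potential, which is ergodic; then
  weak limits of Choquet measures carried by the maximisers are again Choquet measures.\<close>

text \<open>The interaction \<open>f\<close> is weak*-continuous, but its average
  \<open>fint\<close> over ergodic components is not: the components of a weak* limit need not be
  limits of components. This is what separates maximizers from generalized maximizers of the flat
  functional, and what ergodicity of all maximizers of the pressure removes. It is also why the flat
  functional is approached along ergodic measures only, where it coincides with the pressure.
  Convexity of the sets involved rests on \<open>fint\<close> being affine. This holds because an
  integral against a Choquet measure is a limit of quantities linear in the barycenter, a fact that
  also yields uniqueness of the Choquet measure. The entropy can be -\<infinity>, so it is handled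
  through real lower bounds and truncations. The weak* topology is handled by sequences: a fixed
  dense sequence of continuous functions embeds the invariant measures as a compact set of real
  sequences, and questions about compactness, Borel sets and equality of measures are moved
  there.\<close>

text \<open>\<open>PP\<close>, \<open>PT\<close> and \<open>PE\<close> are the sets called \<open>P\<close>, \<open>P(T)\<close> and \<open>P\<^sub>e\<^sub>r\<^sub>g(T)\<close> in the paper; \<open>app\<close> evaluates
  a continuous function, \<open>pr\<close> pairs a functional with one.\<close>

abbreviation (input) "app \<equiv> apply_bcontfun"
abbreviation (input) "cst \<equiv> const_bcontfun"
abbreviation (input) "pr \<equiv> blinfun_apply"
abbreviation (input) "rep \<equiv> repr_measure"
abbreviation (input) "PP \<equiv> prob_functionals"
abbreviation (input) "PT \<equiv> invariant_functionals"
abbreviation (input) "PE \<equiv> ergodic_functionals"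

section \<open>Measures on compact metric spaces\<close>

lemma apply_Bcontfun:
  fixes f :: "'b::topological_space \<Rightarrow> real"
  assumes "continuous_on UNIV f" "\<And>x. \<bar>f x\<bar> \<le> B"
  shows "app (Bcontfun f) = f"
  by (rule Bcontfun_inverse, rule bcontfun_normI) (use assms in auto)

lemma apply_bcontfun_sum:
  fixes f :: "'i \<Rightarrow> 'b::topological_space \<Rightarrow>\<^sub>C real"
  shows "app (sum f I) x = (\<Sum>i\<in>I. app (f i) x)"
  by (induction I rule: infinite_finite_induct) auto

section \<open>Riesz-Markov representation of positive functionals by an outer measure\<close>

definition riesz_content :: "(('b::metric_space \<Rightarrow>\<^sub>C real) \<Rightarrow> real) \<Rightarrow> 'b set \<Rightarrow> ennreal"
  where "riesz_content L U = (SUP f\<in>{f :: 'b \<Rightarrow>\<^sub>C real. \<forall>x. 0 \<le> f x \<and> f x \<le> indicator U x}. ennreal (L f))"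

definition riesz_outer :: "(('b::metric_space \<Rightarrow>\<^sub>C real) \<Rightarrow> real) \<Rightarrow> 'b set \<Rightarrow> ennreal"
  where "riesz_outer L A = (INF U\<in>{U. open U \<and> A \<subseteq> U}. riesz_content L U)"

text \<open>Positivity is imposed through the values on the compact set \<open>K\<close>, while the
  type itself may be non-compact. The representing measure is then carried by \<open>K\<close>; this
  is how limits of Choquet measures, seen as measures on real sequences, stay on the coordinates of
  maximisers.\<close>

locale positive_functional =
  fixes L :: "('b::metric_space \<Rightarrow>\<^sub>C real) \<Rightarrow> real" and K :: "'b set"
  assumes compact_K: "compact K"
    and lin: "linear L"
    and pos: "(\<And>x. x \<in> K \<Longrightarrow> 0 \<le> app f x) \<Longrightarrow> 0 \<le> L f"
    and one: "L (cst 1) = 1"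
begin

lemma Lambda_mono:
  assumes "\<And>x. x \<in> K \<Longrightarrow> app f x \<le> app g x"
  shows "L f \<le> L g"
proof -
  have "0 \<le> L (g - f)"
    using assms by (intro pos) auto
  then show ?thesis by (simp add: linear_diff[OF lin])
qed

lemma Lambda_const: "L (cst c) = c"
proof -
  have "cst c = c *\<^sub>R (cst 1 :: 'b \<Rightarrow>\<^sub>C real)"
    by (rule bcontfun_eqI) (simp add: const_bcontfun.rep_eq)
  then show ?thesis by (simp add: linear_scale[OF lin] one)
qed

lemma content_upper:
  assumes "\<And>x. 0 \<le> app f x" "\<And>x. app f x \<le> indicator U x"
  shows "ennreal (L f) \<le> riesz_content L U"
  unfolding riesz_content_def using assms by (intro SUP_upper) auto

lemma content_mono: "U \<subseteq> V \<Longrightarrow> riesz_content L U \<le> riesz_content L V"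
  unfolding riesz_content_def
  by (rule SUP_subset_mono) (auto intro: order_trans[OF _ indicator_leI])

lemma outer_mono: "A \<subseteq> B \<Longrightarrow> riesz_outer L A \<le> riesz_outer L B"
  unfolding riesz_outer_def by (rule INF_superset_mono) auto

lemma outer_open: "open U \<Longrightarrow> riesz_outer L U = riesz_content L U"
  unfolding riesz_outer_def by (intro antisym INF_lower INF_greatest content_mono) auto

lemma outer_le_content: "open U \<Longrightarrow> A \<subseteq> U \<Longrightarrow> riesz_outer L A \<le> riesz_content L U"
  unfolding riesz_outer_def by (rule INF_lower) auto

lemma content_UNIV: "riesz_content L UNIV = 1"
proof (rule antisym)
  show "riesz_content L UNIV \<le> 1"
    unfolding riesz_content_def
  proof (rule SUP_least)
    fix f :: "'b \<Rightarrow>\<^sub>C real" assume "f \<in> {f :: _ \<Rightarrow>\<^sub>C _. \<forall>x. 0 \<le> f x \<and> f x \<le> indicator UNIV x}"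
    then have "L f \<le> L (cst 1)"
      by (intro Lambda_mono) (auto simp: const_bcontfun.rep_eq)
    then show "ennreal (L f) \<le> 1" by (simp add: one)
  qed
  have "ennreal (L (cst 1)) \<le> riesz_content L UNIV"
    by (rule content_upper) (auto simp: const_bcontfun.rep_eq)
  then show "1 \<le> riesz_content L UNIV" by (simp add: one)
qed

text \<open>\<open>riesz_content\<close> admits every continuous f below the indicator, without a
  support condition. Cutting off at height e replaces it: the points of \<open>K\<close> where f is
  at least e form a compact set, finitely many \<open>U n\<close> cover it, and
  \<open>max 0 (f - e)\<close> is split among these in proportion to the distances from their
  complements. The loss is at most e.\<close>

lemma content_subadditive:
  assumes U: "\<And>n::nat. open (U n)"
  shows "riesz_content L (\<Union>n. U n) \<le> (\<Sum>n. riesz_content L (U n))"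
  unfolding riesz_content_def[of _ "\<Union>n. U n"]
proof (rule SUP_least)
  fix f :: "'b \<Rightarrow>\<^sub>C real" assume "f \<in> {f :: _ \<Rightarrow>\<^sub>C _. \<forall>x. 0 \<le> f x \<and> f x \<le> indicator (\<Union>n. U n) x}"
  then have f0: "0 \<le> f x" and f1: "f x \<le> indicator (\<Union>n. U n) x" for x by auto
  have f1': "f x \<le> 1" for x
    using f1[of x] by (auto simp: indicator_def split: if_splits split_of_bool_asm)
  show "ennreal (L f) \<le> (\<Sum>n. riesz_content L (U n))"
  proof (rule ennreal_le_epsilon)
    fix e :: real assume e: "0 < e"
    define C where "C = K \<inter> {x. e \<le> f x}"
    have C: "compact C" unfolding C_def
      by (intro compact_Int_closed compact_K closed_Collect_le continuous_intros) auto
    have "C \<subseteq> (\<Union>n\<in>UNIV. U n)"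
      using f1 e unfolding C_def by (fastforce simp: indicator_def split: if_splits split_of_bool_asm)
    then obtain I where I: "finite I" "C \<subseteq> (\<Union>n\<in>I. U n)"
      using compactE_image[OF C, of UNIV U] U by auto
    \<comment> \<open>\<open>d n\<close> has to be positive exactly on \<open>U n\<close>. Since
      \<open>infdist\<close> to the empty set is 0 by convention, the value 1 is set by hand when
      \<open>U n\<close> is the whole space.\<close>
    define d where "d n x = (if U n = UNIV then 1 else infdist x (- U n))" for n x
    have dc: "continuous_on S (d n)" for S n
      unfolding d_def by (cases "U n = UNIV") (auto intro!: continuous_intros)
    have d0: "0 \<le> d n x" for n x
      by (simp add: d_def infdist_nonneg)
    have dpos: "d n x > 0 \<longleftrightarrow> x \<in> U n" for n x
    proof (cases "U n = UNIV")
      case False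
      then have "x \<notin> U n \<longleftrightarrow> infdist x (- U n) = 0"
        using in_closed_iff_infdist_zero[of "- U n" x] U[of n] by auto
      then show ?thesis using False d0[of n x] by (auto simp: d_def less_le)
    qed (simp add: d_def)
    define s where "s x = (\<Sum>n\<in>I. d n x)" for x
    have sc: "continuous_on S s" for S
      unfolding s_def by (intro continuous_intros dc)
    have "\<exists>\<delta>>0. \<forall>x\<in>C. \<delta> \<le> s x"
    proof (cases "C = {}")
      case False
      obtain y where y: "y \<in> C" "\<forall>x\<in>C. s y \<le> s x"
        using continuous_attains_inf[OF C False sc] by blast
      obtain n where "n \<in> I" "y \<in> U n" using I y by auto
      then have "0 < s y"
        unfolding s_def using dpos d0 I by (intro sum_pos2[of I n]) auto
      with y show ?thesis by auto
    qed (auto intro: exI[of _ 1])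
    then obtain \<delta> where \<delta>: "\<delta> > 0" "\<And>x. x \<in> C \<Longrightarrow> \<delta> \<le> s x" by auto
    \<comment> \<open>The \<open>max\<close> with \<open>\<delta>\<close> keeps the quotient
      continuous where all \<open>d n\<close> vanish. On \<open>C\<close> it is inactive, so there
      the \<open>G n\<close> add up to f - e.\<close>
    define G where "G n x = max 0 (f x - e) * (d n x / max \<delta> (s x))" for n x
    have Gc: "continuous_on UNIV (G n)" for n
      unfolding G_def using \<delta> by (intro continuous_intros dc sc) (auto simp: max_def)
    have G0: "0 \<le> G n x" for n x
      unfolding G_def using d0[of n x] \<delta> by auto
    have G1: "G n x \<le> indicator (U n) x" if "n \<in> I" for n x
    proof (cases "x \<in> U n")
      case True
      have "d n x \<le> s x" unfolding s_def using that I d0 by (intro member_le_sum) auto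
      then have "d n x / max \<delta> (s x) \<le> 1" using \<delta> by (auto simp: divide_le_eq)
      moreover have "max 0 (f x - e) \<le> 1" using f1'[of x] e by auto
      ultimately have "G n x \<le> 1 * 1" unfolding G_def using d0[of n x] \<delta>
        by (intro mult_mono) auto
      with True show ?thesis by simp
    next
      case False
      then have "d n x = 0" using dpos[of n x] d0[of n x] by linarith
      then show ?thesis by (simp add: G_def False)
    qed
    define g where "g n = Bcontfun (G n)" for n
    have g: "app (g n) = G n" if "n \<in> I" for n
      unfolding g_def by (rule apply_Bcontfun[OF Gc, of _ 1])
        (use G0 in \<open>auto intro!: order_trans[OF G1[OF that]]\<close>)
    have "L f \<le> L (cst e + (\<Sum>n\<in>I. g n))"
    proof (rule Lambda_mono)
      fix x assume x: "x \<in> K"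
      have "f x \<le> e + (\<Sum>n\<in>I. G n x)"
      proof (cases "f x \<le> e")
        case True
        then show ?thesis using sum_nonneg[of I "\<lambda>n. G n x"] G0 by auto
      next
        case False
        then have "x \<in> C" using x by (auto simp: C_def)
        then have s: "max \<delta> (s x) = s x" "s x > 0" using \<delta> by (force simp: max_def)+
        have "(\<Sum>n\<in>I. G n x) = (f x - e) * ((\<Sum>n\<in>I. d n x) / s x)"
          using False by (simp add: G_def s sum_distrib_left sum_divide_distrib)
        also have "\<dots> = f x - e" using s by (simp add: s_def)
        finally show ?thesis by simp
      qed
      then show "app f x \<le> app (cst e + (\<Sum>n\<in>I. g n)) x"
        by (simp add: const_bcontfun.rep_eq apply_bcontfun_sum g)
    qed
    also have "\<dots> = e + (\<Sum>n\<in>I. L (g n))"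
      by (simp add: linear_add[OF lin] linear_sum[OF lin] Lambda_const)
    finally have "L f \<le> (\<Sum>n\<in>I. L (g n)) + e" by simp
    moreover have gpos: "0 \<le> L (g n)" if "n \<in> I" for n
      using that by (intro pos) (simp add: g G0)
    ultimately have "ennreal (L f) \<le> (\<Sum>n\<in>I. ennreal (L (g n))) + ennreal e"
      using e by (simp add: sum_nonneg ennreal_leI flip: ennreal_plus)
    also have "(\<Sum>n\<in>I. ennreal (L (g n))) \<le> (\<Sum>n\<in>I. riesz_content L (U n))"
      by (intro sum_mono content_upper) (auto simp: g G0 G1)
    also have "\<dots> \<le> (\<Sum>n. riesz_content L (U n))"
      by (rule sum_le_suminf) (use I in auto)
    finally show "ennreal (L f) \<le> (\<Sum>n. riesz_content L (U n)) + ennreal e"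
      by (simp add: add_right_mono)
  qed
qed

lemma outer_measure: "outer_measure_space UNIV (riesz_outer L)"
  unfolding outer_measure_space_def
proof (intro conjI)
  have "riesz_content L {} = 0"
  proof -
    have "ennreal (L f) \<le> 0" if "\<forall>x. 0 \<le> f x \<and> f x \<le> indicator {} x" for f :: "'b \<Rightarrow>\<^sub>C real"
    proof -
      have "f = cst 0" using that by (intro bcontfun_eqI) (auto intro: antisym)
      then show ?thesis by (simp add: linear_0[OF lin])
    qed
    then have "riesz_content L {} \<le> 0" unfolding riesz_content_def by (intro SUP_least) auto
    then show ?thesis by simp
  qed
  then show "positive UNIV (riesz_outer L)"
    by (simp add: positive_def outer_open)
  show "increasing UNIV (riesz_outer L)"
    by (auto simp: increasing_def intro: outer_mono)
  show "countably_subadditive UNIV (riesz_outer L)"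
  proof (unfold countably_subadditive_def, intro allI impI)
    fix A :: "nat \<Rightarrow> 'b set"
    show "riesz_outer L (\<Union>i. A i) \<le> (\<Sum>n. riesz_outer L (A n))"
    proof (rule ennreal_le_epsilon)
      fix e :: real assume e: "0 < e" and fin: "(\<Sum>n. riesz_outer L (A n)) < top"
      have "\<exists>U. open U \<and> A n \<subseteq> U \<and> riesz_content L U \<le> riesz_outer L (A n) + ennreal (e * (1/2)^Suc n)" for n
      proof -
        have "riesz_outer L (A n) \<noteq> top"
          using ennreal_suminf_lessD[OF fin, of n] by auto
        then have "riesz_outer L (A n) < riesz_outer L (A n) + ennreal (e * (1/2)^Suc n)"
          using e by (cases "riesz_outer L (A n)")
            (auto simp flip: ennreal_plus simp: ennreal_less_iff)
        from this[unfolded riesz_outer_def[of L "A n"], unfolded INF_less_iff] show ?thesis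
          unfolding riesz_outer_def[of L "A n"] by (blast intro: less_imp_le)
      qed
      then obtain U where U: "\<And>n. open (U n)" "\<And>n. A n \<subseteq> U n"
        "\<And>n. riesz_content L (U n) \<le> riesz_outer L (A n) + ennreal (e * (1/2)^Suc n)" by metis
      have "riesz_outer L (\<Union>i. A i) \<le> riesz_content L (\<Union>n. U n)"
        by (rule outer_le_content) (use U in auto)
      also have "\<dots> \<le> (\<Sum>n. riesz_content L (U n))"
        by (rule content_subadditive[OF U(1)])
      also have "\<dots> \<le> (\<Sum>n. riesz_outer L (A n) + ennreal (e * (1/2)^Suc n))"
        by (intro suminf_le U) auto
      also have "\<dots> = (\<Sum>n. riesz_outer L (A n)) + (\<Sum>n. ennreal (e * (1/2)^Suc n))"
        by (intro suminf_add[symmetric]) auto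
      also have "(\<Sum>n. ennreal (e * (1/2)^Suc n)) = ennreal e"
      proof -
        have "(\<lambda>n. e * (1/2)^Suc n) sums (e * 1)"
          by (intro sums_mult power_half_series)
        then show ?thesis using e by (intro suminf_ennreal_eq) auto
      qed
      finally show "riesz_outer L (\<Union>i. A i) \<le> (\<Sum>n. riesz_outer L (A n)) + ennreal e" .
    qed
  qed
qed

text \<open>\<open>countably_subadditive\<close> speaks of disjoint families, so the second set is
  first cut down to B - A.\<close>

lemma outer_Un: "riesz_outer L (A \<union> B) \<le> riesz_outer L A + riesz_outer L B"
proof -
  have "countably_subadditive UNIV (riesz_outer L)" "positive UNIV (riesz_outer L)"
    using outer_measure by (auto simp: outer_measure_space_def)
  then have cs: "(\<And>N :: nat \<Rightarrow> 'b set. disjoint_family N \<Longrightarrow> riesz_outer L (\<Union>n. N n) \<le> (\<Sum>n. riesz_outer L (N n)))"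
    and e: "riesz_outer L {} = 0"
    by (auto simp: countably_subadditive_def positive_def)
  let ?N = "binaryset A (B - A)"
  have "riesz_outer L (\<Union>n. ?N n) \<le> (\<Sum>n. riesz_outer L (?N n))"
    by (rule cs) (auto simp: disjoint_family_on_def binaryset_def)
  also have "\<dots> = riesz_outer L A + riesz_outer L (B - A)"
    by (rule suminf_binaryset_eq) (rule e)
  also have "\<dots> \<le> riesz_outer L A + riesz_outer L B"
    by (intro add_left_mono outer_mono) auto
  finally show ?thesis by (simp add: UN_binaryset_eq)
qed

text \<open>For f below the indicator of U \<inter> V, the truncation \<open>max 0 (f - e)\<close>
  vanishes off the closed set \<open>C\<close> where f is at least e, and \<open>C\<close> lies
  inside U \<inter> V. Any competitor for V - C, an open set containing V - U, can be added to it
  and the sum stays below the indicator of V. So the two contents add up to at most that of V, up to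
  e.\<close>

lemma open_in_lambda_system:
  assumes U: "open U"
  shows "U \<in> lambda_system UNIV UNIV (riesz_outer L)"
  unfolding lambda_system_def
proof (intro CollectI conjI ballI UNIV_I)
  fix A :: "'b set"
  have "riesz_outer L (U \<inter> A) + riesz_outer L (A - U) \<le> riesz_outer L A"
    unfolding riesz_outer_def[of L A]
  proof (rule INF_greatest)
    fix V assume "V \<in> {V. open V \<and> A \<subseteq> V}"
    then have V: "open V" "A \<subseteq> V" by auto
    have "riesz_content L (U \<inter> V) + riesz_outer L (V - U) \<le> riesz_content L V"
    proof -
      have "ennreal (L f) + riesz_outer L (V - U) \<le> riesz_content L V"
        if f: "\<forall>x. 0 \<le> f x \<and> f x \<le> indicator (U \<inter> V) x" for f :: "'b \<Rightarrow>\<^sub>C real"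
      proof (rule ennreal_le_epsilon)
        fix e :: real assume e: "0 < e"
        define C where "C = {x. e \<le> f x}"
        have Ccl: "closed C" unfolding C_def by (intro closed_Collect_le continuous_intros) auto
        have CU: "C \<subseteq> U \<inter> V"
          unfolding C_def
        proof
          fix x assume "x \<in> {x. e \<le> app f x}"
          with f e have "0 < (indicator (U \<inter> V) x :: real)"
            by (metis mem_Collect_eq less_le_trans)
          then show "x \<in> U \<inter> V" by (simp split: split_indicator_asm)
        qed
        define F where "F = Bcontfun (\<lambda>x. max 0 (f x - e))"
        have fb: "f x \<le> 1" "0 \<le> f x" for x
          using f[rule_format, of x] by (auto simp: indicator_def split: if_splits split_of_bool_asm)
        have F: "app F = (\<lambda>x. max 0 (f x - e))"
          unfolding F_def
        proof (rule apply_Bcontfun[where B=1])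
          show "\<bar>max 0 (f x - e)\<bar> \<le> 1" for x using fb[of x] e by auto
        qed (auto intro!: continuous_intros)
        have "L f \<le> L (F + cst e)"
          by (rule Lambda_mono) (auto simp: F const_bcontfun.rep_eq)
        then have 1: "L f \<le> L F + e"
          by (simp add: linear_add[OF lin] Lambda_const)
        have F0: "0 \<le> L F" by (rule pos) (simp add: F)
        have "ennreal (L F) + riesz_outer L (V - U) \<le> ennreal (L F) + riesz_content L (V - C)"
          by (intro add_left_mono outer_le_content) (use V Ccl CU in auto)
        also have "\<dots> \<le> riesz_content L V"
        proof -
          have "ennreal (L F) + ennreal (L g) \<le> riesz_content L V"
            if g: "\<forall>x. 0 \<le> g x \<and> g x \<le> indicator (V - C) x" for g :: "'b \<Rightarrow>\<^sub>C real"
          proof -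
            have "0 \<le> L g" using g by (intro pos) auto
            then have "ennreal (L F) + ennreal (L g) = ennreal (L (F + g))"
              using F0 by (simp add: linear_add[OF lin])
            also have "\<dots> \<le> riesz_content L V"
            proof (rule content_upper)
              fix x
              show "0 \<le> app (F + g) x" using g by (simp add: F)
              show "app (F + g) x \<le> indicator V x"
                using g[rule_format, of x] fb[of x] e CU
                by (cases "e \<le> f x") (auto simp: F C_def indicator_def split: if_splits split_of_bool_asm)
            qed
            finally show ?thesis .
          qed
          then show ?thesis unfolding riesz_content_def[of _ "V - C"]
            by (subst ennreal_SUP_add_right)
              (auto intro!: SUP_least exI[of _ 0])
        qed
        finally have "ennreal (L F) + riesz_outer L (V - U) \<le> riesz_content L V" .
        moreover have "ennreal (L f) \<le> ennreal (L F) + ennreal e"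
          using 1 F0 e by (simp flip: ennreal_plus add: ennreal_leI)
        ultimately show "ennreal (L f) + riesz_outer L (V - U) \<le> riesz_content L V + ennreal e"
          by (smt (verit) add.assoc add.commute add_left_mono add_right_mono order_trans)
      qed
      then show ?thesis unfolding riesz_content_def[of _ "U \<inter> V"]
        by (subst add.commute, subst ennreal_SUP_add_right)
          (auto intro!: SUP_least exI[of _ 0] simp: add.commute)
    qed
    moreover have "riesz_outer L (U \<inter> A) \<le> riesz_content L (U \<inter> V)"
      by (rule outer_le_content) (use U V in auto)
    moreover have "riesz_outer L (A - U) \<le> riesz_outer L (V - U)"
      by (rule outer_mono) (use V in auto)
    ultimately show "riesz_outer L (U \<inter> A) + riesz_outer L (A - U) \<le> riesz_content L V"
      by (meson add_mono order_trans)
  qed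
  moreover have "riesz_outer L A \<le> riesz_outer L (U \<inter> A) + riesz_outer L (A - U)"
    using outer_Un[of "U \<inter> A" "A - U"] by (simp add: Int_commute Int_Diff_Un)
  moreover have "(UNIV - U) \<inter> A = A - U" by auto
  ultimately show "riesz_outer L (U \<inter> A) + riesz_outer L ((UNIV - U) \<inter> A) = riesz_outer L A"
    by (simp add: antisym)
qed

lemma measure_space_outer: "measure_space UNIV (sets borel) (riesz_outer L)"
proof (rule measure_down)
  interpret sigma_algebra "UNIV :: 'b set" UNIV
    by (metis Pow_UNIV sigma_algebra_Pow)
  show ms: "measure_space UNIV (lambda_system UNIV UNIV (riesz_outer L)) (riesz_outer L)"
    by (rule caratheodory_lemma[OF outer_measure])
  show "sigma_algebra UNIV (sets (borel :: 'b measure))"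
    by (metis sets.sigma_algebra_axioms space_borel)
  interpret L: sigma_algebra UNIV "lambda_system UNIV UNIV (riesz_outer L)"
    using ms by (simp add: measure_space_def)
  show "sets borel \<subseteq> lambda_system UNIV UNIV (riesz_outer L)"
    unfolding sets_borel using open_in_lambda_system
    by (intro L.sigma_sets_subset) auto
qed

definition riesz_measure :: "'b measure"
  where "riesz_measure = measure_of UNIV (sets borel) (riesz_outer L)"

lemma sets_riesz_measure: "sets riesz_measure = sets borel"
  unfolding riesz_measure_def
  by (metis sets.sigma_sets_eq sets.space_closed sets_measure_of space_borel)

lemma emeasure_riesz_measure: "A \<in> sets borel \<Longrightarrow> emeasure riesz_measure A = riesz_outer L A"
  using measure_space_outer unfolding riesz_measure_def
  by (intro emeasure_measure_of_sigma) (auto simp: measure_space_def)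

lemma prob_space_riesz_measure: "prob_space riesz_measure"
proof
  have "space riesz_measure = UNIV"
    using sets_eq_imp_space_eq[OF sets_riesz_measure] by simp
  then show "emeasure riesz_measure (space riesz_measure) = 1"
    by (simp add: emeasure_riesz_measure outer_open content_UNIV)
qed

lemma emeasure_riesz_measure_K: "emeasure riesz_measure K = 1"
proof -
  interpret prob_space riesz_measure by (rule prob_space_riesz_measure)
  have "ennreal (L f) \<le> 0" if "\<forall>x. 0 \<le> f x \<and> f x \<le> indicator (- K) x" for f :: "'b \<Rightarrow>\<^sub>C real"
  proof -
    have "L f \<le> L 0"
      using that by (intro Lambda_mono) (auto simp: indicator_def split: if_splits split_of_bool_asm)
    then show ?thesis by (simp add: linear_0[OF lin] ennreal_neg)
  qed
  then have "riesz_content L (- K) \<le> 0"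
    unfolding riesz_content_def by (intro SUP_least) auto
  moreover have cl: "closed K" by (rule compact_imp_closed[OF compact_K])
  ultimately have "emeasure riesz_measure (- K) = 0"
    by (simp add: emeasure_riesz_measure outer_open open_Compl)
  moreover have "space riesz_measure = UNIV"
    using sets_eq_imp_space_eq[OF sets_riesz_measure] by simp
  ultimately have "prob K = 1"
    using cl prob_compl[of K] by (simp add: sets_riesz_measure emeasure_eq_measure Compl_eq_Diff_UNIV)
  then show ?thesis by (simp add: emeasure_eq_measure)
qed

text \<open>Layer-cake argument: n f is a sum of n unit slices, the j-th lying below the indicator
  of the open set where n f exceeds j. At each point the number of such j is at most n f + 1, and
  the extra 1 becomes 1/n after division.\<close>

lemma Lambda_le_integral:
  assumes f: "\<And>x. 0 \<le> app f x" "\<And>x. app f x \<le> 1"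
  shows "L f \<le> (\<integral>x. f x \<partial>riesz_measure)"
proof (rule field_le_epsilon)
  fix e :: real assume "0 < e"
  then obtain n :: nat where n: "n > 0" "1 / real n < e"
    by (metis nat_approx_posE of_nat_0_less_iff zero_less_Suc)
  interpret prob_space riesz_measure by (rule prob_space_riesz_measure)
  have sp: "space riesz_measure = UNIV"
    using sets_eq_imp_space_eq[OF sets_riesz_measure] by simp
  define G where "G j x = max 0 (min 1 (real n * f x - real j))" for j x
  define g where "g j = Bcontfun (G j)" for j
  have g: "app (g j) = G j" for j
    unfolding g_def by (rule apply_Bcontfun[of _ 1]) (auto simp: G_def intro!: continuous_intros)
  define U where "U j = {x. real j < real n * f x}" for j
  have Uo: "open (U j)" for j
    unfolding U_def by (intro open_Collect_less continuous_intros) auto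
  have tele: "(\<Sum>j<k. max 0 (min 1 (t - real j))) = min t k" if "0 \<le> t" for k t
    using that by (induction k) (auto simp: min_def max_def split: if_splits split_of_bool_asm)
  have Gsum: "(\<Sum>j<n. G j x) = real n * f x" for x
  proof -
    have "(\<Sum>j<n. G j x) = min (real n * f x) n"
      unfolding G_def using f by (intro tele) auto
    also have "\<dots> = real n * f x" using f[of x] by (simp add: min_def mult_left_le)
    finally show ?thesis .
  qed
  have "n *\<^sub>R f = (\<Sum>j<n. g j)"
    by (rule bcontfun_eqI) (simp add: apply_bcontfun_sum g Gsum)
  then have "real n * L f = (\<Sum>j<n. L (g j))"
    by (metis lin linear_scale linear_sum real_scaleR_def)
  also have "\<dots> \<le> (\<Sum>j<n. prob (U j))"
  proof (rule sum_mono)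
    fix j
    have "ennreal (L (g j)) \<le> riesz_content L (U j)"
      by (rule content_upper) (auto simp: g G_def U_def indicator_def)
    also have "\<dots> = ennreal (prob (U j))"
      using emeasure_riesz_measure[of "U j"] Uo[of j]
      by (simp add: outer_open emeasure_eq_measure)
    finally show "L (g j) \<le> prob (U j)" by simp
  qed
  also have "\<dots> = (\<Sum>j<n. (\<integral>x. indicator (U j) x \<partial>riesz_measure))"
    using Uo by (simp add: sp)
  also have "\<dots> = (\<integral>x. (\<Sum>j<n. indicator (U j) x) \<partial>riesz_measure)"
    using Uo by (intro Bochner_Integration.integral_sum[symmetric])
      (auto simp: sets_riesz_measure intro!: integrable_real_indicator simp: emeasure_eq_measure)
  also have "\<dots> \<le> (\<integral>x. real n * f x + 1 \<partial>riesz_measure)"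
  proof (rule integral_mono)
    show "integrable riesz_measure (\<lambda>x. \<Sum>j<n. indicator (U j) x :: real)"
      using Uo by (auto simp: sets_riesz_measure emeasure_eq_measure intro!: Bochner_Integration.integrable_sum integrable_real_indicator)
    have "app f \<in> borel_measurable borel" by (intro borel_measurable_continuous_onI) auto
    then show "integrable riesz_measure (\<lambda>x. real n * f x + 1)"
      using f by (intro integrable_const_bound[where B="n + 1"])
        (auto simp: measurable_cong_sets[OF sets_riesz_measure refl] mult_left_le abs_mult intro!: order_trans[OF abs_triangle_ineq])
    have cnt: "(\<Sum>j<k. indicator {x. real j < real n * f x} x) \<le> min (real n * f x) k + (1::real)" for x k
    proof (induction k)
      case (Suc k)
      show ?case
      proof (cases "real k < real n * f x")
        case True
        have "(\<Sum>j<Suc k. indicator {x. real j < real n * f x} x) \<le> (\<Sum>j<Suc k. (1::real))"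
          by (intro sum_mono) (auto simp: indicator_def)
        then show ?thesis using True by (auto simp: min_def)
      next
        case False
        then show ?thesis using Suc by (auto simp: min_def)
      qed
    qed (use f in simp)
    show "(\<Sum>j<n. indicator (U j) x) \<le> real n * f x + (1::real)" for x
      unfolding U_def by (rule order_trans[OF cnt]) simp
  qed
  also have "\<dots> = real n * (\<integral>x. f x \<partial>riesz_measure) + 1"
  proof -
    have "app f \<in> borel_measurable borel" by (intro borel_measurable_continuous_onI) auto
    then have "integrable riesz_measure f"
      using f by (intro integrable_const_bound[where B=1])
        (auto simp: measurable_cong_sets[OF sets_riesz_measure refl])
    then show ?thesis by (simp add: prob_space)
  qed
  finally have "L f \<le> (\<integral>x. f x \<partial>riesz_measure) + 1 / real n"
    using n by (simp add: field_simps)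
  then show "L f \<le> (\<integral>x. f x \<partial>riesz_measure) + e" using n by simp
qed

text \<open>For values in [0,1] the opposite inequality is the same bound for 1 - f; a general f is
  moved into [0,1] by an affine rescaling.\<close>

lemma Lambda_eq_integral: "L f = (\<integral>x. f x \<partial>riesz_measure)"
proof -
  interpret prob_space riesz_measure by (rule prob_space_riesz_measure)
  have int: "integrable riesz_measure (app g)" for g :: "'b \<Rightarrow>\<^sub>C real"
  proof -
    have 1: "app g \<in> borel_measurable borel" by (intro borel_measurable_continuous_onI) auto
    obtain B where "\<And>x. norm (g x) \<le> B"
      using bounded_apply_bcontfun[of g] by (auto simp: bounded_iff)
    with 1 show ?thesis
      by - (intro integrable_const_bound[where B=B],
        auto simp: measurable_cong_sets[OF sets_riesz_measure refl])
  qed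
  have sp: "space riesz_measure = UNIV"
    using sets_eq_imp_space_eq[OF sets_riesz_measure] by simp
  have eq1: "L f = (\<integral>x. f x \<partial>riesz_measure)"
    if f: "\<And>x. 0 \<le> app f x" "\<And>x. app f x \<le> 1" for f
  proof (rule antisym)
    show "L f \<le> (\<integral>x. f x \<partial>riesz_measure)" by (rule Lambda_le_integral[OF f])
    have "L (cst 1 - f) \<le> (\<integral>x. (cst 1 - f) x \<partial>riesz_measure)"
      by (rule Lambda_le_integral) (use f in \<open>auto simp: const_bcontfun.rep_eq\<close>)
    then show "(\<integral>x. f x \<partial>riesz_measure) \<le> L f"
      using int[of f] by (simp add: const_bcontfun.rep_eq linear_diff[OF lin] one prob_space)
  qed
  obtain B where B: "\<And>x. norm (f x) \<le> B"
    using bounded_apply_bcontfun[of f] by (auto simp: bounded_iff)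
  define b where "b = \<bar>B\<bar> + 1"
  have b: "b > 0" "\<And>x. \<bar>f x\<bar> \<le> b" unfolding b_def using B by (auto intro: order_trans[OF _ abs_ge_self] order_trans[OF B[unfolded real_norm_def]])
  define g where "g = (1 / (2 * b)) *\<^sub>R (f + cst b)"
  have g: "app g x = (f x + b) / (2 * b)" for x
    by (simp add: g_def const_bcontfun.rep_eq)
  have "L g = (\<integral>x. g x \<partial>riesz_measure)"
  proof (rule eq1)
    fix x show "0 \<le> g x" "g x \<le> 1" using b(1) b(2)[of x] by (auto simp: g field_simps abs_le_iff)
  qed
  also have "\<dots> = ((\<integral>x. f x \<partial>riesz_measure) + b) / (2 * b)"
    unfolding g using int[of f] by (simp add: prob_space)
  also have "L g = (L f + b) / (2 * b)"
    by (simp add: g_def linear_scale[OF lin] linear_add[OF lin] Lambda_const)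
  finally show ?thesis using b by simp
qed

theorem riesz_representation:
  obtains M where "prob_space M" "sets M = sets borel" "emeasure M K = 1"
    "\<And>f. L f = (\<integral>x. app f x \<partial>M)"
  using prob_space_riesz_measure sets_riesz_measure emeasure_riesz_measure_K Lambda_eq_integral
  by blast

end

section \<open>Countable products, finite nets and separability of continuous functions\<close>

lemma compact_PiE_UNIV:
  fixes S :: "'i \<Rightarrow> 'b::topological_space set"
  assumes "\<And>i. compact (S i)"
  shows "compact (PiE UNIV S)"
proof -
  have "compactin (product_topology (\<lambda>i. euclidean) UNIV) (PiE UNIV S)"
    using assms by (simp add: compactin_PiE)
  then show ?thesis by (simp add: euclidean_product_topology)
qed

lemma compact_UNIV_fun:
  assumes "compact (UNIV :: 'b::topological_space set)"
  shows "compact (UNIV :: ('i \<Rightarrow> 'b) set)"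
proof -
  have "compact (PiE UNIV (\<lambda>i :: 'i. UNIV :: 'b set))"
    using assms by (intro compact_PiE_UNIV)
  then show ?thesis by (simp add: PiE_UNIV_domain)
qed

text \<open>The product of the intervals is compact and first countable, hence sequentially compact;
  this delivers the diagonal sequence at once.\<close>

lemma diagonal_subsequence:
  fixes a :: "nat \<Rightarrow> nat \<Rightarrow> real"
  assumes "\<And>n j. \<bar>a n j\<bar> \<le> B j"
  obtains r where "strict_mono r" "\<And>j. convergent (\<lambda>n. a (r n) j)"
proof -
  let ?C = "PiE UNIV (\<lambda>j. {- B j..B j})"
  have "seq_compact ?C"
    by (intro compact_imp_seq_compact compact_PiE_UNIV compact_Icc)
  moreover have "a n \<in> ?C" for n
    using assms[of n] by (auto simp: PiE_UNIV_domain abs_le_iff minus_le_iff)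
  ultimately obtain l r where r: "strict_mono r" "(a \<circ> r) \<longlonglongrightarrow> l"
    unfolding seq_compact_def by metis
  have "(\<lambda>n. (a \<circ> r) n j) \<longlonglongrightarrow> l j" for j
    using r(2) by (rule tendsto_compose[rotated, where g="\<lambda>x. x j"])
      (metis continuous_on_product_coordinates continuous_on_eq_continuous_at isCont_def open_UNIV UNIV_I)
  then have "\<And>j. convergent (\<lambda>n. a (r n) j)" by (auto simp: convergent_def)
  with r that show ?thesis by blast
qed

lemma compact_countable_nets:
  fixes K :: "'b::metric_space set"
  assumes "compact K"
  obtains C where "countable C" "C \<subseteq> K"
    "\<And>d. d > 0 \<Longrightarrow> \<exists>F. finite F \<and> F \<subseteq> C \<and> K \<subseteq> (\<Union>x\<in>F. ball x d)"
proof -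
  have "\<exists>F. finite F \<and> F \<subseteq> K \<and> K \<subseteq> (\<Union>x\<in>F. ball x (inverse (real (Suc n))))" for n
    by (rule compactE_image[OF assms, of K "\<lambda>x. ball x (inverse (real (Suc n)))"])
      (auto intro: that[of "{}"])
  then obtain F where F: "\<And>n. finite (F n)" "\<And>n. F n \<subseteq> K"
    "\<And>n. K \<subseteq> (\<Union>x\<in>F n. ball x (inverse (real (Suc n))))" by metis
  show thesis
  proof (rule that[of "\<Union>n. F n"])
    show "\<exists>G. finite G \<and> G \<subseteq> (\<Union>n. F n) \<and> K \<subseteq> (\<Union>x\<in>G. ball x d)" if d: "d > 0" for d
    proof -
      obtain n where n: "inverse (real (Suc n)) < d" using reals_Archimedean[OF d] by blast
      have "(\<Union>x\<in>F n. ball x (inverse (real (Suc n)))) \<subseteq> (\<Union>x\<in>F n. ball x d)"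
        using n by (intro UN_mono subset_ball) auto
      with F(3)[of n] have "K \<subseteq> (\<Union>x\<in>F n. ball x d)" by (rule order_trans)
      moreover have "F n \<subseteq> (\<Union>n. F n)" by (rule UN_upper) simp
      ultimately show ?thesis using F(1) by metis
    qed
    show "countable (\<Union>n. F n)" by (rule countable_UN[OF _ countable_finite[OF F(1)]]) simp
    show "(\<Union>n. F n) \<subseteq> K" using F(2) by blast
  qed
qed

text \<open>The countable family consists of finite maxima of cones p - k * dist x d with rational
  heights p, integer slopes k and centres d from countable nets. The base value -c bounds these
  maxima from below, since cones may be unbounded below off \<open>K\<close>.\<close>

lemma separable_continuous_functions:
  fixes K :: "'b::metric_space set"
  assumes K: "compact K"
  obtains q :: "nat \<Rightarrow> 'b \<Rightarrow>\<^sub>C real"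
  where "\<And>f e. e > 0 \<Longrightarrow> \<exists>j. \<forall>x\<in>K. \<bar>app f x - app (q j) x\<bar> < e"
proof -
  obtain C where C: "countable C" "C \<subseteq> K"
    "\<And>d. d > 0 \<Longrightarrow> \<exists>F. finite F \<and> F \<subseteq> C \<and> K \<subseteq> (\<Union>x\<in>F. ball x d)"
    using that by (rule compact_countable_nets[OF K])
  define h :: "nat \<Rightarrow> nat \<Rightarrow> (real \<times> 'b) list \<Rightarrow> 'b \<Rightarrow> real"
    where "h c k L x = foldr (\<lambda>(p, d) y. max (p - real k * dist x d) y) L (- real c)" for c k L x
  have h_le: "h c k L x \<le> b \<longleftrightarrow> - real c \<le> b \<and> (\<forall>(p, d)\<in>set L. p - real k * dist x d \<le> b)" for c k L x b
    unfolding h_def by (induction L) auto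
  have h_ge: "- real c \<le> h c k L x" "(p, d) \<in> set L \<Longrightarrow> p - real k * dist x d \<le> h c k L x" for c k L x p d
    using h_le[of c k L x "h c k L x"] by auto
  have h_cont: "continuous_on UNIV (h c k L)" for c k L
    unfolding h_def by (induction L) (auto intro!: continuous_intros)
  have h_bcont: "app (Bcontfun (h c k L)) = h c k L" for c k L
  proof (rule apply_Bcontfun[OF h_cont])
    fix x
    let ?B = "real c + (\<Sum>z\<leftarrow>L. \<bar>fst z\<bar>)"
    have nn: "0 \<le> (\<Sum>z\<leftarrow>L. \<bar>fst z\<bar>)" by (induction L) auto
    have "p - real k * dist x d \<le> ?B" if "(p, d) \<in> set L" for p d
    proof -
      have "\<bar>p\<bar> \<le> (\<Sum>z\<leftarrow>L. \<bar>fst z\<bar>)"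
        using that by (induction L) (auto intro!: sum_list_nonneg)
      moreover have "0 \<le> real k * dist x d" by simp
      ultimately show ?thesis by linarith
    qed
    then have "h c k L x \<le> ?B" unfolding h_le using nn by auto
    then show "\<bar>h c k L x\<bar> \<le> ?B" using h_ge(1)[of c k L x] nn by (simp add: abs_le_iff)
  qed
  define I where "I = (UNIV :: nat set) \<times> (UNIV :: nat set) \<times> lists ((\<rat> :: real set) \<times> C)"
  have I: "countable I"
    unfolding I_def using C by (auto intro!: countable_SIGMA countable_lists countable_rat)
  define q where "q j = (case from_nat_into I j of (c, k, L) \<Rightarrow> Bcontfun (h c k L))" for j
  have q: "\<exists>j. q j = Bcontfun (h c k L)" if "set L \<subseteq> \<rat> \<times> C" for c k L
  proof -
    have "(c, k, L) \<in> I" using that by (auto simp: I_def)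
    then obtain j where "from_nat_into I j = (c, k, L)"
      using from_nat_into_surj[OF I] by blast
    then show ?thesis by (auto simp: q_def intro: exI[of _ j])
  qed
  show thesis
  proof (rule that[of q])
    fix f :: "'b \<Rightarrow>\<^sub>C real" and e :: real
    assume e: "e > 0"
    obtain B where B: "\<And>x. \<bar>app f x\<bar> \<le> B"
      using bounded_apply_bcontfun[of f] by (auto simp: bounded_iff)
    have "uniformly_continuous_on K (app f)"
      by (intro compact_uniformly_continuous K) auto
    then obtain \<delta> where \<delta>: "\<delta> > 0"
      "\<And>x y. x \<in> K \<Longrightarrow> y \<in> K \<Longrightarrow> dist x y < \<delta> \<Longrightarrow> \<bar>app f x - app f y\<bar> < e / 4"
      unfolding uniformly_continuous_on_def dist_real_def using e
      by (metis dist_commute divide_pos_pos zero_less_numeral)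
    \<comment> \<open>With this slope a cone whose centre is at distance at least
      \<open>\<delta>\<close> from x has dropped below f x when it reaches x, so only nearby centres
      matter for the upper bound.\<close>
    obtain k :: nat where k: "real k * \<delta> > 2 * B + e"
      using reals_Archimedean3[OF \<delta>(1)] by blast
    obtain c :: nat where c: "B \<le> real c" using real_arch_simple by blast
    obtain F where F: "finite F" "F \<subseteq> C" "K \<subseteq> (\<Union>x\<in>F. ball x (min \<delta> (e / (4 * (real k + 1)))))"
      using C(3)[of "min \<delta> (e / (4 * (real k + 1)))"] e \<delta> by auto
    have "\<exists>p\<in>\<rat>. \<bar>p - app f d\<bar> < e / 4" for d
    proof -
      obtain t where "t \<in> \<rat>" "app f d - e/4 < t" "t < app f d"
        using Rats_dense_in_real[of "app f d - e/4" "app f d"] e by auto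
      then show ?thesis by (intro bexI[of _ t]) (simp_all add: abs_less_iff)
    qed
    then obtain p where p: "\<And>d. p d \<in> \<rat>" "\<And>d. \<bar>p d - app f d\<bar> < e / 4" by metis
    obtain L0 where L0: "set L0 = F" using finite_list[OF F(1)] by blast
    define L where "L = map (\<lambda>d. (p d, d)) L0"
    have L: "set L = (\<lambda>d. (p d, d)) ` F" by (simp add: L_def L0)
    obtain j where j: "q j = Bcontfun (h c k L)"
      using q[of L c k] p F by (auto simp: L)
    show "\<exists>j. \<forall>x\<in>K. \<bar>app f x - app (q j) x\<bar> < e"
    proof (intro exI[of _ j] ballI)
      fix x assume x: "x \<in> K"
      have "h c k L x \<le> app f x + e / 2"
        unfolding h_le
      proof (intro conjI ballI)
        show "- real c \<le> app f x + e / 2" using B[of x] c e by (simp add: abs_le_iff)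
        fix z assume "z \<in> set L"
        then obtain d where d: "z = (p d, d)" "d \<in> F" by (auto simp: L)
        then have dK: "d \<in> K" using F C by auto
        have "p d - real k * dist x d \<le> app f x + e / 2"
        proof (cases "dist x d < \<delta>")
          case True
          have "0 \<le> real k * dist x d" by simp
          then show ?thesis using \<delta>(2)[OF x dK True] p(2)[of d] by linarith
        next
          case False
          then have "real k * \<delta> \<le> real k * dist x d" by (intro mult_left_mono) auto
          then show ?thesis using k p(2)[of d] B[of d] B[of x] e by linarith
        qed
        then show "case z of (p, d) \<Rightarrow> p - real k * dist x d \<le> app f x + e / 2"
          by (simp add: d)
      qed
      moreover have "app f x - 3 * e / 4 \<le> h c k L x"
      proof -
        obtain d where d: "d \<in> F" "dist x d < \<delta>" "dist x d < e / (4 * (real k + 1))"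
          using F(3) x by (auto simp: dist_commute)
        then have dK: "d \<in> K" using F C by auto
        have "dist x d * (4 * (real k + 1)) < e"
          using d(3) by (simp add: pos_less_divide_eq)
        then have "real k * dist x d \<le> e / 4" by (simp add: algebra_simps) (smt (verit) zero_le_dist)
        moreover have "p d - real k * dist x d \<le> h c k L x"
          by (rule h_ge(2)) (use d in \<open>auto simp: L\<close>)
        ultimately show ?thesis using \<delta>(2)[OF x dK d(2)] p(2)[of d] by linarith
      qed
      ultimately show "\<bar>app f x - app (q j) x\<bar> < e"
        using e by (simp add: j h_bcont)
    qed
  qed
qed

section \<open>Sequential compactness of measures and of equicontinuous families\<close>

definition borel_prob :: "'b::topological_space measure \<Rightarrow> bool"
  where "borel_prob M \<longleftrightarrow> prob_space M \<and> sets M = sets borel"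

lemma borel_prob_space: "borel_prob M \<Longrightarrow> space M = UNIV"
  unfolding borel_prob_def using sets_eq_imp_space_eq[of M borel] by simp

lemma borel_prob_measurable: "borel_prob M \<Longrightarrow> f \<in> measurable M N \<longleftrightarrow> f \<in> measurable borel N"
  unfolding borel_prob_def using measurable_cong_sets[of M borel N N] by simp

lemma borel_prob_integrable_bounded:
  fixes f :: "'b::topological_space \<Rightarrow> real"
  assumes M: "borel_prob M" and "f \<in> borel_measurable borel" "\<And>x. \<bar>f x\<bar> \<le> B"
  shows "integrable M f"
proof -
  interpret prob_space M using M by (simp add: borel_prob_def)
  show ?thesis
    by (rule integrable_const_bound[where B=B]) (use assms borel_prob_measurable[OF M] in auto)
qed

lemma measurable_bcontfun [measurable]:
  "app f \<in> borel_measurable borel" for f :: "'b::topological_space \<Rightarrow>\<^sub>C real"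
  by (intro borel_measurable_continuous_onI) auto

lemma abs_bcontfun_le_norm: "\<bar>app f x\<bar> \<le> norm f" for f :: "'b::topological_space \<Rightarrow>\<^sub>C real"
  using norm_bounded[of f x] by simp

lemma borel_prob_integrable_bcontfun:
  "borel_prob M \<Longrightarrow> integrable M (app f)" for f :: "'b::topological_space \<Rightarrow>\<^sub>C real"
  by (erule borel_prob_integrable_bounded) (auto intro: abs_bcontfun_le_norm)

lemma borel_prob_AE_K:
  assumes M: "borel_prob M" and "closed K" "emeasure M K = 1"
  shows "AE x in M. x \<in> K"
proof -
  interpret prob_space M using M by (simp add: borel_prob_def)
  show ?thesis using assms M
    by (intro AE_prob_1) (simp add: emeasure_eq_measure)
qed

lemma borel_prob_integral_close:
  fixes f g :: "'b::topological_space \<Rightarrow> real"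
  assumes M: "borel_prob M" and i: "integrable M f" "integrable M g"
    and c: "AE x in M. \<bar>f x - g x\<bar> \<le> e"
  shows "\<bar>(\<integral>x. f x \<partial>M) - (\<integral>x. g x \<partial>M)\<bar> \<le> e"
proof -
  interpret prob_space M using M by (simp add: borel_prob_def)
  have "\<bar>(\<integral>x. f x - g x \<partial>M)\<bar> \<le> (\<integral>x. \<bar>f x - g x\<bar> \<partial>M)"
    by (rule integral_abs_bound)
  also have "\<dots> \<le> (\<integral>x. e \<partial>M)"
    using i c by (intro integral_mono_AE) auto
  finally show ?thesis using i by (simp add: prob_space)
qed

text \<open>Convergence is extracted on a countable family and spreads to all continuous functions,
  because the measures are carried by \<open>K\<close> and the family is uniformly dense there. The
  limit functional is nonnegative on functions nonnegative on \<open>K\<close>, so the Riesz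
  representation turns it into a measure carried by \<open>K\<close>.\<close>

theorem prokhorov_compact:
  fixes M :: "nat \<Rightarrow> 'b::metric_space measure"
  assumes K: "compact K" and M: "\<And>n. borel_prob (M n)" "\<And>n. emeasure (M n) K = 1"
  obtains r N where "strict_mono r" "borel_prob N" "emeasure N K = 1"
    "\<And>f :: 'b \<Rightarrow>\<^sub>C real. (\<lambda>n. \<integral>x. app f x \<partial>M (r n)) \<longlonglongrightarrow> (\<integral>x. app f x \<partial>N)"
proof -
  obtain q :: "nat \<Rightarrow> 'b \<Rightarrow>\<^sub>C real" where
    q: "\<And>f e. e > 0 \<Longrightarrow> \<exists>j. \<forall>x\<in>K. \<bar>app f x - app (q j) x\<bar> < e"
    using that by (rule separable_continuous_functions[OF K])
  define a where "a n f = (\<integral>x. app f x \<partial>M n)" for n and f :: "'b \<Rightarrow>\<^sub>C real"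
  have AE: "AE x in M n. x \<in> K" for n
    by (intro borel_prob_AE_K M compact_imp_closed K)
  have close: "\<bar>a n f - a n g\<bar> \<le> e"
    if "\<And>x. x \<in> K \<Longrightarrow> \<bar>app f x - app g x\<bar> \<le> e" for n f g e
    unfolding a_def using AE[of n] that
    by (intro borel_prob_integral_close[OF M(1)] borel_prob_integrable_bcontfun M(1)) auto
  have a_const: "a n (cst c) = c" for n c
    using M(1)[of n] unfolding a_def borel_prob_def
    by (simp add: const_bcontfun.rep_eq prob_space.prob_space)
  have a_norm: "\<bar>a n f\<bar> \<le> norm f" for n f
    using close[of f "cst 0" "norm f" n] a_const[of n 0] by (simp add: abs_bcontfun_le_norm)
  obtain r where r: "strict_mono r" "\<And>j. convergent (\<lambda>n. a (r n) (q j))"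
    using that by (rule diagonal_subsequence[of "\<lambda>n j. a n (q j)" "\<lambda>j. norm (q j)", OF a_norm])
  have conv: "convergent (\<lambda>n. a (r n) f)" for f
  proof -
    have "Cauchy (\<lambda>n. a (r n) f)"
    proof (rule metric_CauchyI)
      fix e :: real assume e: "0 < e"
      obtain j where j: "\<And>x. x \<in> K \<Longrightarrow> \<bar>app f x - app (q j) x\<bar> < e / 3"
        using q[of "e/3" f] e by auto
      have "Cauchy (\<lambda>n. a (r n) (q j))" using r(2) by (rule convergent_Cauchy)
      then obtain N where N: "\<And>m n. m \<ge> N \<Longrightarrow> n \<ge> N \<Longrightarrow> dist (a (r m) (q j)) (a (r n) (q j)) < e / 3"
        unfolding Cauchy_def using e by (meson divide_pos_pos zero_less_numeral)
      have c: "\<bar>a n f - a n (q j)\<bar> \<le> e / 3" for n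
        by (rule close) (use j in \<open>auto intro: less_imp_le\<close>)
      have "dist (a (r m) f) (a (r n) f) < e" if "m \<ge> N" "n \<ge> N" for m n
        using N[OF that] c[of "r m"] c[of "r n"] unfolding dist_real_def by linarith
      then show "\<exists>N. \<forall>m\<ge>N. \<forall>n\<ge>N. dist (a (r m) f) (a (r n) f) < e" by blast
    qed
    then show ?thesis by (rule Cauchy_convergent)
  qed
  define \<Lambda> where "\<Lambda> f = lim (\<lambda>n. a (r n) f)" for f
  have lim: "(\<lambda>n. a (r n) f) \<longlonglongrightarrow> \<Lambda> f" for f
    using conv[of f] unfolding \<Lambda>_def by (rule convergent_LIMSEQ_iff[THEN iffD1])
  have "positive_functional \<Lambda> K"
  proof
    show "compact K" by fact
    show "\<Lambda> (f + g) = \<Lambda> f + \<Lambda> g" for f g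
    proof (rule LIMSEQ_unique[OF lim])
      have "a n (f + g) = a n f + a n g" for n
        unfolding a_def by (simp add: borel_prob_integrable_bcontfun[OF M(1)])
      then show "(\<lambda>n. a (r n) (f + g)) \<longlonglongrightarrow> \<Lambda> f + \<Lambda> g"
        using tendsto_add[OF lim lim] by simp
    qed
    show "\<Lambda> (c *\<^sub>R f) = c *\<^sub>R \<Lambda> f" for c f
    proof (rule LIMSEQ_unique[OF lim])
      have "a n (c *\<^sub>R f) = c * a n f" for n unfolding a_def by simp
      then show "(\<lambda>n. a (r n) (c *\<^sub>R f)) \<longlonglongrightarrow> c *\<^sub>R \<Lambda> f"
        using tendsto_mult_left[OF lim] by simp
    qed
    show "0 \<le> \<Lambda> f" if "\<And>x. x \<in> K \<Longrightarrow> 0 \<le> app f x" for f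
    proof (rule LIMSEQ_le_const[OF lim], intro exI allI impI)
      show "0 \<le> a (r n) f" for n
        unfolding a_def using AE[of "r n"] that by (intro integral_nonneg_AE) auto
    qed
    show "\<Lambda> (cst 1) = 1"
      using lim[of "cst 1"] unfolding a_const by (simp add: LIMSEQ_const_iff)
  qed
  then interpret positive_functional \<Lambda> K .
  obtain N where N: "prob_space N" "sets N = sets borel" "emeasure N K = 1"
    "\<And>f. \<Lambda> f = (\<integral>x. app f x \<partial>N)"
    using that by (rule riesz_representation)
  show thesis
  proof (rule that[OF r(1) _ N(3)])
    show "borel_prob N" using N by (simp add: borel_prob_def)
    show "(\<lambda>n. \<integral>x. app f x \<partial>M (r n)) \<longlonglongrightarrow> (\<integral>x. app f x \<partial>N)" for f :: "'b \<Rightarrow>\<^sub>C real"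
      using lim[of f] by (simp add: a_def N(4))
  qed
qed

text \<open>Equicontinuity is phrased with neighbourhoods because it will be verified from Hoelder
  bounds in \<open>d_eta\<close>, which is not the distance that the function type carries.\<close>

theorem arzela_ascoli_bcontfun:
  fixes v :: "nat \<Rightarrow> 'b::metric_space \<Rightarrow>\<^sub>C real"
  assumes K: "compact (UNIV :: 'b set)" and bd: "\<And>n. norm (v n) \<le> B"
    and equi: "\<And>x e. e > 0 \<Longrightarrow> \<exists>U. open U \<and> x \<in> U \<and>
      (\<forall>n. \<forall>y\<in>U. \<bar>app (v n) x - app (v n) y\<bar> < e)"
  obtains r l where "strict_mono r" "(\<lambda>n. v (r n)) \<longlonglongrightarrow> l"
proof -
  obtain C where C: "countable C" "C \<subseteq> UNIV"
    "\<And>d. d > 0 \<Longrightarrow> \<exists>F. finite F \<and> F \<subseteq> C \<and> (UNIV :: 'b set) \<subseteq> (\<Union>x\<in>F. ball x d)"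
    using that by (rule compact_countable_nets[OF K])
  have "C \<noteq> {}" using C(3)[of 1] by auto
  define D where "D = from_nat_into C"
  have D: "\<exists>j. D j \<in> U" if U: "open U" "x \<in> U" for U x
  proof -
    obtain d where d: "d > 0" "ball x d \<subseteq> U" using U open_contains_ball by blast
    obtain y where "y \<in> C" "dist y x < d" using C(3)[OF d(1)] by fastforce
    moreover then obtain j where "D j = y" unfolding D_def
      using from_nat_into_surj[OF C(1)] by blast
    ultimately show ?thesis using d by (auto intro!: exI[of _ j] simp: dist_commute)
  qed
  obtain r where r: "strict_mono r" "\<And>j. convergent (\<lambda>n. app (v (r n)) (D j))"
    using that by (rule diagonal_subsequence[of "\<lambda>n j. app (v n) (D j)" "\<lambda>_. B", OF order_trans[OF abs_bcontfun_le_norm bd]])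
  have "Cauchy (\<lambda>n. v (r n))"
  proof (rule metric_CauchyI)
    fix e :: real assume "0 < e"
    then have e: "0 < e / 6" by simp
    obtain U where U: "\<And>x. open (U x)" "\<And>x. x \<in> U x"
      "\<And>x n y. y \<in> U x \<Longrightarrow> \<bar>app (v n) x - app (v n) y\<bar> < e / 6"
      using equi[OF e] by metis
    have "(UNIV :: 'b set) \<subseteq> (\<Union>x\<in>UNIV. U x)" using U(2) by auto
    then obtain X where X: "X \<subseteq> UNIV" "finite X" "(UNIV :: 'b set) \<subseteq> (\<Union>x\<in>X. U x)"
      using that by (rule compactE_image[OF K U(1)])
    have "\<exists>j. D j \<in> U x" for x by (rule D[OF U(1) U(2)])
    then obtain j where j: "\<And>x. D (j x) \<in> U x" by metis
    have "\<exists>N. \<forall>m\<ge>N. \<forall>n\<ge>N. dist (app (v (r m)) (D (j x))) (app (v (r n)) (D (j x))) < e / 6" for x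
      using convergent_Cauchy[OF r(2)] e unfolding Cauchy_def by blast
    then obtain N where N: "\<And>x m n. m \<ge> N x \<Longrightarrow> n \<ge> N x \<Longrightarrow>
      dist (app (v (r m)) (D (j x))) (app (v (r n)) (D (j x))) < e / 6" by metis
    have "dist (v (r m)) (v (r n)) < e" if mn: "m \<ge> Max (N ` X)" "n \<ge> Max (N ` X)" for m n
    proof -
      have "dist (v (r m)) (v (r n)) \<le> 5 * e / 6"
      proof (rule dist_bound)
        fix y
        obtain x where x: "x \<in> X" "y \<in> U x" using X by auto
        then have "N x \<le> Max (N ` X)" using X by auto
        then have "dist (app (v (r m)) (D (j x))) (app (v (r n)) (D (j x))) < e / 6"
          using mn by (intro N) auto
        then show "dist (app (v (r m)) y) (app (v (r n)) y) \<le> 5 * e / 6"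
          using U(3)[OF x(2), of "r m"] U(3)[OF x(2), of "r n"] U(3)[OF j[of x], of "r m"] U(3)[OF j[of x], of "r n"]
          unfolding dist_real_def by linarith
      qed
      then show ?thesis using \<open>0 < e\<close> by simp
    qed
    then show "\<exists>N. \<forall>m\<ge>N. \<forall>n\<ge>N. dist (v (r m)) (v (r n)) < e" by blast
  qed
  then have "convergent (\<lambda>n. v (r n))" by (rule Cauchy_convergent)
  then obtain l where "(\<lambda>n. v (r n)) \<longlonglongrightarrow> l" unfolding convergent_def by blast
  with r(1) show ?thesis by (rule that)
qed

text \<open>The sets that can be approximated for every e form a Dynkin system containing the closed
  sets. The range [0,1] is part of the claim because the approximants later serve as weights in
  convex combinations.\<close>

lemma indicator_L1_approx:
  fixes M :: "'b::metric_space measure"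
  assumes M: "borel_prob M" and A: "A \<in> sets borel"
  shows "\<forall>e>0. \<exists>w :: 'b \<Rightarrow>\<^sub>C real. (\<forall>x. 0 \<le> app w x \<and> app w x \<le> 1) \<and>
    (\<integral>x. \<bar>indicator A x - app w x\<bar> \<partial>M) < e"
proof -
  interpret prob_space M using M by (simp add: borel_prob_def)
  have sM: "sets M = sets borel" and sp: "space M = UNIV"
    using M borel_prob_space by (auto simp: borel_prob_def)
  have int: "integrable M (\<lambda>x. \<bar>indicator B x - f x\<bar>)"
    if "B \<in> sets borel" "f \<in> borel_measurable borel" "\<And>x. 0 \<le> f x \<and> f x \<le> 1" for B and f :: "'b \<Rightarrow> real"
  proof (rule borel_prob_integrable_bounded[OF M, where B=1])
    show "\<bar>\<bar>indicator B x - f x\<bar>\<bar> \<le> 1" for x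
      using that(3)[of x] by (auto simp: indicator_def)
  qed (use that in auto)
  have "Int_stable {C :: 'b set. closed C}" by (auto simp: Int_stable_def)
  moreover have "{C :: 'b set. closed C} \<subseteq> Pow UNIV" by simp
  moreover have "A \<in> sigma_sets UNIV {C :: 'b set. closed C}"
    using A by (simp add: borel_eq_closed)
  ultimately show ?thesis
  proof (induction rule: sigma_sets_induct_disjoint)
    case (basic C)
    then have C: "closed C" by simp
    show ?case
    proof (intro allI impI)
      fix e :: real assume e: "e > 0"
      show "\<exists>w :: 'b \<Rightarrow>\<^sub>C real. (\<forall>x. 0 \<le> app w x \<and> app w x \<le> 1) \<and>
        (\<integral>x. \<bar>indicator C x - app w x\<bar> \<partial>M) < e"
      proof (cases "C = {}")
        case True
        then show ?thesis using e by (intro exI[of _ 0]) simp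
      next
        case False
        define f where "f k x = max 0 (1 - real k * infdist x C)" for k x
        have f: "0 \<le> f k x" "f k x \<le> 1" for k x by (auto simp: f_def infdist_nonneg)
        have w: "app (Bcontfun (f k)) = f k" for k
          by (rule apply_Bcontfun[of _ 1]) (use f in \<open>auto simp: f_def intro!: continuous_intros\<close>)
        have fm: "f k \<in> borel_measurable borel" for k
          using measurable_bcontfun[of "Bcontfun (f k)"] by (simp add: w)
        have "(\<lambda>k. \<integral>x. \<bar>indicator C x - f k x\<bar> \<partial>M) \<longlonglongrightarrow> (\<integral>x. 0 \<partial>M)"
        proof (rule integral_dominated_convergence[where w="\<lambda>_. 1"])
          show "AE x in M. (\<lambda>k. \<bar>indicator C x - f k x\<bar>) \<longlonglongrightarrow> 0"
          proof (rule AE_I2)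
            fix x
            have "eventually (\<lambda>k. f k x = indicator C x) sequentially"
            proof (cases "x \<in> C")
              case False
              then have pos: "infdist x C > 0"
                using C \<open>C \<noteq> {}\<close> by (metis infdist_nonneg in_closed_iff_infdist_zero order_le_less)
              obtain N where N: "real N * infdist x C > 1"
                using reals_Archimedean3[OF pos] by blast
              have "f k x = 0" if "k \<ge> N" for k
              proof -
                have "real N * infdist x C \<le> real k * infdist x C"
                  using that pos by (intro mult_right_mono) auto
                then show ?thesis using N by (simp add: f_def)
              qed
              then show ?thesis using False by (auto simp: eventually_sequentially)
            qed (simp add: f_def)
            then show "(\<lambda>k. \<bar>indicator C x - f k x\<bar>) \<longlonglongrightarrow> 0"
              by (intro tendsto_eventually) (auto elim: eventually_mono)
          qed
          show "AE x in M. norm \<bar>indicator C x - f k x\<bar> \<le> 1" for k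
          proof (rule AE_I2)
            show "norm \<bar>indicator C x - f k x\<bar> \<le> 1" for x
              using f[of k x] by (auto simp: indicator_def)
          qed
        qed (use fm C in \<open>auto simp: borel_prob_measurable[OF M]\<close>)
        then have "(\<lambda>k. \<integral>x. \<bar>indicator C x - f k x\<bar> \<partial>M) \<longlonglongrightarrow> 0" by simp
        then have "eventually (\<lambda>k. (\<integral>x. \<bar>indicator C x - f k x\<bar> \<partial>M) < e) sequentially"
          using e by (rule order_tendstoD)
        then obtain k where "(\<integral>x. \<bar>indicator C x - f k x\<bar> \<partial>M) < e"
          by (auto simp: eventually_sequentially)
        then show ?thesis by (intro exI[of _ "Bcontfun (f k)"]) (simp add: w f)
      qed
    qed
  next
    case empty
    then show ?case by (intro allI impI exI[of _ 0]) simp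
  next
    case (compl A)
    show ?case
    proof (intro allI impI)
      fix e :: real assume "e > 0"
      with compl.IH obtain w :: "'b \<Rightarrow>\<^sub>C real" where w: "\<forall>x. 0 \<le> app w x \<and> app w x \<le> 1"
        "(\<integral>x. \<bar>indicator A x - app w x\<bar> \<partial>M) < e" by blast
      have "\<bar>indicator (UNIV - A) x - app (cst 1 - w) x\<bar> = \<bar>indicator A x - app w x\<bar>" for x
        by (auto simp: const_bcontfun.rep_eq indicator_def)
      with w show "\<exists>w :: 'b \<Rightarrow>\<^sub>C real. (\<forall>x. 0 \<le> app w x \<and> app w x \<le> 1) \<and>
        (\<integral>x. \<bar>indicator (UNIV - A) x - app w x\<bar> \<partial>M) < e"
        by (intro exI[of _ "cst 1 - w"]) (auto simp: const_bcontfun.rep_eq)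
    qed
  next
    case (union A)
    have Ab: "A i \<in> sets borel" for i using union.hyps(2) by (auto simp: borel_eq_closed)
    show ?case
    proof (intro allI impI)
      fix e :: real assume e: "e > 0"
      have "(\<lambda>n. measure M (A n)) sums measure M (\<Union>n. A n)"
        by (rule finite_measure_UNION) (use Ab sM union.hyps in auto)
      then have "(\<lambda>n. measure M (\<Union>i. A i) - (\<Sum>i<n. measure M (A i))) \<longlonglongrightarrow> measure M (\<Union>i. A i) - measure M (\<Union>i. A i)"
        unfolding sums_def by (intro tendsto_intros)
      then have "eventually (\<lambda>n. measure M (\<Union>i. A i) - (\<Sum>i<n. measure M (A i)) < e / 2) sequentially"
        using e by (intro order_tendstoD) auto
      then obtain n where n: "measure M (\<Union>i. A i) - (\<Sum>i<n. measure M (A i)) < e / 2"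
        by (auto simp: eventually_sequentially)
      have "\<exists>w :: 'b \<Rightarrow>\<^sub>C real. (\<forall>x. 0 \<le> app w x \<and> app w x \<le> 1) \<and>
        (\<integral>x. \<bar>indicator (A i) x - app w x\<bar> \<partial>M) < e / (2 * (real n + 1))" for i
        using union.IH[of i, rule_format, of "e / (2 * (real n + 1))"] e by simp
      then obtain w :: "nat \<Rightarrow> 'b \<Rightarrow>\<^sub>C real" where w: "\<And>i x. 0 \<le> app (w i) x \<and> app (w i) x \<le> 1"
        "\<And>i. (\<integral>x. \<bar>indicator (A i) x - app (w i) x\<bar> \<partial>M) < e / (2 * (real n + 1))" by metis
      \<comment> \<open>Truncation at 1 keeps the range. It can only bring the sum closer to the
        indicator of the finite union, which is itself at most 1.\<close>
      define s where "s x = min 1 (\<Sum>i<n. app (w i) x)" for x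
      have s01: "0 \<le> s x" "s x \<le> 1" for x
        unfolding s_def using w by (auto intro!: sum_nonneg)
      have sw: "app (Bcontfun s) = s"
        by (rule apply_Bcontfun[of _ 1]) (use s01 in \<open>auto simp: s_def intro!: continuous_intros\<close>)
      have sm: "s \<in> borel_measurable borel"
        using measurable_bcontfun[of "Bcontfun s"] by (simp add: sw)
      let ?U = "\<Union>i<n. A i"
      have ind: "indicator ?U x = (\<Sum>i<n. indicator (A i) x :: real)" for x
        using union.hyps by (intro indicator_UN_disjoint) (auto intro: disjoint_family_on_mono)
      have pw: "\<bar>indicator (\<Union>i. A i) x - s x\<bar> \<le> indicator (\<Union>i. A i) x - (\<Sum>i<n. indicator (A i) x) + (\<Sum>i<n. \<bar>indicator (A i) x - app (w i) x\<bar>)" for x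
      proof -
        have "(\<Sum>i<n. indicator (A i) x) \<le> (1::real)"
          unfolding ind[symmetric] by (simp add: indicator_def)
        then have "\<bar>(\<Sum>i<n. indicator (A i) x) - s x\<bar> \<le> \<bar>(\<Sum>i<n. indicator (A i) x) - (\<Sum>i<n. app (w i) x)\<bar>"
          unfolding s_def by (auto simp: min_def)
        also have "\<dots> \<le> (\<Sum>i<n. \<bar>indicator (A i) x - app (w i) x\<bar>)"
          unfolding sum_subtractf[symmetric] by (rule sum_abs)
        finally have 1: "\<bar>(\<Sum>i<n. indicator (A i) x) - s x\<bar> \<le> (\<Sum>i<n. \<bar>indicator (A i) x - app (w i) x\<bar>)" .
        have "(\<Sum>i<n. indicator (A i) x) \<le> (indicator (\<Union>i. A i) x :: real)"
          unfolding ind[symmetric] by (rule indicator_leI) auto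
        with 1 show ?thesis by linarith
      qed
      have i1: "integrable M (\<lambda>x. indicator (A i) x :: real)" "integrable M (\<lambda>x. indicator (\<Union>i. A i) x :: real)" for i
        using Ab by (auto intro!: integrable_real_indicator simp: sM emeasure_eq_measure)
      have i2: "integrable M (\<lambda>x. \<bar>indicator (A i) x - app (w i) x\<bar>)" for i
        by (rule int) (use Ab w in auto)
      have "(\<integral>x. \<bar>indicator (\<Union>i. A i) x - s x\<bar> \<partial>M) \<le>
        (\<integral>x. indicator (\<Union>i. A i) x - (\<Sum>i<n. indicator (A i) x) + (\<Sum>i<n. \<bar>indicator (A i) x - app (w i) x\<bar>) \<partial>M)"
      proof (rule integral_mono)
        show "integrable M (\<lambda>x. \<bar>indicator (\<Union>i. A i) x - s x\<bar>)"
          by (rule int) (use Ab s01 sm in auto)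
      qed (use i1 i2 pw in \<open>auto intro!: Bochner_Integration.integrable_sum\<close>)
      also have "\<dots> = measure M (\<Union>i. A i) - (\<Sum>i<n. measure M (A i)) + (\<Sum>i<n. \<integral>x. \<bar>indicator (A i) x - app (w i) x\<bar> \<partial>M)"
        using i1 i2 by (simp add: sp)
      also have "\<dots> < e / 2 + e / 2"
      proof (intro add_less_le_mono n)
        have "(\<Sum>i<n. \<integral>x. \<bar>indicator (A i) x - app (w i) x\<bar> \<partial>M) \<le> (\<Sum>i<n. e / (2 * (real n + 1)))"
          by (intro sum_mono less_imp_le w)
        also have "\<dots> \<le> e / 2" using e by (simp add: field_simps)
        finally show "(\<Sum>i<n. \<integral>x. \<bar>indicator (A i) x - app (w i) x\<bar> \<partial>M) \<le> e / 2" .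
      qed
      finally show "\<exists>w :: 'b \<Rightarrow>\<^sub>C real. (\<forall>x. 0 \<le> app w x \<and> app w x \<le> 1) \<and>
        (\<integral>x. \<bar>indicator (\<Union>i. A i) x - app w x\<bar> \<partial>M) < e"
        by (intro exI[of _ "Bcontfun s"]) (simp add: sw s01)
    qed
  qed
qed

section \<open>The weak* topology on probability functionals\<close>

text \<open>Sequences are enough for this development: on sets of probability functionals the weak*
  closure is the sequential closure, see \<open>weak_star_closure_iff\<close>.\<close>

definition wlim :: "(nat \<Rightarrow> ('x::real_normed_vector \<Rightarrow>\<^sub>L real)) \<Rightarrow> ('x \<Rightarrow>\<^sub>L real) \<Rightarrow> bool"
  where "wlim u \<mu> \<longleftrightarrow> (\<forall>f. (\<lambda>n. pr (u n) f) \<longlonglongrightarrow> pr \<mu> f)"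

lemma limitin_weak_star_iff: "limitin weak_star u \<mu> sequentially \<longleftrightarrow> wlim u \<mu>"
proof
  assume "limitin weak_star u \<mu> sequentially"
  then have "limitin euclidean ((\<lambda>f. pr f \<phi>) \<circ> u) (pr \<mu> \<phi>) sequentially" for \<phi>
    by (rule continuous_map_limit[OF strong_operator_topology_continuous_evaluation])
  then show "wlim u \<mu>" by (simp add: wlim_def o_def)
next
  assume u: "wlim u \<mu>"
  have "limitin (product_topology (\<lambda>_. euclidean) UNIV) (\<lambda>n. pr (u n)) (pr \<mu>) sequentially"
    using u by (auto simp: limitin_componentwise wlim_def PiE_UNIV_domain)
  then have lim: "limitin euclidean (\<lambda>n. pr (u n)) (pr \<mu>) sequentially"
    by (simp add: euclidean_product_topology)
  show "limitin weak_star u \<mu> sequentially"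
    unfolding limitin_def
  proof (intro conjI allI impI)
    show "\<mu> \<in> topspace weak_star" by (simp add: strong_operator_topology_topspace)
    fix U assume "openin weak_star U \<and> \<mu> \<in> U"
    then obtain V where V: "open V" "U = pr -` V" "\<mu> \<in> U"
      unfolding strong_operator_topology_def openin_pullback_topology by auto
    then have "eventually (\<lambda>n. pr (u n) \<in> V) sequentially"
      using lim unfolding limitin_def by auto
    then show "eventually (\<lambda>n. u n \<in> U) sequentially" using V by simp
  qed
qed

lemma wlim_subseq: "wlim u \<mu> \<Longrightarrow> strict_mono r \<Longrightarrow> wlim (\<lambda>n. u (r n)) \<mu>"
  unfolding wlim_def using LIMSEQ_subseq_LIMSEQ[of "\<lambda>n. pr (u n) _"]
  by (auto simp: o_def)

lemma wlim_const: "wlim (\<lambda>_. \<mu>) \<mu>"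
  by (simp add: wlim_def)

lemma wlim_unique: "wlim u \<mu> \<Longrightarrow> wlim u \<nu> \<Longrightarrow> \<mu> = \<nu>"
  unfolding wlim_def by (intro blinfun_eqI) (blast intro: LIMSEQ_unique)

text \<open>Compactness and upper semicontinuity are both sequential here. Extended real values let
  the entropy be -\<infinity> without a case distinction.\<close>

lemma usc_attains_max:
  fixes F :: "('x::real_normed_vector \<Rightarrow>\<^sub>L real) \<Rightarrow> ereal"
  assumes ne: "K \<noteq> {}"
    and sc: "\<And>u. (\<And>n. u n \<in> K) \<Longrightarrow> \<exists>r \<mu>. strict_mono (r :: nat \<Rightarrow> nat) \<and> \<mu> \<in> K \<and> wlim (\<lambda>n. u (r n)) \<mu>"
    and usc: "\<And>u \<mu> l. (\<And>n. u n \<in> K) \<Longrightarrow> \<mu> \<in> K \<Longrightarrow> wlim u \<mu> \<Longrightarrow> (\<lambda>n. F (u n)) \<longlonglongrightarrow> l \<Longrightarrow> l \<le> F \<mu>"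
  obtains \<mu> where "\<mu> \<in> K" "\<And>\<nu>. \<nu> \<in> K \<Longrightarrow> F \<nu> \<le> F \<mu>"
proof -
  have "F ` K \<noteq> {}" using ne by simp
  then obtain f :: "nat \<Rightarrow> ereal" where f: "incseq f" "range f \<subseteq> F ` K" "Sup (F ` K) = (SUP i. f i)"
    using Sup_countable_SUP by metis
  have "\<exists>x\<in>K. f n = F x" for n using f(2) by auto
  then obtain u where u: "\<And>n. u n \<in> K" "\<And>n. f n = F (u n)" by metis
  obtain r \<mu> where r: "strict_mono (r :: nat \<Rightarrow> nat)" "\<mu> \<in> K" "wlim (\<lambda>n. u (r n)) \<mu>"
    using sc[of u, OF u(1)] by (elim exE conjE) (rule that)
  have "f \<longlonglongrightarrow> Sup (F ` K)" unfolding f(3) by (rule LIMSEQ_SUP[OF f(1)])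
  then have "(\<lambda>n. F (u (r n))) \<longlonglongrightarrow> Sup (F ` K)"
    using LIMSEQ_subseq_LIMSEQ[OF _ r(1)] u(2) by (fastforce simp: o_def)
  then have "Sup (F ` K) \<le> F \<mu>" by (rule usc[OF u(1) r(2,3)])
  then have "F \<nu> \<le> F \<mu>" if "\<nu> \<in> K" for \<nu>
    using that by (meson SUP_upper order_trans)
  with r(2) show thesis by (rule that)
qed

lemma continuous_shift: "continuous_on S (shift :: (nat \<Rightarrow> 'a::topological_space) \<Rightarrow> _)"
  unfolding shift_def
  by (intro continuous_on_coordinatewise_then_product)
    (rule continuous_on_subset[OF continuous_on_product_coordinates subset_UNIV])

lemma measurable_shift [measurable]: "shift \<in> borel \<rightarrow>\<^sub>M (borel :: (nat \<Rightarrow> 'a::topological_space) measure)"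
  by (intro borel_measurable_continuous_onI continuous_shift)

lemma continuous_shift_funpow: "continuous_on S ((shift ^^ n) :: (nat \<Rightarrow> 'a::topological_space) \<Rightarrow> _)"
proof (induction n)
  case (Suc n)
  then have "continuous_on S (shift \<circ> (shift ^^ n) :: (nat \<Rightarrow> 'a) \<Rightarrow> _)"
    by (intro continuous_on_compose continuous_shift)
  then show ?case by simp
qed simp

definition func_of :: "(nat \<Rightarrow> 'a::metric_space) measure \<Rightarrow> 'a CSigma_dual"
  where "func_of M = Blinfun (\<lambda>f. \<integral>x. app f x \<partial>M)"

lemma apply_func_of:
  fixes M :: "(nat \<Rightarrow> 'a::metric_space) measure"
  assumes M: "borel_prob M"
  shows "pr (func_of M) f = (\<integral>x. app f x \<partial>M)"
proof -
  interpret prob_space M using M by (simp add: borel_prob_def)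
  have int: "integrable M (app f)" for f :: "'a CSigma"
    by (rule borel_prob_integrable_bcontfun[OF M])
  have "bounded_linear (\<lambda>f :: 'a CSigma. \<integral>x. app f x \<partial>M)"
  proof (rule bounded_linear_intro[where K=1])
    fix f :: "'a CSigma"
    show "norm (\<integral>x. app f x \<partial>M) \<le> norm f * 1"
      using borel_prob_integral_close[OF M int[of f] int[of 0], of "norm f"]
      by (simp add: abs_bcontfun_le_norm)
  qed (use int in auto)
  then show ?thesis by (simp add: func_of_def bounded_linear_Blinfun_apply)
qed

lemma represents_func_of: "borel_prob M \<Longrightarrow> represents M (func_of M)"
  by (auto simp: represents_def apply_func_of) (auto simp: borel_prob_def)

lemma func_of_prob: "borel_prob M \<Longrightarrow> func_of M \<in> PP"
  using represents_func_of by (auto simp: prob_functionals_def)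

section \<open>Probability functionals on the symbolic space: compactness, closures,
  separation\<close>

locale symbolic_space =
  fixes m :: "'a::metric_space measure" and \<eta> :: real
  assumes compact_alphabet: "compact (UNIV :: 'a set)"
    and dist_le_1: "dist (x :: 'a) y \<le> 1"
    and prob_m: "prob_space m" and sets_m: "sets m = sets borel"
    and full_support: "open (U :: 'a set) \<Longrightarrow> U \<noteq> {} \<Longrightarrow> 0 < emeasure m U"
    and eta: "0 < \<eta>" "\<eta> < 1"
begin

abbreviation (input) "ent \<equiv> entropy_fn m"

lemma compact_Sigma: "compact (UNIV :: (nat \<Rightarrow> 'a) set)"
  by (intro compact_UNIV_fun compact_alphabet)

lemma apply_Bcontfun_Sigma:
  fixes f :: "(nat \<Rightarrow> 'a) \<Rightarrow> real"
  assumes "continuous_on UNIV f"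
  shows "app (Bcontfun f) = f"
proof -
  have "bounded (range f)"
    using compact_continuous_image[OF assms compact_Sigma] by (rule compact_imp_bounded)
  then have "f \<in> bcontfun" using assms by (simp add: bcontfun_def)
  then show ?thesis by (rule Bcontfun_inverse)
qed

lemma repr_measure:
  assumes "\<mu> \<in> PP"
  shows "borel_prob (rep \<mu>)"
    and "pr \<mu> f = (\<integral>x. app f x \<partial>rep \<mu>)"
  using represents_repr_measure[OF assms] by (auto simp: represents_def borel_prob_def)

lemma prob_mono:
  assumes "\<mu> \<in> PP" "\<And>x. app f x \<le> app g x"
  shows "pr \<mu> f \<le> pr \<mu> g"
  unfolding repr_measure(2)[OF assms(1)]
  by (intro integral_mono borel_prob_integrable_bcontfun repr_measure(1) assms)

lemma prob_const: "\<mu> \<in> PP \<Longrightarrow> pr \<mu> (cst c) = c"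
  using repr_measure(1)[of \<mu>]
  by (simp add: repr_measure(2) const_bcontfun.rep_eq borel_prob_def prob_space.prob_space)

lemma prob_close:
  assumes "\<mu> \<in> PP"
  shows "\<bar>pr \<mu> f - pr \<mu> g\<bar> \<le> norm (f - g)"
  unfolding repr_measure(2)[OF assms(1)]
  using abs_bcontfun_le_norm[of "f - g"]
  by (intro borel_prob_integral_close borel_prob_integrable_bcontfun repr_measure(1) assms) auto

lemma prob_abs_le: "\<mu> \<in> PP \<Longrightarrow> \<bar>pr \<mu> f\<bar> \<le> norm f"
  using prob_close[of \<mu> f 0] by (simp add: blinfun.zero_right)

lemma prob_functional_of_positive:
  assumes "linear \<Lambda>" "\<And>f :: 'a CSigma. (\<And>s. 0 \<le> app f s) \<Longrightarrow> 0 \<le> \<Lambda> f"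
    and "\<Lambda> (cst 1) = 1"
  shows "\<exists>\<mu>\<in>PP. \<forall>f. pr \<mu> f = \<Lambda> f"
proof -
  interpret positive_functional \<Lambda> UNIV
    by standard (use assms in \<open>auto simp: compact_Sigma linear_add linear_scale\<close>)
  obtain M where M: "prob_space M" "sets M = sets borel" "emeasure M UNIV = 1"
    "\<And>f. \<Lambda> f = (\<integral>x. app f x \<partial>M)"
    using that by (rule riesz_representation)
  have "borel_prob M" using M by (simp add: borel_prob_def)
  then show ?thesis by (intro bexI[of _ "func_of M"]) (simp_all add: func_of_prob apply_func_of M(4))
qed

definition dense_fn :: "nat \<Rightarrow> 'a CSigma"
  where "dense_fn = (SOME q. \<forall>f e. e > 0 \<longrightarrow> (\<exists>j. norm (f - q j) < e))"

lemma dense_fn: "e > 0 \<Longrightarrow> \<exists>j. norm (\<phi> - dense_fn j) < e"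
proof -
  obtain q :: "nat \<Rightarrow> 'a CSigma" where
    q: "\<And>f e. e > 0 \<Longrightarrow> \<exists>j. \<forall>x\<in>UNIV. \<bar>app f x - app (q j) x\<bar> < e"
    using that by (rule separable_continuous_functions[OF compact_Sigma])
  have "\<exists>j. norm (\<phi> - q j) < e" if e: "e > 0" for \<phi> e
  proof -
    obtain j where j: "\<And>x. \<bar>app \<phi> x - app (q j) x\<bar> < e / 2"
      using q[of "e/2" \<phi>] e by auto
    have "norm (\<phi> - q j) \<le> e / 2"
      by (rule norm_bound) (use j in \<open>auto intro: less_imp_le\<close>)
    then show ?thesis using e by (intro exI[of _ j]) simp
  qed
  then have "\<exists>q :: nat \<Rightarrow> 'a CSigma. \<forall>\<phi> e. e > 0 \<longrightarrow> (\<exists>j. norm (\<phi> - q j) < e)" by blast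
  from someI_ex[OF this] show "e > 0 \<Longrightarrow> \<exists>j. norm (\<phi> - dense_fn j) < e"
    unfolding dense_fn_def by blast
qed

lemma wlim_dense:
  fixes u :: "nat \<Rightarrow> 'a CSigma_dual"
  assumes u: "\<And>n. u n \<in> PP"
    and lim: "\<And>j. (\<lambda>n. pr (u n) (dense_fn j)) \<longlonglongrightarrow> pr \<mu> (dense_fn j)"
  shows "wlim u \<mu>"
  unfolding wlim_def
proof (intro allI LIMSEQ_I)
  fix f and e :: real assume e: "0 < e"
  \<comment> \<open>\<open>\<mu>\<close> is an arbitrary bounded functional at this point, so its
    norm enters the estimate; for the probability functionals \<open>u n\<close> the constant is
    1.\<close>
  define c where "c = norm \<mu> + 1"
  have c: "c \<ge> 1" "norm \<mu> \<le> c" by (simp_all add: c_def)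
  define d where "d = e / (3 * c)"
  have d: "d > 0" "c * d = e / 3" using e c by (simp_all add: d_def)
  obtain j where j: "norm (f - dense_fn j) < d" using dense_fn[OF d(1)] by blast
  have "norm \<mu> * norm (f - dense_fn j) \<le> c * d"
    using j c by (intro mult_mono) auto
  moreover have "\<bar>pr \<mu> f - pr \<mu> (dense_fn j)\<bar> \<le> norm \<mu> * norm (f - dense_fn j)"
    using norm_blinfun[of \<mu> "f - dense_fn j"] by (simp add: blinfun.diff_right)
  ultimately have 1: "\<bar>pr \<mu> f - pr \<mu> (dense_fn j)\<bar> \<le> e / 3" using d by linarith
  have "1 * d \<le> c * d" using d c by (intro mult_right_mono) auto
  then have "d \<le> e / 3" using d by simp
  then have 2: "\<bar>pr (u n) f - pr (u n) (dense_fn j)\<bar> < e / 3" for n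
    using prob_close[OF u, of n f "dense_fn j"] j by linarith
  obtain N where N: "\<And>n. n \<ge> N \<Longrightarrow> \<bar>pr (u n) (dense_fn j) - pr \<mu> (dense_fn j)\<bar> < e / 3"
    using LIMSEQ_D[OF lim[of j], of "e/3"] e by auto
  show "\<exists>N. \<forall>n\<ge>N. norm (pr (u n) f - pr \<mu> f) < e"
  proof (intro exI allI impI)
    fix n assume "N \<le> n"
    from N[OF this] 1 2[of n] show "norm (pr (u n) f - pr \<mu> f) < e"
      unfolding real_norm_def by linarith
  qed
qed

lemma prob_seq_compact:
  fixes u :: "nat \<Rightarrow> 'a CSigma_dual"
  assumes u: "\<And>n. u n \<in> PP"
  obtains r \<mu> where "strict_mono (r :: nat \<Rightarrow> nat)" "\<mu> \<in> PP" "wlim (\<lambda>n. u (r n)) \<mu>"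
proof -
  have em: "emeasure (rep (u n)) UNIV = 1" for n
    using repr_measure(1)[OF u, of n] borel_prob_space[of "rep (u n)"]
    unfolding borel_prob_def by (metis prob_space.emeasure_space_1)
  obtain r N where r: "strict_mono r" "borel_prob N"
    "\<And>f :: 'a CSigma. (\<lambda>n. \<integral>x. app f x \<partial>rep (u (r n))) \<longlonglongrightarrow> (\<integral>x. app f x \<partial>N)"
    using that by (rule prokhorov_compact[OF compact_Sigma repr_measure(1)[OF u] em])
  have "wlim (\<lambda>n. u (r n)) (func_of N)"
    unfolding wlim_def using r(3) by (simp add: repr_measure(2)[OF u] apply_func_of[OF r(2)])
  with r(1) func_of_prob[OF r(2)] show thesis by (rule that)
qed

lemma prob_closed:
  fixes u :: "nat \<Rightarrow> 'a CSigma_dual"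
  assumes "\<And>n. u n \<in> PP" "wlim u \<mu>"
  shows "\<mu> \<in> PP"
proof -
  obtain r \<nu> where r: "strict_mono (r :: nat \<Rightarrow> nat)" "\<nu> \<in> PP" "wlim (\<lambda>n. u (r n)) \<nu>"
    using that by (rule prob_seq_compact[OF assms(1)])
  have "\<mu> = \<nu>" by (rule wlim_unique[OF wlim_subseq[OF assms(2) r(1)] r(3)])
  with r show ?thesis by simp
qed

definition comp_shift :: "'a CSigma \<Rightarrow> 'a CSigma"
  where "comp_shift f = Bcontfun (\<lambda>x. app f (shift x))"

lemma apply_comp_shift [simp]: "app (comp_shift f) = (\<lambda>x. app f (shift x))"
  unfolding comp_shift_def
  by (intro apply_Bcontfun_Sigma continuous_on_compose2[OF continuous_on_apply_bcontfun continuous_shift]) auto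

text \<open>Invariance of the measure becomes a linear, weak*-closed condition on the functional.
  The way back to measures uses that a Borel probability measure is determined by its integrals of
  continuous functions.\<close>

lemma invariant_functionals_iff:
  "\<mu> \<in> PT \<longleftrightarrow> \<mu> \<in> PP \<and> (\<forall>f. pr \<mu> (comp_shift f) = pr \<mu> f)"
proof (cases "\<mu> \<in> PP")
  case True
  let ?M = "rep \<mu>"
  have M: "borel_prob ?M" by (rule repr_measure(1)[OF True])
  then interpret prob_space ?M by (simp add: borel_prob_def)
  have ms: "shift \<in> ?M \<rightarrow>\<^sub>M borel" by (simp add: borel_prob_measurable[OF M])
  have bp: "borel_prob (distr ?M borel shift)"
    by (simp add: borel_prob_def prob_space_distr[OF ms])
  have int: "(\<integral>x. app f x \<partial>distr ?M borel shift) = pr \<mu> (comp_shift f)" for f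
    by (simp add: integral_distr[OF ms] repr_measure(2)[OF True])
  have "distr ?M borel shift = ?M \<longleftrightarrow> (\<forall>f. pr \<mu> (comp_shift f) = pr \<mu> f)"
  proof
    assume "distr ?M borel shift = ?M"
    then show "\<forall>f. pr \<mu> (comp_shift f) = pr \<mu> f"
      by (metis int repr_measure(2)[OF True])
  next
    assume "\<forall>f. pr \<mu> (comp_shift f) = pr \<mu> f"
    then have "represents (distr ?M borel shift) \<mu>"
      using bp by (simp add: represents_def int borel_prob_def)
    then show "distr ?M borel shift = ?M"
      using represents_repr_measure[OF True] by (rule represents_unique)
  qed
  with True show ?thesis by (simp add: invariant_functionals_def)
qed (simp add: invariant_functionals_def)

lemma invariant_prob: "\<mu> \<in> PT \<Longrightarrow> \<mu> \<in> PP"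
  by (simp add: invariant_functionals_def)

lemma invariant_closed:
  fixes u :: "nat \<Rightarrow> 'a CSigma_dual"
  assumes "\<And>n. u n \<in> PT" "wlim u \<mu>"
  shows "\<mu> \<in> PT"
  unfolding invariant_functionals_iff
proof (intro conjI allI)
  show "\<mu> \<in> PP" by (rule prob_closed[OF invariant_prob assms(2)]) (rule assms(1))
  fix f
  have "(\<lambda>n. pr (u n) (comp_shift f)) \<longlonglongrightarrow> pr \<mu> (comp_shift f)"
    using assms(2) by (simp add: wlim_def)
  moreover have "pr (u n) (comp_shift f) = pr (u n) f" for n
    using assms(1)[of n] by (simp add: invariant_functionals_iff)
  moreover have "(\<lambda>n. pr (u n) f) \<longlonglongrightarrow> pr \<mu> f"
    using assms(2) by (simp add: wlim_def)
  ultimately show "pr \<mu> (comp_shift f) = pr \<mu> f"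
    using LIMSEQ_unique by fastforce
qed

lemma invariant_seq_compact:
  fixes u :: "nat \<Rightarrow> 'a CSigma_dual"
  assumes u: "\<And>n. u n \<in> PT"
  obtains r \<mu> where "strict_mono (r :: nat \<Rightarrow> nat)" "\<mu> \<in> PT" "wlim (\<lambda>n. u (r n)) \<mu>"
proof -
  obtain r \<mu> where r: "strict_mono (r :: nat \<Rightarrow> nat)" "\<mu> \<in> PP" "wlim (\<lambda>n. u (r n)) \<mu>"
    using that by (rule prob_seq_compact[OF invariant_prob[OF u]])
  have "\<mu> \<in> PT" by (rule invariant_closed[OF _ r(3)]) (rule u)
  with r(1) show thesis using r(3) by (rule that)
qed

lemma invariant_seq_compact_ex:
  fixes u :: "nat \<Rightarrow> 'a CSigma_dual"
  assumes "\<And>n. u n \<in> PT"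
  shows "\<exists>r \<mu>. strict_mono (r :: nat \<Rightarrow> nat) \<and> \<mu> \<in> PT \<and> wlim (\<lambda>n. u (r n)) \<mu>"
proof -
  obtain r \<mu> where "strict_mono (r :: nat \<Rightarrow> nat)" "\<mu> \<in> PT" "wlim (\<lambda>n. u (r n)) \<mu>"
    using that by (rule invariant_seq_compact[OF assms])
  then show ?thesis by (intro exI[of _ r] exI[of _ \<mu>] conjI)
qed

text \<open>A combination is recognised as a probability functional by positivity and normalisation,
  through the Riesz representation, instead of mixing the representing measures.\<close>

lemma prob_convex: "convex (PP :: 'a CSigma_dual set)"
proof (rule convexI)
  fix \<mu> \<nu> :: "'a CSigma_dual" and a b :: real
  assume \<mu>\<nu>: "\<mu> \<in> PP" "\<nu> \<in> PP" and ab: "0 \<le> a" "0 \<le> b" "a + b = 1"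
  have 1: "linear (pr (a *\<^sub>R \<mu> + b *\<^sub>R \<nu>))"
    by (simp add: blinfun.bounded_linear_right bounded_linear.linear)
  have 2: "0 \<le> pr (a *\<^sub>R \<mu> + b *\<^sub>R \<nu>) f" if "\<And>x. 0 \<le> app f x" for f
  proof -
    have "0 \<le> pr \<mu> f" "0 \<le> pr \<nu> f"
      using prob_mono[of _ 0 f] \<mu>\<nu> that by (auto simp: blinfun.zero_right)
    then show ?thesis using ab by (simp add: blinfun.add_left blinfun.scaleR_left)
  qed
  have 3: "pr (a *\<^sub>R \<mu> + b *\<^sub>R \<nu>) (cst 1) = 1"
    using \<mu>\<nu> ab by (simp add: blinfun.add_left blinfun.scaleR_left prob_const)
  obtain \<rho> where \<rho>: "\<rho> \<in> PP" "\<And>f. pr \<rho> f = pr (a *\<^sub>R \<mu> + b *\<^sub>R \<nu>) f"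
    using prob_functional_of_positive[OF 1 2 3] by blast
  then have "\<rho> = a *\<^sub>R \<mu> + b *\<^sub>R \<nu>" by (intro blinfun_eqI) simp
  with \<rho>(1) show "a *\<^sub>R \<mu> + b *\<^sub>R \<nu> \<in> PP" by simp
qed

lemma invariant_convex: "convex (PT :: 'a CSigma_dual set)"
  using prob_convex unfolding convex_def
  by (auto simp: invariant_functionals_iff blinfun.add_left blinfun.scaleR_left)

lemma wlim_of_close:
  fixes u :: "nat \<Rightarrow> 'a CSigma_dual"
  assumes u: "\<And>n. u n \<in> PP"
    and c: "\<And>n j. j < n \<Longrightarrow> \<bar>pr (u n) (dense_fn j) - pr \<mu> (dense_fn j)\<bar> \<le> C * inverse (real (Suc n))"
  shows "wlim u \<mu>"
proof (rule wlim_dense[OF u])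
  show "(\<lambda>n. pr (u n) (dense_fn j)) \<longlonglongrightarrow> pr \<mu> (dense_fn j)" for j
  proof (rule LIM_zero_cancel, rule Lim_null_comparison)
    show "\<forall>\<^sub>F n in sequentially. norm (pr (u n) (dense_fn j) - pr \<mu> (dense_fn j)) \<le> C * inverse (real (Suc n))"
      using eventually_gt_at_top[of j] by eventually_elim (use c in auto)
    show "(\<lambda>n. C * inverse (real (Suc n))) \<longlonglongrightarrow> 0"
      using tendsto_mult_right_zero[OF LIMSEQ_inverse_real_of_nat, of C] by simp
  qed
qed

lemma wlim_of_near:
  fixes X :: "'a CSigma_dual set"
  assumes X: "X \<subseteq> PP"
    and near: "\<forall>n. \<exists>\<nu>. \<nu> \<in> X \<and> (\<forall>j<n. \<bar>pr \<nu> (dense_fn j) - pr \<mu> (dense_fn j)\<bar> < inverse (real (Suc n)))"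
  shows "\<exists>u. (\<forall>n. u n \<in> X) \<and> wlim u \<mu>"
proof -
  from choice[OF near] obtain u where u: "\<And>n. u n \<in> X"
    "\<And>n j. j < n \<Longrightarrow> \<bar>pr (u n) (dense_fn j) - pr \<mu> (dense_fn j)\<bar> < inverse (real (Suc n))"
    by blast
  have "wlim u \<mu>"
    by (rule wlim_of_close[of u, where C=1]) (use u X in \<open>auto intro: less_imp_le\<close>)
  with u(1) show ?thesis by (intro exI[of _ u] conjI allI)
qed

text \<open>The neighbourhood that prescribes the first n dense functions up to 1/(n+1) meets X. A
  point chosen from each gives a sequence converging on the dense functions, hence everywhere,
  because probability functionals are uniformly bounded.\<close>

lemma weak_star_closure_iff:
  fixes X :: "'a CSigma_dual set"
  assumes X: "X \<subseteq> PP"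
  shows "\<mu> \<in> weak_star closure_of X \<longleftrightarrow> (\<exists>u. (\<forall>n. u n \<in> X) \<and> wlim u \<mu>)"
proof
  assume cl: "\<mu> \<in> weak_star closure_of X"
  show "\<exists>u. (\<forall>n. u n \<in> X) \<and> wlim u \<mu>"
  proof (rule wlim_of_near[OF X], rule allI)
    fix n
    let ?W = "{\<nu>. \<forall>j\<in>{..<n}. pr \<nu> (dense_fn j) \<in> ball (pr \<mu> (dense_fn j)) (inverse (real (Suc n)))}"
    have "openin weak_star ?W" by (intro strong_operator_topology_basis) auto
    moreover have "\<mu> \<in> ?W" by simp
    moreover have "\<forall>T. \<mu> \<in> T \<and> openin weak_star T \<longrightarrow> (\<exists>y. y \<in> X \<and> y \<in> T)"
      using cl unfolding in_closure_of by (rule conjunct2)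
    ultimately have "\<exists>\<nu>. \<nu> \<in> X \<and> \<nu> \<in> ?W" by (simp only: simp_thms)
    then obtain \<nu> where "\<nu> \<in> X" "\<nu> \<in> ?W" by (elim exE conjE)
    then show "\<exists>\<nu>. \<nu> \<in> X \<and> (\<forall>j<n. \<bar>pr \<nu> (dense_fn j) - pr \<mu> (dense_fn j)\<bar> < inverse (real (Suc n)))"
      by (intro exI[of _ \<nu>]) (auto simp: dist_real_def abs_minus_commute)
  qed
next
  assume "\<exists>u. (\<forall>n. u n \<in> X) \<and> wlim u \<mu>"
  then obtain u where u: "\<And>n. u n \<in> X" "wlim u \<mu>" by blast
  then have lim: "limitin weak_star u \<mu> sequentially" by (simp add: limitin_weak_star_iff)
  show "\<mu> \<in> weak_star closure_of X"
    unfolding in_closure_of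
  proof (intro conjI allI impI)
    show "\<mu> \<in> topspace weak_star" by (simp add: strong_operator_topology_topspace)
    fix T assume "\<mu> \<in> T \<and> openin weak_star T"
    then have "eventually (\<lambda>n. u n \<in> T) sequentially" using lim by (simp add: limitin_def)
    then obtain n where "u n \<in> T" by (auto simp: eventually_sequentially)
    then show "\<exists>y. y \<in> X \<and> y \<in> T" using u by blast
  qed
qed

text \<open>The separating function is the gradient, at the nearest point of \<open>K\<close>, of a quadratic
  form in finitely many evaluations; this avoids the Hahn-Banach theorem.\<close>

lemma weak_star_separation:
  fixes K :: "'a CSigma_dual set"
  assumes K: "K \<subseteq> PP" "convex K" "K \<noteq> {}"
    and cl: "\<forall>u \<nu>. (\<forall>n. u n \<in> K) \<longrightarrow> wlim u \<nu> \<longrightarrow> \<nu> \<in> K" and \<mu>: "\<mu> \<notin> K"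
  shows "\<exists>\<phi> c. (\<forall>\<nu>\<in>K. pr \<nu> \<phi> \<le> c) \<and> c < pr \<mu> \<phi>"
proof -
  have "\<exists>n. \<forall>\<nu>\<in>K. \<exists>j<n. inverse (real (Suc n)) \<le> \<bar>pr \<nu> (dense_fn j) - pr \<mu> (dense_fn j)\<bar>"
  proof (rule ccontr)
    assume "\<not> ?thesis"
    then have "\<forall>n. \<exists>\<nu>. \<nu> \<in> K \<and> (\<forall>j<n. \<bar>pr \<nu> (dense_fn j) - pr \<mu> (dense_fn j)\<bar> < inverse (real (Suc n)))"
      by (meson not_less)
    then obtain u where "\<forall>n. u n \<in> K" "wlim u \<mu>" using wlim_of_near[OF K(1)] by blast
    then have "\<mu> \<in> K" using cl[THEN spec, THEN spec, of u \<mu>] by simp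
    with \<mu> show False by simp
  qed
  then obtain n where n: "\<And>\<nu>. \<nu> \<in> K \<Longrightarrow> \<exists>j<n. inverse (real (Suc n)) \<le> \<bar>pr \<nu> (dense_fn j) - pr \<mu> (dense_fn j)\<bar>"
    by blast
  define D where "D \<nu> = (\<Sum>j<n. (pr \<mu> (dense_fn j) - pr \<nu> (dense_fn j))\<^sup>2)" for \<nu>
  obtain p where p: "p \<in> K" "\<And>\<nu>. \<nu> \<in> K \<Longrightarrow> ereal (- D \<nu>) \<le> ereal (- D p)"
  proof (rule usc_attains_max[of K "\<lambda>\<nu>. ereal (- D \<nu>)"])
    show "\<exists>r \<mu>. strict_mono (r :: nat \<Rightarrow> nat) \<and> \<mu> \<in> K \<and> wlim (\<lambda>n. u (r n)) \<mu>" if u: "\<And>n. u n \<in> K" for u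
    proof -
      have up: "u n \<in> PP" for n using u K by auto
      obtain r \<mu> where r: "strict_mono (r :: nat \<Rightarrow> nat)" "\<mu> \<in> PP" "wlim (\<lambda>n. u (r n)) \<mu>"
        using that by (rule prob_seq_compact[OF up])
      moreover have "\<mu> \<in> K" by (rule cl[rule_format, OF _ r(3)]) (rule u)
      ultimately show ?thesis by blast
    qed
    show "l \<le> ereal (- D \<nu>)" if "wlim u \<nu>" "(\<lambda>n. ereal (- D (u n))) \<longlonglongrightarrow> l" for u \<nu> l
    proof -
      have "(\<lambda>n. ereal (- D (u n))) \<longlonglongrightarrow> ereal (- D \<nu>)"
        unfolding D_def using that(1)
        by (intro tendsto_ereal tendsto_minus tendsto_sum tendsto_power tendsto_diff tendsto_const) (auto simp: wlim_def)
      with that(2) have "l = ereal (- D \<nu>)" by (rule LIMSEQ_unique)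
      then show ?thesis by simp
    qed
  qed (use K in auto)
  define a where "a j = pr \<mu> (dense_fn j) - pr p (dense_fn j)" for j
  define \<phi> where "\<phi> = (\<Sum>j<n. a j *\<^sub>R dense_fn j)"
  have app: "pr \<nu> \<phi> = (\<Sum>j<n. a j * pr \<nu> (dense_fn j))" for \<nu>
    by (simp add: \<phi>_def blinfun.sum_right blinfun.scaleR_right)
  show ?thesis
  proof (intro exI[of _ \<phi>] exI[of _ "pr p \<phi>"] conjI ballI)
    fix \<nu> assume \<nu>: "\<nu> \<in> K"
    define b where "b j = pr \<nu> (dense_fn j) - pr p (dense_fn j)" for j
    have "(\<Sum>j<n. a j * b j) \<le> 0 + e" if e: "e > 0" for e
    proof -
      define S where "S = (\<Sum>j<n. (b j)\<^sup>2)"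
      have S: "0 \<le> S" unfolding S_def by (intro sum_nonneg) auto
      define t where "t = min 1 (e / (S + 1))"
      have t: "0 < t" "t \<le> 1" "t * S \<le> e"
      proof -
        have "t * S \<le> e / (S + 1) * (S + 1)" unfolding t_def using S e
          by (intro mult_mono) auto
        then show "t * S \<le> e" using S by simp
      qed (use e S in \<open>auto simp: t_def\<close>)
      have "(1 - t) *\<^sub>R p + t *\<^sub>R \<nu> \<in> K"
        using K(2) p(1) \<nu> t by (intro convexD) auto
      \<comment> \<open>\<open>p\<close> is nearest to \<open>\<mu>\<close>, so a step from it
        towards \<open>\<nu>\<close> cannot reduce the distance. Dividing the resulting quadratic
        inequality by t leaves the first-order term, with an error t * S that was made
        small.\<close>
      then have "D p \<le> D ((1 - t) *\<^sub>R p + t *\<^sub>R \<nu>)" using p(2) by force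
      also have "\<dots> = (\<Sum>j<n. (a j - t * b j)\<^sup>2)"
        unfolding D_def a_def b_def
        unfolding blinfun.add_left blinfun.scaleR_left real_scaleR_def
        by (intro sum.cong refl arg_cong[where f="\<lambda>x. x\<^sup>2"]) (simp add: algebra_simps)
      also have "\<dots> = (\<Sum>j<n. (a j)\<^sup>2) - 2 * t * (\<Sum>j<n. a j * b j) + t\<^sup>2 * S"
        unfolding S_def by (simp add: power2_diff sum.distrib sum_subtractf sum_distrib_left power_mult_distrib mult_ac)
      also have "(\<Sum>j<n. (a j)\<^sup>2) = D p" by (simp add: D_def a_def)
      finally have "t * (2 * (\<Sum>j<n. a j * b j)) \<le> t * (t * S)" by (simp add: power2_eq_square mult_ac)
      then have "2 * (\<Sum>j<n. a j * b j) \<le> t * S" using t by (simp only: mult_le_cancel_left_pos)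
      then show ?thesis using t e by linarith
    qed
    then have "(\<Sum>j<n. a j * b j) \<le> 0" by (rule field_le_epsilon)
    moreover have "pr \<nu> \<phi> - pr p \<phi> = (\<Sum>j<n. a j * b j)"
      unfolding app b_def by (simp add: sum_subtractf[symmetric] algebra_simps)
    ultimately show "pr \<nu> \<phi> \<le> pr p \<phi>" by linarith
  next
    obtain j where j: "j < n" "inverse (real (Suc n)) \<le> \<bar>pr p (dense_fn j) - pr \<mu> (dense_fn j)\<bar>"
      using n[OF p(1)] by blast
    then have "a j \<noteq> 0" by (auto simp: a_def)
    then have "0 < (\<Sum>j<n. (a j)\<^sup>2)" using j(1) by (intro sum_pos2[of _ j]) auto
    moreover have "pr \<mu> \<phi> - pr p \<phi> = (\<Sum>j<n. (a j)\<^sup>2)"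
      unfolding app a_def by (simp add: sum_subtractf[symmetric] algebra_simps power2_eq_square)
    ultimately show "pr p \<phi> < pr \<mu> \<phi>" by linarith
  qed
qed

end

section \<open>The transfer operator and the entropy\<close>

lemma continuous_cons_tail: "continuous_on S (\<lambda>x. case_nat w x :: nat \<Rightarrow> 'a::topological_space)"
proof (rule continuous_on_coordinatewise_then_product)
  show "continuous_on S (\<lambda>x. case_nat w x i)" for i
    by (cases i) (auto intro: continuous_on_subset[OF continuous_on_product_coordinates subset_UNIV])
qed

lemma continuous_cons_head: "continuous_on S (\<lambda>w. case_nat w x :: nat \<Rightarrow> 'a::topological_space)"
proof (rule continuous_on_coordinatewise_then_product)
  show "continuous_on S (\<lambda>w. case_nat w x i)" for i by (cases i) auto
qed

lemma shift_cons [simp]: "shift (case_nat w x) = x"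
  by (simp add: shift_def)

lemma cons_shift: "case_nat (x 0) (shift x) = x"
  by (auto simp: shift_def split: nat.split)

context symbolic_space
begin

lemma measure_UNIV_m: "measure m (UNIV :: 'a set) = 1"
proof -
  have "space m = UNIV" using sets_eq_imp_space_eq[OF sets_m] by simp
  then show ?thesis using prob_space.prob_space[OF prob_m] by simp
qed

lemma borel_prob_m: "borel_prob m"
  by (simp add: borel_prob_def prob_m sets_m)

lemma continuous_apply_cons_head: "continuous_on S (\<lambda>w. app f (case_nat w x))"
  for f :: "'a CSigma"
  by (rule continuous_on_compose2[OF continuous_on_apply_bcontfun continuous_cons_head]) auto

lemma integrable_cons: "integrable m (\<lambda>w. app f (case_nat w x))" for f :: "'a CSigma"
  by (rule borel_prob_integrable_bounded[OF borel_prob_m, where B="norm f"])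
    (auto intro: borel_measurable_continuous_onI continuous_apply_cons_head abs_bcontfun_le_norm)

lemma continuous_transfer_op: "continuous_on UNIV (transfer_op m f)"
  unfolding continuous_on_sequentially
proof (intro allI ballI impI)
  fix x :: "nat \<Rightarrow> nat \<Rightarrow> 'a" and s
  assume "(\<forall>n. x n \<in> UNIV) \<and> x \<longlonglongrightarrow> s"
  then have x: "x \<longlonglongrightarrow> s" by simp
  interpret prob_space m by (rule prob_m)
  have "(\<lambda>n. \<integral>\<omega>. app f (case_nat \<omega> (x n)) \<partial>m) \<longlonglongrightarrow> (\<integral>\<omega>. app f (case_nat \<omega> s) \<partial>m)"
  proof (rule integral_dominated_convergence[where w="\<lambda>_. norm f"])
    have "(\<lambda>n. app f (case_nat \<omega> (x n))) \<longlonglongrightarrow> app f (case_nat \<omega> s)" for \<omega>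
    proof (rule continuous_on_tendsto_compose[of UNIV "\<lambda>s. app f (case_nat \<omega> s)"])
      show "continuous_on UNIV (\<lambda>s. app f (case_nat \<omega> s))"
        by (rule continuous_on_compose2[OF continuous_on_apply_bcontfun continuous_cons_tail]) auto
    qed (use x in auto)
    then show "AE \<omega> in m. (\<lambda>n. app f (case_nat \<omega> (x n))) \<longlonglongrightarrow> app f (case_nat \<omega> s)"
      by simp
    show "(\<lambda>\<omega>. app f (case_nat \<omega> (x n))) \<in> borel_measurable m" for n
      using integrable_cons by (rule borel_measurable_integrable)
    show "(\<lambda>\<omega>. app f (case_nat \<omega> s)) \<in> borel_measurable m"
      using integrable_cons by (rule borel_measurable_integrable)
  qed (auto simp: abs_bcontfun_le_norm)
  then show "(transfer_op m f \<circ> x) \<longlonglongrightarrow> transfer_op m f s"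
    by (simp add: o_def transfer_op_def)
qed

lemma transfer_op_mono:
  "(\<And>x. app f x \<le> app g x) \<Longrightarrow> transfer_op m f x \<le> transfer_op m g x"
  unfolding transfer_op_def by (intro integral_mono integrable_cons)

lemma transfer_op_scale: "transfer_op m (c *\<^sub>R f) x = c * transfer_op m f x"
  unfolding transfer_op_def by simp

lemma transfer_op_const: "transfer_op m (cst c) x = c"
  using sets_eq_imp_space_eq[OF sets_m]
  by (simp add: transfer_op_def const_bcontfun.rep_eq measure_UNIV_m)

definition Lop :: "'a CSigma \<Rightarrow> 'a CSigma"
  where "Lop f = Bcontfun (transfer_op m f)"

lemma apply_Lop [simp]: "app (Lop f) = transfer_op m f"
  unfolding Lop_def by (intro apply_Bcontfun_Sigma continuous_transfer_op)

definition pos_fn :: "'a CSigma \<Rightarrow> bool"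
  where "pos_fn f \<longleftrightarrow> (\<forall>x. app f x > 0)"

lemma pos_fn_lower:
  assumes "pos_fn f"
  obtains d where "d > 0" "\<And>x. d \<le> app f x"
proof -
  obtain y where "\<forall>x\<in>UNIV. app f y \<le> app f x"
    using continuous_attains_inf[OF compact_Sigma, of "app f"] by auto
  with assms show thesis by (intro that[of "app f y"]) (auto simp: pos_fn_def)
qed

lemma transfer_op_pos: assumes "pos_fn f" shows "0 < transfer_op m f x"
proof -
  obtain d where d: "d > 0" "\<And>x. d \<le> app f x" using assms that by (rule pos_fn_lower)
  have "transfer_op m (cst d) x \<le> transfer_op m f x"
    using d by (intro transfer_op_mono) (simp add: const_bcontfun.rep_eq)
  with d show ?thesis by (simp add: transfer_op_const)
qed

definition ell :: "'a CSigma \<Rightarrow> 'a CSigma"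
  where "ell f = Bcontfun (\<lambda>x. ln (transfer_op m f x / app f x))"

lemma apply_ell:
  assumes "pos_fn f"
  shows "app (ell f) = (\<lambda>x. ln (transfer_op m f x / app f x))"
  unfolding ell_def
proof (rule apply_Bcontfun_Sigma)
  have "app f x \<noteq> 0" "transfer_op m f x / app f x \<noteq> 0" for x
    using assms transfer_op_pos[OF assms, of x] unfolding pos_fn_def by (metis less_irrefl, metis divide_eq_0_iff less_irrefl)
  then show "continuous_on UNIV (\<lambda>x. ln (transfer_op m f x / app f x))"
    by (intro continuous_on_ln continuous_on_divide continuous_transfer_op continuous_on_apply_bcontfun) auto
qed

lemma entropy_eq:
  assumes "\<mu> \<in> PP"
  shows "ent \<mu> = (INF f\<in>Collect pos_fn. ereal (pr \<mu> (ell f)))"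
  unfolding entropy_fn_def
  by (intro INF_cong) (auto simp: pos_fn_def[symmetric] repr_measure(2)[OF assms] apply_ell)

lemma entropy_le: "\<mu> \<in> PP \<Longrightarrow> pos_fn f \<Longrightarrow> ent \<mu> \<le> ereal (pr \<mu> (ell f))"
  by (subst entropy_eq) (auto intro: INF_lower)

lemma entropy_greatest:
  "\<mu> \<in> PP \<Longrightarrow> (\<And>f. pos_fn f \<Longrightarrow> c \<le> ereal (pr \<mu> (ell f))) \<Longrightarrow> c \<le> ent \<mu>"
  by (subst entropy_eq) (auto intro: INF_greatest)

lemma entropy_nonpos:
  assumes "\<mu> \<in> PP"
  shows "ent \<mu> \<le> 0"
proof -
  have p: "pos_fn (cst 1)" by (simp add: pos_fn_def const_bcontfun.rep_eq)
  have "ell (cst 1) = 0"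
    by (rule bcontfun_eqI) (simp add: apply_ell[OF p] transfer_op_const const_bcontfun.rep_eq)
  with entropy_le[OF assms p] show ?thesis by (simp add: blinfun.zero_right zero_ereal_def)
qed

lemma entropy_usc:
  assumes u: "\<And>n. u n \<in> PP" and lim: "wlim u \<mu>"
    and l: "(\<lambda>n. ent (u n)) \<longlonglongrightarrow> l"
  shows "l \<le> ent \<mu>"
proof (rule entropy_greatest)
  show "\<mu> \<in> PP" by (rule prob_closed[OF u lim])
  fix f assume f: "pos_fn f"
  have "(\<lambda>n. ereal (pr (u n) (ell f))) \<longlonglongrightarrow> ereal (pr \<mu> (ell f))"
    using lim by (intro tendsto_ereal) (simp add: wlim_def)
  then show "l \<le> ereal (pr \<mu> (ell f))"
    by (rule LIMSEQ_le[OF l]) (auto intro: entropy_le[OF u f])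
qed

text \<open>Real lower bounds stand in for the entropies, which may be -\<infinity>. For a fixed
  test function the integral is affine in the measure, and the bound passes to the infimum.\<close>

lemma entropy_concave:
  assumes "\<mu> \<in> PP" "\<nu> \<in> PP" and ab: "0 \<le> a" "0 \<le> b" "a + b = 1"
    and "ereal c \<le> ent \<mu>" "ereal d \<le> ent \<nu>"
  shows "ereal (a * c + b * d) \<le> ent (a *\<^sub>R \<mu> + b *\<^sub>R \<nu>)"
proof (rule entropy_greatest)
  show "a *\<^sub>R \<mu> + b *\<^sub>R \<nu> \<in> PP" by (rule convexD[OF prob_convex assms(1-5)])
  fix f assume f: "pos_fn f"
  have "c \<le> pr \<mu> (ell f)" "d \<le> pr \<nu> (ell f)"
    using order_trans[OF assms(6) entropy_le[OF assms(1) f]] order_trans[OF assms(7) entropy_le[OF assms(2) f]]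
    by auto
  then show "ereal (a * c + b * d) \<le> ereal (pr (a *\<^sub>R \<mu> + b *\<^sub>R \<nu>) (ell f))"
    using ab by (auto simp: blinfun.add_left blinfun.scaleR_left intro!: add_mono mult_left_mono)
qed

lemma integrable_indicator_bcontfun:
  fixes g :: "'a CSigma"
  assumes M: "borel_prob M" and A: "A \<in> sets borel"
  shows "integrable M (\<lambda>x. indicator A x * app g x)"
  using A abs_bcontfun_le_norm[of g]
  by (intro borel_prob_integrable_bounded[OF M, where B="norm g"]) (auto simp: indicator_def)

text \<open>By L1 approximation the identity extends from continuous g to the indicator of A, where
  it reads M(A) = M(A)^2.\<close>

lemma zero_one_of_decorrelation:
  fixes M :: "(nat \<Rightarrow> 'a) measure"
  assumes M: "borel_prob M" and A: "A \<in> sets borel"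
    and dec: "\<And>g. (\<integral>s. indicator A s * app g s \<partial>M) = measure M A * (\<integral>s. app g s \<partial>M)"
  shows "measure M A = 0 \<or> measure M A = 1"
proof -
  interpret prob_space M using M by (simp add: borel_prob_def)
  have sM: "sets M = sets borel" and sp: "space M = UNIV"
    using M borel_prob_space by (auto simp: borel_prob_def)
  have "\<bar>measure M A - measure M A * measure M A\<bar> \<le> 0 + e" if e: "e > 0" for e
  proof -
    obtain w :: "'a CSigma" where w: "\<And>x. 0 \<le> app w x \<and> app w x \<le> 1"
      "(\<integral>x. \<bar>indicator A x - app w x\<bar> \<partial>M) < e / 2"
      using indicator_L1_approx[OF M A, rule_format, of "e/2"] e by auto
    have iA: "integrable M (\<lambda>x. indicator A x :: real)"
      using A by (auto intro!: integrable_real_indicator simp: sM emeasure_eq_measure)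
    have iw: "integrable M (app w)" by (rule borel_prob_integrable_bcontfun[OF M])
    have iAw: "integrable M (\<lambda>x. indicator A x * app w x)"
      by (rule integrable_indicator_bcontfun[OF M A])
    have idf: "integrable M (\<lambda>x. \<bar>indicator A x - app w x\<bar>)" using iA iw by auto
    have mA: "(\<integral>x. indicator A x \<partial>M) = measure M A" using A by (simp add: sp)
    have "\<bar>measure M A - (\<integral>x. app w x \<partial>M)\<bar> \<le> e / 2"
    proof -
      have "\<bar>\<integral>x. indicator A x - app w x \<partial>M\<bar> \<le> (\<integral>x. \<bar>indicator A x - app w x\<bar> \<partial>M)"
        by (rule integral_abs_bound)
      then show ?thesis using w(2) iA iw mA by simp
    qed
    moreover have "\<bar>measure M A - (\<integral>x. indicator A x * app w x \<partial>M)\<bar> \<le> e / 2"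
    proof -
      have "\<bar>\<integral>x. indicator A x - indicator A x * app w x \<partial>M\<bar> \<le> (\<integral>x. \<bar>indicator A x - indicator A x * app w x\<bar> \<partial>M)"
        by (rule integral_abs_bound)
      also have "\<dots> \<le> (\<integral>x. \<bar>indicator A x - app w x\<bar> \<partial>M)"
        using iA iAw idf by (intro integral_mono) (auto simp: indicator_def)
      finally show ?thesis using w(2) iA iAw mA by simp
    qed
    moreover have "\<bar>measure M A * (\<integral>x. app w x \<partial>M) - measure M A * measure M A\<bar> \<le> e / 2"
    proof -
      have "\<bar>measure M A * ((\<integral>x. app w x \<partial>M) - measure M A)\<bar> \<le> 1 * (e / 2)"
        unfolding abs_mult using \<open>\<bar>measure M A - (\<integral>x. app w x \<partial>M)\<bar> \<le> e / 2\<close>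
        by (intro mult_mono) (auto simp: abs_minus_commute)
      then show ?thesis by (simp add: right_diff_distrib)
    qed
    ultimately show ?thesis using dec[of w] by linarith
  qed
  then have "\<bar>measure M A - measure M A * measure M A\<bar> \<le> 0" by (rule field_le_epsilon)
  then have "measure M A * (1 - measure M A) = 0" by (simp add: algebra_simps)
  then show ?thesis by auto
qed

end

section \<open>Hoelder functions and g-measures\<close>

lemma abs_exp_diff_le:
  fixes x y B :: real
  assumes "x \<le> B" "y \<le> B"
  shows "\<bar>exp x - exp y\<bar> \<le> exp B * \<bar>x - y\<bar>"
proof -
  have *: "exp x - exp y \<le> exp B * \<bar>x - y\<bar>" if "x \<le> B" for x y :: real
  proof -
    have "exp x * (1 + (y - x)) \<le> exp x * exp (y - x)"
      by (intro mult_left_mono exp_ge_add_one_self) auto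
    then have "exp x - exp y \<le> exp x * (x - y)" by (simp add: exp_diff algebra_simps)
    also have "\<dots> \<le> exp x * \<bar>x - y\<bar>" by (intro mult_left_mono) auto
    also have "\<dots> \<le> exp B * \<bar>x - y\<bar>" using that by (intro mult_right_mono) auto
    finally show ?thesis .
  qed
  show ?thesis using *[of x y] *[of y x] assms by (auto simp: abs_if abs_minus_commute)
qed

context symbolic_space
begin

lemma summable_d_eta: "summable (\<lambda>n. \<eta> ^ n * dist (x n :: 'a) (x' n))"
proof (rule summable_comparison_test'[of "\<lambda>n. \<eta> ^ n" 0])
  show "summable (\<lambda>n. \<eta> ^ n)" using eta by (intro summable_geometric) auto
  show "norm (\<eta> ^ n * dist (x n) (x' n)) \<le> \<eta> ^ n" for n
    using eta dist_le_1[of "x n" "x' n"] by (simp add: mult_left_le)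
qed

lemma d_eta_nonneg: "0 \<le> d_eta \<eta> (x :: nat \<Rightarrow> 'a) x'"
  unfolding d_eta_def using eta summable_d_eta
  by (intro mult_nonneg_nonneg suminf_nonneg) auto

lemma d_eta_le_1: "d_eta \<eta> (x :: nat \<Rightarrow> 'a) x' \<le> 1"
proof -
  have "(\<Sum>n. \<eta> ^ n * dist (x n) (x' n)) \<le> (\<Sum>n. \<eta> ^ n)"
    using eta dist_le_1
    by (intro suminf_le summable_d_eta summable_geometric) (auto simp: mult_left_le)
  also have "\<dots> = 1 / (1 - \<eta>)" using eta by (intro suminf_geometric) auto
  finally show ?thesis unfolding d_eta_def using eta by (simp add: field_simps)
qed

lemma d_eta_commute: "d_eta \<eta> (x :: nat \<Rightarrow> 'a) x' = d_eta \<eta> x' x"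
  unfolding d_eta_def by (simp add: dist_commute)

lemma d_eta_cons: "d_eta \<eta> (case_nat w x) (case_nat w x') = \<eta> * d_eta \<eta> x (x' :: nat \<Rightarrow> 'a)"
proof -
  have "(\<Sum>n. \<eta> ^ n * dist (case_nat w x n) (case_nat w x' n)) =
    (\<Sum>n. \<eta> ^ Suc n * dist (x n) (x' n))"
    using suminf_split_head[OF summable_d_eta[of "case_nat w x" "case_nat w x'"]] by simp
  also have "\<dots> = \<eta> * (\<Sum>n. \<eta> ^ n * dist (x n) (x' n))"
    by (subst suminf_mult[OF summable_d_eta, symmetric]) (simp add: mult.assoc)
  finally show ?thesis by (simp add: d_eta_def)
qed

lemma d_eta_prefix:
  fixes x x' :: "nat \<Rightarrow> 'a"
  shows "(\<And>i. i < j \<Longrightarrow> x i = x' i) \<Longrightarrow> d_eta \<eta> x x' \<le> \<eta> ^ j"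
proof (induction j arbitrary: x x')
  case 0
  then show ?case by (simp add: d_eta_le_1)
next
  case (Suc j)
  have "d_eta \<eta> (case_nat (x 0) (shift x)) (case_nat (x 0) (shift x')) \<le> \<eta> * \<eta> ^ j"
    unfolding d_eta_cons using eta by (intro mult_left_mono Suc.IH) (auto simp: shift_def Suc.prems)
  moreover have "x 0 = x' 0" by (rule Suc.prems) simp
  ultimately show ?case using cons_shift[of x] cons_shift[of x'] by simp
qed

lemma continuous_d_eta: "continuous_on UNIV (\<lambda>x'. d_eta \<eta> (x :: nat \<Rightarrow> 'a) x')"
proof -
  have "uniform_limit UNIV (\<lambda>n x'. \<Sum>i<n. \<eta> ^ i * dist (x i) (x' i)) (\<lambda>x'. \<Sum>i. \<eta> ^ i * dist (x i) (x' i)) sequentially"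
  proof (rule Weierstrass_m_test)
    show "summable (\<lambda>n. \<eta> ^ n)" using eta by (intro summable_geometric) auto
    show "norm (\<eta> ^ n * dist (x n) (x' n)) \<le> \<eta> ^ n" for n x'
      using eta dist_le_1[of "x n" "x' n"] by (simp add: mult_left_le)
  qed
  moreover have "continuous_on UNIV (\<lambda>x'. \<Sum>i<n. \<eta> ^ i * dist (x i) (x' i))" for n
    by (intro continuous_intros continuous_on_product_coordinates)
  ultimately have "continuous_on UNIV (\<lambda>x'. \<Sum>i. \<eta> ^ i * dist (x i) (x' i))"
    by (intro uniform_limit_theorem[where F=sequentially]) auto
  then show ?thesis unfolding d_eta_def by (intro continuous_intros)
qed

lemma dist_coord_le_d_eta: "dist (x n) (x' n) \<le> d_eta \<eta> x x' / ((1 - \<eta>) * \<eta> ^ n)" for x :: "nat \<Rightarrow> 'a"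
proof -
  have "\<eta> ^ n * dist (x n) (x' n) = (\<Sum>i\<in>{n}. \<eta> ^ i * dist (x i) (x' i))" by simp
  also have "\<dots> \<le> (\<Sum>i. \<eta> ^ i * dist (x i) (x' i))"
    using eta by (intro sum_le_suminf summable_d_eta) auto
  finally have "(1 - \<eta>) * (\<eta> ^ n * dist (x n) (x' n)) \<le> d_eta \<eta> x x'"
    unfolding d_eta_def using eta by (intro mult_left_mono) auto
  then show ?thesis using eta by (simp add: field_simps)
qed

definition expf :: "'a CSigma \<Rightarrow> 'a CSigma"
  where "expf f = Bcontfun (\<lambda>x. exp (app f x))"

definition mulf :: "'a CSigma \<Rightarrow> 'a CSigma \<Rightarrow> 'a CSigma"
  where "mulf f g = Bcontfun (\<lambda>x. app f x * app g x)"

definition lnf :: "'a CSigma \<Rightarrow> 'a CSigma"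
  where "lnf f = Bcontfun (\<lambda>x. ln (app f x))"

lemma apply_expf [simp]: "app (expf f) = (\<lambda>x. exp (app f x))"
  unfolding expf_def by (intro apply_Bcontfun_Sigma continuous_intros) auto

lemma apply_mulf [simp]: "app (mulf f g) = (\<lambda>x. app f x * app g x)"
  unfolding mulf_def by (intro apply_Bcontfun_Sigma continuous_intros) auto

lemma apply_lnf: "pos_fn f \<Longrightarrow> app (lnf f) = (\<lambda>x. ln (app f x))"
  unfolding lnf_def pos_fn_def
  by (intro apply_Bcontfun_Sigma continuous_on_ln) (auto simp: less_imp_neq[THEN not_sym])

lemma pos_expf: "pos_fn (expf f)"
  by (simp add: pos_fn_def)

end

locale holder_exponent = symbolic_space m \<eta> for m :: "'a::metric_space measure" and \<eta> +
  fixes \<alpha> :: real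
  assumes alpha: "0 < \<alpha>" "\<alpha> \<le> 1"
begin

definition gauge :: "(nat \<Rightarrow> 'a) \<Rightarrow> (nat \<Rightarrow> 'a) \<Rightarrow> real"
  where "gauge x x' = d_eta \<eta> x x' powr \<alpha>"

text \<open>The factor by which prepending a common symbol shrinks \<open>gauge\<close>. That it is
  below 1 drives all contraction estimates.\<close>

definition \<kappa> :: real where "\<kappa> = \<eta> powr \<alpha>"

definition hol :: "real \<Rightarrow> 'a CSigma \<Rightarrow> bool"
  where "hol A u \<longleftrightarrow> (\<forall>x x'. \<bar>app u x - app u x'\<bar> \<le> A * gauge x x')"

lemma kappa: "0 < \<kappa>" "\<kappa> < 1"
  unfolding \<kappa>_def using eta alpha powr_less_mono2[of \<alpha> \<eta> 1] by auto

lemma gauge_nonneg: "0 \<le> gauge x x'"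
  by (simp add: gauge_def)

lemma gauge_le_1: "gauge x x' \<le> 1"
  unfolding gauge_def using alpha d_eta_nonneg d_eta_le_1 by (intro powr_le1) auto

lemma gauge_commute: "gauge x x' = gauge x' x"
  by (simp add: gauge_def d_eta_commute)

lemma gauge_cons: "gauge (case_nat w x) (case_nat w x') = \<kappa> * gauge x x'"
  using eta d_eta_nonneg[of x x'] by (simp add: gauge_def \<kappa>_def d_eta_cons powr_mult)

lemma gauge_prefix: "(\<And>i. i < j \<Longrightarrow> x i = x' i) \<Longrightarrow> gauge x x' \<le> \<kappa> ^ j"
proof -
  assume "\<And>i. i < j \<Longrightarrow> x i = x' i"
  then have "gauge x x' \<le> (\<eta> ^ j) powr \<alpha>"
    unfolding gauge_def using alpha d_eta_nonneg d_eta_prefix by (intro powr_mono2) auto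
  also have "\<dots> = \<kappa> ^ j"
    unfolding \<kappa>_def using eta by (simp add: powr_realpow[symmetric] powr_powr mult.commute)
  finally show ?thesis .
qed

lemma d_eta_le_gauge: "d_eta \<eta> x x' \<le> gauge x x'"
proof (cases "d_eta \<eta> x x' = 0")
  case False
  then have "d_eta \<eta> x x' powr 1 \<le> d_eta \<eta> x x' powr \<alpha>"
    using alpha d_eta_nonneg[of x x'] d_eta_le_1[of x x'] by (intro powr_mono') auto
  then show ?thesis using d_eta_nonneg[of x x'] by (simp add: gauge_def)
qed (simp add: gauge_def)

lemma gauge_small_nhd: assumes "e > 0" shows "\<exists>U. open U \<and> x \<in> U \<and> (\<forall>x'\<in>U. gauge x x' < e)"
proof -
  have "continuous_on UNIV (\<lambda>x'. gauge x x')"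
    unfolding gauge_def using alpha d_eta_nonneg
    by (intro continuous_on_powr' continuous_d_eta) auto
  then have "open {x'. gauge x x' < e}" by (intro open_Collect_less) auto
  moreover have "gauge x x = 0" by (simp add: gauge_def d_eta_def)
  ultimately show ?thesis using assms by (intro exI[of _ "{x'. gauge x x' < e}"]) auto
qed

lemma equicontinuous_of_gauge:
  assumes "\<And>n x x'. \<bar>app (v n) x - app (v n) x'\<bar> \<le> A * gauge x x'" and e: "e > 0"
  shows "\<exists>U. open U \<and> x \<in> U \<and> (\<forall>n. \<forall>x'\<in>U. \<bar>app (v n) x - app (v n) x'\<bar> < e)"
proof -
  obtain U where U: "open U" "x \<in> U" "\<And>x'. x' \<in> U \<Longrightarrow> gauge x x' < e / (\<bar>A\<bar> + 1)"
    using gauge_small_nhd[of "e / (\<bar>A\<bar> + 1)" x] e by (auto simp: add_nonneg_pos)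
  have "\<bar>app (v n) x - app (v n) x'\<bar> < e" if "x' \<in> U" for n x'
  proof -
    have "A * gauge x x' \<le> (\<bar>A\<bar> + 1) * gauge x x'" by (intro mult_right_mono gauge_nonneg) auto
    also have "\<dots> < e" using U(3)[OF that] by (simp add: pos_less_divide_eq mult.commute add_nonneg_pos)
    finally show ?thesis using assms(1)[of n x x'] by linarith
  qed
  with U show ?thesis by blast
qed

text \<open>Stone-Weierstrass for the algebra of functions that are Hoelder with respect to
  \<open>gauge\<close>. The distance of one coordinate to a fixed letter is Lipschitz in
  \<open>d_eta\<close>, and such functions separate points.\<close>

lemma hol_dense:
  assumes "e > 0"
  shows "\<exists>\<psi> A. hol A \<psi> \<and> norm (\<phi> - \<psi>) < e"
proof -
  define R where "R = {f :: (nat \<Rightarrow> 'a) \<Rightarrow> real. continuous_on UNIV f \<and> (\<exists>A. \<forall>s s'. \<bar>f s - f s'\<bar> \<le> A * gauge s s')}"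
  interpret function_ring_on R UNIV
  proof
    show "compact (UNIV :: (nat \<Rightarrow> 'a) set)" by (rule compact_Sigma)
    show "continuous_on UNIV f" if "f \<in> R" for f using that by (simp add: R_def)
    show "(\<lambda>x. c) \<in> R" for c
      unfolding R_def by (auto intro!: exI[of _ 0])
    show "(\<lambda>x. f x + g x) \<in> R" if fg: "f \<in> R" "g \<in> R" for f g
    proof -
      obtain A B where "\<And>s s'. \<bar>f s - f s'\<bar> \<le> A * gauge s s'" "\<And>s s'. \<bar>g s - g s'\<bar> \<le> B * gauge s s'"
        using fg unfolding R_def by auto
      then have "\<bar>(f s + g s) - (f s' + g s')\<bar> \<le> (A + B) * gauge s s'" for s s'
        unfolding distrib_right by (smt (verit, best))
      with fg show ?thesis unfolding R_def by (auto intro!: continuous_intros)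
    qed
    show "(\<lambda>x. f x * g x) \<in> R" if fg: "f \<in> R" "g \<in> R" for f g
    proof -
      have cont: "continuous_on UNIV f" "continuous_on UNIV g" using fg by (auto simp: R_def)
      define F where "F = norm (Bcontfun f)" define G where "G = norm (Bcontfun g)"
      have F: "\<bar>f s\<bar> \<le> F" and G: "\<bar>g s\<bar> \<le> G" for s
        using abs_bcontfun_le_norm[of "Bcontfun f" s] abs_bcontfun_le_norm[of "Bcontfun g" s]
        by (simp_all add: F_def G_def apply_Bcontfun_Sigma[OF cont(1)] apply_Bcontfun_Sigma[OF cont(2)])
      obtain A B where A: "\<And>s s'. \<bar>f s - f s'\<bar> \<le> A * gauge s s'" and B: "\<And>s s'. \<bar>g s - g s'\<bar> \<le> B * gauge s s'"
        using fg unfolding R_def by auto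
      have "\<bar>f s * g s - f s' * g s'\<bar> \<le> (F * B + A * G) * gauge s s'" for s s'
      proof -
        have "\<bar>f s * g s - f s' * g s'\<bar> = \<bar>f s * (g s - g s') + (f s - f s') * g s'\<bar>"
          by (simp add: algebra_simps)
        also have "\<dots> \<le> \<bar>f s\<bar> * \<bar>g s - g s'\<bar> + \<bar>f s - f s'\<bar> * \<bar>g s'\<bar>"
          by (metis abs_mult abs_triangle_ineq)
        also have "\<dots> \<le> F * (B * gauge s s') + (A * gauge s s') * G"
          using F[of s] G[of s'] A[of s s'] B[of s s'] by (intro add_mono mult_mono) auto
        finally show ?thesis by (simp add: algebra_simps)
      qed
      with cont show ?thesis unfolding R_def by (auto intro!: continuous_intros)
    qed
    show "\<exists>f\<in>R. f s \<noteq> f y" if "s \<noteq> y" for s y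
    proof -
      obtain n where n: "s n \<noteq> y n" using \<open>s \<noteq> y\<close> by (meson ext)
      have "\<bar>dist (s' n) (s n) - dist (s'' n) (s n)\<bar> \<le> (1 / ((1 - \<eta>) * \<eta> ^ n)) * gauge s' s''" for s' s''
      proof -
        have "\<bar>dist (s' n) (s n) - dist (s'' n) (s n)\<bar> \<le> dist (s' n) (s'' n)"
          by (metis abs_dist_diff_le dist_commute)
        also have "\<dots> \<le> d_eta \<eta> s' s'' / ((1 - \<eta>) * \<eta> ^ n)" by (rule dist_coord_le_d_eta)
        also have "\<dots> \<le> gauge s' s'' / ((1 - \<eta>) * \<eta> ^ n)"
          using eta by (intro divide_right_mono d_eta_le_gauge) auto
        finally show ?thesis by simp
      qed
      moreover have "continuous_on UNIV (\<lambda>s' :: nat \<Rightarrow> 'a. dist (s' n) (s n))"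
        by (intro continuous_intros continuous_on_product_coordinates)
      ultimately have "(\<lambda>s'. dist (s' n) (s n)) \<in> R" unfolding R_def by blast
      then show ?thesis using n by (intro bexI[of _ "\<lambda>s'. dist (s' n) (s n)"]) auto
    qed
  qed
  obtain g where g: "g \<in> R" "\<And>s. \<bar>app \<phi> s - g s\<bar> < e / 2"
    using Stone_Weierstrass_basic[of "app \<phi>" "e/2"] assms by auto
  then obtain A where A: "\<And>s s'. \<bar>g s - g s'\<bar> \<le> A * gauge s s'" by (auto simp: R_def)
  have app: "app (Bcontfun g) = g" using g(1) by (intro apply_Bcontfun_Sigma) (simp add: R_def)
  have "hol A (Bcontfun g)" using A by (simp add: hol_def app)
  moreover have "norm (\<phi> - Bcontfun g) \<le> e / 2"
    by (rule norm_bound) (use g(2) in \<open>auto simp: app intro: less_imp_le\<close>)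
  then have "norm (\<phi> - Bcontfun g) < e" using assms by linarith
  ultimately show ?thesis by blast
qed

end

section \<open>Normalised transfer operators and convergence of their iterates\<close>

locale g_function = holder_exponent m \<eta> \<alpha> for m :: "'a::metric_space measure" and \<eta> \<alpha> +
  fixes G :: "'a CSigma" and Cg :: real
  assumes normalized: "transfer_op m (expf G) x = 1"
    and hol_G: "\<bar>app G (case_nat w x) - app G (case_nat w x')\<bar> \<le> Cg * gauge x x'"
begin

definition Lg :: "'a CSigma \<Rightarrow> 'a CSigma"
  where "Lg u = Lop (mulf (expf G) u)"

lemma apply_Lg: "app (Lg u) x = (\<integral>w. exp (app G (case_nat w x)) * app u (case_nat w x) \<partial>m)"
  by (simp add: Lg_def transfer_op_def)

lemma integrable_Lg: "integrable m (\<lambda>w. exp (app G (case_nat w x)) * app u (case_nat w x))"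
  using integrable_cons[of "mulf (expf G) u" x] by simp

lemma integral_exp_G: "(\<integral>w. exp (app G (case_nat w x)) \<partial>m) = 1"
  using normalized[of x] by (simp add: transfer_op_def)

lemma integrable_exp_G: "integrable m (\<lambda>w. exp (app G (case_nat w x)))"
  using integrable_cons[of "expf G" x] by simp

lemma Lg_add: "Lg (u + v) = Lg u + Lg v"
  by (rule bcontfun_eqI) (simp add: apply_Lg integrable_Lg distrib_left)

lemma Lg_scale: "Lg (c *\<^sub>R u) = c *\<^sub>R Lg u"
  by (rule bcontfun_eqI) (simp add: apply_Lg mult.left_commute)

lemma Lg_diff: "Lg (u - v) = Lg u - Lg v"
  by (rule bcontfun_eqI) (simp add: apply_Lg integrable_Lg right_diff_distrib)

lemma Lg_const: "Lg (cst c) = cst c"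
  by (rule bcontfun_eqI) (simp add: apply_Lg const_bcontfun.rep_eq integral_exp_G)

lemma Lg_mono:
  "(\<And>x. app u x \<le> app v x) \<Longrightarrow> app (Lg u) x \<le> app (Lg v) x"
  unfolding apply_Lg by (intro integral_mono integrable_Lg) auto

lemma Lg_le: "(\<And>x. app u x \<le> c) \<Longrightarrow> app (Lg u) x \<le> c"
  using Lg_mono[of u "cst c" x] by (simp add: Lg_const const_bcontfun.rep_eq)

lemma norm_Lg_le: "norm (Lg u) \<le> norm u"
proof (rule norm_bound)
  fix x
  have "app (Lg u) x \<le> norm u"
    using abs_bcontfun_le_norm[of u] by (intro Lg_le) (auto simp: abs_le_iff)
  moreover have "app (Lg (- 1 *\<^sub>R u)) x \<le> norm u"
    using abs_bcontfun_le_norm[of u] by (intro Lg_le) (auto simp: abs_le_iff)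
  then have "- app (Lg u) x \<le> norm u" unfolding Lg_scale by simp
  ultimately show "norm (app (Lg u) x) \<le> norm u" by simp
qed

text \<open>A function of \<open>shift x\<close> is constant over the preimages that
  \<open>Lg\<close> averages and so comes out of it. Invariance and mixing of the g-measure both
  follow from this relation.\<close>

lemma Lg_mult_shift: "Lg (mulf (comp_shift u) v) = mulf u (Lg v)"
proof (rule bcontfun_eqI)
  fix x
  show "app (Lg (mulf (comp_shift u) v)) x = app (mulf u (Lg v)) x"
    by (simp add: apply_Lg mult.left_commute)
qed

lemma Lg_pow_add: "(Lg ^^ n) (u + v) = (Lg ^^ n) u + (Lg ^^ n) v"
  by (induction n) (auto simp: Lg_add)

lemma Lg_pow_diff: "(Lg ^^ n) (u - v) = (Lg ^^ n) u - (Lg ^^ n) v"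
  by (induction n) (auto simp: Lg_diff)

lemma Lg_pow_scale: "(Lg ^^ n) (c *\<^sub>R u) = c *\<^sub>R (Lg ^^ n) u"
  by (induction n) (auto simp: Lg_scale)

lemma Lg_pow_const: "(Lg ^^ n) (cst c) = cst c"
  by (induction n) (auto simp: Lg_const)

lemma Lg_pow_mono:
  "(\<And>x. app u x \<le> app v x) \<Longrightarrow> app ((Lg ^^ n) u) x \<le> app ((Lg ^^ n) v) x"
proof (induction n arbitrary: x)
  case (Suc n)
  then show ?case by (auto intro!: Lg_mono)
qed auto

lemma norm_Lg_pow_le: "norm ((Lg ^^ n) u) \<le> norm u"
  by (induction n) (auto intro: order_trans[OF norm_Lg_le])

definition C2 :: real where "C2 = exp (norm G) * Cg"

text \<open>Lasota-Yorke inequality: prepending a symbol contracts the Hoelder constant of u by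
  \<open>\<kappa>\<close>, while the variation of the weight enters only through the sup norm of u.
  The operator compares preimages with a common first symbol, which explains the form of
  \<open>hol_G\<close>.\<close>

lemma hol_Lg:
  assumes u: "hol A u"
  shows "hol (\<kappa> * A + norm u * C2) (Lg u)"
  unfolding hol_def
proof (intro allI)
  fix x x'
  let ?g = "\<lambda>w x. exp (app G (case_nat w x))"
  let ?u = "\<lambda>w x. app u (case_nat w x)"
  have pw: "\<bar>?g w x * ?u w x - ?g w x' * ?u w x'\<bar> \<le>
    ?g w x * (\<kappa> * A * gauge x x') + C2 * gauge x x' * norm u" for w
  proof -
    have "\<bar>?g w x * ?u w x - ?g w x' * ?u w x'\<bar> = \<bar>?g w x * (?u w x - ?u w x') + (?g w x - ?g w x') * ?u w x'\<bar>"
      by (simp add: algebra_simps)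
    also have "\<dots> \<le> ?g w x * \<bar>?u w x - ?u w x'\<bar> + \<bar>?g w x - ?g w x'\<bar> * \<bar>?u w x'\<bar>"
      by (metis (no_types) abs_exp_cancel abs_mult abs_triangle_ineq)
    also have "\<dots> \<le> ?g w x * (\<kappa> * A * gauge x x') + (C2 * gauge x x') * norm u"
    proof (intro add_mono mult_mono mult_left_mono)
      show "\<bar>?u w x - ?u w x'\<bar> \<le> \<kappa> * A * gauge x x'"
        using u[unfolded hol_def, rule_format, of "case_nat w x" "case_nat w x'"]
        by (simp add: gauge_cons mult_ac)
      have "\<bar>?g w x - ?g w x'\<bar> \<le> exp (norm G) * \<bar>app G (case_nat w x) - app G (case_nat w x')\<bar>"
        using abs_bcontfun_le_norm[of G] by (intro abs_exp_diff_le) (auto simp: abs_le_iff)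
      also have "\<dots> \<le> exp (norm G) * (Cg * gauge x x')"
        by (intro mult_left_mono hol_G) auto
      finally show "\<bar>?g w x - ?g w x'\<bar> \<le> C2 * gauge x x'" by (simp add: C2_def)
      then show "0 \<le> C2 * gauge x x'" by (rule order_trans[OF abs_ge_zero])
    qed (auto simp: abs_bcontfun_le_norm)
    finally show ?thesis by simp
  qed
  have "\<bar>app (Lg u) x - app (Lg u) x'\<bar> = \<bar>\<integral>w. ?g w x * ?u w x - ?g w x' * ?u w x' \<partial>m\<bar>"
    by (simp add: apply_Lg integrable_Lg)
  also have "\<dots> \<le> (\<integral>w. \<bar>?g w x * ?u w x - ?g w x' * ?u w x'\<bar> \<partial>m)"
    by (rule integral_abs_bound)
  also have "\<dots> \<le> (\<integral>w. ?g w x * (\<kappa> * A * gauge x x') + C2 * gauge x x' * norm u \<partial>m)"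
    using pw prob_space.finite_measure[OF prob_m]
    by (intro integral_mono integrable_abs Bochner_Integration.integrable_diff Bochner_Integration.integrable_add integrable_Lg
        integrable_mult_left integrable_exp_G finite_measure.integrable_const)
  also have "\<dots> = \<kappa> * A * gauge x x' + C2 * gauge x x' * norm u"
    using prob_space.finite_measure[OF prob_m] integrable_exp_G[of x] sets_eq_imp_space_eq[OF sets_m]
    by (simp add: finite_measure.integrable_const integral_exp_G measure_UNIV_m)
  finally show "\<bar>app (Lg u) x - app (Lg u) x'\<bar> \<le> (\<kappa> * A + norm u * C2) * gauge x x'"
    by (simp add: algebra_simps)
qed

lemma hol_mono: "hol A u \<Longrightarrow> A \<le> B \<Longrightarrow> hol B u"
  unfolding hol_def by (meson gauge_nonneg mult_right_mono order_trans)

lemma hol_Lg_pow: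
  assumes u: "hol A u"
  obtains B where "\<And>n. hol B ((Lg ^^ n) u)"
proof -
  define N where "N = norm u"
  \<comment> \<open>Large enough that t -> \<open>\<kappa> * t + N * C2\<close> does not increase
    it, so that one Hoelder constant serves all iterates.\<close>
  define B where "B = max A (N * C2 / (1 - \<kappa>))"
  have B: "\<kappa> * B + N * C2 \<le> B"
  proof -
    have "N * C2 / (1 - \<kappa>) \<le> B" by (simp add: B_def)
    then have "N * C2 \<le> B * (1 - \<kappa>)" using kappa by (simp add: pos_divide_le_eq)
    then show ?thesis by (simp add: algebra_simps)
  qed
  have "hol B ((Lg ^^ n) u)" for n
  proof (induction n)
    case 0
    show ?case using u by (simp add: B_def hol_mono)
  next
    case (Suc n)
    have "hol (\<kappa> * B + norm ((Lg ^^ n) u) * C2) (Lg ((Lg ^^ n) u))" by (rule hol_Lg[OF Suc])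
    moreover have "(\<kappa> * B + norm ((Lg ^^ n) u) * C2) * gauge x x' \<le> B * gauge x x'" for x x'
    proof -
      \<comment> \<open>The sign comes from \<open>hol_G\<close>, whose right-hand side bounds an
        absolute value.\<close>
      have "0 \<le> C2 * gauge x x'"
      proof -
        have "0 \<le> Cg * gauge x x'" using hol_G[of undefined x x'] by (rule order_trans[OF abs_ge_zero])
        then show ?thesis by (simp add: C2_def mult.assoc)
      qed
      then have "norm ((Lg ^^ n) u) * (C2 * gauge x x') \<le> N * (C2 * gauge x x')"
        unfolding N_def by (intro mult_right_mono norm_Lg_pow_le)
      moreover have "(\<kappa> * B + N * C2) * gauge x x' \<le> B * gauge x x'"
        by (rule mult_right_mono[OF B gauge_nonneg])
      ultimately show ?thesis by (simp add: algebra_simps)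
    qed
    ultimately show ?case unfolding hol_def funpow.simps o_def by (meson order_trans)
  qed
  then show thesis by (rule that)
qed

definition mx :: "'a CSigma \<Rightarrow> real"
  where "mx f = (SUP x. app f x)"

lemma le_mx: "app f x \<le> mx f"
  unfolding mx_def
  by (rule cSUP_upper) (auto intro!: bounded_imp_bdd_above)

lemma mx_least: "(\<And>x. app f x \<le> c) \<Longrightarrow> mx f \<le> c"
  unfolding mx_def by (rule cSUP_least) auto

lemma mx_attained: obtains y where "app f y = mx f"
proof -
  obtain y where "\<forall>x\<in>UNIV. app f x \<le> app f y"
    using continuous_attains_sup[OF compact_Sigma, of "app f"] by auto
  then have "app f y = mx f" by (intro antisym le_mx mx_least) auto
  then show thesis by (rule that)
qed

lemma mx_diff_le: "mx f \<le> mx g + norm (f - g)"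
proof (rule mx_least)
  fix x show "app f x \<le> mx g + norm (f - g)"
    using abs_bcontfun_le_norm[of "f - g" x] le_mx[of g x] by (simp add: abs_le_iff)
qed

lemma mx_tendsto:
  assumes "f \<longlonglongrightarrow> l"
  shows "(\<lambda>n. mx (f n)) \<longlonglongrightarrow> mx l"
proof (rule LIM_zero_cancel, rule Lim_null_comparison)
  show "(\<lambda>n. norm (f n - l)) \<longlonglongrightarrow> 0" using assms by (simp add: tendsto_norm_zero LIM_zero)
  show "\<forall>\<^sub>F n in sequentially. norm (mx (f n) - mx l) \<le> norm (f n - l)"
    using mx_diff_le[of "f _" l] mx_diff_le[of l "f _"]
    by (intro always_eventually allI) (auto simp: abs_le_iff norm_minus_commute diff_le_eq add.commute)
qed

text \<open>\<open>Lg\<close> averages over first symbols with a strictly positive density. If the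
  average reaches the upper bound s, then f equals s for \<open>m\<close>-almost every first symbol;
  the exceptional symbols form an open null set, which is empty because \<open>m\<close> has full
  support.\<close>

lemma Lg_eq_max:
  assumes f: "\<And>x. app f x \<le> s" and eq: "app (Lg f) y = s"
  shows "app f (case_nat w y) = s"
proof (rule ccontr)
  let ?h = "\<lambda>w. exp (app G (case_nat w y)) * (s - app f (case_nat w y))"
  assume "app f (case_nat w y) \<noteq> s"
  then have ne: "w \<in> {w. app f (case_nat w y) < s}" using f[of "case_nat w y"] by simp
  have h: "?h = (\<lambda>w. s * exp (app G (case_nat w y)) - exp (app G (case_nat w y)) * app f (case_nat w y))"
    by (simp add: algebra_simps)
  have int: "integrable m ?h"
    unfolding h by (intro Bochner_Integration.integrable_diff integrable_Lg integrable_mult_right integrable_exp_G)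
  have "(\<integral>w. ?h w \<partial>m) = 0"
    unfolding h by (simp add: integrable_Lg integrable_exp_G integral_exp_G eq[unfolded apply_Lg])
  then have "AE w in m. ?h w = 0"
    using f by (subst (asm) integral_nonneg_eq_0_iff_AE[OF int]) auto
  then have "AE w in m. \<not> app f (case_nat w y) < s" by eventually_elim auto
  moreover have op: "open {w. app f (case_nat w y) < s}"
    by (intro open_Collect_less continuous_apply_cons_head) auto
  ultimately have "emeasure m {w. app f (case_nat w y) < s} = 0"
    using sets_eq_imp_space_eq[OF sets_m] by (subst (asm) AE_iff_measurable[OF _ refl]) (auto simp: sets_m)
  moreover have "0 < emeasure m {w. app f (case_nat w y) < s}"
    using ne by (intro full_support op) blast
  ultimately show False by simp
qed

text \<open>Iterated equality case: where the j-th iterate reaches the bound, f reaches it after any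
  word of length j is put in front. The word occupies the positions below j.\<close>

lemma Lg_pow_eq_max:
  assumes "\<And>x. app f x \<le> s" "app ((Lg ^^ j) f) y = s"
  shows "app f (\<lambda>i. if i < j then x i else y (i - j)) = s"
  using assms(2)
proof (induction j arbitrary: y)
  case 0
  then show ?case by simp
next
  case (Suc j)
  have "app ((Lg ^^ j) f) x' \<le> s" for x'
    using Lg_pow_mono[of f "cst s" j x'] assms(1) by (simp add: Lg_pow_const const_bcontfun.rep_eq)
  then have "app ((Lg ^^ j) f) (case_nat (x j) y) = s"
    using Suc.prems by (intro Lg_eq_max) auto
  from Suc.IH[OF this]
  have "app f (\<lambda>i. if i < j then x i else case_nat (x j) y (i - j)) = s" .
  moreover have "(\<lambda>i. if i < j then x i else case_nat (x j) y (i - j)) = (\<lambda>i. if i < Suc j then x i else y (i - Suc j))"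
    by (auto simp: fun_eq_iff split: nat.split) (metis Suc_diff_Suc diff_Suc_Suc less_antisym nat.inject diff_is_0_eq not_less_eq zero_less_diff le_antisym linorder_not_less)+
  ultimately show ?case by simp
qed

text \<open>Iterates of a Hoelder function are equicontinuous and accumulate at some v. Their maxima
  decrease, so every \<open>(Lg ^^ j) v\<close> has the same maximum s. By the equality case v takes
  the value s in every cylinder of length j, for every j, and is constant by continuity.\<close>

lemma Lg_pow_converges:
  assumes u: "hol A u"
  obtains s where "(\<lambda>n. (Lg ^^ n) u) \<longlonglongrightarrow> cst s"
proof -
  obtain B where B: "\<And>n. hol B ((Lg ^^ n) u)" using hol_Lg_pow[OF u] by blast
  have "\<exists>U. open U \<and> x \<in> U \<and> (\<forall>n. \<forall>y\<in>U. \<bar>app ((Lg ^^ n) u) x - app ((Lg ^^ n) u) y\<bar> < e)"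
    if "e > 0" for x e
    by (rule equicontinuous_of_gauge[where A=B]) (use B that in \<open>auto simp: hol_def\<close>)
  then obtain r v where r: "strict_mono r" "(\<lambda>n. (Lg ^^ (r n)) u) \<longlonglongrightarrow> v"
    using arzela_ascoli_bcontfun[OF compact_Sigma, of "\<lambda>n. (Lg ^^ n) u" "norm u"] norm_Lg_pow_le by metis
  have cLg: "(\<lambda>n. (Lg ^^ j) (f n)) \<longlonglongrightarrow> (Lg ^^ j) l" if "f \<longlonglongrightarrow> l" for f l j
  proof (rule LIM_zero_cancel, rule Lim_null_comparison)
    show "(\<lambda>n. norm (f n - l)) \<longlonglongrightarrow> 0" using that by (simp add: tendsto_norm_zero LIM_zero)
    show "\<forall>\<^sub>F n in sequentially. norm ((Lg ^^ j) (f n) - (Lg ^^ j) l) \<le> norm (f n - l)"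
      by (intro always_eventually allI) (metis Lg_pow_diff norm_Lg_pow_le)
  qed
  have dec: "decseq (\<lambda>n. mx ((Lg ^^ n) u))"
    unfolding decseq_Suc_iff by (auto intro!: mx_least Lg_le le_mx)
  have bdd: "- norm u \<le> mx ((Lg ^^ n) u)" for n
    using abs_bcontfun_le_norm[of "(Lg ^^ n) u" undefined] norm_Lg_pow_le[of n u] le_mx[of "(Lg ^^ n) u" undefined]
    by linarith
  obtain s where s: "(\<lambda>n. mx ((Lg ^^ n) u)) \<longlonglongrightarrow> s"
    using decseq_convergent[OF dec] bdd by blast
  have mxv: "mx ((Lg ^^ j) v) = s" for j
  proof (rule LIMSEQ_unique)
    show "(\<lambda>n. mx ((Lg ^^ j) ((Lg ^^ r n) u))) \<longlonglongrightarrow> mx ((Lg ^^ j) v)"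
      by (intro mx_tendsto cLg r)
    have "strict_mono (\<lambda>n. j + r n)" using r(1) by (simp add: strict_mono_def)
    from LIMSEQ_subseq_LIMSEQ[OF s this]
    show "(\<lambda>n. mx ((Lg ^^ j) ((Lg ^^ r n) u))) \<longlonglongrightarrow> s" by (simp add: o_def funpow_add)
  qed
  have vs: "app v z = s" for z
  proof (rule antisym)
    show "app v z \<le> s" using le_mx[of v z] mxv[of 0] by simp
    have holv: "\<bar>app v z - app v z'\<bar> \<le> B * gauge z z'" for z z'
    proof (rule LIMSEQ_le_const2)
      have "(\<lambda>n. app ((Lg ^^ r n) u) x) \<longlonglongrightarrow> app v x" for x
      proof (rule LIM_zero_cancel, rule Lim_null_comparison)
        show "(\<lambda>n. norm ((Lg ^^ r n) u - v)) \<longlonglongrightarrow> 0" using r(2) by (simp add: tendsto_norm_zero LIM_zero)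
        show "\<forall>\<^sub>F n in sequentially. norm (app ((Lg ^^ r n) u) x - app v x) \<le> norm ((Lg ^^ r n) u - v)"
          using abs_bcontfun_le_norm[of "(Lg ^^ r _) u - v" x] by (intro always_eventually allI) simp
      qed
      then show "(\<lambda>n. \<bar>app ((Lg ^^ r n) u) z - app ((Lg ^^ r n) u) z'\<bar>) \<longlonglongrightarrow> \<bar>app v z - app v z'\<bar>"
        by (intro tendsto_intros)
      show "\<exists>N. \<forall>n\<ge>N. \<bar>app ((Lg ^^ r n) u) z - app ((Lg ^^ r n) u) z'\<bar> \<le> B * gauge z z'"
        using B by (auto simp: hol_def)
    qed
    have "s - \<bar>B\<bar> * \<kappa> ^ j \<le> app v z" for j
    proof -
      \<comment> \<open>The first j symbols of z are put in front of a maximum point of the j-th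
        iterate. At the resulting point v equals s, and its \<open>gauge\<close> distance from z is
        at most \<open>\<kappa> ^ j\<close>.\<close>
      obtain \<tau> where \<tau>: "app ((Lg ^^ j) v) \<tau> = s" using mx_attained mxv by metis
      let ?z' = "\<lambda>i. if i < j then z i else \<tau> (i - j)"
      have "app v ?z' = s"
        by (rule Lg_pow_eq_max[OF _ \<tau>]) (use le_mx[of v] mxv[of 0] in simp)
      moreover have "gauge z ?z' \<le> \<kappa> ^ j" by (rule gauge_prefix) simp
      then have "\<bar>B\<bar> * gauge z ?z' \<le> \<bar>B\<bar> * \<kappa> ^ j" by (intro mult_left_mono) auto
      moreover have "B * gauge z ?z' \<le> \<bar>B\<bar> * gauge z ?z'" by (intro mult_right_mono gauge_nonneg) auto
      ultimately show ?thesis using holv[of z ?z'] by linarith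
    qed
    moreover have "(\<lambda>j. s - \<bar>B\<bar> * \<kappa> ^ j) \<longlonglongrightarrow> s - \<bar>B\<bar> * 0"
      using kappa by (intro tendsto_intros LIMSEQ_power_zero) auto
    ultimately show "s \<le> app v z"
      by (intro LIMSEQ_le_const2[of "\<lambda>j. s - \<bar>B\<bar> * \<kappa> ^ j"]) auto
  qed
  have v: "v = cst s" by (rule bcontfun_eqI) (simp add: vs const_bcontfun.rep_eq)
  \<comment> \<open>\<open>Lg\<close> fixes constants and does not increase the norm, so closeness
    to the constant at one index persists at all later ones: the subsequence forces the whole
    sequence.\<close>
  have "(\<lambda>n. (Lg ^^ n) u) \<longlonglongrightarrow> cst s"
  proof (rule metric_LIMSEQ_I)
    fix e :: real assume "e > 0"
    then obtain k where k: "dist ((Lg ^^ r k) u) (cst s) < e"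
      using metric_LIMSEQ_D[OF r(2)[unfolded v]] by blast
    have "dist ((Lg ^^ n) u) (cst s) < e" if "n \<ge> r k" for n
    proof -
      have "(Lg ^^ n) u - cst s = (Lg ^^ (n - r k)) ((Lg ^^ r k) u - cst s)"
        using that by (simp add: Lg_pow_diff Lg_pow_const flip: funpow_add[unfolded o_def fun_eq_iff, rule_format])
      then have "norm ((Lg ^^ n) u - cst s) \<le> norm ((Lg ^^ r k) u - cst s)"
        by (metis norm_Lg_pow_le)
      with k show ?thesis by (simp add: dist_norm)
    qed
    then show "\<exists>N. \<forall>n\<ge>N. dist ((Lg ^^ n) u) (cst s) < e" by blast
  qed
  then show thesis by (rule that)
qed

end

lemma exp_le_quadratic:
  fixes x :: real
  assumes "x \<le> 1"
  shows "exp x \<le> 1 + x + x\<^sup>2"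
proof (cases "0 \<le> x")
  case True
  then show ?thesis using assms by (rule exp_bound)
next
  case False
  have "0 \<le> 1 + x + x\<^sup>2"
    using False zero_le_power2[of "x + 1/2"] by (simp add: power2_eq_square algebra_simps)
  \<comment> \<open>For negative x the claim is multiplied by exp (- x), which is at least 1 - x;
    and 1 + x + x^2 times 1 - x equals 1 - x^3, which is at least 1.\<close>
  have "1 \<le> 1 + (- x) ^ 3" using False by simp
  also have "\<dots> = (1 + x + x\<^sup>2) * (1 + (- x))" by (simp add: power2_eq_square power3_eq_cube algebra_simps)
  also have "\<dots> \<le> (1 + x + x\<^sup>2) * exp (- x)"
    using \<open>0 \<le> 1 + x + x\<^sup>2\<close> by (intro mult_left_mono exp_ge_add_one_self) auto
  finally have "1 * exp x \<le> (1 + x + x\<^sup>2) * exp (- x) * exp x" by (intro mult_right_mono) auto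
  then show ?thesis by (simp add: mult.assoc flip: exp_add)
qed

context symbolic_space
begin

lemma invariant_integral:
  fixes F :: "(nat \<Rightarrow> 'a) \<Rightarrow> real"
  assumes \<mu>: "\<mu> \<in> PT" and F: "F \<in> borel_measurable borel"
  shows "(\<integral>x. F ((shift ^^ n) x) \<partial>rep \<mu>) = (\<integral>x. F x \<partial>rep \<mu>)"
proof -
  have M: "borel_prob (rep \<mu>)" by (rule repr_measure(1)[OF invariant_prob[OF \<mu>]])
  have d: "distr (rep \<mu>) borel shift = rep \<mu>"
    using \<mu> by (simp add: invariant_functionals_def)
  have 1: "(\<integral>x. F (shift x) \<partial>rep \<mu>) = (\<integral>x. F x \<partial>rep \<mu>)"
    if "F \<in> borel_measurable borel" for F :: "(nat \<Rightarrow> 'a) \<Rightarrow> real"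
  proof -
    have "(\<integral>x. F x \<partial>distr (rep \<mu>) borel shift) = (\<integral>x. F (shift x) \<partial>rep \<mu>)"
      using that by (intro integral_distr) (simp_all add: borel_prob_measurable[OF M])
    then show ?thesis by (simp add: d)
  qed
  show ?thesis
  proof (induction n)
    case (Suc n)
    have "(\<lambda>x. F ((shift ^^ n) x)) \<in> borel_measurable borel"
      by (rule measurable_compose[OF borel_measurable_continuous_onI[OF continuous_shift_funpow] F])
    from 1[OF this] Suc show ?case by (simp only: funpow_Suc_right o_def)
  qed simp
qed

lemma apply_comp_shift_pow: "app ((comp_shift ^^ n) w) x = app w ((shift ^^ n) x)"
proof (induction n arbitrary: x)
  case (Suc n)
  then show ?case by (simp add: funpow_swap1[of shift])
qed simp

lemma indicator_invariant_pow:
  assumes "shift -` A = A"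
  shows "(indicator A ((shift ^^ n) s) :: real) = indicator A s"
proof -
  have "shift x \<in> A \<longleftrightarrow> x \<in> A" for x using assms by auto
  then have "(shift ^^ n) s \<in> A \<longleftrightarrow> s \<in> A" by (induction n) auto
  then show ?thesis by (simp add: indicator_def)
qed

lemma prob_eq_of_dense:
  assumes "\<mu> \<in> PP" "\<nu> \<in> PP"
    and d: "\<And>f e. e > 0 \<Longrightarrow> \<exists>g. pr \<mu> g = pr \<nu> g \<and> norm (f - g) < e"
  shows "\<mu> = \<nu>"
proof (rule blinfun_eqI)
  fix f
  have "\<bar>pr \<mu> f - pr \<nu> f\<bar> \<le> 0 + e" if e: "e > 0" for e
  proof -
    obtain g where g: "pr \<mu> g = pr \<nu> g" "norm (f - g) < e / 2"
      using d[of "e/2" f] e by auto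
    then show ?thesis using prob_close[OF assms(1), of f g] prob_close[OF assms(2), of f g] by linarith
  qed
  then have "\<bar>pr \<mu> f - pr \<nu> f\<bar> \<le> 0" by (rule field_le_epsilon)
  then show "pr \<mu> f = pr \<nu> f" by simp
qed

end

section \<open>The g-measure: existence, uniqueness, ergodicity and entropy\<close>

context g_function
begin

text \<open>The functional is a weak* limit of the dual iterates applied to one point mass. On
  Hoelder functions the iterates converge to constants, which must be its values; invariance is
  obtained there and extended by density.\<close>

lemma ex_g_measure:
  "\<exists>\<nu>\<in>PP. (\<forall>f. pr \<nu> (Lg f) = pr \<nu> f) \<and>
    (\<forall>A g. hol A g \<longrightarrow> (\<lambda>n. (Lg ^^ n) g) \<longlonglongrightarrow> cst (pr \<nu> g))"
proof -
  fix x0 :: "nat \<Rightarrow> 'a"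
  have "\<exists>\<mu>\<in>PP. \<forall>f. pr \<mu> f = app ((Lg ^^ n) f) x0" for n
  proof (rule prob_functional_of_positive)
    show "linear (\<lambda>f. app ((Lg ^^ n) f) x0)"
      by (rule linearI) (simp_all add: Lg_pow_add Lg_pow_scale)
    show "0 \<le> app ((Lg ^^ n) f) x0" if "\<And>x. 0 \<le> app f x" for f
      using Lg_pow_mono[of "cst 0" f n x0] that Lg_pow_const[of n 0] by simp
    show "app ((Lg ^^ n) (cst 1)) x0 = 1"
      by (simp add: Lg_pow_const const_bcontfun.rep_eq)
  qed
  then obtain u where u: "\<And>n. u n \<in> PP"
    "\<And>n f. pr (u n) f = app ((Lg ^^ n) f) x0" by metis
  obtain r \<nu> where r: "strict_mono r" "\<nu> \<in> PP" "wlim (\<lambda>n. u (r n)) \<nu>"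
    using that by (rule prob_seq_compact[OF u(1)])
  have conv: "(\<lambda>n. (Lg ^^ n) g) \<longlonglongrightarrow> cst (pr \<nu> g)" if g: "hol A g" for A g
  proof -
    obtain s where s: "(\<lambda>n. (Lg ^^ n) g) \<longlonglongrightarrow> cst s" by (rule Lg_pow_converges[OF g])
    have "(\<lambda>n. pr (u n) g) \<longlonglongrightarrow> s"
    proof (rule LIM_zero_cancel, rule Lim_null_comparison)
      show "(\<lambda>n. norm ((Lg ^^ n) g - cst s)) \<longlonglongrightarrow> 0" using s by (simp add: tendsto_norm_zero LIM_zero)
      show "\<forall>\<^sub>F n in sequentially. norm (pr (u n) g - s) \<le> norm ((Lg ^^ n) g - cst s)"
        using abs_bcontfun_le_norm[of "(Lg ^^ _) g - cst s" x0]
        by (intro always_eventually allI) (simp add: u const_bcontfun.rep_eq)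
    qed
    then have "(\<lambda>n. pr (u (r n)) g) \<longlonglongrightarrow> s"
      using LIMSEQ_subseq_LIMSEQ[OF _ r(1)] by (simp add: o_def)
    moreover have "(\<lambda>n. pr (u (r n)) g) \<longlonglongrightarrow> pr \<nu> g"
      using r(3) by (simp add: wlim_def)
    ultimately have "s = pr \<nu> g" by (rule LIMSEQ_unique)
    with s show ?thesis by simp
  qed
  have inv: "pr \<nu> (Lg g) = pr \<nu> g" if g: "hol A g" for A g
  proof -
    have "(\<lambda>n. (Lg ^^ n) (Lg g)) \<longlonglongrightarrow> cst (pr \<nu> (Lg g))" by (rule conv[OF hol_Lg[OF g]])
    moreover have "(\<lambda>n. (Lg ^^ n) (Lg g)) \<longlonglongrightarrow> cst (pr \<nu> g)"
      using LIMSEQ_Suc[OF conv[OF g]] by (simp add: funpow_swap1)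
    ultimately have "cst (pr \<nu> (Lg g)) = (cst (pr \<nu> g) :: 'a CSigma)"
      by (rule LIMSEQ_unique)
    then have "app (cst (pr \<nu> (Lg g)) :: 'a CSigma) x0 = app (cst (pr \<nu> g)) x0"
      by simp
    then show ?thesis by (simp only: const_bcontfun.rep_eq)
  qed
  have "pr \<nu> (Lg f) = pr \<nu> f" for f
  proof -
    have "\<bar>pr \<nu> (Lg f) - pr \<nu> f\<bar> \<le> 0 + e" if e: "e > 0" for e
    proof -
      obtain g A where g: "hol A g" "norm (f - g) < e / 2" using hol_dense[of "e/2" f] e by auto
      have "norm (Lg f - Lg g) \<le> norm (f - g)" using norm_Lg_le[of "f - g"] by (simp add: Lg_diff)
      then show ?thesis using inv[OF g(1)] g(2) prob_close[OF r(2), of f g] prob_close[OF r(2), of "Lg f" "Lg g"]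
        by linarith
    qed
    then have "\<bar>pr \<nu> (Lg f) - pr \<nu> f\<bar> \<le> 0" by (rule field_le_epsilon)
    then show ?thesis by simp
  qed
  with conv r(2) show ?thesis by blast
qed

definition g_measure :: "'a CSigma_dual"
  where "g_measure = (SOME \<nu>. \<nu> \<in> PP \<and> (\<forall>f. pr \<nu> (Lg f) = pr \<nu> f) \<and>
    (\<forall>A g. hol A g \<longrightarrow> (\<lambda>n. (Lg ^^ n) g) \<longlonglongrightarrow> cst (pr \<nu> g)))"

lemma g_measure:
  "g_measure \<in> PP"
  "pr g_measure (Lg f) = pr g_measure f"
  "hol A g \<Longrightarrow> (\<lambda>n. (Lg ^^ n) g) \<longlonglongrightarrow> cst (pr g_measure g)"
  using someI_ex[OF ex_g_measure[unfolded Bex_def]] unfolding g_measure_def[symmetric] by blast+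

lemma g_measure_unique:
  assumes \<mu>: "\<mu> \<in> PP" and inv: "\<And>f. pr \<mu> (Lg f) = pr \<mu> f"
  shows "\<mu> = g_measure"
proof (rule prob_eq_of_dense[OF \<mu> g_measure(1)])
  fix f :: "'a CSigma" and e :: real assume "e > 0"
  then obtain g A where g: "hol A g" "norm (f - g) < e" using hol_dense by blast
  have pow: "pr \<mu> ((Lg ^^ n) g) = pr \<mu> g" for n
    by (induction n) (simp_all add: inv)
  have "(\<lambda>n. pr \<mu> ((Lg ^^ n) g)) \<longlonglongrightarrow> pr \<mu> (cst (pr g_measure g))"
    by (intro blinfun.tendsto tendsto_const g_measure(3)[OF g(1)])
  then have "pr \<mu> g = pr g_measure g"
    by (simp add: pow prob_const[OF \<mu>] LIMSEQ_const_iff)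
  with g show "\<exists>g. pr \<mu> g = pr g_measure g \<and> norm (f - g) < e" by blast
qed

lemma g_measure_invariant: "g_measure \<in> PT"
  unfolding invariant_functionals_iff
proof (intro conjI allI)
  fix f :: "'a CSigma"
  have "comp_shift f = mulf (comp_shift f) (cst 1)"
    by (rule bcontfun_eqI) (simp add: const_bcontfun.rep_eq)
  then have "Lg (comp_shift f) = mulf f (cst 1)"
    by (metis Lg_mult_shift Lg_const)
  also have "\<dots> = f" by (rule bcontfun_eqI) (simp add: const_bcontfun.rep_eq)
  finally show "pr g_measure (comp_shift f) = pr g_measure f"
    using g_measure(2)[of "comp_shift f"] by simp
qed (rule g_measure(1))

text \<open>Duality between composition with the shift and \<open>Lg\<close>: n shifts of w are
  traded for n applications of \<open>Lg\<close> to g.\<close>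

lemma g_measure_mixing:
  "pr g_measure (mulf ((comp_shift ^^ n) w) g) = pr g_measure (mulf w ((Lg ^^ n) g))"
proof (induction n arbitrary: g)
  case (Suc n)
  have "pr g_measure (mulf (comp_shift ((comp_shift ^^ n) w)) g) =
    pr g_measure (mulf ((comp_shift ^^ n) w) (Lg g))"
    by (metis Lg_mult_shift g_measure(2))
  also have "\<dots> = pr g_measure (mulf w ((Lg ^^ n) (Lg g)))" by (rule Suc)
  finally show ?case by (simp add: funpow_swap1)
qed simp

text \<open>The indicator of an invariant set is unchanged by n shifts, so w and its n-fold shift
  approximate it with the same L1 error. Trading the shifts for iterates on a Hoelder
  \<open>\<psi>\<close> and letting n grow decouples w from \<open>\<psi>\<close>, and in this way
  the invariant set decorrelates from all continuous functions.\<close>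

lemma g_measure_ergodic: "g_measure \<in> PE"
  unfolding ergodic_functionals_def
proof (intro CollectI conjI ballI impI g_measure_invariant)
  fix A :: "(nat \<Rightarrow> 'a) set"
  assume A: "A \<in> sets borel" and inv: "shift -` A = A"
  let ?M = "rep g_measure"
  note M = repr_measure(1)[OF g_measure(1)]
  note int = repr_measure(2)[OF g_measure(1), symmetric]
  interpret M: prob_space ?M using M by (simp add: borel_prob_def)
  have iA: "integrable ?M (\<lambda>x. indicator A x :: real)"
    using A M by (auto intro!: integrable_real_indicator simp: borel_prob_def M.emeasure_eq_measure)
  have mA: "(\<integral>x. indicator A x \<partial>?M) = measure ?M A"
    using A borel_prob_space[OF M] by simp
  have main: "\<bar>(\<integral>s. indicator A s * app \<psi> s \<partial>?M) - measure ?M A * pr g_measure \<psi>\<bar> \<le> 2 * norm \<psi> * e"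
    if \<psi>: "hol B \<psi>" and e: "e > 0" for B \<psi> e
  proof -
    obtain w :: "'a CSigma" where w: "\<And>x. 0 \<le> app w x \<and> app w x \<le> 1"
      "(\<integral>x. \<bar>indicator A x - app w x\<bar> \<partial>?M) < e"
      using indicator_L1_approx[OF M A, rule_format, OF e] by blast
    have idf: "integrable ?M (\<lambda>x. \<bar>indicator A x - app w x\<bar>)"
      using iA borel_prob_integrable_bcontfun[OF M, of w] by auto
    have idf': "integrable ?M (\<lambda>x. \<bar>indicator A x - app ((comp_shift ^^ n) w) x\<bar>)" for n
      using iA borel_prob_integrable_bcontfun[OF M, of "(comp_shift ^^ n) w"] by auto
    have approx: "\<bar>(\<integral>s. indicator A s * app \<psi> s \<partial>?M) - pr g_measure (mulf w ((Lg ^^ n) \<psi>))\<bar> \<le> norm \<psi> * e" for n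
    proof -
      have i1: "integrable ?M (\<lambda>s. indicator A s * app \<psi> s)"
        by (rule integrable_indicator_bcontfun[OF M A])
      have i2: "integrable ?M (app (mulf ((comp_shift ^^ n) w) \<psi>))"
        by (rule borel_prob_integrable_bcontfun[OF M])
      have "\<bar>(\<integral>s. indicator A s * app \<psi> s \<partial>?M) - pr g_measure (mulf ((comp_shift ^^ n) w) \<psi>)\<bar>
        = \<bar>\<integral>s. indicator A s * app \<psi> s - app (mulf ((comp_shift ^^ n) w) \<psi>) s \<partial>?M\<bar>"
        unfolding int[symmetric] using i1 i2 by simp
      also have "\<dots> \<le> (\<integral>s. \<bar>indicator A s * app \<psi> s - app (mulf ((comp_shift ^^ n) w) \<psi>) s\<bar> \<partial>?M)"
        by (rule integral_abs_bound)
      also have "\<dots> \<le> (\<integral>s. norm \<psi> * \<bar>indicator A s - app ((comp_shift ^^ n) w) s\<bar> \<partial>?M)"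
      proof (rule integral_mono)
        fix s
        have "\<bar>indicator A s * app \<psi> s - app (mulf ((comp_shift ^^ n) w) \<psi>) s\<bar>
          = \<bar>app \<psi> s\<bar> * \<bar>indicator A s - app ((comp_shift ^^ n) w) s\<bar>"
          by (simp add: abs_mult[symmetric] algebra_simps)
        also have "\<dots> \<le> norm \<psi> * \<bar>indicator A s - app ((comp_shift ^^ n) w) s\<bar>"
          by (intro mult_right_mono abs_bcontfun_le_norm) auto
        finally show "\<bar>indicator A s * app \<psi> s - app (mulf ((comp_shift ^^ n) w) \<psi>) s\<bar>
          \<le> norm \<psi> * \<bar>indicator A s - app ((comp_shift ^^ n) w) s\<bar>" .
      qed (use i1 i2 idf' in auto)
      also have "\<dots> = norm \<psi> * (\<integral>s. \<bar>indicator A ((shift ^^ n) s) - app w ((shift ^^ n) s)\<bar> \<partial>?M)"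
        by (simp add: apply_comp_shift_pow indicator_invariant_pow[OF inv])
      also have "(\<integral>s. \<bar>indicator A ((shift ^^ n) s) - app w ((shift ^^ n) s)\<bar> \<partial>?M) = (\<integral>s. \<bar>indicator A s - app w s\<bar> \<partial>?M)"
        by (rule invariant_integral[OF g_measure_invariant]) (use A in measurable)
      also have "norm \<psi> * \<dots> \<le> norm \<psi> * e" using w(2) by (intro mult_left_mono) auto
      finally show ?thesis by (simp add: g_measure_mixing)
    qed
    have "(\<lambda>n. pr g_measure (mulf w ((Lg ^^ n) \<psi>))) \<longlonglongrightarrow> pr g_measure \<psi> * pr g_measure w"
    proof (rule LIM_zero_cancel, rule Lim_null_comparison)
      let ?l = "cst (pr g_measure \<psi>)"
      show "(\<lambda>n. norm ((Lg ^^ n) \<psi> - ?l)) \<longlonglongrightarrow> 0"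
        using g_measure(3)[OF \<psi>] by (simp add: tendsto_norm_zero LIM_zero)
      have sc: "(pr g_measure \<psi>) *\<^sub>R w = mulf w ?l"
        by (rule bcontfun_eqI) (simp add: const_bcontfun.rep_eq)
      have "norm (mulf w f - mulf w g) \<le> norm (f - g)" for f g
      proof (rule norm_bound)
        fix x
        have "\<bar>app w x\<bar> * \<bar>app (f - g) x\<bar> \<le> 1 * norm (f - g)"
          using w(1)[of x] by (intro mult_mono abs_bcontfun_le_norm) auto
        then show "norm (app (mulf w f - mulf w g) x) \<le> norm (f - g)"
          by (simp add: abs_mult[symmetric] algebra_simps)
      qed
      then have "\<bar>pr g_measure (mulf w ((Lg ^^ n) \<psi>)) - pr g_measure (mulf w ?l)\<bar> \<le> norm ((Lg ^^ n) \<psi> - ?l)" for n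
        using prob_close[OF g_measure(1)] by (meson order_trans)
      then show "\<forall>\<^sub>F n in sequentially. norm (pr g_measure (mulf w ((Lg ^^ n) \<psi>)) - pr g_measure \<psi> * pr g_measure w) \<le> norm ((Lg ^^ n) \<psi> - ?l)"
        using blinfun.scaleR_right[of g_measure "pr g_measure \<psi>" w]
        by (intro always_eventually allI) (simp add: sc)
    qed
    then have "(\<lambda>n. \<bar>(\<integral>s. indicator A s * app \<psi> s \<partial>?M) - pr g_measure (mulf w ((Lg ^^ n) \<psi>))\<bar>)
      \<longlonglongrightarrow> \<bar>(\<integral>s. indicator A s * app \<psi> s \<partial>?M) - pr g_measure \<psi> * pr g_measure w\<bar>"
      by (intro tendsto_intros)
    then have 1: "\<bar>(\<integral>s. indicator A s * app \<psi> s \<partial>?M) - pr g_measure \<psi> * pr g_measure w\<bar> \<le> norm \<psi> * e"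
      by (rule LIMSEQ_le_const2) (use approx in auto)
    have "\<bar>measure ?M A - pr g_measure w\<bar> \<le> (\<integral>x. \<bar>indicator A x - app w x\<bar> \<partial>?M)"
      using integral_abs_bound[of ?M "\<lambda>x. indicator A x - app w x"] iA borel_prob_integrable_bcontfun[OF M, of w]
      by (simp add: int borel_prob_space[OF M])
    then have "\<bar>pr g_measure \<psi>\<bar> * \<bar>measure ?M A - pr g_measure w\<bar> \<le> norm \<psi> * e"
      using w(2) by (intro mult_mono prob_abs_le[OF g_measure(1)]) auto
    then have 2: "\<bar>pr g_measure \<psi> * measure ?M A - pr g_measure \<psi> * pr g_measure w\<bar> \<le> norm \<psi> * e"
      by (simp add: abs_mult[symmetric] right_diff_distrib)
    show ?thesis using 1 2 by (simp add: mult.commute)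
  qed
  have dec_hol: "(\<integral>s. indicator A s * app \<psi> s \<partial>?M) = measure ?M A * pr g_measure \<psi>"
    if \<psi>: "hol B \<psi>" for B \<psi>
  proof -
    have "\<bar>(\<integral>s. indicator A s * app \<psi> s \<partial>?M) - measure ?M A * pr g_measure \<psi>\<bar> \<le> 0 + e" if e: "e > 0" for e
    proof -
      define c where "c = norm \<psi> + 1"
      have c: "c > 0" "norm \<psi> \<le> c" by (simp_all add: c_def add_nonneg_pos)
      have "2 * norm \<psi> * (e / (2 * c)) \<le> 2 * c * (e / (2 * c))"
        using c e by (intro mult_right_mono) auto
      also have "\<dots> = e" using c by simp
      finally show ?thesis using main[OF \<psi>, of "e / (2 * c)"] e c by simp
    qed
    then have "\<bar>(\<integral>s. indicator A s * app \<psi> s \<partial>?M) - measure ?M A * pr g_measure \<psi>\<bar> \<le> 0" by (rule field_le_epsilon)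
    then show ?thesis by simp
  qed
  show "measure ?M A = 0 \<or> measure ?M A = 1"
  proof (rule zero_one_of_decorrelation[OF M A])
    fix \<psi> :: "'a CSigma"
    have "\<bar>(\<integral>s. indicator A s * app \<psi> s \<partial>?M) - measure ?M A * pr g_measure \<psi>\<bar> \<le> 0 + e" if e: "e > 0" for e
    proof -
      obtain \<phi> B where \<phi>: "hol B \<phi>" "norm (\<psi> - \<phi>) < e / 2" using hol_dense[of "e/2" \<psi>] e by auto
      have "\<bar>(\<integral>s. indicator A s * app \<psi> s \<partial>?M) - (\<integral>s. indicator A s * app \<phi> s \<partial>?M)\<bar> \<le> e / 2"
      proof (rule borel_prob_integral_close[OF M])
        have "\<bar>indicator A s * app \<psi> s - indicator A s * app \<phi> s\<bar> \<le> e / 2" for s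
          using abs_bcontfun_le_norm[of "\<psi> - \<phi>" s] \<phi>(2) e by (auto simp: indicator_def)
        then show "AE s in ?M. \<bar>indicator A s * app \<psi> s - indicator A s * app \<phi> s\<bar> \<le> e / 2" by simp
      qed (intro integrable_indicator_bcontfun[OF M A])+
      moreover have "measure ?M A * \<bar>pr g_measure \<psi> - pr g_measure \<phi>\<bar> \<le> 1 * (e / 2)"
        using prob_close[OF g_measure(1), of \<psi> \<phi>] \<phi>(2) by (intro mult_mono) auto
      then have "\<bar>measure ?M A * pr g_measure \<psi> - measure ?M A * pr g_measure \<phi>\<bar> \<le> e / 2"
        by (simp add: abs_mult flip: right_diff_distrib)
      ultimately show ?thesis using dec_hol[OF \<phi>(1)] by linarith
    qed
    then have "\<bar>(\<integral>s. indicator A s * app \<psi> s \<partial>?M) - measure ?M A * pr g_measure \<psi>\<bar> \<le> 0" by (rule field_le_epsilon)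
    then show "(\<integral>s. indicator A s * app \<psi> s \<partial>?M) = measure ?M A * (\<integral>s. app \<psi> s \<partial>?M)"
      by (simp add: int)
  qed
qed

text \<open>Gibbs inequality: since ln t \<le> t - 1, the average of ln f - G with weights exp G is
  at most the logarithm of the transfer operator applied to f. Invariance under \<open>Lg\<close>
  removes the averaging, and what remains is the claim for the test function f.\<close>

lemma entropy_g_measure: "ereal (- pr g_measure G) \<le> ent g_measure"
proof (rule entropy_greatest[OF g_measure(1)])
  fix f :: "'a CSigma" assume f: "pos_fn f"
  have pL: "pos_fn (Lop f)" using transfer_op_pos[OF f] by (simp add: pos_fn_def)
  have ell: "ell f = lnf (Lop f) - lnf f"
  proof (rule bcontfun_eqI)
    fix x
    have "0 < app f x" using f by (simp add: pos_fn_def)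
    then show "app (ell f) x = app (lnf (Lop f) - lnf f) x"
      using transfer_op_pos[OF f, of x] by (simp add: apply_ell[OF f] apply_lnf[OF f] apply_lnf[OF pL] ln_div)
  qed
  have "app (Lg (lnf f - G)) x \<le> app (lnf (Lop f)) x" for x
  proof -
    define a where "a = transfer_op m f x"
    have a: "a > 0" unfolding a_def by (rule transfer_op_pos[OF f])
    have pw: "exp (app G y) * (ln (app f y) - app G y) \<le>
      exp (app G y) * ln a + app f y / a - exp (app G y)" for y
    proof -
      have p: "app f y > 0" using f by (simp add: pos_fn_def)
      define w where "w = app f y / exp (app G y)"
      have w: "w > 0" "exp (app G y) * w = app f y" using p by (simp_all add: w_def)
      have "ln (w / a) \<le> w / a - 1" using w a by (intro ln_le_minus_one) simp
      then have "ln w \<le> ln a + w / a - 1" using w a by (simp add: ln_div)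
      moreover have "ln w = ln (app f y) - app G y" using p by (simp add: w_def ln_div)
      ultimately have "exp (app G y) * (ln (app f y) - app G y) \<le> exp (app G y) * (ln a + w / a - 1)"
        by (intro mult_left_mono) auto
      also have "\<dots> = exp (app G y) * ln a + (exp (app G y) * w) / a - exp (app G y)"
        by (simp add: algebra_simps)
      finally show ?thesis by (simp only: w(2))
    qed
    have "app (Lg (lnf f - G)) x \<le> (\<integral>\<omega>. exp (app G (case_nat \<omega> x)) * ln a + app f (case_nat \<omega> x) / a - exp (app G (case_nat \<omega> x)) \<partial>m)"
      unfolding apply_Lg
    proof (rule integral_mono[OF integrable_Lg])
      show "integrable m (\<lambda>\<omega>. exp (app G (case_nat \<omega> x)) * ln a + app f (case_nat \<omega> x) / a - exp (app G (case_nat \<omega> x)))"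
        by (intro Bochner_Integration.integrable_diff Bochner_Integration.integrable_add integrable_mult_left integrable_divide integrable_exp_G integrable_cons)
    qed (simp add: apply_lnf[OF f] pw)
    also have "\<dots> = ln a + a / a - 1"
      by (simp add: integrable_exp_G integrable_cons integral_exp_G) (simp add: a_def transfer_op_def)
    finally show ?thesis using a by (simp add: apply_lnf[OF pL] a_def)
  qed
  then have "pr g_measure (Lg (lnf f - G)) \<le> pr g_measure (lnf (Lop f))"
    by (rule prob_mono[OF g_measure(1)])
  then show "ereal (- pr g_measure G) \<le> ereal (pr g_measure (ell f))"
    by (simp add: ell g_measure(2) blinfun.diff_right)
qed

text \<open>Testing the entropy against \<open>exp (G + t u)\<close> and differentiating at \<open>t = 0\<close> forces an
  entropy maximiser to be fixed by the dual of the normalised transfer operator.\<close>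

lemma equilibrium_eq_g_measure:
  assumes \<mu>: "\<mu> \<in> PP" and h: "ereal (- pr \<mu> G) \<le> ent \<mu>"
  shows "\<mu> = g_measure"
proof (rule g_measure_unique[OF \<mu>])
  have nonneg: "0 \<le> pr \<mu> (Lg u) - pr \<mu> u" for u
  proof (rule field_le_epsilon)
    fix e :: real assume e: "e > 0"
    define N where "N = norm u + 1"
    have N: "N \<ge> 1" by (simp add: N_def)
    have uN: "\<bar>app u x\<bar> \<le> N" for x
      using abs_bcontfun_le_norm[of u x] by (simp add: N_def)
    \<comment> \<open>The bound 1 / N keeps t u in the range of \<open>exp_le_quadratic\<close>; the
      bound e / N^2 makes the second-order error at most e after division by t.\<close>
    define t where "t = min (1 / N) (e / N\<^sup>2)"
    have t: "t > 0" "t * N \<le> 1" "t * N\<^sup>2 \<le> e"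
      using N e by (auto simp: t_def min_def field_simps)
    define \<phi> where "\<phi> = expf (G + t *\<^sub>R u)"
    have \<phi>: "pos_fn \<phi>" unfolding \<phi>_def by (rule pos_expf)
    have pw: "app (ell \<phi>) x \<le> app (t *\<^sub>R Lg u + cst (t\<^sup>2 * N\<^sup>2) - G - t *\<^sub>R u) x" for x
    proof -
      have "transfer_op m \<phi> x = app (Lg (expf (t *\<^sub>R u))) x"
        by (simp add: \<phi>_def transfer_op_def apply_Lg exp_add)
      also have "\<dots> \<le> app (Lg (cst (1 + t\<^sup>2 * N\<^sup>2) + t *\<^sub>R u)) x"
      proof (rule Lg_mono)
        fix y
        have le: "\<bar>t * app u y\<bar> \<le> t * N" using t uN[of y] by (simp add: abs_mult)
        have "exp (t * app u y) \<le> 1 + t * app u y + (t * app u y)\<^sup>2"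
          using le t by (intro exp_le_quadratic) linarith
        moreover have "(t * app u y)\<^sup>2 \<le> (t * N)\<^sup>2"
          using le t N by (intro abs_le_square_iff[THEN iffD1]) auto
        ultimately show "app (expf (t *\<^sub>R u)) y \<le> app (cst (1 + t\<^sup>2 * N\<^sup>2) + t *\<^sub>R u) y"
          by (simp add: const_bcontfun.rep_eq power_mult_distrib)
      qed
      also have "\<dots> = 1 + t\<^sup>2 * N\<^sup>2 + t * app (Lg u) x"
        by (simp add: Lg_add Lg_const Lg_scale const_bcontfun.rep_eq)
      finally have 1: "transfer_op m \<phi> x \<le> 1 + t\<^sup>2 * N\<^sup>2 + t * app (Lg u) x" .
      have "ln (transfer_op m \<phi> x) \<le> transfer_op m \<phi> x - 1"
        by (rule ln_le_minus_one[OF transfer_op_pos[OF \<phi>]])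
      moreover have "app (ell \<phi>) x = ln (transfer_op m \<phi> x) - (app G x + t * app u x)"
        using transfer_op_pos[OF \<phi>, of x] unfolding apply_ell[OF \<phi>] by (simp add: ln_div \<phi>_def)
      ultimately show ?thesis using 1 by (simp add: const_bcontfun.rep_eq)
    qed
    have "- pr \<mu> G \<le> pr \<mu> (ell \<phi>)"
      using order_trans[OF h entropy_le[OF \<mu> \<phi>]] by simp
    also have "\<dots> \<le> pr \<mu> (t *\<^sub>R Lg u + cst (t\<^sup>2 * N\<^sup>2) - G - t *\<^sub>R u)"
      by (rule prob_mono[OF \<mu> pw])
    also have "\<dots> = t * (pr \<mu> (Lg u) - pr \<mu> u + t * N\<^sup>2) - pr \<mu> G"
      by (simp add: blinfun.add_right blinfun.diff_right blinfun.scaleR_right prob_const[OF \<mu>] algebra_simps power2_eq_square)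
    finally have "0 \<le> t * (pr \<mu> (Lg u) - pr \<mu> u + t * N\<^sup>2)" by simp
    then have "0 \<le> pr \<mu> (Lg u) - pr \<mu> u + t * N\<^sup>2"
      using t(1) by (simp add: zero_le_mult_iff)
    then show "0 \<le> pr \<mu> (Lg u) - pr \<mu> u + e" using t(3) by linarith
  qed
  fix u :: "'a CSigma"
  show "pr \<mu> (Lg u) = pr \<mu> u"
    using nonneg[of u] nonneg[of "- 1 *\<^sub>R u"] unfolding Lg_scale blinfun.scaleR_right by simp
qed

end

lemma tendsto_apply_bcontfun:
  fixes f :: "nat \<Rightarrow> 'b::topological_space \<Rightarrow>\<^sub>C real"
  assumes "f \<longlonglongrightarrow> l"
  shows "(\<lambda>n. app (f n) x) \<longlonglongrightarrow> app l x"
proof (rule LIM_zero_cancel, rule Lim_null_comparison)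
  show "(\<lambda>n. norm (f n - l)) \<longlonglongrightarrow> 0" using assms by (simp add: tendsto_norm_zero LIM_zero)
  show "\<forall>\<^sub>F n in sequentially. norm (app (f n) x - app l x) \<le> norm (f n - l)"
    using abs_bcontfun_le_norm[of "f _ - l" x] by (intro always_eventually allI) simp
qed

section \<open>Normalisation of Hoelder potentials and ergodicity of their equilibrium
  states\<close>

context holder_exponent
begin

text \<open>A discount \<open>\<beta>\<close> below 1 makes the logarithm of the transfer operator,
  as a map of u, a sup-norm contraction. The Hoelder bound \<open>B\<close> does not depend on
  \<open>\<beta>\<close>, and it is what survives when the discount tends to 1.\<close>

lemma discounted_fixed_point:
  assumes \<Theta>: "hol C \<Theta>" and C: "0 \<le> C" and \<beta>: "0 \<le> \<beta>" "\<beta> < 1"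
    and B: "0 \<le> B" "\<kappa> * (C + B) \<le> B"
  obtains u where "hol B u"
    "\<And>s. app u s = ln (transfer_op m (expf (\<Theta> + \<beta> *\<^sub>R u)) s)"
proof -
  define F where "F u = lnf (Lop (expf (\<Theta> + \<beta> *\<^sub>R u)))" for u
  have pos: "0 < transfer_op m (expf w) s" for w s by (rule transfer_op_pos[OF pos_expf])
  have F: "app (F u) s = ln (transfer_op m (expf (\<Theta> + \<beta> *\<^sub>R u)) s)" for u s
  proof -
    have "pos_fn (Lop (expf (\<Theta> + \<beta> *\<^sub>R u)))" using pos by (simp add: pos_fn_def)
    then show ?thesis by (simp add: F_def apply_lnf)
  qed
  have ln_mono: "ln (transfer_op m (expf w) s) \<le> ln (transfer_op m (expf w') s') + c"
    if le: "\<And>\<omega>. app w (case_nat \<omega> s) \<le> app w' (case_nat \<omega> s') + c" for w w' c s s'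
  proof -
    have "transfer_op m (expf w) s \<le> (\<integral>\<omega>. exp c * app (expf w') (case_nat \<omega> s') \<partial>m)"
      unfolding transfer_op_def using le
      by (intro integral_mono integrable_mult_right integrable_cons) (simp add: add.commute flip: exp_add)
    also have "\<dots> = exp c * transfer_op m (expf w') s'" by (simp add: transfer_op_def)
    finally have "ln (transfer_op m (expf w) s) \<le> ln (exp c * transfer_op m (expf w') s')"
      using pos by (subst ln_le_cancel_iff) auto
    also have "\<dots> = c + ln (transfer_op m (expf w') s')" using pos[of w' s'] by (subst ln_mult_pos) auto
    finally show ?thesis by simp
  qed
  define S where "S = {u. hol B u}"
  have contr: "dist (F u) (F v) \<le> \<beta> * dist u v" for u v
  proof (rule dist_bound)
    fix s
    have *: "app (F u) s \<le> app (F v) s + \<beta> * norm (u - v)" for u v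
      unfolding F
    proof (rule ln_mono)
      fix \<omega>
      have "app u (case_nat \<omega> s) - app v (case_nat \<omega> s) \<le> norm (u - v)"
        using abs_bcontfun_le_norm[of "u - v" "case_nat \<omega> s"] by simp
      then have "\<beta> * (app u (case_nat \<omega> s) - app v (case_nat \<omega> s)) \<le> \<beta> * norm (u - v)"
        using \<beta> by (intro mult_left_mono)
      then show "app (\<Theta> + \<beta> *\<^sub>R u) (case_nat \<omega> s) \<le> app (\<Theta> + \<beta> *\<^sub>R v) (case_nat \<omega> s) + \<beta> * norm (u - v)"
        by (simp add: algebra_simps)
    qed
    show "dist (app (F u) s) (app (F v) s) \<le> \<beta> * dist u v"
      using *[of u v] *[of v u] by (simp add: dist_norm norm_minus_commute abs_le_iff)
  qed
  have "\<exists>!u\<in>S. F u = u"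
  proof (rule Banach_fix)
    have "closed S" unfolding closed_sequential_limits
    proof (intro allI impI)
      fix f l assume f: "(\<forall>n. f n \<in> S) \<and> f \<longlonglongrightarrow> l"
      have "\<bar>app l s - app l s'\<bar> \<le> B * gauge s s'" for s s'
      proof (rule LIMSEQ_le_const2)
        show "(\<lambda>n. \<bar>app (f n) s - app (f n) s'\<bar>) \<longlonglongrightarrow> \<bar>app l s - app l s'\<bar>"
          using f by (intro tendsto_rabs tendsto_diff tendsto_apply_bcontfun) auto
      qed (use f in \<open>auto simp: S_def hol_def\<close>)
      then show "l \<in> S" by (simp add: S_def hol_def)
    qed
    then show "Topological_Spaces.complete S" by (simp add: complete_eq_closed)
    have "hol B 0" using B gauge_nonneg by (simp add: hol_def)
    then show "S \<noteq> {}" by (auto simp: S_def)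
    show "F ` S \<subseteq> S"
    proof clarify
      fix u assume "u \<in> S"
      then have u: "hol B u" by (simp add: S_def)
      have *: "app (F u) s \<le> app (F u) s' + B * gauge s s'" for s s'
        unfolding F
      proof (rule ln_mono)
        fix \<omega>
        have tb: "app \<Theta> (case_nat \<omega> s) - app \<Theta> (case_nat \<omega> s') \<le> C * (\<kappa> * gauge s s')"
          using \<Theta>[unfolded hol_def, rule_format, of "case_nat \<omega> s" "case_nat \<omega> s'"] by (simp add: gauge_cons)
        have ub: "app u (case_nat \<omega> s) - app u (case_nat \<omega> s') \<le> B * (\<kappa> * gauge s s')"
          using u[unfolded hol_def, rule_format, of "case_nat \<omega> s" "case_nat \<omega> s'"] by (simp add: gauge_cons)
        have "\<beta> * (app u (case_nat \<omega> s) - app u (case_nat \<omega> s')) \<le> \<beta> * (B * (\<kappa> * gauge s s'))"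
          using \<beta> by (intro mult_left_mono ub)
        also have "\<dots> \<le> 1 * (B * (\<kappa> * gauge s s'))"
          using \<beta> B kappa gauge_nonneg by (intro mult_right_mono) auto
        finally have bb: "\<beta> * app u (case_nat \<omega> s) - \<beta> * app u (case_nat \<omega> s') \<le> B * (\<kappa> * gauge s s')"
          by (simp add: algebra_simps)
        have kb: "\<kappa> * (C + B) * gauge s s' \<le> B * gauge s s'"
          by (intro mult_right_mono B gauge_nonneg)
        show "app (\<Theta> + \<beta> *\<^sub>R u) (case_nat \<omega> s) \<le> app (\<Theta> + \<beta> *\<^sub>R u) (case_nat \<omega> s') + B * gauge s s'"
          using tb bb kb by (simp add: algebra_simps)
      qed
      have "\<bar>app (F u) s - app (F u) s'\<bar> \<le> B * gauge s s'" for s s'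
        using *[of s s'] *[of s' s] by (simp add: gauge_commute abs_le_iff)
      then show "F u \<in> S" by (simp add: S_def hol_def)
    qed
    show "dist (F x) (F y) \<le> \<beta> * dist x y" for x y by (rule contr)
  qed (use \<beta> in auto)
  then obtain u where "u \<in> S" "F u = u" by blast
  with F[of u] show thesis by (intro that[of u]) (auto simp: S_def)
qed

text \<open>The eigenfunction is a limit of discounted fixed points as the discount tends to \<open>1\<close>.\<close>

lemma ruelle_perron_frobenius:
  assumes \<Theta>: "hol C \<Theta>" and C: "0 \<le> C"
  obtains v c B where "hol B v"
    "\<And>s. transfer_op m (expf (\<Theta> + v)) s = exp (app v s + c)"
proof -
  fix s0 :: "nat \<Rightarrow> 'a"
  \<comment> \<open>The solution of B = \<open>\<kappa> * (C + B)\<close>.\<close>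
  define B where "B = \<kappa> * C / (1 - \<kappa>)"
  have B: "0 \<le> B" "\<kappa> * (C + B) \<le> B"
  proof -
    show "0 \<le> B" using kappa C by (simp add: B_def)
    have "B * (1 - \<kappa>) = \<kappa> * C" using kappa by (simp add: B_def)
    then show "\<kappa> * (C + B) \<le> B" by (simp add: algebra_simps)
  qed
  define \<beta> where "\<beta> n = 1 - inverse (real (Suc n))" for n
  have \<beta>: "0 \<le> \<beta> n" "\<beta> n < 1" for n by (auto simp: \<beta>_def inverse_le_1_iff)
  have "\<exists>u. hol B u \<and> (\<forall>s. app u s = ln (transfer_op m (expf (\<Theta> + \<beta> n *\<^sub>R u)) s))" for n
    by (rule discounted_fixed_point[OF \<Theta> C \<beta>[of n] B]) blast
  then obtain u where u: "\<And>n. hol B (u n)"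
    "\<And>n s. app (u n) s = ln (transfer_op m (expf (\<Theta> + \<beta> n *\<^sub>R u n)) s)" by metis
  define a where "a n = app (u n) s0" for n
  \<comment> \<open>The fixed points need not stay bounded as \<open>\<beta> n\<close> tends to 1.
    Subtracting the value at \<open>s0\<close> leaves functions bounded by \<open>B\<close>, and (1
    - \<beta> n) times the subtracted value converges to the logarithm c of the eigenvalue.\<close>
  define w where "w n = u n - cst (a n)" for n
  have w: "app (w n) s = app (u n) s - a n" for n s
    by (simp add: w_def const_bcontfun.rep_eq)
  have pos: "0 < transfer_op m (expf w) s" for w s by (rule transfer_op_pos[OF pos_expf])
  have eq: "app (w n) s + (1 - \<beta> n) * a n = ln (transfer_op m (expf (\<Theta> + \<beta> n *\<^sub>R w n)) s)" for n s
  proof -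
    have "expf (\<Theta> + \<beta> n *\<^sub>R u n) = exp (\<beta> n * a n) *\<^sub>R expf (\<Theta> + \<beta> n *\<^sub>R w n)"
      by (rule bcontfun_eqI) (simp add: w algebra_simps flip: exp_add)
    then have "app (u n) s = \<beta> n * a n + ln (transfer_op m (expf (\<Theta> + \<beta> n *\<^sub>R w n)) s)"
      using pos[of "\<Theta> + \<beta> n *\<^sub>R w n" s] unfolding u(2)[of n s] by (simp add: transfer_op_scale ln_mult_pos)
    then show ?thesis by (simp add: w algebra_simps)
  qed
  have gw: "\<bar>app (w n) s - app (w n) s'\<bar> \<le> B * gauge s s'" for n s s'
    using u(1)[of n] by (simp add: w hol_def)
  have nw: "norm (w n) \<le> B" for n
  proof (rule norm_bound)
    fix s
    have "B * gauge s s0 \<le> B * 1" by (intro mult_left_mono gauge_le_1 B)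
    then show "norm (app (w n) s) \<le> B" using gw[of n s s0] by (simp add: w a_def)
  qed
  have "\<exists>U. open U \<and> x \<in> U \<and> (\<forall>n. \<forall>y\<in>U. \<bar>app (w n) x - app (w n) y\<bar> < e)"
    if "e > 0" for x e
    by (rule equicontinuous_of_gauge[where A=B]) (use gw that in auto)
  then obtain r v where r: "strict_mono r" "(\<lambda>n. w (r n)) \<longlonglongrightarrow> v"
    using arzela_ascoli_bcontfun[OF compact_Sigma, of w B] nw by metis
  have holv: "hol B v"
    unfolding hol_def
  proof (intro allI)
    fix s s'
    show "\<bar>app v s - app v s'\<bar> \<le> B * gauge s s'"
    proof (rule LIMSEQ_le_const2)
      show "(\<lambda>n. \<bar>app (w (r n)) s - app (w (r n)) s'\<bar>) \<longlonglongrightarrow> \<bar>app v s - app v s'\<bar>"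
        by (intro tendsto_rabs tendsto_diff tendsto_apply_bcontfun r)
    qed (use gw in auto)
  qed
  have b1: "(\<lambda>n. \<beta> (r n)) \<longlonglongrightarrow> 1"
  proof -
    have "\<beta> \<longlonglongrightarrow> 1 - 0" unfolding \<beta>_def by (intro tendsto_diff tendsto_const LIMSEQ_inverse_real_of_nat)
    then show ?thesis using LIMSEQ_subseq_LIMSEQ[OF _ r(1)] by (simp add: o_def)
  qed
  interpret prob_space m by (rule prob_m)
  have lim: "(\<lambda>n. ln (transfer_op m (expf (\<Theta> + \<beta> (r n) *\<^sub>R w (r n))) s)) \<longlonglongrightarrow> ln (transfer_op m (expf (\<Theta> + v)) s)" for s
  proof (rule tendsto_ln)
    show "(\<lambda>n. transfer_op m (expf (\<Theta> + \<beta> (r n) *\<^sub>R w (r n))) s) \<longlonglongrightarrow> transfer_op m (expf (\<Theta> + v)) s"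
      unfolding transfer_op_def
    proof (rule integral_dominated_convergence[where w="\<lambda>_. exp (norm \<Theta> + B)"])
      show "AE \<omega> in m. (\<lambda>n. app (expf (\<Theta> + \<beta> (r n) *\<^sub>R w (r n))) (case_nat \<omega> s)) \<longlonglongrightarrow> app (expf (\<Theta> + v)) (case_nat \<omega> s)"
      proof (rule AE_I2)
        fix \<omega>
        have "(\<lambda>n. exp (app \<Theta> (case_nat \<omega> s) + \<beta> (r n) * app (w (r n)) (case_nat \<omega> s))) \<longlonglongrightarrow> exp (app \<Theta> (case_nat \<omega> s) + 1 * app v (case_nat \<omega> s))"
          by (intro tendsto_exp tendsto_add tendsto_const tendsto_mult b1 tendsto_apply_bcontfun r)
        then show "(\<lambda>n. app (expf (\<Theta> + \<beta> (r n) *\<^sub>R w (r n))) (case_nat \<omega> s)) \<longlonglongrightarrow> app (expf (\<Theta> + v)) (case_nat \<omega> s)"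
          by simp
      qed
      show "AE \<omega> in m. norm (app (expf (\<Theta> + \<beta> (r n) *\<^sub>R w (r n))) (case_nat \<omega> s)) \<le> exp (norm \<Theta> + B)" for n
      proof (rule AE_I2)
        fix \<omega>
        let ?x = "case_nat \<omega> s"
        have "\<bar>\<beta> (r n)\<bar> * \<bar>app (w (r n)) ?x\<bar> \<le> 1 * B"
          using \<beta>[of "r n"] order_trans[OF abs_bcontfun_le_norm nw] by (intro mult_mono) auto
        then have "\<bar>\<beta> (r n) * app (w (r n)) ?x\<bar> \<le> B" by (simp add: abs_mult)
        then have "app \<Theta> ?x + \<beta> (r n) * app (w (r n)) ?x \<le> norm \<Theta> + B"
          using abs_bcontfun_le_norm[of \<Theta> ?x] by linarith
        then show "norm (app (expf (\<Theta> + \<beta> (r n) *\<^sub>R w (r n))) ?x) \<le> exp (norm \<Theta> + B)"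
          by simp
      qed
    qed (use integrable_cons[THEN borel_measurable_integrable] in auto)
    show "transfer_op m (expf (\<Theta> + v)) s \<noteq> 0" using pos[of "\<Theta> + v" s] by simp
  qed
  define c where "c = ln (transfer_op m (expf (\<Theta> + v)) s0)"
  have ac: "(\<lambda>n. (1 - \<beta> (r n)) * a (r n)) \<longlonglongrightarrow> c"
    using lim[of s0] unfolding eq[symmetric] c_def by (simp add: w a_def)
  have "transfer_op m (expf (\<Theta> + v)) s = exp (app v s + c)" for s
  proof -
    have "(\<lambda>n. app (w (r n)) s + (1 - \<beta> (r n)) * a (r n)) \<longlonglongrightarrow> app v s + c"
      by (intro tendsto_add tendsto_apply_bcontfun r ac)
    then have "app v s + c = ln (transfer_op m (expf (\<Theta> + v)) s)"
      unfolding eq by (rule LIMSEQ_unique[OF _ lim])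
    then show ?thesis using pos[of "\<Theta> + v" s] by simp
  qed
  with holv show thesis by (rule that)
qed

definition equilibrium :: "'a CSigma \<Rightarrow> 'a CSigma_dual \<Rightarrow> bool"
  where "equilibrium \<Theta> \<mu> \<longleftrightarrow> \<mu> \<in> PT \<and> (\<forall>\<nu>\<in>PT.
    ent \<nu> + ereal (pr \<nu> \<Theta>) \<le> ent \<mu> + ereal (pr \<mu> \<Theta>))"

text \<open>A coboundary and a constant turn \<Theta> into the normalised \<open>G\<close>, which
  changes the integral against every invariant measure by the same constant c. Comparison with the
  g-measure shows that the entropy of an equilibrium state is at least minus its integral of
  \<open>G\<close>, and only the g-measure achieves this.\<close>

theorem equilibrium_ergodic:
  assumes \<Theta>: "hol C \<Theta>" and eq: "equilibrium \<Theta> \<mu>"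
  shows "\<mu> \<in> PE"
proof -
  have \<Theta>': "hol \<bar>C\<bar> \<Theta>" using \<Theta> unfolding hol_def
    by (meson abs_ge_self gauge_nonneg mult_right_mono order_trans)
  obtain v c B where v: "hol B v"
    "\<And>x. transfer_op m (expf (\<Theta> + v)) x = exp (app v x + c)"
    using that by (rule ruelle_perron_frobenius[OF \<Theta>' abs_ge_zero])
  define G where "G = \<Theta> + v - comp_shift v - cst c"
  have G: "app G x = app \<Theta> x + app v x - app v (shift x) - c" for x
    by (simp add: G_def const_bcontfun.rep_eq)
  \<comment> \<open>\<Theta> and v are compared at prefixed points, which gives the two terms with
    \<open>\<kappa>\<close>; the coboundary term compares v at x and x' themselves and gives the
    last B.\<close>
  interpret g_function m \<eta> \<alpha> G "C * \<kappa> + B * \<kappa> + B"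
  proof
    show "transfer_op m (expf G) x = 1" for x
    proof -
      have "exp (app G (case_nat w x)) = exp (- app v x - c) * app (expf (\<Theta> + v)) (case_nat w x)" for w
        by (simp add: G algebra_simps flip: exp_add)
      then have "transfer_op m (expf G) x = exp (- app v x - c) * transfer_op m (expf (\<Theta> + v)) x"
        unfolding transfer_op_def apply_expf[of G] by simp
      then show ?thesis by (simp add: v(2) flip: exp_add)
    qed
    show "\<bar>app G (case_nat w x) - app G (case_nat w x')\<bar> \<le> (C * \<kappa> + B * \<kappa> + B) * gauge x x'" for w x x'
      using \<Theta>[unfolded hol_def, rule_format, of "case_nat w x" "case_nat w x'"]
        v(1)[unfolded hol_def, rule_format, of "case_nat w x" "case_nat w x'"]
        v(1)[unfolded hol_def, rule_format, of x x']
      by (simp add: G gauge_cons distrib_right mult.assoc abs_le_iff)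
  qed
  have inv: "\<mu> \<in> PT" using eq by (simp add: equilibrium_def)
  have G_int: "pr \<nu> G = pr \<nu> \<Theta> - c" if "\<nu> \<in> PT" for \<nu>
    using that by (simp add: G_def blinfun.diff_right blinfun.add_right invariant_functionals_iff prob_const)
  have "ereal (- pr g_measure G) + ereal (pr g_measure \<Theta>) \<le> ent g_measure + ereal (pr g_measure \<Theta>)"
    by (intro add_right_mono entropy_g_measure)
  also have "\<dots> \<le> ent \<mu> + ereal (pr \<mu> \<Theta>)"
    using eq g_measure_invariant by (simp add: equilibrium_def)
  finally have "ereal (- pr \<mu> G) \<le> ent \<mu>"
    by (cases "ent \<mu>") (auto simp: G_int[OF g_measure_invariant] G_int[OF inv])
  then have "\<mu> = g_measure" by (rule equilibrium_eq_g_measure[OF invariant_prob[OF inv]])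
  with g_measure_ergodic show ?thesis by simp
qed

lemma hol_sum:
  assumes "\<And>j. j \<in> J \<Longrightarrow> \<exists>A. hol A (f j)"
  shows "\<exists>A. hol A (\<Sum>j\<in>J. a j *\<^sub>R f j)"
  using assms
proof (induction J rule: infinite_finite_induct)
  case (insert j J)
  then obtain A where A: "hol A (\<Sum>j\<in>J. a j *\<^sub>R f j)" by auto
  obtain B where B: "hol B (f j)" using insert.prems by auto
  have "hol (A + \<bar>a j\<bar> * B) (\<Sum>j\<in>insert j J. a j *\<^sub>R f j)"
    unfolding hol_def
  proof (intro allI)
    fix x x'
    have "\<bar>a j\<bar> * \<bar>app (f j) x - app (f j) x'\<bar> \<le> \<bar>a j\<bar> * (B * gauge x x')"
      using B by (intro mult_left_mono) (auto simp: hol_def)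
    then have "\<bar>a j * app (f j) x - a j * app (f j) x'\<bar> \<le> \<bar>a j\<bar> * (B * gauge x x')"
      by (simp add: abs_mult[symmetric] right_diff_distrib)
    moreover have "\<bar>app (\<Sum>j\<in>J. a j *\<^sub>R f j) x - app (\<Sum>j\<in>J. a j *\<^sub>R f j) x'\<bar> \<le> A * gauge x x'"
      using A by (simp add: hol_def)
    ultimately show "\<bar>app (\<Sum>j\<in>insert j J. a j *\<^sub>R f j) x - app (\<Sum>j\<in>insert j J. a j *\<^sub>R f j) x'\<bar> \<le> (A + \<bar>a j\<bar> * B) * gauge x x'"
      using insert.hyps by (simp add: distrib_right mult.assoc)
  qed
  then show ?case by blast
qed (auto simp: hol_def intro!: exI[of _ 0])

end

section \<open>Approximation by ergodic measures without loss of entropy\<close>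

context symbolic_space
begin

text \<open>The approximating measures maximise the entropy minus a quadratic penalty; by concavity a
  maximiser is an equilibrium state of the linearised, hence Lipschitz, potential.\<close>

theorem entropy_dense_ergodic:
  assumes \<mu>: "\<mu> \<in> PT" and h: "ent \<mu> \<noteq> - \<infinity>"
  obtains u where "\<And>n. u n \<in> PE" "\<And>n. ent \<mu> \<le> ent (u n)" "wlim u \<mu>"
proof -
  interpret holder_exponent m \<eta> 1 by standard auto
  obtain k where k: "ent \<mu> = ereal k" "k \<le> 0"
    using h entropy_nonpos[OF invariant_prob[OF \<mu>]] by (cases "ent \<mu>") auto
  have "\<exists>\<nu>\<in>PE. ent \<mu> \<le> ent \<nu> \<and>
    (\<forall>j<n. \<bar>pr \<nu> (dense_fn j) - pr \<mu> (dense_fn j)\<bar> \<le> 3 * inverse (real (Suc n)))" for n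
  proof -
    define d where "d = inverse (real (Suc n))"
    have d: "d > 0" by (simp add: d_def)
    \<comment> \<open>The penalty is built from Hoelder approximants of the dense functions, so that
      its gradient is a Hoelder potential.\<close>
    have "\<exists>g. (\<exists>A. hol A g) \<and> norm (dense_fn j - g) < d" for j using hol_dense[OF d] by blast
    then obtain g where g: "\<And>j. \<exists>A. hol A (g j)" "\<And>j. norm (dense_fn j - g j) < d" by metis
    \<comment> \<open>Forces \<open>Q \<nu> \<le> d\<^sup>2\<close> at the maximiser: its penalised
      entropy is at least k and its entropy at most 0, so L * Q \<nu> is at most -k. The additional
      1 keeps \<open>L\<close> positive when k = 0.\<close>
    define L where "L = (1 - k) / d\<^sup>2"
    have L: "L > 0" "L * d\<^sup>2 = 1 - k" using d k by (auto simp: L_def)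
    define Q where "Q \<nu> = (\<Sum>j<n. (pr \<nu> (g j) - pr \<mu> (g j))\<^sup>2)" for \<nu>
    have Q0: "0 \<le> Q \<nu>" for \<nu> unfolding Q_def by (intro sum_nonneg) auto
    obtain \<nu> where \<nu>: "\<nu> \<in> PT"
      "\<And>\<rho>. \<rho> \<in> PT \<Longrightarrow> ent \<rho> - ereal (L * Q \<rho>) \<le> ent \<nu> - ereal (L * Q \<nu>)"
    proof (rule usc_attains_max[of invariant_functionals "\<lambda>\<rho>. ent \<rho> - ereal (L * Q \<rho>)"])
      show "PT \<noteq> ({} :: 'a CSigma_dual set)" using \<mu> by blast
      show "\<exists>r \<mu>. strict_mono (r :: nat \<Rightarrow> nat) \<and> \<mu> \<in> PT \<and> wlim (\<lambda>n. u (r n)) \<mu>"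
        if u: "\<And>n. u n \<in> PT" for u :: "nat \<Rightarrow> 'a CSigma_dual"
        by (rule invariant_seq_compact_ex[OF u])
      fix u :: "nat \<Rightarrow> 'a CSigma_dual" and \<rho> l
      assume u: "\<And>n. u n \<in> PT" "wlim u \<rho>"
        and l: "(\<lambda>n. ent (u n) - ereal (L * Q (u n))) \<longlonglongrightarrow> l"
      have Q: "(\<lambda>n. ereal (L * Q (u n))) \<longlonglongrightarrow> ereal (L * Q \<rho>)"
        unfolding Q_def using u(2)
        by (intro tendsto_ereal tendsto_mult tendsto_const tendsto_sum tendsto_power tendsto_diff) (auto simp: wlim_def)
      have "(\<lambda>n. (ent (u n) - ereal (L * Q (u n))) + ereal (L * Q (u n))) \<longlonglongrightarrow> l + ereal (L * Q \<rho>)"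
        by (intro tendsto_add_ereal_general1 l Q) auto
      moreover have "(x - ereal y) + ereal y = x" for x y by (cases x) auto
      ultimately have "(\<lambda>n. ent (u n)) \<longlonglongrightarrow> l + ereal (L * Q \<rho>)" by simp
      then have "l + ereal (L * Q \<rho>) \<le> ent \<rho>"
        by (rule entropy_usc[OF invariant_prob[OF u(1)] u(2)])
      then show "l \<le> ent \<rho> - ereal (L * Q \<rho>)"
        by (cases l; cases "ent \<rho>") auto
    qed (rule that)
    have "Q \<mu> = 0" by (simp add: Q_def)
    then have 1: "ereal k \<le> ent \<nu> - ereal (L * Q \<nu>)" using \<nu>(2)[OF \<mu>] k by simp
    then obtain k0 where k0: "ent \<nu> = ereal k0" "k0 \<le> 0"
      using entropy_nonpos[OF invariant_prob[OF \<nu>(1)]] by (cases "ent \<nu>") auto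
    have 2: "k \<le> k0 - L * Q \<nu>" using 1 k0 by simp
    then have "L * Q \<nu> \<le> L * d\<^sup>2" using L k0 by simp
    then have Qd: "Q \<nu> \<le> d\<^sup>2" using L(1) by (simp only: mult_le_cancel_left_pos)
    have "0 \<le> L * Q \<nu>" using L(1) Q0[of \<nu>] by simp
    with 2 have "k \<le> k0" by linarith
    define a where "a j = pr \<nu> (g j) - pr \<mu> (g j)" for j
    \<comment> \<open>Minus the gradient of \<open>L * Q\<close> at \<open>\<nu>\<close>, so that
      the second-order term is all that separates the penalised problem from the linear one.\<close>
    define \<Theta> where "\<Theta> = (\<Sum>j<n. (- 2 * L * a j) *\<^sub>R g j)"
    have "\<exists>A. hol A \<Theta>" unfolding \<Theta>_def by (rule hol_sum) (rule g)
    moreover have "equilibrium \<Theta> \<nu>"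
      unfolding equilibrium_def
    proof (intro conjI ballI \<nu>)
      fix \<rho> :: "'a CSigma_dual" assume \<rho>: "\<rho> \<in> PT"
      show "ent \<rho> + ereal (pr \<rho> \<Theta>) \<le> ent \<nu> + ereal (pr \<nu> \<Theta>)"
      proof (cases "ent \<rho> = - \<infinity>")
        case False
        then obtain k1 where k1: "ent \<rho> = ereal k1"
          using entropy_nonpos[OF invariant_prob[OF \<rho>]] by (cases "ent \<rho>") auto
        define b where "b j = pr \<rho> (g j) - pr \<nu> (g j)" for j
        define S where "S = (\<Sum>j<n. (b j)\<^sup>2)"
        have S: "0 \<le> S" unfolding S_def by (intro sum_nonneg) auto
        have "k1 - k0 \<le> 2 * L * (\<Sum>j<n. a j * b j) + e" if e: "e > 0" for e
        proof -
          define t where "t = min 1 (e / (L * S + 1))"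
          have LS: "0 \<le> L * S" using L S by simp
          have t: "0 < t" "t \<le> 1" "t * (L * S) \<le> e"
          proof -
            have "t * (L * S) \<le> e / (L * S + 1) * (L * S + 1)" unfolding t_def using LS e
              by (intro mult_mono) auto
            then show "t * (L * S) \<le> e" using LS by simp
          qed (use e LS in \<open>auto simp: t_def\<close>)
          let ?m = "(1 - t) *\<^sub>R \<nu> + t *\<^sub>R \<rho>"
          have m: "?m \<in> PT" using t by (intro convexD[OF invariant_convex] \<nu> \<rho>) auto
          have "ereal ((1 - t) * k0 + t * k1) \<le> ent ?m"
            using t k0 k1 by (intro entropy_concave invariant_prob \<nu> \<rho>) auto
          then have "ereal ((1 - t) * k0 + t * k1) - ereal (L * Q ?m) \<le> ent ?m - ereal (L * Q ?m)"
            by (intro ereal_minus_mono) auto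
          also have "\<dots> \<le> ent \<nu> - ereal (L * Q \<nu>)" by (rule \<nu>(2)[OF m])
          finally have 3: "(1 - t) * k0 + t * k1 - L * Q ?m \<le> k0 - L * Q \<nu>" by (simp add: k0)
          have "Q ?m = (\<Sum>j<n. (a j + t * b j)\<^sup>2)"
            unfolding Q_def a_def b_def blinfun.add_left blinfun.scaleR_left real_scaleR_def
            by (intro sum.cong refl arg_cong[where f="\<lambda>x. x\<^sup>2"]) (simp add: algebra_simps)
          also have "\<dots> = (\<Sum>j<n. (a j)\<^sup>2) + 2 * t * (\<Sum>j<n. a j * b j) + t\<^sup>2 * S"
            unfolding S_def by (simp add: power2_sum sum.distrib sum_distrib_left power_mult_distrib mult_ac)
          also have "(\<Sum>j<n. (a j)\<^sup>2) = Q \<nu>" by (simp add: Q_def a_def)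
          finally have "t * (k1 - k0) \<le> t * (2 * L * (\<Sum>j<n. a j * b j) + t * (L * S))"
            using 3 by (simp add: algebra_simps power2_eq_square)
          then have "k1 - k0 \<le> 2 * L * (\<Sum>j<n. a j * b j) + t * (L * S)"
            using t by (simp only: mult_le_cancel_left_pos)
          then show ?thesis using t by linarith
        qed
        then have "k1 - k0 \<le> 2 * L * (\<Sum>j<n. a j * b j)" by (rule field_le_epsilon)
        moreover have "pr \<nu> \<Theta> - pr \<rho> \<Theta> = 2 * L * (\<Sum>j<n. a j * b j)"
          unfolding \<Theta>_def b_def blinfun.sum_right blinfun.scaleR_right
          by (simp add: sum_subtractf[symmetric] sum_distrib_left algebra_simps)
        ultimately show ?thesis by (simp add: k0 k1)
      qed simp
    qed
    ultimately have "\<nu> \<in> PE" using equilibrium_ergodic by blast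
    moreover have "ent \<mu> \<le> ent \<nu>" using \<open>k \<le> k0\<close> by (simp add: k k0)
    \<comment> \<open>One \<open>d\<close> comes from the penalty and one from each of the two
      replacements of \<open>dense_fn j\<close> by \<open>g j\<close>.\<close>
    moreover have "\<bar>pr \<nu> (dense_fn j) - pr \<mu> (dense_fn j)\<bar> \<le> 3 * d" if "j < n" for j
    proof -
      have "(a j)\<^sup>2 \<le> Q \<nu>" unfolding Q_def a_def using that by (intro member_le_sum) auto
      then have "\<bar>a j\<bar> \<le> d" using Qd d by (metis abs_le_square_iff abs_of_pos order_trans)
      then show ?thesis
        using prob_close[OF invariant_prob[OF \<nu>(1)], of "dense_fn j" "g j"]
          prob_close[OF invariant_prob[OF \<mu>], of "dense_fn j" "g j"] g(2)[of j]
        unfolding a_def by linarith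
    qed
    ultimately show ?thesis unfolding d_def by blast
  qed
  then obtain u where u: "\<And>n. u n \<in> PE" "\<And>n. ent \<mu> \<le> ent (u n)"
    "\<And>n j. j < n \<Longrightarrow> \<bar>pr (u n) (dense_fn j) - pr \<mu> (dense_fn j)\<bar> \<le> 3 * inverse (real (Suc n))"
    by metis
  have "wlim u \<mu>"
  proof (rule wlim_of_close[where C=3])
    show "u n \<in> PP" for n using u(1)[of n] by (simp add: ergodic_functionals_def invariant_prob)
  qed (rule u(3))
  with u(1,2) show thesis by (rule that)
qed

end

section \<open>The mean ergodic theorem\<close>

lemma L1_Cauchy_AE_convergent:
  fixes a :: "nat \<Rightarrow> 'b::topological_space \<Rightarrow> real"
  assumes M: "borel_prob M" and a: "\<And>n. a n \<in> borel_measurable borel" and bd: "\<And>n x. \<bar>a n x\<bar> \<le> B"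
    and cauchy: "\<And>e. e > 0 \<Longrightarrow> \<exists>N. \<forall>n\<ge>N. \<forall>k\<ge>N. (\<integral>x. \<bar>a n x - a k x\<bar> \<partial>M) < e"
  obtains r where "strict_mono r" "AE x in M. convergent (\<lambda>k. a (r k) x)"
proof -
  have "\<exists>N. \<forall>n\<ge>N. \<forall>k\<ge>N. (\<integral>x. \<bar>a n x - a k x\<bar> \<partial>M) < (1/2)^i" for i :: nat
    by (rule cauchy) simp
  then obtain N where N: "\<And>i n k. n \<ge> N i \<Longrightarrow> k \<ge> N i \<Longrightarrow> (\<integral>x. \<bar>a n x - a k x\<bar> \<partial>M) < (1/2)^i"
    by metis
  \<comment> \<open>The summand i makes r strictly increasing and the sum pushes it beyond
    \<open>N i\<close>; consecutive differences are then summable in L1.\<close>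
  define r where "r i = i + (\<Sum>l\<le>i. N l)" for i
  have r: "strict_mono r" unfolding strict_mono_Suc_iff r_def by simp
  have rN: "N i \<le> r i" for i
  proof -
    have "N i \<le> (\<Sum>l\<le>i. N l)" by (rule member_le_sum) auto
    then show ?thesis by (simp add: r_def)
  qed
  define d where "d i x = a (r (Suc i)) x - a (r i) x" for i x
  have int: "integrable M (\<lambda>x. \<bar>d i x\<bar>)" for i
  proof (rule borel_prob_integrable_bounded[OF M, where B="2 * B"])
    show "(\<lambda>x. \<bar>d i x\<bar>) \<in> borel_measurable borel" unfolding d_def using a by measurable
    show "\<bar>\<bar>d i x\<bar>\<bar> \<le> 2 * B" for x
      using bd[of "r (Suc i)" x] bd[of "r i" x] by (simp add: d_def)
  qed
  have di: "(\<integral>x. \<bar>d i x\<bar> \<partial>M) \<le> (1/2)^i" for i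
  proof -
    have "r i \<le> r (Suc i)" using r by (simp add: strict_mono_Suc_iff less_imp_le)
    then show ?thesis unfolding d_def using N[of i "r (Suc i)" "r i"] rN[of i] by auto
  qed
  have "(\<integral>\<^sup>+x. (\<Sum>i. ennreal \<bar>d i x\<bar>) \<partial>M) = (\<Sum>i. \<integral>\<^sup>+x. ennreal \<bar>d i x\<bar> \<partial>M)"
    using int by (intro nn_integral_suminf) auto
  also have "\<dots> = (\<Sum>i. ennreal (\<integral>x. \<bar>d i x\<bar> \<partial>M))"
    using int by (intro suminf_cong nn_integral_eq_integral) auto
  also have "\<dots> \<le> (\<Sum>i. ennreal ((1/2)^i))"
    by (intro suminf_le ennreal_leI di) auto
  also have "\<dots> = ennreal (\<Sum>i. (1/2)^i)"
    by (rule suminf_ennreal2) (auto intro: summable_geometric)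
  also have "\<dots> < \<infinity>" by simp
  finally have "(\<integral>\<^sup>+x. (\<Sum>i. ennreal \<bar>d i x\<bar>) \<partial>M) \<noteq> \<infinity>" by simp
  then have "AE x in M. (\<Sum>i. ennreal \<bar>d i x\<bar>) \<noteq> \<infinity>"
    using int by (intro nn_integral_PInf_AE) auto
  then have "AE x in M. convergent (\<lambda>k. a (r k) x)"
  proof eventually_elim
    case (elim x)
    then have "summable (\<lambda>i. \<bar>d i x\<bar>)"
      by (intro summable_suminf_not_top) auto
    then have "summable (\<lambda>i. d i x)" by (rule summable_rabs_cancel)
    then have "convergent (\<lambda>n. \<Sum>i<n. d i x)" by (simp add: summable_iff_convergent)
    then have "convergent (\<lambda>n. a (r 0) x + (\<Sum>i<n. d i x))"
      by (intro convergent_add convergent_const)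
    moreover have "a (r 0) x + (\<Sum>i<n. d i x) = a (r n) x" for n
      by (induction n) (auto simp: d_def)
    ultimately show ?case by simp
  qed
  with r show thesis by (rule that)
qed

context symbolic_space
begin

definition avg :: "nat \<Rightarrow> 'a CSigma \<Rightarrow> 'a CSigma"
  where "avg N f = inverse (real N) *\<^sub>R (\<Sum>k<N. (comp_shift ^^ k) f)"

lemma apply_avg: "app (avg N f) x = inverse (real N) * (\<Sum>k<N. app f ((shift ^^ k) x))"
  by (simp add: avg_def apply_bcontfun_sum apply_comp_shift_pow)

lemma comp_shift_add: "comp_shift (f + g) = comp_shift f + comp_shift g"
  by (rule bcontfun_eqI) simp

lemma comp_shift_scale: "comp_shift (c *\<^sub>R f) = c *\<^sub>R comp_shift f"
  by (rule bcontfun_eqI) simp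

lemma norm_comp_shift_le: "norm (comp_shift f) \<le> norm f"
  by (rule norm_bound) (simp add: abs_bcontfun_le_norm)

lemma norm_comp_shift_pow_le: "norm ((comp_shift ^^ k) f) \<le> norm f"
  by (induction k) (auto intro: order_trans[OF norm_comp_shift_le])

lemma norm_avg_le: "norm (avg N f) \<le> norm f"
proof (cases "N = 0")
  case False
  have "norm (\<Sum>k<N. (comp_shift ^^ k) f) \<le> (\<Sum>k<N. norm f)"
    by (intro sum_norm_le norm_comp_shift_pow_le)
  then show ?thesis using False by (simp add: avg_def field_simps)
qed (simp add: avg_def)

lemma comp_shift_pow_add: "(comp_shift ^^ k) (f + g) = (comp_shift ^^ k) f + (comp_shift ^^ k) g"
  by (induction k) (auto simp: comp_shift_add)

lemma comp_shift_pow_scale: "(comp_shift ^^ k) (c *\<^sub>R f) = c *\<^sub>R (comp_shift ^^ k) f"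
  by (induction k) (auto simp: comp_shift_scale)

lemma avg_add: "avg N (f + g) = avg N f + avg N g"
  by (simp add: avg_def comp_shift_pow_add sum.distrib scaleR_add_right)

lemma avg_scale: "avg N (c *\<^sub>R f) = c *\<^sub>R avg N f"
  by (simp add: avg_def comp_shift_pow_scale scaleR_sum_right[symmetric] mult.commute)

lemma avg_sum: "avg N (\<Sum>i\<in>I. f i) = (\<Sum>i\<in>I. avg N (f i))"
proof (induction I rule: infinite_finite_induct)
  case (insert i I)
  then show ?case by (simp add: avg_add)
qed (use avg_scale[of N 0 0] in auto)

lemma avg_comp_shift_diff: "norm (avg N (comp_shift f) - avg N f) \<le> 2 * norm f / real N"
proof -
  have "(\<Sum>k<N. (comp_shift ^^ k) (comp_shift f)) - (\<Sum>k<N. (comp_shift ^^ k) f) = (comp_shift ^^ N) f - f"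
    by (induction N) (auto simp: funpow_swap1 algebra_simps)
  then have "avg N (comp_shift f) - avg N f = inverse (real N) *\<^sub>R ((comp_shift ^^ N) f - f)"
    by (simp add: avg_def scaleR_diff_right[symmetric])
  then have "norm (avg N (comp_shift f) - avg N f) \<le> inverse (real N) * (norm ((comp_shift ^^ N) f) + norm f)"
    by (simp add: mult_left_mono norm_triangle_ineq4)
  also have "\<dots> \<le> inverse (real N) * (norm f + norm f)"
    by (intro mult_left_mono add_mono norm_comp_shift_pow_le) auto
  finally show ?thesis by (simp add: field_simps)
qed

lemma avg_comp_shift_pow_diff: "norm (avg N ((comp_shift ^^ j) f) - avg N f) \<le> real j * (2 * norm f / real N)"
proof (induction j)
  case (Suc j)
  have "norm (avg N ((comp_shift ^^ Suc j) f) - avg N ((comp_shift ^^ j) f)) \<le> 2 * norm ((comp_shift ^^ j) f) / real N"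
    using avg_comp_shift_diff[of N "(comp_shift ^^ j) f"] by simp
  also have "\<dots> \<le> 2 * norm f / real N"
    by (intro divide_right_mono mult_left_mono norm_comp_shift_pow_le) auto
  finally have "norm (avg N ((comp_shift ^^ Suc j) f) - avg N ((comp_shift ^^ j) f)) \<le> 2 * norm f / real N" .
  with Suc have "norm (avg N ((comp_shift ^^ Suc j) f) - avg N ((comp_shift ^^ j) f)) + norm (avg N ((comp_shift ^^ j) f) - avg N f)
    \<le> real j * (2 * norm f / real N) + 2 * norm f / real N" by linarith
  also have "\<dots> = real (Suc j) * (2 * norm f / real N)" by (simp only: of_nat_Suc distrib_right mult_1 add.commute)
  finally have "norm (avg N ((comp_shift ^^ Suc j) f) - avg N ((comp_shift ^^ j) f)) + norm (avg N ((comp_shift ^^ j) f) - avg N f)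
    \<le> real (Suc j) * (2 * norm f / real N)" .
  then show ?case by (rule order_trans[OF norm_diff_triangle_ineq[of _ "avg N ((comp_shift ^^ j) f)" "avg N ((comp_shift ^^ j) f)", simplified]])
qed simp

text \<open>An average over N shifts is a mean of shifted copies of f, and an average of length L
  changes little under fewer than N shifts. With N fixed the bound vanishes as L grows.\<close>

lemma avg_avg_diff:
  assumes "N > 0"
  shows "norm (avg L (avg N f) - avg L f) \<le> 2 * real N * norm f / real L"
proof -
  have "avg L f = inverse (real N) *\<^sub>R (\<Sum>k<N. avg L f)"
    using assms by (simp add: sum_constant_scaleR)
  moreover have "avg L (avg N f) = inverse (real N) *\<^sub>R (\<Sum>k<N. avg L ((comp_shift ^^ k) f))"
    by (simp add: avg_def[of N] avg_scale avg_sum)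
  ultimately have "avg L (avg N f) - avg L f = inverse (real N) *\<^sub>R (\<Sum>k<N. avg L ((comp_shift ^^ k) f) - avg L f)"
    by (simp only: scaleR_diff_right sum_subtractf)
  then have "norm (avg L (avg N f) - avg L f) = inverse (real N) * norm (\<Sum>k<N. avg L ((comp_shift ^^ k) f) - avg L f)"
    by simp
  also have "\<dots> \<le> inverse (real N) * (\<Sum>k<N. real N * (2 * norm f / real L))"
  proof (intro mult_left_mono sum_norm_le)
    fix k assume "k \<in> {..<N}"
    then have "real k * (2 * norm f / real L) \<le> real N * (2 * norm f / real L)"
      by (intro mult_right_mono) auto
    then show "norm (avg L ((comp_shift ^^ k) f) - avg L f) \<le> real N * (2 * norm f / real L)"
      by (rule order_trans[OF avg_comp_shift_pow_diff])
  qed auto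
  also have "\<dots> = 2 * real N * norm f / real L" using assms by (simp add: field_simps)
  finally show ?thesis .
qed

text \<open>The squared L2 norm under \<mu>, kept as an evaluation at a continuous function so that
  it is measurable in the measure.\<close>

definition sqi :: "'a CSigma_dual \<Rightarrow> 'a CSigma \<Rightarrow> real"
  where "sqi \<mu> f = pr \<mu> (mulf f f)"

lemma invariant_avg:
  assumes "\<mu> \<in> PT" "N > 0"
  shows "pr \<mu> (avg N f) = pr \<mu> f"
proof -
  have "pr \<mu> ((comp_shift ^^ k) f) = pr \<mu> f" for k
    using assms by (induction k) (auto simp: invariant_functionals_iff)
  then show ?thesis using assms by (simp add: avg_def blinfun.scaleR_right blinfun.sum_right)
qed

lemma sqi_nonneg: "\<mu> \<in> PP \<Longrightarrow> 0 \<le> sqi \<mu> f"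
  unfolding sqi_def using prob_mono[of \<mu> 0 "mulf f f"] by (simp add: blinfun.zero_right)

lemma sqi_diff_le:
  assumes "\<mu> \<in> PP"
  shows "\<bar>sqi \<mu> f - sqi \<mu> g\<bar> \<le> norm (f - g) * (norm f + norm g)"
proof -
  have "norm (mulf f f - mulf g g) \<le> norm (f - g) * (norm f + norm g)"
  proof (rule norm_bound)
    fix x
    have "\<bar>app (f - g) x\<bar> * \<bar>app (f + g) x\<bar> \<le> norm (f - g) * norm (f + g)"
      by (intro mult_mono abs_bcontfun_le_norm) auto
    also have "\<dots> \<le> norm (f - g) * (norm f + norm g)" by (intro mult_left_mono norm_triangle_ineq) auto
    finally show "norm (app (mulf f f - mulf g g) x) \<le> norm (f - g) * (norm f + norm g)"
      by (simp add: abs_mult[symmetric] algebra_simps)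
  qed
  then show ?thesis unfolding sqi_def using prob_close[OF assms, of "mulf f f" "mulf g g"] by linarith
qed

lemma sqi_avg_le:
  assumes \<mu>: "\<mu> \<in> PT" and N: "N > 0"
  shows "sqi \<mu> (avg N f) \<le> sqi \<mu> f"
proof -
  have "pr \<mu> (mulf (avg N f) (avg N f)) \<le> pr \<mu> (avg N (mulf f f))"
  proof (rule prob_mono[OF invariant_prob[OF \<mu>]])
    fix s
    let ?x = "\<lambda>k. app f ((shift ^^ k) s)"
    have "(\<Sum>k<N. ?x k)\<^sup>2 \<le> (\<Sum>k<N. (?x k)\<^sup>2) * real (card {..<N})"
      by (rule sum_squared_le_sum_of_squares)
    then have "(\<Sum>k<N. ?x k) * (\<Sum>k<N. ?x k) \<le> real N * (\<Sum>k<N. ?x k * ?x k)"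
      by (simp add: power2_eq_square mult.commute)
    then have "inverse (real N) * (inverse (real N) * ((\<Sum>k<N. ?x k) * (\<Sum>k<N. ?x k))) \<le> inverse (real N) * (\<Sum>k<N. ?x k * ?x k)"
      using N by (intro mult_left_mono) (auto simp: field_simps)
    then show "app (mulf (avg N f) (avg N f)) s \<le> app (avg N (mulf f f)) s"
      by (simp add: apply_avg mult_ac)
  qed
  then show ?thesis by (simp add: sqi_def invariant_avg[OF \<mu> N])
qed

text \<open>Von Neumann's argument by the parallelogram law. All long averages have squared norm
  close to the infimum d. The midpoint h of two of them has squared norm at least d, because
  averaging h over a very long time nearly gives an average of f and does not increase the
  norm.\<close>

lemma avg_L2_Cauchy:
  assumes \<mu>: "\<mu> \<in> PT" and e: "e > 0"
  shows "\<exists>N0>0. \<forall>N\<ge>N0. \<forall>K\<ge>N0. sqi \<mu> (avg N f - avg K f) < e"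
proof -
  note p = invariant_prob[OF \<mu>]
  define d where "d = (INF N\<in>{0<..}. sqi \<mu> (avg N f))"
  have bdd: "bdd_below ((\<lambda>N. sqi \<mu> (avg N f)) ` {0<..})"
    by (rule bdd_belowI2[where m=0]) (simp add: sqi_nonneg[OF p])
  have d_le: "d \<le> sqi \<mu> (avg N f)" if "N > 0" for N
    unfolding d_def using that by (intro cINF_lower bdd) auto
  define c where "c = norm f"
  obtain N1 where N1: "N1 > 0" "sqi \<mu> (avg N1 f) < d + e / 8"
    using cINF_less_iff[of "{0<..}" "\<lambda>N. sqi \<mu> (avg N f)" "d + e/8"] bdd e by (auto simp: d_def)
  have up: "sqi \<mu> (avg L f) \<le> sqi \<mu> (avg N1 f) + 4 * real N1 * c\<^sup>2 / real L" if "L > 0" for L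
  proof -
    have "sqi \<mu> (avg L f) \<le> sqi \<mu> (avg L (avg N1 f)) + norm (avg L (avg N1 f) - avg L f) * (norm (avg L (avg N1 f)) + norm (avg L f))"
      using sqi_diff_le[OF p, of "avg L (avg N1 f)" "avg L f"] by linarith
    also have "\<dots> \<le> sqi \<mu> (avg N1 f) + (2 * real N1 * c / real L) * (c + c)"
      unfolding c_def
      by (intro add_mono mult_mono sqi_avg_le[OF \<mu> that] avg_avg_diff N1 norm_avg_le order_trans[OF norm_avg_le norm_avg_le]) auto
    finally show ?thesis by (simp add: power2_eq_square)
  qed
  obtain N0 :: nat where N0: "N0 > 0" "4 * real N1 * c\<^sup>2 / real N0 < e / 8"
  proof -
    obtain n :: nat where n: "4 * real N1 * c\<^sup>2 / (e / 8) < real n" using reals_Archimedean2 by blast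
    moreover have "0 \<le> 4 * real N1 * c\<^sup>2 / (e / 8)" using e by simp
    ultimately have "n > 0" by (metis of_nat_0_less_iff order_le_less_trans)
    moreover have "4 * real N1 * c\<^sup>2 / real n < e / 8"
      using n e \<open>n > 0\<close> by (simp add: field_simps)
    ultimately show ?thesis by (rule that)
  qed
  have close: "sqi \<mu> (avg N f) < d + e / 4" if "N \<ge> N0" for N
  proof -
    have "4 * real N1 * c\<^sup>2 / real N \<le> 4 * real N1 * c\<^sup>2 / real N0"
      using that N0 by (intro divide_left_mono) auto
    then show ?thesis using up[of N] N1 N0 that by linarith
  qed
  have "sqi \<mu> (avg N f - avg K f) < e" if NK: "N \<ge> N0" "K \<ge> N0" for N K
  proof -
    have pos: "N > 0" "K > 0" using NK N0 by auto
    define h where "h = (1/2) *\<^sub>R (avg N f + avg K f)"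
    have nh: "norm h \<le> c"
      unfolding h_def c_def using norm_triangle_ineq[of "avg N f" "avg K f"] norm_avg_le[of N f] norm_avg_le[of K f] by simp
    have "d \<le> sqi \<mu> h + e'" if e': "e' > 0" for e'
    proof -
      define S where "S = (2 * real N * c + 2 * real K * c) * (c + c)"
      have S: "0 \<le> S" by (simp add: S_def c_def)
      obtain L :: nat where L: "S / e' < real L" using reals_Archimedean2 by blast
      have "0 \<le> S / e'" using S e' by simp
      with L have L0: "L > 0" by (metis of_nat_0_less_iff order_le_less_trans)
      have SL: "S / real L \<le> e'" using L L0 e' by (simp add: field_simps)
      have "avg L h - avg L f = (1/2) *\<^sub>R ((avg L (avg N f) - avg L f) + (avg L (avg K f) - avg L f))"
        by (simp add: h_def avg_scale avg_add algebra_simps scaleR_2[symmetric])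
      then have "norm (avg L h - avg L f) \<le> (1/2) * (norm (avg L (avg N f) - avg L f) + norm (avg L (avg K f) - avg L f))"
        by (simp add: norm_triangle_ineq)
      also have "\<dots> \<le> 1 * (2 * real N * norm f / real L + 2 * real K * norm f / real L)"
        by (intro mult_mono add_mono avg_avg_diff pos) auto
      finally have nd: "norm (avg L h - avg L f) \<le> (2 * real N * c + 2 * real K * c) / real L"
        by (simp add: c_def add_divide_distrib)
      have "sqi \<mu> (avg L f) \<le> sqi \<mu> (avg L h) + norm (avg L h - avg L f) * (norm (avg L h) + norm (avg L f))"
        using sqi_diff_le[OF p, of "avg L h" "avg L f"] by linarith
      also have "\<dots> \<le> sqi \<mu> h + (2 * real N * c + 2 * real K * c) / real L * (c + c)"
        using nd norm_avg_le[of L f] order_trans[OF norm_avg_le nh]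
        by (intro add_mono mult_mono sqi_avg_le[OF \<mu> L0]) (auto simp: c_def)
      also have "\<dots> = sqi \<mu> h + S / real L" by (simp add: S_def)
      finally show ?thesis using d_le[OF L0] SL by linarith
    qed
    then have dh: "d \<le> sqi \<mu> h" by (rule field_le_epsilon)
    have "mulf (avg N f - avg K f) (avg N f - avg K f) = 2 *\<^sub>R mulf (avg N f) (avg N f) + 2 *\<^sub>R mulf (avg K f) (avg K f) - 4 *\<^sub>R mulf h h"
      by (rule bcontfun_eqI) (simp add: h_def field_simps)
    then have "sqi \<mu> (avg N f - avg K f) = 2 * sqi \<mu> (avg N f) + 2 * sqi \<mu> (avg K f) - 4 * sqi \<mu> h"
      by (simp add: sqi_def blinfun.add_right blinfun.diff_right blinfun.scaleR_right)
    then show ?thesis using dh close[OF NK(1)] close[OF NK(2)] by linarith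
  qed
  with N0(1) show ?thesis by blast
qed

text \<open>Arithmetic-geometric mean inequality in place of Cauchy-Schwarz. The free parameter d is
  later taken equal to a bound for the L2 norm.\<close>

lemma abs_integral_le_sqi:
  assumes p: "\<mu> \<in> PP" and d: "d > 0"
  shows "(\<integral>x. \<bar>app f x\<bar> \<partial>rep \<mu>) \<le> (sqi \<mu> f / d + d) / 2"
proof -
  note M = repr_measure(1)[OF p]
  interpret prob_space "rep \<mu>" using M by (simp add: borel_prob_def)
  have i1: "integrable (rep \<mu>) (\<lambda>x. \<bar>app f x\<bar>)"
    using borel_prob_integrable_bcontfun[OF M, of f] by simp
  have i2: "integrable (rep \<mu>) (\<lambda>x. app f x * app f x)"
    using borel_prob_integrable_bcontfun[OF M, of "mulf f f"] by simp
  have "(\<integral>x. \<bar>app f x\<bar> \<partial>rep \<mu>) \<le> (\<integral>x. (app f x * app f x / d + d) / 2 \<partial>rep \<mu>)"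
  proof (rule integral_mono[OF i1])
    fix x
    have "0 \<le> (\<bar>app f x\<bar> - d)\<^sup>2" by simp
    then have "2 * d * \<bar>app f x\<bar> \<le> app f x * app f x + d * d"
      by (simp add: power2_eq_square algebra_simps)
    then show "\<bar>app f x\<bar> \<le> (app f x * app f x / d + d) / 2"
      using d by (simp add: field_simps)
  qed (use i2 in auto)
  also have "\<dots> = (sqi \<mu> f / d + d) / 2"
    using i2 by (simp add: sqi_def repr_measure(2)[OF p] prob_space)
  finally show ?thesis .
qed

theorem mean_ergodic:
  assumes \<mu>: "\<mu> \<in> PT"
  obtains F where "F \<in> borel_measurable borel" "\<And>x. F (shift x) = F x" "\<And>x. \<bar>F x\<bar> \<le> norm f"
    "(\<lambda>N. \<integral>x. \<bar>app (avg N f) x - F x\<bar> \<partial>rep \<mu>) \<longlonglongrightarrow> 0"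
proof -
  note p = invariant_prob[OF \<mu>]
  note M = repr_measure(1)[OF p]
  interpret prob_space "rep \<mu>" using M by (simp add: borel_prob_def)
  let ?a = "\<lambda>N. app (avg N f)"
  have abd: "\<bar>?a N x\<bar> \<le> norm f" for N x by (rule order_trans[OF abs_bcontfun_le_norm norm_avg_le])
  have cauchy: "\<exists>N0. \<forall>N\<ge>N0. \<forall>K\<ge>N0. (\<integral>x. \<bar>?a N x - ?a K x\<bar> \<partial>rep \<mu>) < e" if e: "e > 0" for e
  proof -
    obtain N0 where N0: "\<And>N K. N \<ge> N0 \<Longrightarrow> K \<ge> N0 \<Longrightarrow> sqi \<mu> (avg N f - avg K f) < e * e"
      using avg_L2_Cauchy[OF \<mu>, of "e * e" f] e by auto
    have "(\<integral>x. \<bar>?a N x - ?a K x\<bar> \<partial>rep \<mu>) < e" if "N \<ge> N0" "K \<ge> N0" for N K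
    proof -
      have "sqi \<mu> (avg N f - avg K f) / e < e" using N0[OF that] e by (simp add: pos_divide_less_eq)
      then show ?thesis using abs_integral_le_sqi[OF p e, of "avg N f - avg K f"] by simp
    qed
    then show ?thesis by blast
  qed
  have "\<exists>r. strict_mono (r :: nat \<Rightarrow> nat) \<and> (AE x in rep \<mu>. convergent (\<lambda>k. ?a (r k) x))"
  proof (rule L1_Cauchy_AE_convergent[of "rep \<mu>" ?a "norm f", OF M measurable_bcontfun abd])
    show "\<exists>N0. \<forall>N\<ge>N0. \<forall>K\<ge>N0. (\<integral>x. \<bar>?a N x - ?a K x\<bar> \<partial>rep \<mu>) < e" if "e > 0" for e
      by (rule cauchy[OF that])
  qed blast
  then obtain r where r: "strict_mono (r :: nat \<Rightarrow> nat)" "AE x in rep \<mu>. convergent (\<lambda>k. ?a (r k) x)"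
    by (elim exE conjE)
  \<comment> \<open>The averages at x and at \<open>shift x\<close> differ by a null sequence and
    have the same limits, so \<open>lim\<close> returns the same value at both, even when there is
    no convergence. This makes F invariant at every point; clipping makes it bounded at every
    point.\<close>
  define F where "F x = max (- norm f) (min (norm f) (lim (\<lambda>k. ?a (r k) x)))" for x
  have Fm: "F \<in> borel_measurable borel" unfolding F_def by measurable
  have Fb: "\<bar>F x\<bar> \<le> norm f" for x
    unfolding F_def using norm_ge_zero[of f] by linarith
  have Finv: "F (shift x) = F x" for x
  proof -
    have d: "\<bar>?a N (shift x) - ?a N x\<bar> \<le> 2 * norm f / real N" for N
    proof -
      have "(\<Sum>k<N. (comp_shift ^^ k) (comp_shift f)) = (\<Sum>k<N. comp_shift ((comp_shift ^^ k) f))"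
        by (simp add: funpow_swap1)
      then have "app (avg N (comp_shift f)) x = ?a N (shift x)"
        by (simp add: avg_def apply_bcontfun_sum)
      then show ?thesis
        using abs_bcontfun_le_norm[of "avg N (comp_shift f) - avg N f" x] avg_comp_shift_diff[of N f] by simp
    qed
    have d0: "(\<lambda>k. ?a (r k) (shift x) - ?a (r k) x) \<longlonglongrightarrow> 0"
    proof (rule Lim_null_comparison)
      show "\<forall>\<^sub>F k in sequentially. norm (?a (r k) (shift x) - ?a (r k) x) \<le> 2 * norm f / real (r k)"
        using d by (simp add: always_eventually)
      have "(\<lambda>k. 2 * norm f / real k) \<longlonglongrightarrow> 0" by (rule lim_const_over_n)
      from LIMSEQ_subseq_LIMSEQ[OF this r(1)] show "(\<lambda>k. 2 * norm f / real (r k)) \<longlonglongrightarrow> 0" by (simp add: o_def)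
    qed
    have "((\<lambda>k. ?a (r k) (shift x)) \<longlonglongrightarrow> l) \<longleftrightarrow> ((\<lambda>k. ?a (r k) x) \<longlonglongrightarrow> l)" for l
      using tendsto_add[OF d0, of "\<lambda>k. ?a (r k) x" l] tendsto_diff[OF _ d0, of "\<lambda>k. ?a (r k) (shift x)" l] by auto
    then show ?thesis by (simp add: F_def lim_def)
  qed
  have Flim: "AE x in rep \<mu>. (\<lambda>k. ?a (r k) x) \<longlonglongrightarrow> F x"
    using r(2)
  proof eventually_elim
    case (elim x)
    then obtain l where l: "(\<lambda>k. ?a (r k) x) \<longlonglongrightarrow> l" by (auto simp: convergent_def)
    have "\<bar>l\<bar> \<le> norm f" by (rule LIMSEQ_le_const2[OF tendsto_rabs[OF l]]) (use abd in auto)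
    then show ?case using l by (simp add: F_def limI abs_le_iff)
  qed
  have int: "integrable (rep \<mu>) (\<lambda>x. \<bar>?a N x - F x\<bar>)" for N
  proof (rule borel_prob_integrable_bounded[OF M, where B="2 * norm f"])
    show "(\<lambda>x. \<bar>?a N x - F x\<bar>) \<in> borel_measurable borel" using Fm by measurable
    show "\<bar>\<bar>?a N x - F x\<bar>\<bar> \<le> 2 * norm f" for x using abd[of N x] Fb[of x] by simp
  qed
  have sub: "(\<lambda>k. \<integral>x. \<bar>?a (r k) x - F x\<bar> \<partial>rep \<mu>) \<longlonglongrightarrow> (\<integral>x. 0 \<partial>rep \<mu>)"
  proof (rule integral_dominated_convergence[where w="\<lambda>_. 2 * norm f"])
    show "AE x in rep \<mu>. (\<lambda>k. \<bar>?a (r k) x - F x\<bar>) \<longlonglongrightarrow> 0"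
      using Flim by eventually_elim (intro tendsto_rabs_zero LIM_zero)
    show "AE x in rep \<mu>. norm \<bar>?a (r k) x - F x\<bar> \<le> 2 * norm f" for k
    proof (rule AE_I2)
      fix x show "norm \<bar>?a (r k) x - F x\<bar> \<le> 2 * norm f" using abd[of "r k" x] Fb[of x] by simp
    qed
  qed (use int[THEN borel_measurable_integrable] in auto)
  have "(\<lambda>N. \<integral>x. \<bar>?a N x - F x\<bar> \<partial>rep \<mu>) \<longlonglongrightarrow> 0"
  proof (rule LIMSEQ_I)
    fix e :: real assume e: "e > 0"
    obtain N0 where N0: "\<And>N K. N \<ge> N0 \<Longrightarrow> K \<ge> N0 \<Longrightarrow> (\<integral>x. \<bar>?a N x - ?a K x\<bar> \<partial>rep \<mu>) < e / 2"
      using cauchy[of "e/2"] e by auto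
    obtain k0 where k0: "\<And>k. k \<ge> k0 \<Longrightarrow> (\<integral>x. \<bar>?a (r k) x - F x\<bar> \<partial>rep \<mu>) < e / 2"
      using LIMSEQ_D[OF sub, of "e/2"] e by fastforce
    define k where "k = max k0 N0"
    have rk: "r k \<ge> N0" using seq_suble[OF r(1), of k] by (simp add: k_def)
    have "norm ((\<integral>x. \<bar>?a N x - F x\<bar> \<partial>rep \<mu>) - 0) < e" if N: "N \<ge> N0" for N
    proof -
      have i3: "integrable (rep \<mu>) (\<lambda>x. \<bar>?a N x - ?a (r k) x\<bar>)"
        using borel_prob_integrable_bcontfun[OF M, of "avg N f - avg (r k) f"] by auto
      have "(\<integral>x. \<bar>?a N x - F x\<bar> \<partial>rep \<mu>) \<le> (\<integral>x. \<bar>?a N x - ?a (r k) x\<bar> + \<bar>?a (r k) x - F x\<bar> \<partial>rep \<mu>)"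
        using int i3 by (intro integral_mono) auto
      also have "\<dots> = (\<integral>x. \<bar>?a N x - ?a (r k) x\<bar> \<partial>rep \<mu>) + (\<integral>x. \<bar>?a (r k) x - F x\<bar> \<partial>rep \<mu>)"
        using int i3 by (intro Bochner_Integration.integral_add)
      also have "\<dots> < e / 2 + e / 2" by (intro add_strict_mono N0 N rk k0) (simp add: k_def)
      finally show ?thesis by simp
    qed
    then show "\<exists>N0. \<forall>N\<ge>N0. norm ((\<integral>x. \<bar>?a N x - F x\<bar> \<partial>rep \<mu>) - 0) < e" by blast
  qed
  with Fm Finv Fb show thesis by (rule that)
qed

end

section \<open>The weak* Borel structure of the invariant measures\<close>

lemma LIMSEQ_fun_iff:
  fixes x :: "nat \<Rightarrow> nat \<Rightarrow> real"
  shows "x \<longlonglongrightarrow> l \<longleftrightarrow> (\<forall>i. (\<lambda>n. x n i) \<longlonglongrightarrow> l i)"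
proof -
  have "limitin (product_topology (\<lambda>_. euclidean) UNIV) x l sequentially \<longleftrightarrow> (\<forall>i. (\<lambda>n. x n i) \<longlonglongrightarrow> l i)"
    by (auto simp: limitin_componentwise PiE_UNIV_domain)
  then show ?thesis by (simp add: euclidean_product_topology)
qed

definition inv_borel :: "'a::metric_space CSigma_dual measure"
  where "inv_borel = borel_of_topology (subtopology weak_star PT)"

lemma topspace_inv: "topspace (subtopology weak_star PT) = (PT :: 'a::metric_space CSigma_dual set)"
  by (simp add: strong_operator_topology_topspace)

lemma inv_openin_subset: "{U. openin (subtopology weak_star PT) U} \<subseteq> Pow (PT :: 'a::metric_space CSigma_dual set)"
  using openin_subset[of "subtopology weak_star PT"] unfolding topspace_inv by blast

lemma space_inv_borel: "space (inv_borel :: 'a::metric_space CSigma_dual measure) = PT"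
  unfolding inv_borel_def borel_of_topology_def topspace_inv by (rule space_measure_of[OF inv_openin_subset])

lemma sets_inv_borel: "sets (inv_borel :: 'a::metric_space CSigma_dual measure) =
    sigma_sets PT {U. openin (subtopology weak_star PT) U}"
  unfolding inv_borel_def borel_of_topology_def topspace_inv by (rule sets_measure_of[OF inv_openin_subset])

lemma openin_inv_measurable:
  "openin (subtopology weak_star PT) U \<Longrightarrow> U \<in> sets (inv_borel :: 'a::metric_space CSigma_dual measure)"
  unfolding sets_inv_borel by (rule sigma_sets.Basic) simp

lemma measurable_eval [measurable]:
  "(\<lambda>\<nu>. pr \<nu> f) \<in> borel_measurable (inv_borel :: 'a::metric_space CSigma_dual measure)"
proof (rule borel_measurableI)
  fix S :: "real set" assume S: "open S"
  have "openin weak_star {\<nu> \<in> topspace weak_star. pr \<nu> f \<in> S}"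
    by (rule openin_continuous_map_preimage[OF strong_operator_topology_continuous_evaluation]) (simp add: S)
  then have "openin (subtopology weak_star PT) ({\<nu> \<in> topspace weak_star. pr \<nu> f \<in> S} \<inter> PT)"
    unfolding openin_subtopology by blast
  moreover have "{\<nu> \<in> topspace weak_star. pr \<nu> f \<in> S} \<inter> PT = (\<lambda>\<nu>. pr \<nu> f) -` S \<inter> space (inv_borel :: 'a CSigma_dual measure)"
    by (auto simp: space_inv_borel strong_operator_topology_topspace)
  ultimately show "(\<lambda>\<nu>. pr \<nu> f) -` S \<inter> space inv_borel \<in> sets (inv_borel :: 'a CSigma_dual measure)"
    using openin_inv_measurable by metis
qed

context symbolic_space
begin

text \<open>Embeds the probability functionals into the real sequences. Convergence of coordinates
  is weak* convergence there, and the image of the invariant functionals is compact.\<close>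

definition coords :: "'a CSigma_dual \<Rightarrow> nat \<Rightarrow> real"
  where "coords \<nu> j = pr \<nu> (dense_fn j)"

lemma coords_inj:
  assumes "\<mu> \<in> PP" "\<nu> \<in> PP" "coords \<mu> = coords \<nu>"
  shows "\<mu> = \<nu>"
proof (rule prob_eq_of_dense[OF assms(1,2)])
  fix f and e :: real assume "e > 0"
  then obtain j where "norm (f - dense_fn j) < e" using dense_fn by blast
  moreover have "pr \<mu> (dense_fn j) = pr \<nu> (dense_fn j)"
    using fun_cong[OF assms(3), of j] by (simp add: coords_def)
  ultimately show "\<exists>g. pr \<mu> g = pr \<nu> g \<and> norm (f - g) < e" by blast
qed

lemma wlim_coords_iff:
  assumes "\<And>n. u n \<in> PP"
  shows "wlim u \<mu> \<longleftrightarrow> (\<lambda>n. coords (u n)) \<longlonglongrightarrow> coords \<mu>"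
proof
  show "wlim u \<mu> \<Longrightarrow> (\<lambda>n. coords (u n)) \<longlonglongrightarrow> coords \<mu>" by (simp add: LIMSEQ_fun_iff coords_def wlim_def)
  assume "(\<lambda>n. coords (u n)) \<longlonglongrightarrow> coords \<mu>"
  then show "wlim u \<mu>" by (intro wlim_dense assms) (simp add: LIMSEQ_fun_iff coords_def)
qed

lemma measurable_coords [measurable]: "coords \<in> borel_measurable inv_borel"
  by (rule measurable_coordinatewise_then_product) (simp add: coords_def measurable_eval)

lemma closed_coords_image:
  fixes C :: "'a CSigma_dual set"
  assumes C: "C \<subseteq> PT"
    and cl: "\<And>u \<nu>. (\<And>n. u n \<in> C) \<Longrightarrow> \<nu> \<in> PT \<Longrightarrow> wlim u \<nu> \<Longrightarrow> \<nu> \<in> C"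
  shows "closed (coords ` C)"
  unfolding closed_sequential_limits
proof (intro allI impI)
  fix x l assume x: "(\<forall>n. x n \<in> coords ` C) \<and> x \<longlonglongrightarrow> l"
  then have "\<forall>n. \<exists>\<nu>\<in>C. x n = coords \<nu>" by auto
  then obtain u where u: "\<And>n. u n \<in> C" "\<And>n. x n = coords (u n)" by metis
  have uI: "u n \<in> PT" for n using u(1) C by auto
  obtain r \<nu> where r: "strict_mono (r :: nat \<Rightarrow> nat)" "\<nu> \<in> PT" "wlim (\<lambda>n. u (r n)) \<nu>"
    using that by (rule invariant_seq_compact[OF uI])
  have "\<nu> \<in> C" by (rule cl[OF _ r(2,3)]) (rule u(1))
  moreover have "(\<lambda>n. coords (u (r n))) \<longlonglongrightarrow> coords \<nu>"
    using r(3) by (subst (asm) wlim_coords_iff) (rule invariant_prob[OF uI])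
  moreover have "(\<lambda>n. coords (u (r n))) \<longlonglongrightarrow> l"
    using LIMSEQ_subseq_LIMSEQ[OF conjunct2[OF x] r(1)] by (simp add: o_def u(2))
  ultimately show "l \<in> coords ` C" using LIMSEQ_unique by blast
qed

lemma closed_coords_invariant: "closed (coords ` PT)"
  by (rule closed_coords_image) auto

lemma coords_box: "\<nu> \<in> PP \<Longrightarrow> coords \<nu> \<in> PiE UNIV (\<lambda>j. {- norm (dense_fn j)..norm (dense_fn j)})"
  using prob_abs_le[of \<nu>] by (auto simp: PiE_UNIV_domain coords_def abs_le_iff minus_le_iff)

lemma compact_coords_box: "compact (PiE UNIV (\<lambda>j. {- norm (dense_fn j)..norm (dense_fn j)}))"
  by (intro compact_PiE_UNIV compact_Icc)

lemma compact_coords_image: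
  fixes C :: "'a CSigma_dual set"
  assumes C: "C \<subseteq> PT"
    and cl: "\<And>u \<nu>. (\<And>n. u n \<in> C) \<Longrightarrow> \<nu> \<in> PT \<Longrightarrow> wlim u \<nu> \<Longrightarrow> \<nu> \<in> C"
  shows "compact (coords ` C)"
proof -
  have "closed (coords ` C)" using assms by (rule closed_coords_image)
  moreover have "coords ` C \<subseteq> PiE UNIV (\<lambda>j. {- norm (dense_fn j)..norm (dense_fn j)})"
  proof
    fix x assume "x \<in> coords ` C"
    then obtain \<nu> where \<nu>: "\<nu> \<in> C" "x = coords \<nu>" by blast
    show "x \<in> PiE UNIV (\<lambda>j. {- norm (dense_fn j)..norm (dense_fn j)})"
      unfolding \<nu>(2) by (rule coords_box[OF invariant_prob]) (use \<nu> C in auto)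
  qed
  ultimately show ?thesis using compact_Int_closed[OF compact_coords_box, of "coords ` C"] by (simp only: Int_absorb1)
qed

lemma inv_preimage_eq:
  fixes C :: "'a CSigma_dual set"
  assumes "C \<subseteq> PT"
  shows "{\<nu> \<in> PT. coords \<nu> \<in> coords ` C} = C"
  using assms coords_inj[OF invariant_prob invariant_prob] by blast

lemma seq_closed_measurable:
  fixes C :: "'a CSigma_dual set"
  assumes C: "C \<subseteq> PT"
    and cl: "\<And>u \<nu>. (\<And>n. u n \<in> C) \<Longrightarrow> \<nu> \<in> PT \<Longrightarrow> wlim u \<nu> \<Longrightarrow> \<nu> \<in> C"
  shows "C \<in> sets inv_borel"
proof -
  have "closed (coords ` C)" using assms by (rule closed_coords_image)
  then have "coords -` (coords ` C) \<inter> space inv_borel \<in> sets inv_borel"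
    by (intro measurable_sets[OF measurable_coords]) simp
  moreover have "coords -` (coords ` C) \<inter> space inv_borel = C"
    using inv_preimage_eq[OF C] by (auto simp: space_inv_borel)
  ultimately show ?thesis by simp
qed

text \<open>By weak* compactness the image of a relatively closed set is closed among the sequences,
  so open sets, and with them all Borel sets, are preimages under \<open>coords\<close>.
  Measurability into \<open>inv_borel\<close> and equality of measures on it can then be decided on
  sequences.\<close>

lemma sets_inv_borel_coords:
  fixes S :: "'a CSigma_dual set"
  assumes "S \<in> sets inv_borel"
  shows "\<exists>B\<in>sets borel. S = {\<nu> \<in> PT. coords \<nu> \<in> B}"
  using assms unfolding sets_inv_borel
proof (induction rule: sigma_sets.induct)
  case (Basic U)
  then obtain W where W: "openin weak_star W" "U = W \<inter> PT"
    by (auto simp: openin_subtopology)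
  let ?C = "PT - U"
  have "closed (coords ` ?C)"
  proof (rule closed_coords_image)
    fix u :: "nat \<Rightarrow> 'a CSigma_dual" and \<nu>
    assume u: "\<And>n. u n \<in> ?C" and \<nu>: "\<nu> \<in> PT" "wlim u \<nu>"
    have "\<nu> \<notin> U"
    proof
      assume "\<nu> \<in> U"
      then have "\<nu> \<in> W" using W by simp
      with \<nu>(2) W(1) have "eventually (\<lambda>n. u n \<in> W) sequentially"
        unfolding limitin_weak_star_iff[symmetric] limitin_def by blast
      then obtain n where "u n \<in> W" by (auto simp: eventually_sequentially)
      with u[of n] W show False by auto
    qed
    with \<nu> show "\<nu> \<in> ?C" by simp
  qed auto
  moreover have "U = {\<nu> \<in> PT. coords \<nu> \<in> - (coords ` ?C)}"
    using inv_preimage_eq[of ?C] W by auto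
  ultimately show ?case by (intro bexI[of _ "- (coords ` ?C)"]) (auto simp: borel_closed borel_comp)
next
  case Empty
  then show ?case by (intro bexI[of _ "{}"]) auto
next
  case (Compl S)
  then obtain B where "B \<in> sets borel" "S = {\<nu> \<in> PT. coords \<nu> \<in> B}" by blast
  then show ?case by (intro bexI[of _ "- B"]) (auto simp: borel_comp)
next
  case (Union S)
  have "\<forall>i. \<exists>B. B \<in> sets borel \<and> S i = {\<nu> \<in> PT. coords \<nu> \<in> B}"
    using Union.IH unfolding Bex_def by (rule allI)
  from choice[OF this] obtain B where B: "\<forall>i. B i \<in> sets borel \<and> S i = {\<nu> \<in> PT. coords \<nu> \<in> B i}"
    by (rule exE)
  show ?case
  proof (rule bexI[of _ "\<Union>i. B i"])
    show "(\<Union>i. B i) \<in> sets borel" using B by (intro sets.countable_UN) auto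
    show "(\<Union>i. S i) = {\<nu> \<in> PT. coords \<nu> \<in> (\<Union>i. B i)}" using B by auto
  qed
qed

lemma measurable_into_inv_borel:
  fixes f :: "'b \<Rightarrow> 'a CSigma_dual"
  assumes f: "\<And>x. x \<in> space N \<Longrightarrow> f x \<in> PT"
    and m: "(\<lambda>x. coords (f x)) \<in> borel_measurable N"
  shows "f \<in> N \<rightarrow>\<^sub>M inv_borel"
proof (rule measurableI)
  show "f x \<in> space inv_borel" if "x \<in> space N" for x using f[OF that] by (simp add: space_inv_borel)
  fix S :: "'a CSigma_dual set" assume "S \<in> sets inv_borel"
  then obtain B where B: "B \<in> sets borel" "S = {\<nu> \<in> PT. coords \<nu> \<in> B}"
    using sets_inv_borel_coords by blast
  then have "f -` S \<inter> space N = (\<lambda>x. coords (f x)) -` B \<inter> space N" using f by auto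
  then show "f -` S \<inter> space N \<in> sets N" using measurable_sets[OF m B(1)] by simp
qed

lemma seq_continuous_measurable:
  fixes g :: "'a CSigma_dual \<Rightarrow> real"
  assumes g: "\<And>u \<nu>. (\<And>n. u n \<in> PT) \<Longrightarrow> \<nu> \<in> PT \<Longrightarrow> wlim u \<nu> \<Longrightarrow> (\<lambda>n. g (u n)) \<longlonglongrightarrow> g \<nu>"
  shows "g \<in> borel_measurable inv_borel"
  unfolding borel_measurable_iff_le
proof (intro allI)
  fix a
  have "{\<nu> \<in> PT. g \<nu> \<le> a} \<in> sets inv_borel"
  proof (rule seq_closed_measurable)
    fix u :: "nat \<Rightarrow> 'a CSigma_dual" and \<nu>
    assume u: "\<And>n. u n \<in> {\<nu> \<in> PT. g \<nu> \<le> a}" and \<nu>: "\<nu> \<in> PT" "wlim u \<nu>"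
    have "(\<lambda>n. g (u n)) \<longlonglongrightarrow> g \<nu>" by (rule g[OF _ \<nu>]) (use u in auto)
    then have "g \<nu> \<le> a" by (rule LIMSEQ_le_const2) (use u in auto)
    with \<nu> show "\<nu> \<in> {\<nu> \<in> PT. g \<nu> \<le> a}" by simp
  qed auto
  then show "{w \<in> space inv_borel. g w \<le> a} \<in> sets inv_borel" by (simp add: space_inv_borel)
qed

section \<open>Invariant sets, ergodic limits and measurability of ergodicity\<close>

definition inv_set :: "(nat \<Rightarrow> 'a) set \<Rightarrow> bool"
  where "inv_set A \<longleftrightarrow> A \<in> sets borel \<and> shift -` A = A"

lemma integral_inv_set_avg:
  assumes \<mu>: "\<mu> \<in> PT" and A: "inv_set A" and N: "N > 0"
  shows "(\<integral>x. indicator A x * app (avg N f) x \<partial>rep \<mu>) = (\<integral>x. indicator A x * app f x \<partial>rep \<mu>)"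
proof -
  note M = repr_measure(1)[OF invariant_prob[OF \<mu>]]
  have Ab: "A \<in> sets borel" and Ai: "shift -` A = A" using A by (auto simp: inv_set_def)
  have i: "integrable (rep \<mu>) (\<lambda>x. indicator A x * app f ((shift ^^ k) x))" for k
    using integrable_indicator_bcontfun[OF M Ab, of "(comp_shift ^^ k) f"] by (simp add: apply_comp_shift_pow)
  have "(\<integral>x. indicator A x * app f ((shift ^^ k) x) \<partial>rep \<mu>) = (\<integral>x. indicator A x * app f x \<partial>rep \<mu>)" for k
    using invariant_integral[OF \<mu>, of "\<lambda>x. indicator A x * app f x" k] Ab
    by (simp add: indicator_invariant_pow[OF Ai])
  moreover have "(\<integral>x. indicator A x * app (avg N f) x \<partial>rep \<mu>) =
    (\<integral>x. inverse (real N) * (\<Sum>k<N. indicator A x * app f ((shift ^^ k) x)) \<partial>rep \<mu>)"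
  proof (rule Bochner_Integration.integral_cong[OF refl])
    show "indicator A x * app (avg N f) x = inverse (real N) * (\<Sum>k<N. indicator A x * app f ((shift ^^ k) x))" for x
      unfolding apply_avg sum_distrib_left[symmetric] by (rule mult.left_commute)
  qed
  ultimately show ?thesis using N
    by (simp only: integral_mult_right_zero Bochner_Integration.integral_sum[OF i]) simp
qed

text \<open>A version of the conditional expectation of f given the invariant sets, chosen invariant
  and bounded at every point and not only almost everywhere.\<close>

definition erg_lim :: "'a CSigma_dual \<Rightarrow> 'a CSigma \<Rightarrow> (nat \<Rightarrow> 'a) \<Rightarrow> real"
  where "erg_lim \<mu> f = (SOME F. F \<in> borel_measurable borel \<and> (\<forall>x. F (shift x) = F x) \<and> (\<forall>x. \<bar>F x\<bar> \<le> norm f) \<and>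
    (\<lambda>N. \<integral>x. \<bar>app (avg N f) x - F x\<bar> \<partial>rep \<mu>) \<longlonglongrightarrow> 0)"

lemma erg_lim:
  assumes "\<mu> \<in> PT"
  shows "erg_lim \<mu> f \<in> borel_measurable borel" "erg_lim \<mu> f (shift x) = erg_lim \<mu> f x" "\<bar>erg_lim \<mu> f x\<bar> \<le> norm f"
    "(\<lambda>N. \<integral>x. \<bar>app (avg N f) x - erg_lim \<mu> f x\<bar> \<partial>rep \<mu>) \<longlonglongrightarrow> 0"
proof -
  have "\<exists>F. F \<in> borel_measurable borel \<and> (\<forall>x. F (shift x) = F x) \<and> (\<forall>x. \<bar>F x\<bar> \<le> norm f) \<and>
    (\<lambda>N. \<integral>x. \<bar>app (avg N f) x - F x\<bar> \<partial>rep \<mu>) \<longlonglongrightarrow> 0"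
    by (rule mean_ergodic[OF assms, of f]) blast
  from someI_ex[OF this, folded erg_lim_def]
  show "erg_lim \<mu> f \<in> borel_measurable borel" "erg_lim \<mu> f (shift x) = erg_lim \<mu> f x" "\<bar>erg_lim \<mu> f x\<bar> \<le> norm f"
    "(\<lambda>N. \<integral>x. \<bar>app (avg N f) x - erg_lim \<mu> f x\<bar> \<partial>rep \<mu>) \<longlonglongrightarrow> 0"
    by auto
qed

lemma integral_inv_set_erg_lim:
  assumes \<mu>: "\<mu> \<in> PT" and A: "inv_set A"
  shows "(\<integral>x. indicator A x * app f x \<partial>rep \<mu>) = (\<integral>x. indicator A x * erg_lim \<mu> f x \<partial>rep \<mu>)"
proof -
  note M = repr_measure(1)[OF invariant_prob[OF \<mu>]]
  note F = erg_lim[OF \<mu>, of f]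
  have Ab: "A \<in> sets borel" using A by (auto simp: inv_set_def)
  let ?I = "\<integral>x. indicator A x * app f x \<partial>rep \<mu>"
  let ?J = "\<integral>x. indicator A x * erg_lim \<mu> f x \<partial>rep \<mu>"
  have iF: "integrable (rep \<mu>) (erg_lim \<mu> f)"
    by (rule borel_prob_integrable_bounded[OF M F(1) F(3)])
  have iAF: "integrable (rep \<mu>) (\<lambda>x. indicator A x * erg_lim \<mu> f x)"
  proof (rule borel_prob_integrable_bounded[OF M, where B="norm f"])
    show "(\<lambda>x. indicator A x * erg_lim \<mu> f x) \<in> borel_measurable borel" using Ab F(1) by measurable
    show "\<bar>indicator A x * erg_lim \<mu> f x\<bar> \<le> norm f" for x using F(3)[of x] by (simp add: indicator_def)
  qed
  have bound: "\<bar>?I - ?J\<bar> \<le> (\<integral>x. \<bar>app (avg N f) x - erg_lim \<mu> f x\<bar> \<partial>rep \<mu>)" if N: "N > 0" for N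
  proof -
    have i1: "integrable (rep \<mu>) (\<lambda>x. indicator A x * app (avg N f) x)"
      by (rule integrable_indicator_bcontfun[OF M Ab])
    have "?I - ?J = (\<integral>x. indicator A x * app (avg N f) x - indicator A x * erg_lim \<mu> f x \<partial>rep \<mu>)"
      using i1 iAF by (simp add: integral_inv_set_avg[OF \<mu> A N])
    also have "\<bar>\<dots>\<bar> \<le> (\<integral>x. \<bar>indicator A x * app (avg N f) x - indicator A x * erg_lim \<mu> f x\<bar> \<partial>rep \<mu>)"
      by (rule integral_abs_bound)
    also have "\<dots> \<le> (\<integral>x. \<bar>app (avg N f) x - erg_lim \<mu> f x\<bar> \<partial>rep \<mu>)"
      using i1 iAF iF borel_prob_integrable_bcontfun[OF M, of "avg N f"]
      by (intro integral_mono) (auto simp: indicator_def)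
    finally show ?thesis .
  qed
  have "\<bar>?I - ?J\<bar> \<le> 0"
    by (rule LIMSEQ_le_const[OF F(4)]) (use bound in \<open>auto intro!: exI[of _ 1]\<close>)
  then show ?thesis by simp
qed

text \<open>The variance of the N-th ergodic average, for invariant measures and N > 0. In this
  expanded form it is a polynomial in evaluations and therefore measurable in the measure.\<close>

definition var_avg :: "nat \<Rightarrow> nat \<Rightarrow> 'a CSigma_dual \<Rightarrow> real"
  where "var_avg N j \<nu> = sqi \<nu> (avg N (dense_fn j)) - (pr \<nu> (dense_fn j))\<^sup>2"

lemma var_avg_eq:
  assumes \<nu>: "\<nu> \<in> PT" and N: "N > 0"
  shows "var_avg N j \<nu> = sqi \<nu> (avg N (dense_fn j) - cst (pr \<nu> (dense_fn j)))"
proof -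
  let ?c = "pr \<nu> (dense_fn j)" and ?f = "avg N (dense_fn j)"
  have "mulf (?f - cst ?c) (?f - cst ?c) = mulf ?f ?f - (2 * ?c) *\<^sub>R ?f + cst (?c\<^sup>2)"
    by (rule bcontfun_eqI) (simp add: const_bcontfun.rep_eq power2_eq_square algebra_simps)
  then have "sqi \<nu> (?f - cst ?c) = sqi \<nu> ?f - 2 * ?c * ?c + ?c\<^sup>2"
    unfolding sqi_def
    by (simp add: blinfun.add_right blinfun.diff_right blinfun.scaleR_right invariant_avg[OF \<nu> N] prob_const[OF invariant_prob[OF \<nu>]])
  then show ?thesis by (simp add: var_avg_def power2_eq_square)
qed

lemma var_avg_nonneg: "\<nu> \<in> PT \<Longrightarrow> N > 0 \<Longrightarrow> 0 \<le> var_avg N j \<nu>"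
  by (simp add: var_avg_eq sqi_nonneg invariant_prob)

lemma var_avg_le:
  assumes \<nu>: "\<nu> \<in> PT" and N: "N > 0"
  shows "var_avg N j \<nu> \<le> 2 * norm (dense_fn j) * (\<integral>x. \<bar>app (avg N (dense_fn j)) x - pr \<nu> (dense_fn j)\<bar> \<partial>rep \<nu>)"
proof -
  note p = invariant_prob[OF \<nu>]
  let ?h = "avg N (dense_fn j) - cst (pr \<nu> (dense_fn j))"
  have h: "app ?h x = app (avg N (dense_fn j)) x - pr \<nu> (dense_fn j)" for x
    by (simp add: const_bcontfun.rep_eq)
  have hb: "\<bar>app ?h x\<bar> \<le> 2 * norm (dense_fn j)" for x
    unfolding h using order_trans[OF abs_bcontfun_le_norm norm_avg_le, of N "dense_fn j" x] prob_abs_le[OF p, of "dense_fn j"] by linarith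
  have "sqi \<nu> ?h = (\<integral>x. app (mulf ?h ?h) x \<partial>rep \<nu>)"
    unfolding sqi_def by (rule repr_measure(2)[OF p])
  also have "\<dots> \<le> (\<integral>x. 2 * norm (dense_fn j) * \<bar>app ?h x\<bar> \<partial>rep \<nu>)"
  proof (rule integral_mono)
    show "integrable (rep \<nu>) (app (mulf ?h ?h))"
      by (rule borel_prob_integrable_bcontfun[OF repr_measure(1)[OF p]])
    show "integrable (rep \<nu>) (\<lambda>x. 2 * norm (dense_fn j) * \<bar>app ?h x\<bar>)"
      using borel_prob_integrable_bcontfun[OF repr_measure(1)[OF p], of ?h] by auto
    fix x
    have "app (mulf ?h ?h) x \<le> \<bar>app ?h x\<bar> * \<bar>app ?h x\<bar>" by simp
    also have "\<dots> \<le> 2 * norm (dense_fn j) * \<bar>app ?h x\<bar>" by (intro mult_right_mono hb) auto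
    finally show "app (mulf ?h ?h) x \<le> 2 * norm (dense_fn j) * \<bar>app ?h x\<bar>" .
  qed
  finally show ?thesis by (simp add: var_avg_eq[OF \<nu> N] h)
qed

text \<open>All sublevel sets are invariant and have measure 0 or 1; the constant is the infimum of
  the levels with measure 1.\<close>

lemma invariant_fn_constant:
  fixes F :: "(nat \<Rightarrow> 'a) \<Rightarrow> real"
  assumes \<nu>: "\<nu> \<in> PE"
    and F: "F \<in> borel_measurable borel" "\<And>x. F (shift x) = F x" "\<And>x. \<bar>F x\<bar> \<le> B"
  obtains c where "AE x in rep \<nu>. F x = c"
proof -
  have i: "\<nu> \<in> PT" using \<nu> by (simp add: ergodic_functionals_def)
  note M = repr_measure(1)[OF invariant_prob[OF i]]
  interpret prob_space "rep \<nu>" using M by (simp add: borel_prob_def)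
  define A where "A a = {x. F x \<le> a}" for a :: real
  have Ab: "A a \<in> sets borel" for a using F(1) unfolding A_def borel_measurable_iff_le by simp
  have A01: "prob (A a) = 0 \<or> prob (A a) = 1" for a
  proof -
    have "shift -` A a = A a" by (auto simp: A_def F(2))
    then show ?thesis using \<nu> Ab[of a] by (simp add: ergodic_functionals_def)
  qed
  define S where "S = {a. prob (A a) = 1}"
  have "A B = UNIV" using F(3) by (auto simp: A_def abs_le_iff)
  then have B: "B \<in> S" using prob_space borel_prob_space[OF M] by (simp add: S_def)
  have lower: "- B \<le> a" if "a \<in> S" for a
  proof (rule ccontr)
    assume "\<not> - B \<le> a"
    have "x \<notin> A a" for x using \<open>\<not> - B \<le> a\<close> F(3)[of x] by (auto simp: A_def)
    then have "A a = {}" by blast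
    then show False using that by (simp add: S_def)
  qed
  define c where "c = Inf S"
  have bdd: "bdd_below S" using lower by (rule bdd_belowI)
  have sM: "sets (rep \<nu>) = sets borel" using M by (simp add: borel_prob_def)
  have up: "AE x in rep \<nu>. F x \<le> c + inverse (real (Suc n))" for n
  proof -
    have "Inf S < c + inverse (real (Suc n))" by (simp add: c_def)
    then obtain a where a: "a \<in> S" "a < c + inverse (real (Suc n))"
      using cInf_less_iff[OF _ bdd] B by blast
    have "AE x in rep \<nu>. x \<in> A a"
      using a(1) Ab[of a] by (intro AE_prob_1) (simp add: S_def)
    then show ?thesis by eventually_elim (use a in \<open>auto simp: A_def\<close>)
  qed
  have lo: "AE x in rep \<nu>. c - inverse (real (Suc n)) \<le> F x" for n
  proof -
    have "c - inverse (real (Suc n)) \<notin> S"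
    proof
      assume "c - inverse (real (Suc n)) \<in> S"
      then have "c \<le> c - inverse (real (Suc n))" unfolding c_def by (intro cInf_lower bdd)
      then show False by simp
    qed
    then have "prob (A (c - inverse (real (Suc n)))) = 0" using A01 by (auto simp: S_def)
    then have "emeasure (rep \<nu>) (A (c - inverse (real (Suc n)))) = 0" by (simp add: emeasure_eq_measure)
    then have "A (c - inverse (real (Suc n))) \<in> null_sets (rep \<nu>)"
      using Ab sM by (intro null_setsI) auto
    then have "AE x in rep \<nu>. x \<notin> A (c - inverse (real (Suc n)))" by (rule AE_not_in)
    then show ?thesis by eventually_elim (auto simp: A_def)
  qed
  have "AE x in rep \<nu>. \<forall>n. F x \<le> c + inverse (real (Suc n)) \<and> c - inverse (real (Suc n)) \<le> F x"
    unfolding AE_all_countable using up lo by auto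
  then have "AE x in rep \<nu>. F x = c"
  proof eventually_elim
    case (elim x)
    have "(\<lambda>n. c + inverse (real (Suc n))) \<longlonglongrightarrow> c + 0" "(\<lambda>n. c - inverse (real (Suc n))) \<longlonglongrightarrow> c - 0"
      by (intro tendsto_intros LIMSEQ_inverse_real_of_nat)+
    then show ?case
      using elim LIMSEQ_le_const[of "\<lambda>n. c + inverse (real (Suc n))" c "F x"] LIMSEQ_le_const2[of "\<lambda>n. c - inverse (real (Suc n))" c "F x"]
      by (intro antisym) auto
  qed
  then show thesis by (rule that)
qed

lemma ergodic_avg_L1:
  assumes \<nu>: "\<nu> \<in> PE"
  shows "(\<lambda>N. \<integral>x. \<bar>app (avg N f) x - pr \<nu> f\<bar> \<partial>rep \<nu>) \<longlonglongrightarrow> 0"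
proof -
  have i: "\<nu> \<in> PT" using \<nu> by (simp add: ergodic_functionals_def)
  note p = invariant_prob[OF i]
  note M = repr_measure(1)[OF p]
  interpret prob_space "rep \<nu>" using M by (simp add: borel_prob_def)
  note F = erg_lim[OF i, of f]
  obtain c where c: "AE x in rep \<nu>. erg_lim \<nu> f x = c"
    using that by (rule invariant_fn_constant[OF \<nu> F(1) F(2) F(3)])
  have "inv_set UNIV" by (simp add: inv_set_def)
  from integral_inv_set_erg_lim[OF i this, of f]
  have "pr \<nu> f = (\<integral>x. erg_lim \<nu> f x \<partial>rep \<nu>)" by (simp add: repr_measure(2)[OF p])
  also have "\<dots> = (\<integral>x. c \<partial>rep \<nu>)"
    using c F(1) by (intro integral_cong_AE) (auto simp: borel_prob_measurable[OF M])
  also have "\<dots> = c" by (simp add: prob_space)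
  finally have vc: "pr \<nu> f = c" .
  have "(\<integral>x. \<bar>app (avg N f) x - erg_lim \<nu> f x\<bar> \<partial>rep \<nu>) = (\<integral>x. \<bar>app (avg N f) x - pr \<nu> f\<bar> \<partial>rep \<nu>)" for N
  proof (rule integral_cong_AE)
    show "AE x in rep \<nu>. \<bar>app (avg N f) x - erg_lim \<nu> f x\<bar> = \<bar>app (avg N f) x - pr \<nu> f\<bar>"
      using c by eventually_elim (simp add: vc)
  qed (use F(1) in \<open>simp_all add: borel_prob_measurable[OF M]\<close>)
  then show ?thesis using F(4) by simp
qed

text \<open>Reduces ergodicity to countably many inequalities between measurable quantities, which
  makes the set of ergodic functionals Borel. For the converse, small variance decorrelates an
  invariant set from the dense functions, hence from all continuous ones, and the zero-one law
  follows.\<close>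

lemma ergodic_iff_var_avg:
  "\<nu> \<in> PE \<longleftrightarrow> \<nu> \<in> PT \<and> (\<forall>j k. \<exists>N>0. var_avg N j \<nu> < inverse (real (Suc k)))"
proof (intro iffI conjI allI)
  assume \<nu>: "\<nu> \<in> PE"
  then show i: "\<nu> \<in> PT" by (simp add: ergodic_functionals_def)
  fix j k
  have "(\<lambda>N. 2 * norm (dense_fn j) * (\<integral>s. \<bar>app (avg N (dense_fn j)) s - pr \<nu> (dense_fn j)\<bar> \<partial>rep \<nu>)) \<longlonglongrightarrow> 0"
    by (intro tendsto_mult_right_zero ergodic_avg_L1 \<nu>)
  then have "eventually (\<lambda>N. 2 * norm (dense_fn j) * (\<integral>s. \<bar>app (avg N (dense_fn j)) s - pr \<nu> (dense_fn j)\<bar> \<partial>rep \<nu>) < inverse (real (Suc k))) sequentially"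
    by (rule order_tendstoD) simp
  then have "eventually (\<lambda>N. N > 0 \<and> 2 * norm (dense_fn j) * (\<integral>s. \<bar>app (avg N (dense_fn j)) s - pr \<nu> (dense_fn j)\<bar> \<partial>rep \<nu>) < inverse (real (Suc k))) sequentially"
    by (intro eventually_conj eventually_gt_at_top)
  then obtain N where N: "N > 0" "2 * norm (dense_fn j) * (\<integral>s. \<bar>app (avg N (dense_fn j)) s - pr \<nu> (dense_fn j)\<bar> \<partial>rep \<nu>) < inverse (real (Suc k))"
    unfolding eventually_sequentially by blast
  then show "\<exists>N>0. var_avg N j \<nu> < inverse (real (Suc k))"
    using var_avg_le[OF i N(1), of j] by (intro exI[of _ N]) linarith
next
  assume a: "\<nu> \<in> PT \<and> (\<forall>j k. \<exists>N>0. var_avg N j \<nu> < inverse (real (Suc k)))"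
  then have i: "\<nu> \<in> PT" by simp
  note p = invariant_prob[OF i]
  note M = repr_measure(1)[OF p]
  interpret prob_space "rep \<nu>" using M by (simp add: borel_prob_def)
  show "\<nu> \<in> PE"
    unfolding ergodic_functionals_def
  proof (intro CollectI conjI i ballI impI)
    fix A :: "(nat \<Rightarrow> 'a) set" assume Ab: "A \<in> sets borel" and Ai: "shift -` A = A"
    then have A: "inv_set A" by (simp add: inv_set_def)
    have iA: "integrable (rep \<nu>) (\<lambda>x. indicator A x :: real)"
      using Ab M by (auto intro!: integrable_real_indicator simp: borel_prob_def emeasure_eq_measure)
    have dec_dense: "(\<integral>s. indicator A s * app (dense_fn j) s \<partial>rep \<nu>) = prob A * pr \<nu> (dense_fn j)" for j
    proof -
      let ?c = "pr \<nu> (dense_fn j)"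
      have "\<bar>(\<integral>s. indicator A s * app (dense_fn j) s \<partial>rep \<nu>) - prob A * ?c\<bar> \<le> 0 + e" if e: "e > 0" for e
      proof -
        obtain k where k: "inverse (real (Suc k)) < e * e" using reals_Archimedean[of "e * e"] e by auto
        obtain N where N: "N > 0" "var_avg N j \<nu> < e * e" using a k by (meson less_trans)
        let ?h = "avg N (dense_fn j) - cst ?c"
        have h: "app ?h s = app (avg N (dense_fn j)) s - ?c" for s by (simp add: const_bcontfun.rep_eq)
        have ih: "integrable (rep \<nu>) (app ?h)" by (rule borel_prob_integrable_bcontfun[OF M])
        have "(\<integral>s. \<bar>app ?h s\<bar> \<partial>rep \<nu>) \<le> (sqi \<nu> ?h / e + e) / 2" by (rule abs_integral_le_sqi[OF p e])
        moreover have "sqi \<nu> ?h / e < e" using N e by (simp add: var_avg_eq[OF i N(1)] pos_divide_less_eq)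
        ultimately have 1: "(\<integral>s. \<bar>app ?h s\<bar> \<partial>rep \<nu>) \<le> e" by simp
        have i1: "integrable (rep \<nu>) (\<lambda>s. indicator A s * app (avg N (dense_fn j)) s)"
          by (rule integrable_indicator_bcontfun[OF M Ab])
        have "(\<integral>s. indicator A s * app (dense_fn j) s \<partial>rep \<nu>) - prob A * ?c = (\<integral>s. indicator A s * app (avg N (dense_fn j)) s - indicator A s * ?c \<partial>rep \<nu>)"
          using i1 iA Ab by (simp add: integral_inv_set_avg[OF i A N(1)] borel_prob_space[OF M])
        also have "\<bar>\<dots>\<bar> \<le> (\<integral>s. \<bar>indicator A s * app (avg N (dense_fn j)) s - indicator A s * ?c\<bar> \<partial>rep \<nu>)"
          by (rule integral_abs_bound)
        also have "\<dots> \<le> (\<integral>s. \<bar>app ?h s\<bar> \<partial>rep \<nu>)"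
          using i1 iA ih by (intro integral_mono) (auto simp: indicator_def h)
        finally show ?thesis using 1 by simp
      qed
      then have "\<bar>(\<integral>s. indicator A s * app (dense_fn j) s \<partial>rep \<nu>) - prob A * ?c\<bar> \<le> 0" by (rule field_le_epsilon)
      then show ?thesis by simp
    qed
    show "prob A = 0 \<or> prob A = 1"
    proof (rule zero_one_of_decorrelation[OF M Ab])
      fix g :: "'a CSigma"
      have "\<bar>(\<integral>s. indicator A s * app g s \<partial>rep \<nu>) - prob A * pr \<nu> g\<bar> \<le> 0 + e" if e: "e > 0" for e
      proof -
        obtain j where j: "norm (g - dense_fn j) < e / 2" using dense_fn[of "e/2" g] e by auto
        have "\<bar>(\<integral>s. indicator A s * app g s \<partial>rep \<nu>) - (\<integral>s. indicator A s * app (dense_fn j) s \<partial>rep \<nu>)\<bar> \<le> e / 2"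
        proof (rule borel_prob_integral_close[OF M])
          have "\<bar>indicator A s * app g s - indicator A s * app (dense_fn j) s\<bar> \<le> e / 2" for s
            using abs_bcontfun_le_norm[of "g - dense_fn j" s] j e by (auto simp: indicator_def)
          then show "AE s in rep \<nu>. \<bar>indicator A s * app g s - indicator A s * app (dense_fn j) s\<bar> \<le> e / 2" by simp
        qed (intro integrable_indicator_bcontfun[OF M Ab])+
        moreover have "prob A * \<bar>pr \<nu> g - pr \<nu> (dense_fn j)\<bar> \<le> 1 * (e / 2)"
          using prob_close[OF p, of g "dense_fn j"] j by (intro mult_mono) auto
        then have "\<bar>prob A * pr \<nu> g - prob A * pr \<nu> (dense_fn j)\<bar> \<le> e / 2"
          by (simp add: abs_mult flip: right_diff_distrib)
        ultimately show ?thesis using dec_dense[of j] by linarith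
      qed
      then have "\<bar>(\<integral>s. indicator A s * app g s \<partial>rep \<nu>) - prob A * pr \<nu> g\<bar> \<le> 0" by (rule field_le_epsilon)
      then show "(\<integral>s. indicator A s * app g s \<partial>rep \<nu>) = prob A * (\<integral>s. app g s \<partial>rep \<nu>)"
        by (simp add: repr_measure(2)[OF p])
    qed
  qed
qed

lemma ergodic_measurable: "(PE :: 'a CSigma_dual set) \<in> sets inv_borel"
proof -
  have "var_avg N j \<in> borel_measurable inv_borel" for N j
    unfolding var_avg_def sqi_def by measurable
  then have "{\<nu> \<in> space inv_borel. \<forall>j k. \<exists>N\<in>{0<..}. var_avg N j \<nu> < inverse (real (Suc k))} \<in> sets inv_borel"
    by measurable
  also have "{\<nu> \<in> space inv_borel. \<forall>j k. \<exists>N\<in>{0<..}. var_avg N j \<nu> < inverse (real (Suc k))} = PE"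
    unfolding space_inv_borel Bex_def greaterThan_iff using ergodic_iff_var_avg by blast
  finally show ?thesis .
qed

end

section \<open>The ergodic decomposition\<close>

context symbolic_space
begin

lemma conditional_functional:
  assumes \<mu>: "\<mu> \<in> PT" and A: "inv_set A" and pos: "0 < measure (rep \<mu>) A"
  shows "\<exists>\<nu>\<in>PT. \<forall>f. pr \<nu> f =
    (\<integral>x. indicator A x * app f x \<partial>rep \<mu>) / measure (rep \<mu>) A"
proof -
  let ?M = "rep \<mu>"
  note M = repr_measure(1)[OF invariant_prob[OF \<mu>]]
  have Ab: "A \<in> sets borel" and Ai: "shift -` A = A" using A by (auto simp: inv_set_def)
  define \<Lambda> where "\<Lambda> f = (\<integral>x. indicator A x * app f x \<partial>?M) / measure ?M A" for f :: "'a CSigma"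
  note int = integrable_indicator_bcontfun[OF M Ab]
  have "\<exists>\<nu>\<in>PP. \<forall>f. pr \<nu> f = \<Lambda> f"
  proof (rule prob_functional_of_positive)
    show "linear \<Lambda>"
    proof (rule linearI)
      fix f g :: "'a CSigma" and c :: real
      show "\<Lambda> (f + g) = \<Lambda> f + \<Lambda> g"
        using int[of f] int[of g] by (simp add: \<Lambda>_def distrib_left add_divide_distrib)
      show "\<Lambda> (c *\<^sub>R f) = c *\<^sub>R \<Lambda> f"
        by (simp add: \<Lambda>_def mult.left_commute)
    qed
    show "0 \<le> \<Lambda> f" if "\<And>x. 0 \<le> app f x" for f
      unfolding \<Lambda>_def using that by (intro divide_nonneg_nonneg Bochner_Integration.integral_nonneg mult_nonneg_nonneg) auto
    show "\<Lambda> (cst 1) = 1"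
      using pos Ab borel_prob_space[OF M] by (simp add: \<Lambda>_def const_bcontfun.rep_eq)
  qed
  then obtain \<nu> where \<nu>: "\<nu> \<in> PP" "\<And>f. pr \<nu> f = \<Lambda> f" by blast
  have "\<Lambda> (comp_shift f) = \<Lambda> f" for f
    using invariant_integral[OF \<mu>, of "\<lambda>x. indicator A x * app f x" 1] Ab
      indicator_invariant_pow[OF Ai, of 1] by (simp add: \<Lambda>_def)
  then have "\<nu> \<in> PT" by (simp add: invariant_functionals_iff \<nu>)
  with \<nu>(2) show ?thesis by (auto simp: \<Lambda>_def)
qed

definition erg_vec :: "'a CSigma_dual \<Rightarrow> (nat \<Rightarrow> 'a) \<Rightarrow> nat \<Rightarrow> real"
  where "erg_vec \<mu> x j = erg_lim \<mu> (dense_fn j) x"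

lemma erg_vec_shift: "\<mu> \<in> PT \<Longrightarrow> erg_vec \<mu> (shift x) = erg_vec \<mu> x"
  by (simp add: erg_vec_def fun_eq_iff erg_lim(2))

lemma measurable_erg_vec: "\<mu> \<in> PT \<Longrightarrow> erg_vec \<mu> \<in> borel_measurable borel"
  by (rule measurable_coordinatewise_then_product) (simp add: erg_vec_def erg_lim(1))

text \<open>Conditioning \<open>\<mu>\<close> on invariant sets on which finitely many coordinates are nearly constant
  shows that \<open>erg_vec \<mu>\<close> is a limit of coordinates of invariant measures.\<close>

lemma AE_erg_vec:
  assumes \<mu>: "\<mu> \<in> PT"
  shows "AE s in rep \<mu>. erg_vec \<mu> s \<in> coords ` PT"
proof -
  let ?M = "rep \<mu>"
  note M = repr_measure(1)[OF invariant_prob[OF \<mu>]]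
  interpret prob_space ?M using M by (simp add: borel_prob_def)
  have sM: "sets ?M = sets borel" using M by (simp add: borel_prob_def)
  \<comment> \<open>Cells on which the first n coordinates of \<open>erg_vec \<mu>\<close> are
    determined up to 1/(n+1). They are labelled by integer lists, hence countably many, and almost
    every point lies in none of the null ones.\<close>
  define B where "B n c = {y. \<forall>j<n. \<lfloor>real (Suc n) * erg_vec \<mu> y j\<rfloor> = c ! j}" for n and c :: "int list"
  have meas: "(\<lambda>y. erg_vec \<mu> y j) \<in> borel_measurable borel" for j
    using erg_lim(1)[OF \<mu>, of "dense_fn j"] by (simp add: erg_vec_def)
  have Bb: "B n c \<in> sets borel" for n c
  proof -
    have "{y \<in> space borel. \<lfloor>real (Suc n) * erg_vec \<mu> y j\<rfloor> = c ! j} \<in> sets borel" for j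
    proof -
      have "{y \<in> space borel. \<lfloor>real (Suc n) * erg_vec \<mu> y j\<rfloor> = c ! j} =
        {y \<in> space borel. real_of_int (c ! j) \<le> real (Suc n) * erg_vec \<mu> y j \<and> real (Suc n) * erg_vec \<mu> y j < real_of_int (c ! j) + 1}"
        by (auto simp: floor_eq_iff)
      also have "\<dots> \<in> sets borel" using meas[of j] by measurable
      finally show ?thesis .
    qed
    then have "(\<Inter>j\<in>{..<n}. {y \<in> space borel. \<lfloor>real (Suc n) * erg_vec \<mu> y j\<rfloor> = c ! j}) \<inter> space borel \<in> sets borel"
      by (cases "n = 0") (auto intro!: sets.finite_INT sets.Int)
    also have "(\<Inter>j\<in>{..<n}. {y \<in> space borel. \<lfloor>real (Suc n) * erg_vec \<mu> y j\<rfloor> = c ! j}) \<inter> space borel = B n c"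
      by (auto simp: B_def)
    finally show ?thesis .
  qed
  have Binv: "inv_set (B n c)" for n c
  proof -
    have "shift y \<in> B n c \<longleftrightarrow> y \<in> B n c" for y
      by (simp only: B_def mem_Collect_eq erg_vec_shift[OF \<mu>])
    then have "shift -` B n c = B n c" by blast
    with Bb[of n c] show ?thesis unfolding inv_set_def by (rule conjI)
  qed
  have "AE s in ?M. \<forall>n c. prob (B n c) = 0 \<longrightarrow> s \<notin> B n c"
    unfolding AE_all_countable
  proof (intro allI)
    fix n c
    show "AE s in ?M. prob (B n c) = 0 \<longrightarrow> s \<notin> B n c"
    proof (cases "prob (B n c) = 0")
      case True
      then have "B n c \<in> null_sets ?M" using Bb sM by (intro null_setsI) (auto simp: emeasure_eq_measure)
      then have "AE s in ?M. s \<notin> B n c" by (rule AE_not_in)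
      then show ?thesis by eventually_elim simp
    qed simp
  qed
  then show ?thesis
  proof eventually_elim
    case (elim s)
    have ex: "\<exists>\<nu>. \<nu> \<in> PT \<and> (\<forall>j<n. \<bar>coords \<nu> j - erg_vec \<mu> s j\<bar> \<le> inverse (real (Suc n)))" for n
    proof -
      define c where "c = map (\<lambda>j. \<lfloor>real (Suc n) * erg_vec \<mu> s j\<rfloor>) [0..<n]"
      have cj: "c ! j = \<lfloor>real (Suc n) * erg_vec \<mu> s j\<rfloor>" if "j < n" for j using that by (simp add: c_def)
      then have "s \<in> B n c" by (simp add: B_def)
      then have "prob (B n c) \<noteq> 0" using elim by blast
      then have pos: "0 < prob (B n c)" using measure_nonneg[of ?M "B n c"] by linarith
      obtain \<nu> where \<nu>: "\<nu> \<in> PT"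
        "\<And>\<phi>. pr \<nu> \<phi> = (\<integral>s. indicator (B n c) s * app \<phi> s \<partial>?M) / prob (B n c)"
        using conditional_functional[OF \<mu> Binv pos] by blast
      have "\<bar>coords \<nu> j - erg_vec \<mu> s j\<bar> \<le> inverse (real (Suc n))" if j: "j < n" for j
      proof -
        let ?f = "erg_lim \<mu> (dense_fn j)"
        have iB: "integrable ?M (\<lambda>x. indicator (B n c) x :: real)"
          using Bb sM by (auto intro!: integrable_real_indicator simp: emeasure_eq_measure)
        have iBF: "integrable ?M (\<lambda>y. indicator (B n c) y * ?f y)"
        proof (rule borel_prob_integrable_bounded[OF M, where B="norm (dense_fn j)"])
          show "(\<lambda>y. indicator (B n c) y * ?f y) \<in> borel_measurable borel" using Bb[of n c] erg_lim(1)[OF \<mu>] by measurable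
          show "\<bar>indicator (B n c) y * ?f y\<bar> \<le> norm (dense_fn j)" for y using erg_lim(3)[OF \<mu>, of "dense_fn j" y] by (simp add: indicator_def)
        qed
        have mB: "(\<integral>y. indicator (B n c) y \<partial>?M) = prob (B n c)" using Bb borel_prob_space[OF M] by simp
        have "\<bar>(\<integral>y. indicator (B n c) y * ?f y \<partial>?M) - prob (B n c) * ?f s\<bar> = \<bar>\<integral>y. indicator (B n c) y * ?f y - indicator (B n c) y * ?f s \<partial>?M\<bar>"
          using iB iBF mB by simp
        also have "\<dots> \<le> (\<integral>y. \<bar>indicator (B n c) y * ?f y - indicator (B n c) y * ?f s\<bar> \<partial>?M)" by (rule integral_abs_bound)
        also have "\<dots> \<le> (\<integral>y. indicator (B n c) y * inverse (real (Suc n)) \<partial>?M)"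
        proof (rule integral_mono)
          fix y
          show "\<bar>indicator (B n c) y * ?f y - indicator (B n c) y * ?f s\<bar> \<le> indicator (B n c) y * inverse (real (Suc n))"
          proof (cases "y \<in> B n c")
            case True
            then have "\<lfloor>real (Suc n) * ?f y\<rfloor> = \<lfloor>real (Suc n) * ?f s\<rfloor>" using j cj by (auto simp: B_def erg_vec_def)
            then have "\<bar>real (Suc n) * ?f y - real (Suc n) * ?f s\<bar> \<le> 1" by linarith
            then have "real (Suc n) * \<bar>?f y - ?f s\<bar> \<le> 1" by (simp only: right_diff_distrib[symmetric] abs_mult abs_of_nat)
            then have "\<bar>?f y - ?f s\<bar> \<le> inverse (real (Suc n))" by (simp only: inverse_eq_divide pos_le_divide_eq of_nat_0_less_iff zero_less_Suc mult.commute)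
            then show ?thesis using True by simp
          qed simp
        qed (use iB iBF in auto)
        also have "\<dots> = prob (B n c) * inverse (real (Suc n))" using mB iB by simp
        finally have le: "\<bar>(\<integral>y. indicator (B n c) y * ?f y \<partial>?M) - prob (B n c) * ?f s\<bar> \<le> prob (B n c) * inverse (real (Suc n))" .
        have "coords \<nu> j - erg_vec \<mu> s j = ((\<integral>y. indicator (B n c) y * ?f y \<partial>?M) - prob (B n c) * ?f s) / prob (B n c)"
          using pos by (simp add: coords_def erg_vec_def \<nu>(2) integral_inv_set_erg_lim[OF \<mu> Binv] diff_divide_distrib)
        then have "\<bar>coords \<nu> j - erg_vec \<mu> s j\<bar> = \<bar>(\<integral>y. indicator (B n c) y * ?f y \<partial>?M) - prob (B n c) * ?f s\<bar> / prob (B n c)"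
          using pos by (simp add: abs_divide)
        also have "\<dots> \<le> inverse (real (Suc n))" using le pos by (simp only: pos_divide_le_eq mult.commute)
        finally show ?thesis .
      qed
      with \<nu>(1) show ?thesis by blast
    qed
    from choice[OF allI[OF ex]]
    obtain \<nu> where \<nu>': "\<forall>n. \<nu> n \<in> PT \<and> (\<forall>j<n. \<bar>coords (\<nu> n) j - erg_vec \<mu> s j\<bar> \<le> inverse (real (Suc n)))"
      by (rule exE)
    have \<nu>: "\<nu> n \<in> PT" "j < n \<Longrightarrow> \<bar>coords (\<nu> n) j - erg_vec \<mu> s j\<bar> \<le> inverse (real (Suc n))" for n j
      by (rule spec[OF \<nu>', THEN conjunct1], rule spec[OF \<nu>', THEN conjunct2, rule_format])
    have lim: "(\<lambda>n. coords (\<nu> n)) \<longlonglongrightarrow> erg_vec \<mu> s"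
      unfolding LIMSEQ_fun_iff
    proof (rule allI, rule LIM_zero_cancel)
      fix j
      show "(\<lambda>n. coords (\<nu> n) j - erg_vec \<mu> s j) \<longlonglongrightarrow> 0"
      proof (rule Lim_null_comparison[OF _ LIMSEQ_inverse_real_of_nat])
        show "\<forall>\<^sub>F n in sequentially. norm (coords (\<nu> n) j - erg_vec \<mu> s j) \<le> inverse (real (Suc n))"
          using eventually_gt_at_top[of j] by eventually_elim (use \<nu>(2) in auto)
      qed
    qed
    show ?case
      by (rule closed_sequentially[OF closed_coords_invariant imageI[OF \<nu>(1)] lim])
  qed
qed

text \<open>Off the full-measure set of \<open>AE_erg_vec\<close> the value \<open>\<mu>\<close> is
  a default that keeps the map total, shift-invariant and measurable.\<close>

definition erg_comp :: "'a CSigma_dual \<Rightarrow> (nat \<Rightarrow> 'a) \<Rightarrow> 'a CSigma_dual"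
  where "erg_comp \<mu> x = (if erg_vec \<mu> x \<in> coords ` PT
    then SOME \<nu>. \<nu> \<in> PT \<and> coords \<nu> = erg_vec \<mu> x else \<mu>)"

lemma erg_comp:
  assumes \<mu>: "\<mu> \<in> PT"
  shows "erg_comp \<mu> x \<in> PT"
    and "erg_comp \<mu> (shift x) = erg_comp \<mu> x"
    and "coords (erg_comp \<mu> x) = (if erg_vec \<mu> x \<in> coords ` PT then erg_vec \<mu> x else coords \<mu>)"
proof -
  have *: "(SOME \<nu>. \<nu> \<in> PT \<and> coords \<nu> = erg_vec \<mu> x) \<in> PT \<and>
    coords (SOME \<nu>. \<nu> \<in> PT \<and> coords \<nu> = erg_vec \<mu> x) = erg_vec \<mu> x"
    if "erg_vec \<mu> x \<in> coords ` PT"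
    by (rule someI_ex) (use that in auto)
  show "erg_comp \<mu> x \<in> PT"
    and "coords (erg_comp \<mu> x) = (if erg_vec \<mu> x \<in> coords ` PT then erg_vec \<mu> x else coords \<mu>)"
    using * \<mu> by (auto simp: erg_comp_def)
  show "erg_comp \<mu> (shift x) = erg_comp \<mu> x" by (simp add: erg_comp_def erg_vec_shift[OF \<mu>])
qed

lemma measurable_erg_comp:
  assumes \<mu>: "\<mu> \<in> PT"
  shows "erg_comp \<mu> \<in> borel \<rightarrow>\<^sub>M inv_borel"
proof (rule measurable_into_inv_borel)
  show "erg_comp \<mu> x \<in> PT" for x by (rule erg_comp(1)[OF \<mu>])
  have "coords ` PT \<in> sets borel" using closed_coords_invariant by (rule borel_closed)
  then show "(\<lambda>x. coords (erg_comp \<mu> x)) \<in> borel_measurable borel"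
    unfolding erg_comp(3)[OF \<mu>] using measurable_erg_vec[OF \<mu>] by measurable
qed

lemma measurable_erg_comp_eval:
  assumes \<mu>: "\<mu> \<in> PT"
  shows "(\<lambda>x. pr (erg_comp \<mu> x) f) \<in> borel_measurable borel"
  by (rule measurable_compose[OF measurable_erg_comp[OF \<mu>] measurable_eval])

lemma AE_erg_comp_dense:
  assumes \<mu>: "\<mu> \<in> PT"
  shows "AE x in rep \<mu>. \<forall>j. pr (erg_comp \<mu> x) (dense_fn j) = erg_lim \<mu> (dense_fn j) x"
  using AE_erg_vec[OF \<mu>]
proof eventually_elim
  case (elim x)
  then have "coords (erg_comp \<mu> x) = erg_vec \<mu> x" by (simp add: erg_comp(3)[OF \<mu>])
  then show ?case by (simp add: fun_eq_iff coords_def erg_vec_def)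
qed

text \<open>Disintegration over invariant sets. On the dense functions it is the conditional
  expectation property of \<open>erg_lim\<close>; both sides are continuous in f.\<close>

lemma integral_inv_set_erg_comp:
  assumes \<mu>: "\<mu> \<in> PT" and A: "inv_set A"
  shows "(\<integral>x. indicator A x * pr (erg_comp \<mu> x) f \<partial>rep \<mu>) = (\<integral>x. indicator A x * app f x \<partial>rep \<mu>)"
proof -
  let ?M = "rep \<mu>"
  note M = repr_measure(1)[OF invariant_prob[OF \<mu>]]
  have Ab: "A \<in> sets borel" using A by (simp add: inv_set_def)
  have pk: "erg_comp \<mu> x \<in> PP" for x by (rule invariant_prob[OF erg_comp(1)[OF \<mu>]])
  have ik: "integrable ?M (\<lambda>x. indicator A x * pr (erg_comp \<mu> x) f)" for f
  proof (rule borel_prob_integrable_bounded[OF M, where B="norm f"])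
    show "(\<lambda>x. indicator A x * pr (erg_comp \<mu> x) f) \<in> borel_measurable borel"
      using Ab measurable_erg_comp_eval[OF \<mu>] by measurable
    show "\<bar>indicator A x * pr (erg_comp \<mu> x) f\<bar> \<le> norm f" for x
      using prob_abs_le[OF pk, of x f] by (simp add: indicator_def)
  qed
  have dense: "(\<integral>x. indicator A x * pr (erg_comp \<mu> x) (dense_fn j) \<partial>?M) = (\<integral>x. indicator A x * app (dense_fn j) x \<partial>?M)" for j
    unfolding integral_inv_set_erg_lim[OF \<mu> A]
  proof (rule integral_cong_AE)
    show "AE x in ?M. indicator A x * pr (erg_comp \<mu> x) (dense_fn j) = indicator A x * erg_lim \<mu> (dense_fn j) x"
      using AE_erg_comp_dense[OF \<mu>] by eventually_elim simp
    show "(\<lambda>x. indicator A x * erg_lim \<mu> (dense_fn j) x) \<in> borel_measurable ?M"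
      unfolding borel_prob_measurable[OF M] using Ab erg_lim(1)[OF \<mu>] by measurable
  qed (rule borel_measurable_integrable[OF ik])
  have "\<bar>(\<integral>x. indicator A x * pr (erg_comp \<mu> x) f \<partial>?M) - (\<integral>x. indicator A x * app f x \<partial>?M)\<bar> \<le> 0 + e" if e: "e > 0" for e
  proof -
    obtain j where j: "norm (f - dense_fn j) < e / 2" using dense_fn[of "e/2" f] e by auto
    have "\<bar>(\<integral>x. indicator A x * pr (erg_comp \<mu> x) f \<partial>?M) - (\<integral>x. indicator A x * pr (erg_comp \<mu> x) (dense_fn j) \<partial>?M)\<bar> \<le> e / 2"
    proof (rule borel_prob_integral_close[OF M ik ik])
      have "\<bar>indicator A x * pr (erg_comp \<mu> x) f - indicator A x * pr (erg_comp \<mu> x) (dense_fn j)\<bar> \<le> e / 2" for x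
        using prob_close[OF pk, of x f "dense_fn j"] j e by (auto simp: indicator_def)
      then show "AE x in ?M. \<bar>indicator A x * pr (erg_comp \<mu> x) f - indicator A x * pr (erg_comp \<mu> x) (dense_fn j)\<bar> \<le> e / 2" by simp
    qed
    moreover have "\<bar>(\<integral>x. indicator A x * app f x \<partial>?M) - (\<integral>x. indicator A x * app (dense_fn j) x \<partial>?M)\<bar> \<le> e / 2"
    proof (rule borel_prob_integral_close[OF M])
      have "\<bar>indicator A x * app f x - indicator A x * app (dense_fn j) x\<bar> \<le> e / 2" for x
        using abs_bcontfun_le_norm[of "f - dense_fn j" x] j e by (auto simp: indicator_def)
      then show "AE x in ?M. \<bar>indicator A x * app f x - indicator A x * app (dense_fn j) x\<bar> \<le> e / 2" by simp
    qed (intro integrable_indicator_bcontfun[OF M Ab])+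
    ultimately show ?thesis using dense[of j] by linarith
  qed
  then have "\<bar>(\<integral>x. indicator A x * pr (erg_comp \<mu> x) f \<partial>?M) - (\<integral>x. indicator A x * app f x \<partial>?M)\<bar> \<le> 0" by (rule field_le_epsilon)
  then show ?thesis by simp
qed

lemma integral_erg_comp:
  assumes \<mu>: "\<mu> \<in> PT"
  shows "(\<integral>x. pr (erg_comp \<mu> x) f \<partial>rep \<mu>) = pr \<mu> f"
  using integral_inv_set_erg_comp[OF \<mu>, of UNIV f]
  by (simp add: inv_set_def repr_measure(2)[OF invariant_prob[OF \<mu>]])

text \<open>Integrated over x, the variance of the N-th average under
  \<open>erg_comp \<mu> x\<close> equals the \<mu>-integral of the squared average minus the squared
  ergodic limit, which tends to 0. So the points at which the variance stays above a fixed
  \<open>\<delta>\<close> for all N form a null set.\<close>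

lemma AE_erg_comp_ergodic:
  assumes \<mu>: "\<mu> \<in> PT"
  shows "AE x in rep \<mu>. erg_comp \<mu> x \<in> PE"
proof -
  let ?M = "rep \<mu>"
  note p = invariant_prob[OF \<mu>]
  note M = repr_measure(1)[OF p]
  interpret prob_space ?M using M by (simp add: borel_prob_def)
  have sM: "sets ?M = sets borel" and sp: "space ?M = UNIV"
    using M borel_prob_space by (auto simp: borel_prob_def)
  note k = erg_comp(1)[OF \<mu>]
  have vm: "(\<lambda>x. var_avg N j (erg_comp \<mu> x)) \<in> borel_measurable borel" for N j
    unfolding var_avg_def sqi_def using measurable_erg_comp_eval[OF \<mu>] by measurable
  have "AE x in ?M. \<exists>N>0. var_avg N j (erg_comp \<mu> x) < inverse (real (Suc l))" for j l
  proof -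
    define \<delta> where "\<delta> = inverse (real (Suc l))"
    have \<delta>: "\<delta> > 0" by (simp add: \<delta>_def)
    define E where "E = {x \<in> space borel. \<forall>N\<in>{0<..}. \<delta> \<le> var_avg N j (erg_comp \<mu> x)}"
    have Eb: "E \<in> sets borel" unfolding E_def using vm by measurable
    let ?q = "dense_fn j" let ?F = "erg_lim \<mu> (dense_fn j)"
    note F = erg_lim[OF \<mu>, of "dense_fn j"]
    have bound: "\<delta> * prob E \<le> 2 * norm ?q * (\<integral>x. \<bar>app (avg N ?q) x - ?F x\<bar> \<partial>?M)" if N: "N > 0" for N
    proof -
      let ?a = "avg N ?q"
      have ab: "\<bar>app ?a x\<bar> \<le> norm ?q" for x by (rule order_trans[OF abs_bcontfun_le_norm norm_avg_le])
      have iF2: "integrable ?M (\<lambda>x. (?F x)\<^sup>2)"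
      proof (rule borel_prob_integrable_bounded[OF M, where B="(norm ?q)\<^sup>2"])
        show "\<bar>(?F x)\<^sup>2\<bar> \<le> (norm ?q)\<^sup>2" for x using F(3)[of x] by (simp add: abs_le_square_iff[symmetric])
      qed (use F(1) in measurable)
      have ia2: "integrable ?M (app (mulf ?a ?a))" by (rule borel_prob_integrable_bcontfun[OF M])
      have ik2: "integrable ?M (\<lambda>x. pr (erg_comp \<mu> x) (mulf ?a ?a))"
        by (rule borel_prob_integrable_bounded[OF M measurable_erg_comp_eval[OF \<mu>] prob_abs_le[OF invariant_prob[OF k]]])
      have veq: "AE x in ?M. var_avg N j (erg_comp \<mu> x) = pr (erg_comp \<mu> x) (mulf ?a ?a) - (?F x)\<^sup>2"
        using AE_erg_comp_dense[OF \<mu>] by eventually_elim (simp add: var_avg_def sqi_def)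
      have iv: "integrable ?M (\<lambda>x. var_avg N j (erg_comp \<mu> x))"
        using Bochner_Integration.integrable_diff[OF ik2 iF2] veq vm
        by (subst integrable_cong_AE[OF _ _ veq]) (auto simp: borel_prob_measurable[OF M])
      have "\<delta> * prob E = (\<integral>x. \<delta> * indicator E x \<partial>?M)" using Eb by (simp add: sp)
      also have "\<dots> \<le> (\<integral>x. var_avg N j (erg_comp \<mu> x) \<partial>?M)"
      proof (rule integral_mono[OF _ iv])
        show "integrable ?M (\<lambda>x. \<delta> * indicator E x)"
          using Eb by (intro integrable_mult_right integrable_real_indicator) (auto simp: sM emeasure_eq_measure)
        show "\<delta> * indicator E x \<le> var_avg N j (erg_comp \<mu> x)" for x
          using var_avg_nonneg[OF k N, of j x] N by (auto simp: indicator_def E_def)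
      qed
      also have "\<dots> = (\<integral>x. pr (erg_comp \<mu> x) (mulf ?a ?a) - (?F x)\<^sup>2 \<partial>?M)"
        using iv ik2 iF2 by (intro integral_cong_AE veq) auto
      also have "\<dots> = (\<integral>x. app (mulf ?a ?a) x - (?F x)\<^sup>2 \<partial>?M)"
        using ik2 iF2 ia2 by (simp add: integral_erg_comp[OF \<mu>] repr_measure(2)[OF p] del: apply_mulf)
      also have "\<dots> \<le> (\<integral>x. 2 * norm ?q * \<bar>app ?a x - ?F x\<bar> \<partial>?M)"
      proof (rule integral_mono)
        show "integrable ?M (\<lambda>x. app (mulf ?a ?a) x - (?F x)\<^sup>2)"
          using ia2 iF2 by (rule Bochner_Integration.integrable_diff)
        show "integrable ?M (\<lambda>x. 2 * norm ?q * \<bar>app ?a x - ?F x\<bar>)"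
          using borel_prob_integrable_bcontfun[OF M, of ?a] borel_prob_integrable_bounded[OF M F(1) F(3)] by auto
        fix x
        have "app (mulf ?a ?a) x - (?F x)\<^sup>2 = (app ?a x + ?F x) * (app ?a x - ?F x)"
          by (simp add: power2_eq_square algebra_simps)
        also have "\<dots> \<le> \<bar>app ?a x + ?F x\<bar> * \<bar>app ?a x - ?F x\<bar>"
          by (metis abs_ge_self abs_mult)
        also have "\<dots> \<le> (2 * norm ?q) * \<bar>app ?a x - ?F x\<bar>"
          using ab[of x] F(3)[of x] by (intro mult_right_mono) auto
        finally show "app (mulf ?a ?a) x - (?F x)\<^sup>2 \<le> 2 * norm ?q * \<bar>app ?a x - ?F x\<bar>" .
      qed
      finally show ?thesis by simp
    qed
    have "(\<lambda>N. 2 * norm ?q * (\<integral>x. \<bar>app (avg N ?q) x - ?F x\<bar> \<partial>?M)) \<longlonglongrightarrow> 0"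
      by (intro tendsto_mult_right_zero F(4))
    then have "\<delta> * prob E \<le> 0"
      by (rule LIMSEQ_le_const) (use bound in \<open>auto intro!: exI[of _ 1]\<close>)
    then have "prob E = 0" using \<delta> measure_nonneg[of ?M E] by (simp add: mult_le_0_iff)
    then have "E \<in> null_sets ?M" using Eb sM by (intro null_setsI) (auto simp: emeasure_eq_measure)
    then have "AE x in ?M. x \<notin> E" by (rule AE_not_in)
    then show ?thesis by eventually_elim (auto simp: E_def \<delta>_def not_le)
  qed
  then have "AE x in ?M. \<forall>j l. \<exists>N>0. var_avg N j (erg_comp \<mu> x) < inverse (real (Suc l))"
    by (simp only: AE_all_countable) blast
  then show ?thesis
    by eventually_elim (use k in \<open>auto simp: ergodic_iff_var_avg\<close>)
qed

lemma is_choquet_erg_comp: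
  assumes \<mu>: "\<mu> \<in> PT"
  shows "is_choquet_measure \<mu> (distr (rep \<mu>) inv_borel (erg_comp \<mu>))"
proof -
  let ?M = "rep \<mu>"
  note M = repr_measure(1)[OF invariant_prob[OF \<mu>]]
  interpret prob_space ?M using M by (simp add: borel_prob_def)
  have m: "erg_comp \<mu> \<in> ?M \<rightarrow>\<^sub>M inv_borel" using measurable_erg_comp[OF \<mu>] by (simp add: borel_prob_measurable[OF M])
  interpret D: prob_space "distr ?M inv_borel (erg_comp \<mu>)" by (rule prob_space_distr[OF m])
  have "AE \<nu> in distr ?M inv_borel (erg_comp \<mu>). \<nu> \<in> PE"
  proof (subst AE_distr_iff[OF m])
    show "{x \<in> space inv_borel. x \<in> (PE :: 'a CSigma_dual set)} \<in> sets inv_borel"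
      using ergodic_measurable sets.Int_space_eq1[OF ergodic_measurable] by (simp add: Int_def)
  qed (rule AE_erg_comp_ergodic[OF \<mu>])
  then have "emeasure (distr ?M inv_borel (erg_comp \<mu>)) PE = 1"
    using D.emeasure_eq_1_AE[of ergodic_functionals] ergodic_measurable by simp
  moreover have "pr \<mu> f = (\<integral>\<nu>. pr \<nu> f \<partial>distr ?M inv_borel (erg_comp \<mu>))" for f
    by (simp add: integral_distr[OF m measurable_eval] integral_erg_comp[OF \<mu>])
  ultimately show ?thesis
    unfolding is_choquet_measure_def using D.prob_space_axioms
    by (simp add: space_inv_borel) (simp add: inv_borel_def)
qed

text \<open>Uniqueness: for an ergodic \<open>\<nu>\<close> every continuous function of the coordinates of \<open>\<nu>\<close> is a limit
  of \<open>\<nu>\<close>-integrals of functions on the sequence space not depending on \<open>\<nu>\<close>.\<close>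

definition cyl :: "((nat \<Rightarrow> real) \<Rightarrow>\<^sub>C real) \<Rightarrow> nat \<Rightarrow> 'a CSigma"
  where "cyl H N = Bcontfun (\<lambda>x. app H (\<lambda>j. app (avg N (dense_fn j)) x))"

lemma apply_cyl: "app (cyl H N) = (\<lambda>x. app H (\<lambda>j. app (avg N (dense_fn j)) x))"
  unfolding cyl_def
proof (rule apply_Bcontfun_Sigma)
  have "continuous_on UNIV (\<lambda>x j. app (avg N (dense_fn j)) x)"
    by (intro continuous_on_coordinatewise_then_product) auto
  then show "continuous_on UNIV (\<lambda>x. app H (\<lambda>j. app (avg N (dense_fn j)) x))"
    by (rule continuous_on_compose2[OF continuous_on_apply_bcontfun]) auto
qed

lemma cyl_tendsto:
  assumes \<nu>: "\<nu> \<in> PE"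
  shows "(\<lambda>N. pr \<nu> (cyl H N)) \<longlonglongrightarrow> app H (coords \<nu>)"
proof (rule LIMSEQ_I)
  fix e :: real assume e: "e > 0"
  have i: "\<nu> \<in> PT" using \<nu> by (simp add: ergodic_functionals_def)
  note p = invariant_prob[OF i]
  note M = repr_measure(1)[OF p]
  interpret prob_space "rep \<nu>" using M by (simp add: borel_prob_def)
  let ?K = "PiE UNIV (\<lambda>j. {- norm (dense_fn j)..norm (dense_fn j)})"
  have "uniformly_continuous_on ?K (app H)"
    by (intro compact_uniformly_continuous compact_coords_box) auto
  then have "\<exists>d>0. \<forall>x\<in>?K. \<forall>y\<in>?K. dist y x < d \<longrightarrow> dist (app H y) (app H x) < e / 2"
    unfolding uniformly_continuous_on_def by (rule allE[of _ "e/2"]) (use e in simp)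
  then obtain \<delta> where \<delta>': "\<delta> > 0"
    "\<forall>x\<in>?K. \<forall>y\<in>?K. dist y x < \<delta> \<longrightarrow> dist (app H y) (app H x) < e / 2"
    by (elim exE conjE)
  have \<delta>: "\<delta> > 0" "x \<in> ?K \<Longrightarrow> y \<in> ?K \<Longrightarrow> dist x y < \<delta> \<Longrightarrow> \<bar>app H x - app H y\<bar> < e / 2" for x y
    by (rule \<delta>'(1), rule \<delta>'(2)[rule_format, of y x, unfolded dist_real_def])
  \<comment> \<open>The product distance is at most twice the largest of the terms up to l, plus
    (1/2)^l. Coordinates in \<open>I\<close> within \<delta>/4 therefore give a distance below
    \<delta>.\<close>
  obtain l :: nat where l: "(1/2::real) ^ l < \<delta> / 2" using real_arch_pow_inv[of "\<delta>/2" "1/2"] \<delta> by auto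
  define I where "I = (from_nat :: nat \<Rightarrow> nat) ` {..l}"
  have I: "finite I" by (simp add: I_def)
  \<comment> \<open>If some coordinate in \<open>I\<close> is off by at least \<delta>/4, the
    difference is still at most twice the norm of H, and with this weight the sum of deviations
    dominates it.\<close>
  define R where "R = 2 * norm H * (4 / \<delta>)"
  have R: "R \<ge> 0" using \<delta> by (simp add: R_def)
  define av where "av N s = (\<lambda>j. app (avg N (dense_fn j)) s)" for N s
  have avK: "av N s \<in> ?K" for N s
    using order_trans[OF abs_bcontfun_le_norm norm_avg_le] by (auto simp: av_def PiE_UNIV_domain abs_le_iff minus_le_iff)
  have pw: "\<bar>app H (av N s) - app H (coords \<nu>)\<bar> \<le> e / 2 + R * (\<Sum>j\<in>I. \<bar>av N s j - coords \<nu> j\<bar>)" for N s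
  proof (cases "\<forall>j\<in>I. \<bar>av N s j - coords \<nu> j\<bar> < \<delta> / 4")
    case True
    let ?D = "{dist (av N s (from_nat n)) (coords \<nu> (from_nat n))|n. n \<le> l}"
    have D: "?D = (\<lambda>n. dist (av N s (from_nat n)) (coords \<nu> (from_nat n))) ` {..l}" by auto
    have "Max ?D < \<delta> / 4"
      unfolding D using True by (subst Max_less_iff) (auto simp: I_def dist_real_def)
    then have "dist (av N s) (coords \<nu>) < \<delta>"
      using dist_fun_le_dist_first_terms[of "av N s" "coords \<nu>" l] l by linarith
    then have "\<bar>app H (av N s) - app H (coords \<nu>)\<bar> < e / 2"
      by (intro \<delta>(2) avK coords_box p)
    moreover have "0 \<le> R * (\<Sum>j\<in>I. \<bar>av N s j - coords \<nu> j\<bar>)" using R by (intro mult_nonneg_nonneg sum_nonneg) auto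
    ultimately show ?thesis by linarith
  next
    case False
    then obtain j where j: "j \<in> I" "\<delta> / 4 \<le> \<bar>av N s j - coords \<nu> j\<bar>" by (auto simp: not_less)
    have "\<delta> / 4 \<le> (\<Sum>j\<in>I. \<bar>av N s j - coords \<nu> j\<bar>)"
      using j(2) by (rule order_trans) (use j(1) I in \<open>intro member_le_sum, auto\<close>)
    then have "R * (\<delta> / 4) \<le> R * (\<Sum>j\<in>I. \<bar>av N s j - coords \<nu> j\<bar>)" using R by (intro mult_left_mono)
    moreover have "R * (\<delta> / 4) = 2 * norm H" using \<delta> by (simp add: R_def)
    ultimately show ?thesis
      using abs_bcontfun_le_norm[of H "av N s"] abs_bcontfun_le_norm[of H "coords \<nu>"] e by linarith
  qed
  have iav: "integrable (rep \<nu>) (\<lambda>s. \<bar>av N s j - coords \<nu> j\<bar>)" for N j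
    unfolding av_def using borel_prob_integrable_bcontfun[OF M, of "avg N (dense_fn j)"] by auto
  have ic: "integrable (rep \<nu>) (app (cyl H N))" for N by (rule borel_prob_integrable_bcontfun[OF M])
  have bound: "\<bar>pr \<nu> (cyl H N) - app H (coords \<nu>)\<bar> \<le> e / 2 + R * (\<Sum>j\<in>I. \<integral>s. \<bar>av N s j - coords \<nu> j\<bar> \<partial>rep \<nu>)" for N
  proof -
    have "pr \<nu> (cyl H N) - app H (coords \<nu>) = (\<integral>s. app (cyl H N) s - app H (coords \<nu>) \<partial>rep \<nu>)"
      using ic[of N] by (simp add: repr_measure(2)[OF p] prob_space)
    also have "\<bar>\<dots>\<bar> \<le> (\<integral>s. \<bar>app (cyl H N) s - app H (coords \<nu>)\<bar> \<partial>rep \<nu>)"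
      by (rule integral_abs_bound)
    also have "\<dots> \<le> (\<integral>s. e / 2 + R * (\<Sum>j\<in>I. \<bar>av N s j - coords \<nu> j\<bar>) \<partial>rep \<nu>)"
      using ic[of N] iav pw[unfolded av_def] by (intro integral_mono) (auto simp: apply_cyl av_def)
    also have "\<dots> = e / 2 + R * (\<Sum>j\<in>I. \<integral>s. \<bar>av N s j - coords \<nu> j\<bar> \<partial>rep \<nu>)"
      using iav by (simp add: prob_space)
    finally show ?thesis .
  qed
  have "(\<lambda>N. R * (\<Sum>j\<in>I. \<integral>s. \<bar>av N s j - coords \<nu> j\<bar> \<partial>rep \<nu>)) \<longlonglongrightarrow> R * (\<Sum>j\<in>I. 0)"
    unfolding av_def coords_def by (intro tendsto_mult tendsto_const tendsto_sum ergodic_avg_L1 \<nu>)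
  then have "(\<lambda>N. R * (\<Sum>j\<in>I. \<integral>s. \<bar>av N s j - coords \<nu> j\<bar> \<partial>rep \<nu>)) \<longlonglongrightarrow> 0" by simp
  then have "eventually (\<lambda>N. R * (\<Sum>j\<in>I. \<integral>s. \<bar>av N s j - coords \<nu> j\<bar> \<partial>rep \<nu>) < e / 2) sequentially"
    using e by (intro order_tendstoD) auto
  then obtain N0 where "\<And>N. N \<ge> N0 \<Longrightarrow> R * (\<Sum>j\<in>I. \<integral>s. \<bar>av N s j - coords \<nu> j\<bar> \<partial>rep \<nu>) < e / 2"
    unfolding eventually_sequentially by blast
  then have "norm (pr \<nu> (cyl H N) - app H (coords \<nu>)) < e" if "N \<ge> N0" for N
    using bound[of N] that by fastforce
  then show "\<exists>N0. \<forall>N\<ge>N0. norm (pr \<nu> (cyl H N) - app H (coords \<nu>)) < e" by blast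
qed

lemma choquet_props:
  assumes "is_choquet_measure \<mu> \<xi>"
  shows "prob_space \<xi>" "sets \<xi> = sets inv_borel" "space \<xi> = PT"
    "AE \<nu> in \<xi>. \<nu> \<in> PE" "pr \<mu> f = (\<integral>\<nu>. pr \<nu> f \<partial>\<xi>)"
proof -
  show p: "prob_space \<xi>" and s: "sets \<xi> = sets inv_borel" and "space \<xi> = PT"
    and "pr \<mu> f = (\<integral>\<nu>. pr \<nu> f \<partial>\<xi>)"
    using assms by (auto simp: is_choquet_measure_def inv_borel_def)
  interpret prob_space \<xi> by (rule p)
  show "AE \<nu> in \<xi>. \<nu> \<in> PE"
    using assms by (intro AE_prob_1) (simp add: is_choquet_measure_def emeasure_eq_measure)
qed

text \<open>The sequence on the left involves only \<open>\<mu>\<close> and is linear in it. Hence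
  both the uniqueness of the Choquet measure and the affinity of integrals against it.\<close>

lemma choquet_integral_coords:
  assumes \<xi>: "is_choquet_measure \<mu> \<xi>"
  shows "(\<lambda>N. pr \<mu> (cyl H N)) \<longlonglongrightarrow> (\<integral>\<nu>. app H (coords \<nu>) \<partial>\<xi>)"
proof -
  note c = choquet_props[OF \<xi>]
  interpret prob_space \<xi> by (rule c(1))
  have meas: "(\<lambda>\<nu>. pr \<nu> f) \<in> borel_measurable \<xi>" for f
    using measurable_eval measurable_cong_sets[OF c(2) refl] by blast
  have "coords \<in> borel_measurable \<xi>" using measurable_coords measurable_cong_sets[OF c(2) refl] by blast
  then have mH: "(\<lambda>\<nu>. app H (coords \<nu>)) \<in> borel_measurable \<xi>" by measurable
  have "(\<lambda>N. \<integral>\<nu>. pr \<nu> (cyl H N) \<partial>\<xi>) \<longlonglongrightarrow> (\<integral>\<nu>. app H (coords \<nu>) \<partial>\<xi>)"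
  proof (rule integral_dominated_convergence[where w="\<lambda>_. norm H"])
    show "AE \<nu> in \<xi>. (\<lambda>N. pr \<nu> (cyl H N)) \<longlonglongrightarrow> app H (coords \<nu>)"
      using c(4) by eventually_elim (rule cyl_tendsto)
    show "AE \<nu> in \<xi>. norm (pr \<nu> (cyl H N)) \<le> norm H" for N
    proof (rule AE_I2)
      fix \<nu> assume "\<nu> \<in> space \<xi>"
      then have "\<nu> \<in> PP" using c(3) invariant_prob by auto
      from prob_abs_le[OF this, of "cyl H N"] have "norm (pr \<nu> (cyl H N)) \<le> norm (cyl H N)" by simp
      also have "norm (cyl H N) \<le> norm H" by (rule norm_bound) (simp add: apply_cyl abs_bcontfun_le_norm)
      finally show "norm (pr \<nu> (cyl H N)) \<le> norm H" .
    qed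
  qed (use meas mH in auto)
  then show ?thesis by (simp add: c(5)[symmetric])
qed

text \<open>The image measures under \<open>coords\<close> have the same integrals of continuous
  functions and therefore agree; every Borel set of invariant functionals is a preimage under
  \<open>coords\<close>.\<close>

lemma choquet_unique:
  fixes \<xi> \<xi>' :: "'a CSigma_dual measure"
  assumes \<xi>: "is_choquet_measure \<mu> \<xi>" and \<xi>': "is_choquet_measure \<mu> \<xi>'"
  shows "\<xi> = \<xi>'"
proof -
  note c = choquet_props[OF \<xi>] and c' = choquet_props[OF \<xi>']
  have m: "coords \<in> \<xi> \<rightarrow>\<^sub>M borel" and m': "coords \<in> \<xi>' \<rightarrow>\<^sub>M borel"
    using measurable_coords measurable_cong_sets[OF c(2) refl] measurable_cong_sets[OF c'(2) refl] by blast+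
  have b: "borel_prob (distr \<xi> borel coords)" "borel_prob (distr \<xi>' borel coords)"
    by (auto simp: borel_prob_def intro: prob_space.prob_space_distr c(1) c'(1) m m')
  have "func_of (distr \<xi> borel coords) = func_of (distr \<xi>' borel coords)"
  proof (rule blinfun_eqI)
    fix H :: "real CSigma"
    have "(\<integral>\<nu>. app H (coords \<nu>) \<partial>\<xi>) = (\<integral>\<nu>. app H (coords \<nu>) \<partial>\<xi>')"
      by (rule LIMSEQ_unique[OF choquet_integral_coords[OF \<xi>] choquet_integral_coords[OF \<xi>']])
    then show "pr (func_of (distr \<xi> borel coords)) H = pr (func_of (distr \<xi>' borel coords)) H"
      by (simp add: apply_func_of[OF b(1)] apply_func_of[OF b(2)] integral_distr[OF m measurable_bcontfun] integral_distr[OF m' measurable_bcontfun])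
  qed
  then have eq: "distr \<xi> borel coords = distr \<xi>' borel coords"
    using represents_func_of[OF b(1)] represents_func_of[OF b(2)] represents_unique by metis
  show ?thesis
  proof (rule measure_eqI)
    show "sets \<xi> = sets \<xi>'" by (simp add: c(2) c'(2))
    fix S assume "S \<in> sets \<xi>"
    then obtain B where B: "B \<in> sets borel" "S = {\<nu> \<in> PT. coords \<nu> \<in> B}"
      using sets_inv_borel_coords[of S] c(2) by auto
    have "emeasure (distr \<xi> borel coords) B = emeasure (distr \<xi>' borel coords) B" by (simp only: eq)
    moreover have "coords -` B \<inter> PT = S" using B(2) by auto
    ultimately show "emeasure \<xi> S = emeasure \<xi>' S"
      by (simp add: emeasure_distr[OF m B(1)] emeasure_distr[OF m' B(1)] c(3) c'(3))
  qed
qed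

theorem choquet_measure_eq:
  assumes \<mu>: "\<mu> \<in> PT"
  shows "choquet_measure \<mu> = distr (rep \<mu>) inv_borel (erg_comp \<mu>)"
  unfolding choquet_measure_def
  using is_choquet_erg_comp[OF \<mu>] choquet_unique by (intro the_equality) auto

lemma choquet_measureI: "is_choquet_measure \<mu> \<xi> \<Longrightarrow> choquet_measure \<mu> = \<xi>"
  for \<xi> :: "'a CSigma_dual measure"
  unfolding choquet_measure_def using choquet_unique by (intro the_equality) auto

end

section \<open>The entropy and the ergodic decomposition\<close>

lemma abs_ln_diff_le:
  fixes x y l :: real
  assumes "0 < l" "l \<le> x" "l \<le> y"
  shows "\<bar>ln x - ln y\<bar> \<le> \<bar>x - y\<bar> / l"
proof -
  have *: "ln x - ln y \<le> \<bar>x - y\<bar> / l" if "l \<le> x" "l \<le> y" for x y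
  proof -
    have p: "x > 0" "y > 0" using that assms(1) by auto
    have "ln x - ln y = ln (x / y)" using p by (simp add: ln_div)
    also have "\<dots> \<le> x / y - 1" using p by (intro ln_le_minus_one) simp
    also have "\<dots> = (x - y) / y" using p by (simp add: field_simps)
    also have "\<dots> \<le> \<bar>x - y\<bar> / y" using p by (intro divide_right_mono) auto
    also have "\<dots> \<le> \<bar>x - y\<bar> / l" using that assms(1) by (intro divide_left_mono) auto
    finally show ?thesis .
  qed
  show ?thesis using *[OF assms(2,3)] *[OF assms(3,2)] by (simp add: abs_le_iff abs_minus_commute)
qed

context symbolic_space
begin

text \<open>\<open>adm\<close> describes the pairs \<open>(L\<phi>, \<phi>)\<close> for certain merely measurable \<open>\<phi>\<close>, as \<open>L\<^sup>1\<close>-limits.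
  Gluing along an invariant set \<open>A\<close> approximates its indicator by \<open>w \<circ> T\<close>, since the
  transfer operator pulls functions of this form out.\<close>

definition adm :: "'a CSigma_dual \<Rightarrow> real \<Rightarrow> real \<Rightarrow> ((nat \<Rightarrow> 'a) \<Rightarrow> real) \<Rightarrow> ((nat \<Rightarrow> 'a) \<Rightarrow> real) \<Rightarrow> bool"
  where "adm \<mu> l u a b \<longleftrightarrow> a \<in> borel_measurable borel \<and> b \<in> borel_measurable borel \<and>
    (\<forall>x. l \<le> a x \<and> a x \<le> u \<and> l \<le> b x \<and> b x \<le> u) \<and>
    (\<forall>e>0. \<exists>f. (\<forall>x. l \<le> app f x \<and> app f x \<le> u) \<and>
      (\<integral>x. \<bar>transfer_op m f x - a x\<bar> \<partial>rep \<mu>) \<le> e \<and>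
      (\<integral>x. \<bar>app f x - b x\<bar> \<partial>rep \<mu>) \<le> e)"

lemma transfer_op_bounds:
  assumes "\<And>x. l \<le> app f x \<and> app f x \<le> u"
  shows "l \<le> transfer_op m f x" "transfer_op m f x \<le> u"
  using transfer_op_mono[of "cst l" f x] transfer_op_mono[of f "cst u" x] assms
  by (simp_all add: transfer_op_const const_bcontfun.rep_eq)

lemma measurable_transfer_op [measurable]: "transfer_op m f \<in> borel_measurable borel"
  using measurable_bcontfun[of "Lop f"] by simp

lemma adm_base:
  assumes "\<And>x. l \<le> app f x \<and> app f x \<le> u"
  shows "adm \<mu> l u (transfer_op m f) (app f)"
  unfolding adm_def using assms transfer_op_bounds[OF assms]
  by (auto intro!: exI[of _ f])

lemma adm_glue:
  assumes \<mu>: "\<mu> \<in> PT" and A: "inv_set A" and l: "0 < l" "l \<le> u"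
    and 1: "adm \<mu> l u a b" and 2: "adm \<mu> l u a' b'"
  shows "adm \<mu> l u (\<lambda>s. if s \<in> A then a s else a' s) (\<lambda>s. if s \<in> A then b s else b' s)"
  unfolding adm_def
proof (intro conjI allI impI)
  let ?M = "rep \<mu>"
  note M = repr_measure(1)[OF invariant_prob[OF \<mu>]]
  have Ab: "A \<in> sets borel" and Ai: "shift -` A = A" using A by (auto simp: inv_set_def)
  have am: "a \<in> borel_measurable borel" "b \<in> borel_measurable borel" "a' \<in> borel_measurable borel" "b' \<in> borel_measurable borel"
    and ab: "\<And>s. l \<le> a s \<and> a s \<le> u \<and> l \<le> b s \<and> b s \<le> u" "\<And>s. l \<le> a' s \<and> a' s \<le> u \<and> l \<le> b' s \<and> b' s \<le> u"
    using 1 2 by (auto simp: adm_def)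
  show "(\<lambda>s. if s \<in> A then a s else a' s) \<in> borel_measurable borel" "(\<lambda>s. if s \<in> A then b s else b' s) \<in> borel_measurable borel"
    using am Ab by measurable
  show "l \<le> (if s \<in> A then a s else a' s)" "(if s \<in> A then a s else a' s) \<le> u"
    "l \<le> (if s \<in> A then b s else b' s)" "(if s \<in> A then b s else b' s) \<le> u" for s
    using ab by auto
  fix e :: real assume e: "e > 0"
  have e3: "e / 3 > 0" using e by simp
  have ex1: "\<exists>\<phi>. (\<forall>s. l \<le> app \<phi> s \<and> app \<phi> s \<le> u) \<and>
      (\<integral>s. \<bar>transfer_op m \<phi> s - a s\<bar> \<partial>?M) \<le> e / 3 \<and> (\<integral>s. \<bar>app \<phi> s - b s\<bar> \<partial>?M) \<le> e / 3"
    using 1 e3 unfolding adm_def by blast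
  have ex2: "\<exists>\<phi>. (\<forall>s. l \<le> app \<phi> s \<and> app \<phi> s \<le> u) \<and>
      (\<integral>s. \<bar>transfer_op m \<phi> s - a' s\<bar> \<partial>?M) \<le> e / 3 \<and> (\<integral>s. \<bar>app \<phi> s - b' s\<bar> \<partial>?M) \<le> e / 3"
    using 2 e3 unfolding adm_def by blast
  obtain f where f: "\<And>s. l \<le> app f s \<and> app f s \<le> u"
    "(\<integral>s. \<bar>transfer_op m f s - a s\<bar> \<partial>?M) \<le> e / 3" "(\<integral>s. \<bar>app f s - b s\<bar> \<partial>?M) \<le> e / 3"
    using ex1 by blast
  obtain g where g: "\<And>s. l \<le> app g s \<and> app g s \<le> u"
    "(\<integral>s. \<bar>transfer_op m g s - a' s\<bar> \<partial>?M) \<le> e / 3" "(\<integral>s. \<bar>app g s - b' s\<bar> \<partial>?M) \<le> e / 3"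
    using ex2 by blast
  have u: "u > 0" using l by simp
  obtain w :: "'a CSigma" where w: "\<And>x. 0 \<le> app w x \<and> app w x \<le> 1"
    "(\<integral>x. \<bar>indicator A x - app w x\<bar> \<partial>?M) < e / (3 * u)"
    using indicator_L1_approx[OF M Ab, rule_format, of "e / (3 * u)"] e u by auto
  define \<phi> where "\<phi> = mulf (comp_shift w) f + mulf (cst 1 - comp_shift w) g"
  have \<phi>: "app \<phi> s = app w (shift s) * app f s + (1 - app w (shift s)) * app g s" for s
    by (simp add: \<phi>_def const_bcontfun.rep_eq)
  have L\<phi>: "transfer_op m \<phi> s = app w s * transfer_op m f s + (1 - app w s) * transfer_op m g s" for s
    unfolding transfer_op_def \<phi> using integrable_cons[of f s] integrable_cons[of g s] by simp
  have conv: "l \<le> t * x + (1 - t) * y \<and> t * x + (1 - t) * y \<le> u" if "0 \<le> t \<and> t \<le> 1" "l \<le> x \<and> x \<le> u" "l \<le> y \<and> y \<le> u" for t x y :: real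
  proof -
    have "t * l + (1 - t) * l \<le> t * x + (1 - t) * y" "t * x + (1 - t) * y \<le> t * u + (1 - t) * u"
      using that by (intro add_mono mult_left_mono; simp)+
    then show ?thesis by (simp add: algebra_simps)
  qed
  \<comment> \<open>Moving the weight t to 0 or 1 changes a mixture of two values in [l, u] by at
    most u times the change of weight; the rest is the error of the selected value.\<close>
  have dist: "\<bar>(t * x + (1 - t) * y) - (if P then c else d)\<bar> \<le> \<bar>x - c\<bar> + \<bar>y - d\<bar> + u * \<bar>of_bool P - t\<bar>"
    if t: "0 \<le> t \<and> t \<le> 1" and xy: "l \<le> x \<and> x \<le> u" "l \<le> y \<and> y \<le> u" for t x y c d :: real and P
  proof -
    have "\<bar>x - y\<bar> \<le> u" using xy l by (auto simp: abs_le_iff)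
    then have "\<bar>of_bool P - t\<bar> * \<bar>x - y\<bar> \<le> \<bar>of_bool P - t\<bar> * u" by (intro mult_left_mono) auto
    then have *: "\<bar>(of_bool P - t) * (x - y)\<bar> \<le> u * \<bar>of_bool P - t\<bar>" by (simp add: abs_mult mult.commute)
    show ?thesis
    proof (cases P)
      case True
      then have "(t * x + (1 - t) * y) - (if P then c else d) = (x - c) - (of_bool P - t) * (x - y)" by (simp add: algebra_simps)
      then show ?thesis using * by linarith
    next
      case False
      then have "(t * x + (1 - t) * y) - (if P then c else d) = (y - d) - (of_bool P - t) * (x - y)" by (simp add: algebra_simps)
      then show ?thesis using * by linarith
    qed
  qed
  have iw: "integrable ?M (\<lambda>s. \<bar>indicator A s - app w s\<bar>)"
    using Ab w(1) by (intro borel_prob_integrable_bounded[OF M, where B=1]) (auto simp: indicator_def)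
  have iwT: "integrable ?M (\<lambda>s. \<bar>indicator A s - app w (shift s)\<bar>)"
  proof (rule borel_prob_integrable_bounded[OF M, where B=1])
    show "(\<lambda>s. \<bar>indicator A s - app w (shift s)\<bar>) \<in> borel_measurable borel" using Ab by measurable
    show "\<bar>\<bar>indicator A s - app w (shift s)\<bar>\<bar> \<le> 1" for s using w(1)[of "shift s"] by (auto simp: indicator_def)
  qed
  \<comment> \<open>Both \<open>A\<close> and \<open>\<mu>\<close> are invariant, so the shifted
    weight approximates the indicator of \<open>A\<close> exactly as well as w does.\<close>
  have wT: "(\<integral>s. \<bar>indicator A s - app w (shift s)\<bar> \<partial>?M) = (\<integral>s. \<bar>indicator A s - app w s\<bar> \<partial>?M)"
    using invariant_integral[OF \<mu>, of "\<lambda>s. \<bar>indicator A s - app w s\<bar>" 1] indicator_invariant_pow[OF Ai, of 1] Ab by simp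
  have ib: "integrable ?M (\<lambda>s. \<bar>x s - y s\<bar>)"
    if "x \<in> borel_measurable borel" "y \<in> borel_measurable borel" "\<And>s. l \<le> x s \<and> x s \<le> u" "\<And>s. l \<le> y s \<and> y s \<le> u" for x y :: "(nat \<Rightarrow> 'a) \<Rightarrow> real"
  proof (rule borel_prob_integrable_bounded[OF M, where B=u])
    show "(\<lambda>s. \<bar>x s - y s\<bar>) \<in> borel_measurable borel" using that by measurable
    show "\<bar>\<bar>x s - y s\<bar>\<bar> \<le> u" for s using that(3)[of s] that(4)[of s] l by auto
  qed
  have est: "(\<integral>s. \<bar>z s - (if s \<in> A then c s else d s)\<bar> \<partial>?M) \<le> e"
    if z: "\<And>s. z s = t s * x s + (1 - t s) * y s" and t: "\<And>s. 0 \<le> t s \<and> t s \<le> 1"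
      and ti: "integrable ?M (\<lambda>s. \<bar>indicator A s - t s\<bar>)" "(\<integral>s. \<bar>indicator A s - t s\<bar> \<partial>?M) \<le> e / (3 * u)"
      and xm: "x \<in> borel_measurable borel" "y \<in> borel_measurable borel" "z \<in> borel_measurable borel" "c \<in> borel_measurable borel" "d \<in> borel_measurable borel"
      and xb: "\<And>s. l \<le> x s \<and> x s \<le> u" "\<And>s. l \<le> y s \<and> y s \<le> u" "\<And>s. l \<le> c s \<and> c s \<le> u" "\<And>s. l \<le> d s \<and> d s \<le> u"
      and xc: "(\<integral>s. \<bar>x s - c s\<bar> \<partial>?M) \<le> e / 3" "(\<integral>s. \<bar>y s - d s\<bar> \<partial>?M) \<le> e / 3" for x y z c d t :: "(nat \<Rightarrow> 'a) \<Rightarrow> real"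
  proof -
    have zb: "l \<le> z s \<and> z s \<le> u" for s unfolding z by (rule conv[OF t xb(1,2)])
    have ic: "integrable ?M (\<lambda>s. \<bar>x s - c s\<bar>)" "integrable ?M (\<lambda>s. \<bar>y s - d s\<bar>)"
      by (rule ib[OF xm(1,4) xb(1,3)], rule ib[OF xm(2,5) xb(2,4)])
    have "(\<integral>s. \<bar>z s - (if s \<in> A then c s else d s)\<bar> \<partial>?M) \<le> (\<integral>s. (\<bar>x s - c s\<bar> + \<bar>y s - d s\<bar>) + u * \<bar>indicator A s - t s\<bar> \<partial>?M)"
    proof (rule integral_mono)
      show "integrable ?M (\<lambda>s. \<bar>z s - (if s \<in> A then c s else d s)\<bar>)"
      proof (rule ib[OF xm(3) _ zb])
        show "(\<lambda>s. if s \<in> A then c s else d s) \<in> borel_measurable borel" using xm Ab by measurable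
      qed (use xb in auto)
      show "\<bar>z s - (if s \<in> A then c s else d s)\<bar> \<le> (\<bar>x s - c s\<bar> + \<bar>y s - d s\<bar>) + u * \<bar>indicator A s - t s\<bar>" for s
        using dist[OF t xb(1,2), of s s s "s \<in> A" "c s" "d s"] by (simp add: z indicator_def)
    qed (use ic ti in auto)
    also have "\<dots> = (\<integral>s. \<bar>x s - c s\<bar> \<partial>?M) + (\<integral>s. \<bar>y s - d s\<bar> \<partial>?M) + u * (\<integral>s. \<bar>indicator A s - t s\<bar> \<partial>?M)"
      using ic ti by simp
    also have "\<dots> \<le> e / 3 + e / 3 + u * (e / (3 * u))"
      using xc ti(2) u by (intro add_mono mult_left_mono) auto
    also have "\<dots> = e" using u by simp
    finally show ?thesis .
  qed
  show "\<exists>\<phi>. (\<forall>s. l \<le> app \<phi> s \<and> app \<phi> s \<le> u) \<and>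
      (\<integral>s. \<bar>transfer_op m \<phi> s - (if s \<in> A then a s else a' s)\<bar> \<partial>?M) \<le> e \<and>
      (\<integral>s. \<bar>app \<phi> s - (if s \<in> A then b s else b' s)\<bar> \<partial>?M) \<le> e"
  proof (intro exI[of _ \<phi>] conjI allI)
    show "l \<le> app \<phi> s" "app \<phi> s \<le> u" for s
      using conv[OF w(1)[of "shift s"] f(1)[of s] g(1)[of s]] by (simp_all add: \<phi>)
    show "(\<integral>s. \<bar>transfer_op m \<phi> s - (if s \<in> A then a s else a' s)\<bar> \<partial>?M) \<le> e"
      by (rule est[OF L\<phi> w(1) iw less_imp_le[OF w(2)]])
        (use am ab f g transfer_op_bounds[OF f(1)] transfer_op_bounds[OF g(1)] in auto)
    show "(\<integral>s. \<bar>app \<phi> s - (if s \<in> A then b s else b' s)\<bar> \<partial>?M) \<le> e"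
      by (rule est[OF \<phi> w(1) iwT less_imp_le[OF w(2)[folded wT]]]) (use am ab f g in auto)
  qed
qed

text \<open>On values at least l the logarithm is Lipschitz with constant 1/l, so L1 closeness of
  the approximating pair to a and b passes to the entropy integrand.\<close>

lemma adm_entropy:
  assumes \<mu>: "\<mu> \<in> PT" and l: "0 < l" and ad: "adm \<mu> l u a b"
  shows "ent \<mu> \<le> ereal (\<integral>x. ln (a x) - ln (b x) \<partial>rep \<mu>)"
proof (rule ereal_le_epsilon2)
  let ?M = "rep \<mu>"
  note p = invariant_prob[OF \<mu>]
  note M = repr_measure(1)[OF p]
  have am: "a \<in> borel_measurable borel" "b \<in> borel_measurable borel"
    and ab: "\<And>x. l \<le> a x \<and> a x \<le> u \<and> l \<le> b x \<and> b x \<le> u"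
    using ad by (auto simp: adm_def)
  fix e :: real assume e: "0 < e"
  then have "e * l / 2 > 0" using l by simp
  then have "\<exists>f. (\<forall>x. l \<le> app f x \<and> app f x \<le> u) \<and>
      (\<integral>x. \<bar>transfer_op m f x - a x\<bar> \<partial>?M) \<le> e * l / 2 \<and>
      (\<integral>x. \<bar>app f x - b x\<bar> \<partial>?M) \<le> e * l / 2"
    using ad unfolding adm_def by blast
  then obtain f where f: "\<And>x. l \<le> app f x \<and> app f x \<le> u"
      "(\<integral>x. \<bar>transfer_op m f x - a x\<bar> \<partial>?M) \<le> e * l / 2"
      "(\<integral>x. \<bar>app f x - b x\<bar> \<partial>?M) \<le> e * l / 2" by blast
  have pos: "pos_fn f" using f(1) l by (auto simp: pos_fn_def intro: less_le_trans)
  have Lb: "l \<le> transfer_op m f x" "transfer_op m f x \<le> u" for x using transfer_op_bounds[OF f(1)] by auto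
  have lu: "0 < u" using ab l by (meson less_le_trans)
  have iab: "integrable ?M (\<lambda>x. ln (a x) - ln (b x))"
  proof (rule borel_prob_integrable_bounded[OF M, where B="u / l"])
    show "(\<lambda>x. ln (a x) - ln (b x)) \<in> borel_measurable borel" using am by measurable
    show "\<bar>ln (a x) - ln (b x)\<bar> \<le> u / l" for x
    proof -
      have "\<bar>ln (a x) - ln (b x)\<bar> \<le> \<bar>a x - b x\<bar> / l" using ab[of x] l by (intro abs_ln_diff_le) auto
      also have "\<dots> \<le> u / l" using ab[of x] l by (intro divide_right_mono) auto
      finally show ?thesis .
    qed
  qed
  have i1: "integrable ?M (\<lambda>x. \<bar>transfer_op m f x - a x\<bar>)" "integrable ?M (\<lambda>x. \<bar>app f x - b x\<bar>)"
  proof -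
    have "\<bar>\<bar>transfer_op m f x - a x\<bar>\<bar> \<le> u" "\<bar>\<bar>app f x - b x\<bar>\<bar> \<le> u" for x
      using Lb[of x] ab[of x] f(1)[of x] l by auto
    then show "integrable ?M (\<lambda>x. \<bar>transfer_op m f x - a x\<bar>)" "integrable ?M (\<lambda>x. \<bar>app f x - b x\<bar>)"
      using am by (intro borel_prob_integrable_bounded[OF M, where B=u]; measurable)+
  qed
  have "pr \<mu> (ell f) \<le> (\<integral>x. (ln (a x) - ln (b x)) + (\<bar>transfer_op m f x - a x\<bar> / l + \<bar>app f x - b x\<bar> / l) \<partial>?M)"
    unfolding repr_measure(2)[OF p]
  proof (rule integral_mono)
    show "integrable ?M (app (ell f))" by (rule borel_prob_integrable_bcontfun[OF M])
    show "integrable ?M (\<lambda>x. (ln (a x) - ln (b x)) + (\<bar>transfer_op m f x - a x\<bar> / l + \<bar>app f x - b x\<bar> / l))"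
      using iab i1 by auto
    fix x
    have "app (ell f) x = ln (transfer_op m f x) - ln (app f x)"
      using transfer_op_pos[OF pos, of x] pos by (simp add: apply_ell[OF pos] ln_div pos_fn_def order.strict_implies_not_eq[OF pos[unfolded pos_fn_def, rule_format, of x], symmetric])
    moreover have "\<bar>ln (transfer_op m f x) - ln (a x)\<bar> \<le> \<bar>transfer_op m f x - a x\<bar> / l"
      using Lb[of x] ab[of x] l by (intro abs_ln_diff_le) auto
    moreover have "\<bar>ln (app f x) - ln (b x)\<bar> \<le> \<bar>app f x - b x\<bar> / l"
      using f(1)[of x] ab[of x] l by (intro abs_ln_diff_le) auto
    ultimately show "app (ell f) x \<le> (ln (a x) - ln (b x)) + (\<bar>transfer_op m f x - a x\<bar> / l + \<bar>app f x - b x\<bar> / l)"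
      by linarith
  qed
  also have "\<dots> = (\<integral>x. ln (a x) - ln (b x) \<partial>?M) + ((\<integral>x. \<bar>transfer_op m f x - a x\<bar> \<partial>?M) / l + (\<integral>x. \<bar>app f x - b x\<bar> \<partial>?M) / l)"
    using iab i1 by (simp only: Bochner_Integration.integral_add integral_divide_zero Bochner_Integration.integrable_add integrable_divide simp_thms)
  also have "\<dots> \<le> (\<integral>x. ln (a x) - ln (b x) \<partial>?M) + (e * l / 2 / l + e * l / 2 / l)"
    using f(2,3) l by (intro add_left_mono add_mono divide_right_mono) auto
  also have "\<dots> = (\<integral>x. ln (a x) - ln (b x) \<partial>?M) + e" using l by simp
  finally have "ereal (pr \<mu> (ell f)) \<le> ereal (\<integral>x. ln (a x) - ln (b x) \<partial>?M) + ereal e" by simp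
  with entropy_le[OF p pos] show "ent \<mu> \<le> ereal (\<integral>x. ln (a x) - ln (b x) \<partial>?M) + ereal e"
    by (rule order_trans)
qed

section \<open>The entropy as a decreasing limit of finite minima and its average over
  components\<close>

definition ell_seq :: "nat \<Rightarrow> 'a CSigma"
  where "ell_seq i = ell (expf (dense_fn i))"

lemma apply_ell_seq:
  "app (ell_seq i) x = ln (transfer_op m (expf (dense_fn i)) x) - ln (app (expf (dense_fn i)) x)"
  using transfer_op_pos[OF pos_expf, of "dense_fn i" x] by (simp add: ell_seq_def apply_ell[OF pos_expf] ln_div)

text \<open>Finite minima decrease to the entropy because \<open>ell\<close> is continuous in ln
  \<phi>. Unlike the entropy they are real and bounded on probability functionals, so they can be
  integrated over the ergodic components.\<close>

primrec Hmin :: "nat \<Rightarrow> 'a CSigma_dual \<Rightarrow> real" where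
  "Hmin 0 \<nu> = pr \<nu> (ell_seq 0)"
| "Hmin (Suc n) \<nu> = min (Hmin n \<nu>) (pr \<nu> (ell_seq (Suc n)))"

lemma Hmin_le: "i \<le> n \<Longrightarrow> Hmin n \<nu> \<le> pr \<nu> (ell_seq i)"
  by (induction n) (auto simp: le_Suc_eq min_le_iff_disj)

lemma measurable_Hmin [measurable]: "Hmin n \<in> borel_measurable inv_borel"
  by (induction n) (auto intro: measurable_eval)

lemma Hmin_bounded: "\<exists>C. \<forall>\<nu>\<in>PP. \<bar>Hmin n \<nu>\<bar> \<le> C"
proof (induction n)
  case 0
  show ?case using prob_abs_le by auto
next
  case (Suc n)
  then obtain C where C: "\<And>\<nu>. \<nu> \<in> PP \<Longrightarrow> \<bar>Hmin n \<nu>\<bar> \<le> C" by blast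
  have "\<bar>Hmin (Suc n) \<nu>\<bar> \<le> C + norm (ell_seq (Suc n))" if "\<nu> \<in> PP" for \<nu>
    using C[OF that] prob_abs_le[OF that, of "ell_seq (Suc n)"] by auto
  then show ?case by blast
qed

lemma Hmin_ge_entropy: "\<nu> \<in> PP \<Longrightarrow> ent \<nu> \<le> ereal (Hmin n \<nu>)"
proof (induction n)
  case 0
  then show ?case unfolding Hmin.simps ell_seq_def by (rule entropy_le[OF _ pos_expf])
next
  case (Suc n)
  have "ent \<nu> \<le> ereal (pr \<nu> (ell_seq (Suc n)))"
    unfolding ell_seq_def by (rule entropy_le[OF Suc.prems pos_expf])
  then show ?case using Suc by (simp add: min_def)
qed

text \<open>A change of ln \<phi> by at most c changes each of the two logarithms in
  \<open>ell\<close> by at most c; for the transfer operator this is monotonicity and scaling by exp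
  c.\<close>

lemma ell_seq_approx:
  assumes \<phi>: "pos_fn \<phi>" and e: "e > 0"
  shows "\<exists>i. norm (ell \<phi> - ell_seq i) \<le> e"
proof -
  obtain i where i: "norm (lnf \<phi> - dense_fn i) < e / 2" using dense_fn[of "e/2" "lnf \<phi>"] e by auto
  define c where "c = e / 2"
  have near: "\<bar>ln (app \<phi> y) - app (dense_fn i) y\<bar> \<le> c" for y
    using abs_bcontfun_le_norm[of "lnf \<phi> - dense_fn i" y] i by (simp add: apply_lnf[OF \<phi>] c_def)
  have pe: "pos_fn (expf (dense_fn i))" by (rule pos_expf)
  have L: "ln (transfer_op m f x) \<le> ln (transfer_op m g x) + c"
    if f: "pos_fn f" and g: "pos_fn g" and le: "\<And>y. ln (app f y) \<le> ln (app g y) + c" for f g x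
  proof -
    have "app f y \<le> app (exp c *\<^sub>R g) y" for y
    proof -
      have "exp (ln (app f y)) \<le> exp (ln (app g y) + c)" using le[of y] by simp
      then show ?thesis using f g by (simp add: pos_fn_def exp_add mult.commute)
    qed
    then have "transfer_op m f x \<le> exp c * transfer_op m g x"
      using transfer_op_mono[of f "exp c *\<^sub>R g" x] by (simp add: transfer_op_scale)
    then have "ln (transfer_op m f x) \<le> ln (exp c * transfer_op m g x)"
      using transfer_op_pos[OF f, of x] transfer_op_pos[OF g, of x] by (subst ln_le_cancel_iff) auto
    then show ?thesis using transfer_op_pos[OF g, of x] by (simp add: ln_mult_pos)
  qed
  have "norm (ell \<phi> - ell_seq i) \<le> e"
  proof (rule norm_bound)
    fix x
    have 1: "ln (transfer_op m \<phi> x) \<le> ln (transfer_op m (expf (dense_fn i)) x) + c"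
      by (rule L[OF \<phi> pe]) (use near in \<open>simp add: abs_le_iff algebra_simps\<close>)
    have 2: "ln (transfer_op m (expf (dense_fn i)) x) \<le> ln (transfer_op m \<phi> x) + c"
      by (rule L[OF pe \<phi>]) (use near in \<open>simp add: abs_le_iff algebra_simps\<close>)
    have "app (ell \<phi>) x = ln (transfer_op m \<phi> x) - ln (app \<phi> x)"
      using transfer_op_pos[OF \<phi>, of x] \<phi> by (simp add: apply_ell[OF \<phi>] ln_div pos_fn_def order.strict_implies_not_eq[OF \<phi>[unfolded pos_fn_def, rule_format, of x], symmetric])
    then have "\<bar>app (ell \<phi>) x - app (ell_seq i) x\<bar> \<le> c + c"
      using 1 2 near[of x] by (simp add: apply_ell_seq)
    then show "norm (app (ell \<phi> - ell_seq i) x) \<le> e" by (simp add: c_def)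
  qed
  then show ?thesis by blast
qed

lemma Hmin_tendsto:
  assumes \<nu>: "\<nu> \<in> PP"
  shows "(\<lambda>n. ereal (Hmin n \<nu>)) \<longlonglongrightarrow> ent \<nu>"
proof -
  have dec: "decseq (\<lambda>n. ereal (Hmin n \<nu>))" unfolding decseq_Suc_iff by simp
  have "(INF n. ereal (Hmin n \<nu>)) = ent \<nu>"
  proof (rule antisym)
    show "ent \<nu> \<le> (INF n. ereal (Hmin n \<nu>))" by (intro INF_greatest Hmin_ge_entropy \<nu>)
    show "(INF n. ereal (Hmin n \<nu>)) \<le> ent \<nu>"
    proof (rule entropy_greatest[OF \<nu>], rule ereal_le_epsilon2)
      fix f and e :: real assume f: "pos_fn f" and e: "0 < e"
      obtain i where i: "norm (ell f - ell_seq i) \<le> e" using ell_seq_approx[OF f e] by blast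
      have "(INF n. ereal (Hmin n \<nu>)) \<le> ereal (Hmin i \<nu>)" by (rule INF_lower) simp
      also have "Hmin i \<nu> \<le> pr \<nu> (ell_seq i)" by (rule Hmin_le) simp
      also have "\<dots> \<le> pr \<nu> (ell f) + e" using prob_close[OF \<nu>, of "ell f" "ell_seq i"] i by linarith
      finally show "(INF n. ereal (Hmin n \<nu>)) \<le> ereal (pr \<nu> (ell f)) + ereal e" by simp
    qed
  qed
  then show ?thesis using LIMSEQ_INF[OF dec] by simp
qed

lemma inv_set_Int: "inv_set A \<Longrightarrow> inv_set B \<Longrightarrow> inv_set (A \<inter> B)"
  by (auto simp: inv_set_def)

lemma inv_set_Diff: "inv_set A \<Longrightarrow> inv_set B \<Longrightarrow> inv_set (A - B)"
  by (auto simp: inv_set_def)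

text \<open>The points at which the new test function beats the previous minimum form an invariant
  set, because the ergodic component is the same along an orbit, so gluing applies. The identity is
  claimed for every invariant B because the induction step splits B along that set.\<close>

lemma adm_Hmin:
  assumes \<mu>: "\<mu> \<in> PT" and l: "0 < l" "l \<le> u"
    and b: "\<And>i x. i \<le> n \<Longrightarrow> l \<le> app (expf (dense_fn i)) x \<and> app (expf (dense_fn i)) x \<le> u"
  shows "\<exists>a b. adm \<mu> l u a b \<and> (\<forall>B. inv_set B \<longrightarrow>
    (\<integral>x. indicator B x * (ln (a x) - ln (b x)) \<partial>rep \<mu>) = (\<integral>x. indicator B x * Hmin n (erg_comp \<mu> x) \<partial>rep \<mu>))"
  using b
proof (induction n)
  case 0
  let ?f = "expf (dense_fn 0)"
  show ?case
  proof (intro exI conjI allI impI)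
    show "adm \<mu> l u (transfer_op m ?f) (app ?f)" by (rule adm_base) (rule 0, simp)
    show "(\<integral>x. indicator B x * (ln (transfer_op m ?f x) - ln (app ?f x)) \<partial>rep \<mu>) = (\<integral>x. indicator B x * Hmin 0 (erg_comp \<mu> x) \<partial>rep \<mu>)"
    if "inv_set B" for B
    using integral_inv_set_erg_comp[OF \<mu> that, of "ell_seq 0"] by (simp only: apply_ell_seq Hmin.simps)
  qed
next
  case (Suc n)
  let ?M = "rep \<mu>" let ?k = "erg_comp \<mu>"
  note M = repr_measure(1)[OF invariant_prob[OF \<mu>]]
  obtain a b where ab: "adm \<mu> l u a b"
    "\<And>B. inv_set B \<Longrightarrow> (\<integral>x. indicator B x * (ln (a x) - ln (b x)) \<partial>?M) = (\<integral>x. indicator B x * Hmin n (?k x) \<partial>?M)"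
    using Suc.IH[OF Suc.prems] by (meson le_SucI)
  let ?f = "expf (dense_fn (Suc n))"
  have Hm: "(\<lambda>x. Hmin i (?k x)) \<in> borel_measurable borel" for i
    by (rule measurable_compose[OF measurable_erg_comp[OF \<mu>] measurable_Hmin])
  have em: "(\<lambda>x. pr (?k x) g) \<in> borel_measurable borel" for g by (rule measurable_erg_comp_eval[OF \<mu>])
  define A where "A = {x \<in> space borel. pr (?k x) (ell_seq (Suc n)) < Hmin n (?k x)}"
  have "A \<in> sets borel" unfolding A_def using Hm[of n] em[of "ell_seq (Suc n)"] by measurable
  moreover have "shift -` A = A" by (simp add: A_def erg_comp(2)[OF \<mu>] vimage_def)
  ultimately have A: "inv_set A" by (simp add: inv_set_def)
  have Ab: "A \<in> sets borel" using A by (simp add: inv_set_def)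
  let ?a = "\<lambda>x. if x \<in> A then transfer_op m ?f x else a x"
  let ?b = "\<lambda>x. if x \<in> A then app ?f x else b x"
  have adm: "adm \<mu> l u ?a ?b"
    by (rule adm_glue[OF \<mu> A l adm_base ab(1)]) (rule Suc.prems, simp)
  have am: "a \<in> borel_measurable borel" "b \<in> borel_measurable borel"
    and abb: "\<And>x. l \<le> a x \<and> a x \<le> u \<and> l \<le> b x \<and> b x \<le> u"
    using ab(1) by (auto simp: adm_def)
  have kp: "?k x \<in> PP" for x by (rule invariant_prob[OF erg_comp(1)[OF \<mu>]])
  have "(\<integral>x. indicator B x * (ln (?a x) - ln (?b x)) \<partial>?M) = (\<integral>x. indicator B x * Hmin (Suc n) (?k x) \<partial>?M)"
    if B: "inv_set B" for B
  proof -
    have Bb: "B \<in> sets borel" using B by (simp add: inv_set_def)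
    have BA: "inv_set (B \<inter> A)" "inv_set (B - A)" using A B by (auto intro: inv_set_Int inv_set_Diff)
    have BAb: "B \<inter> A \<in> sets borel" "B - A \<in> sets borel" using Ab Bb by auto
    have i1: "integrable ?M (\<lambda>x. indicator (B \<inter> A) x * app (ell_seq (Suc n)) x)"
      by (rule integrable_indicator_bcontfun[OF M BAb(1)])
    have i2: "integrable ?M (\<lambda>x. indicator (B - A) x * (ln (a x) - ln (b x)))"
    proof (rule borel_prob_integrable_bounded[OF M, where B="u / l"])
      show "(\<lambda>x. indicator (B - A) x * (ln (a x) - ln (b x))) \<in> borel_measurable borel" using am BAb by measurable
      show "\<bar>indicator (B - A) x * (ln (a x) - ln (b x))\<bar> \<le> u / l" for x
      proof -
        have "\<bar>ln (a x) - ln (b x)\<bar> \<le> \<bar>a x - b x\<bar> / l" using abb[of x] l by (intro abs_ln_diff_le) auto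
        also have "\<dots> \<le> u / l" using abb[of x] l by (intro divide_right_mono) auto
        finally show ?thesis using l by (auto simp: indicator_def)
      qed
    qed
    have i3: "integrable ?M (\<lambda>x. indicator (B \<inter> A) x * pr (?k x) (ell_seq (Suc n)))"
    proof (rule borel_prob_integrable_bounded[OF M, where B="norm (ell_seq (Suc n))"])
      show "(\<lambda>x. indicator (B \<inter> A) x * pr (?k x) (ell_seq (Suc n))) \<in> borel_measurable borel" using em BAb by measurable
      show "\<bar>indicator (B \<inter> A) x * pr (?k x) (ell_seq (Suc n))\<bar> \<le> norm (ell_seq (Suc n))" for x
        using prob_abs_le[OF invariant_prob[OF erg_comp(1)[OF \<mu>]], of x "ell_seq (Suc n)"] by (auto simp: indicator_def)
    qed
    obtain C where C: "\<And>x. \<bar>Hmin n (?k x)\<bar> \<le> C" using Hmin_bounded[of n] kp by blast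
    have i4: "integrable ?M (\<lambda>x. indicator (B - A) x * Hmin n (?k x))"
    proof (rule borel_prob_integrable_bounded[OF M, where B=C])
      show "(\<lambda>x. indicator (B - A) x * Hmin n (?k x)) \<in> borel_measurable borel" using Hm BAb by measurable
      show "\<bar>indicator (B - A) x * Hmin n (?k x)\<bar> \<le> C" for x
        using C[of x] by (auto simp: indicator_def)
    qed
    have "(\<integral>x. indicator B x * (ln (?a x) - ln (?b x)) \<partial>?M) =
      (\<integral>x. indicator (B \<inter> A) x * app (ell_seq (Suc n)) x + indicator (B - A) x * (ln (a x) - ln (b x)) \<partial>?M)"
      by (intro Bochner_Integration.integral_cong) (auto simp: indicator_def apply_ell_seq)
    also have "\<dots> = (\<integral>x. indicator (B \<inter> A) x * app (ell_seq (Suc n)) x \<partial>?M) + (\<integral>x. indicator (B - A) x * (ln (a x) - ln (b x)) \<partial>?M)"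
      using i1 i2 by (rule Bochner_Integration.integral_add)
    also have "\<dots> = (\<integral>x. indicator (B \<inter> A) x * pr (?k x) (ell_seq (Suc n)) \<partial>?M) + (\<integral>x. indicator (B - A) x * Hmin n (?k x) \<partial>?M)"
      by (simp only: integral_inv_set_erg_comp[OF \<mu> BA(1)] ab(2)[OF BA(2)])
    also have "\<dots> = (\<integral>x. indicator (B \<inter> A) x * pr (?k x) (ell_seq (Suc n)) + indicator (B - A) x * Hmin n (?k x) \<partial>?M)"
      using i3 i4 by (rule Bochner_Integration.integral_add[symmetric])
    also have "\<dots> = (\<integral>x. indicator B x * Hmin (Suc n) (?k x) \<partial>?M)"
      by (intro Bochner_Integration.integral_cong) (auto simp: indicator_def A_def min_def)
    finally show ?thesis .
  qed
  with adm show ?case by (intro exI[of _ ?a] exI[of _ ?b] conjI allI impI)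
qed

lemma entropy_le_integral_Hmin:
  assumes \<mu>: "\<mu> \<in> PT"
  shows "ent \<mu> \<le> ereal (\<integral>x. Hmin n (erg_comp \<mu> x) \<partial>rep \<mu>)"
proof -
  define N where "N = (\<Sum>i\<le>n. norm (dense_fn i))"
  have N: "norm (dense_fn i) \<le> N" if "i \<le> n" for i
    unfolding N_def using that by (intro member_le_sum) auto
  have b: "exp (- N) \<le> app (expf (dense_fn i)) x \<and> app (expf (dense_fn i)) x \<le> exp N" if "i \<le> n" for i x
    using N[OF that] abs_bcontfun_le_norm[of "dense_fn i" x] by (simp add: abs_le_iff)
  have "0 \<le> N" unfolding N_def by (intro sum_nonneg) auto
  then have "exp (- N) \<le> exp N" by simp
  obtain a b where ab: "adm \<mu> (exp (- N)) (exp N) a b"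
    "\<And>B. inv_set B \<Longrightarrow> (\<integral>x. indicator B x * (ln (a x) - ln (b x)) \<partial>rep \<mu>) = (\<integral>x. indicator B x * Hmin n (erg_comp \<mu> x) \<partial>rep \<mu>)"
    using adm_Hmin[OF \<mu> exp_gt_zero \<open>exp (- N) \<le> exp N\<close> b, of n] by blast
  have "inv_set UNIV" by (simp add: inv_set_def)
  from ab(2)[OF this] have "(\<integral>x. ln (a x) - ln (b x) \<partial>rep \<mu>) = (\<integral>x. Hmin n (erg_comp \<mu> x) \<partial>rep \<mu>)" by simp
  with adm_entropy[OF \<mu> exp_gt_zero ab(1)] show ?thesis by simp
qed

text \<open>Cut off at -K the entropy is a bounded real function and can be integrated against
  Choquet measures, where the value -\<infinity> would have no meaning.\<close>

definition htr :: "real \<Rightarrow> 'a CSigma_dual \<Rightarrow> real"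
  where "htr K \<nu> = real_of_ereal (max (ent \<nu>) (ereal (- K)))"

lemma htr:
  assumes \<nu>: "\<nu> \<in> PP" and K: "0 \<le> K"
  shows "ereal (htr K \<nu>) = max (ent \<nu>) (ereal (- K))" "- K \<le> htr K \<nu>" "htr K \<nu> \<le> 0"
proof -
  show 1: "ereal (htr K \<nu>) = max (ent \<nu>) (ereal (- K))"
    using entropy_nonpos[OF \<nu>] unfolding htr_def by (cases "ent \<nu>") (auto simp: max_def)
  have "ereal (- K) \<le> ereal (htr K \<nu>)" unfolding 1 by simp
  then show "- K \<le> htr K \<nu>" by simp
  have "ereal (htr K \<nu>) \<le> 0" unfolding 1 using entropy_nonpos[OF \<nu>] K by simp
  then show "htr K \<nu> \<le> 0" by simp
qed

lemma Hmin_tendsto_htr: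
  assumes \<nu>: "\<nu> \<in> PP" and K: "0 \<le> K"
  shows "(\<lambda>n. max (Hmin n \<nu>) (- K)) \<longlonglongrightarrow> htr K \<nu>"
proof -
  have "(\<lambda>n. max (ereal (Hmin n \<nu>)) (ereal (- K))) \<longlonglongrightarrow> max (ent \<nu>) (ereal (- K))"
    by (intro tendsto_max Hmin_tendsto \<nu> tendsto_const)
  moreover have "max (ereal (Hmin n \<nu>)) (ereal (- K)) = ereal (max (Hmin n \<nu>) (- K))" for n
    by (simp add: max_def)
  ultimately have "(\<lambda>n. ereal (max (Hmin n \<nu>) (- K))) \<longlonglongrightarrow> ereal (htr K \<nu>)"
    by (simp only: htr(1)[OF \<nu> K])
  then show ?thesis by (simp only: lim_ereal)
qed

lemma measurable_htr:
  assumes "0 \<le> K"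
  shows "htr K \<in> borel_measurable inv_borel"
proof (rule borel_measurable_LIMSEQ_real)
  show "(\<lambda>n. max (Hmin n \<nu>) (- K)) \<longlonglongrightarrow> htr K \<nu>" if "\<nu> \<in> space inv_borel" for \<nu>
    using that assms by (intro Hmin_tendsto_htr invariant_prob) (simp_all add: space_inv_borel)
qed measurable

text \<open>The passage to the limit under the integral needs a lower bound for the decreasing
  \<open>Hmin n\<close>. Cutting at -K supplies it and only enlarges the right-hand side.\<close>

theorem entropy_le_choquet_integral:
  assumes \<mu>: "\<mu> \<in> PT" and K: "0 \<le> K"
  shows "ent \<mu> \<le> ereal (\<integral>\<nu>. htr K \<nu> \<partial>choquet_measure \<mu>)"
proof -
  let ?M = "rep \<mu>" let ?k = "erg_comp \<mu>"
  note M = repr_measure(1)[OF invariant_prob[OF \<mu>]]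
  have km: "?k \<in> ?M \<rightarrow>\<^sub>M inv_borel" using measurable_erg_comp[OF \<mu>] by (simp add: borel_prob_measurable[OF M])
  have kp: "?k x \<in> PP" for x by (rule invariant_prob[OF erg_comp(1)[OF \<mu>]])
  interpret prob_space ?M using M by (simp add: borel_prob_def)
  define C where "C = K + norm (ell_seq 0)"
  have Hn: "max (Hmin n (?k x)) (- K) \<le> C" for n x
    using Hmin_le[of 0 n "?k x"] prob_abs_le[OF kp, of x "ell_seq 0"] K norm_ge_zero[of "ell_seq 0"] by (simp add: C_def)
  have bd: "\<bar>max (Hmin n (?k x)) (- K)\<bar> \<le> C" for n x
    using Hn[of n x] K norm_ge_zero[of "ell_seq 0"] unfolding C_def by linarith
  have mm: "(\<lambda>x. max (Hmin n (?k x)) (- K)) \<in> borel_measurable ?M" for n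
    using km by measurable
  have lim: "(\<lambda>n. \<integral>x. max (Hmin n (?k x)) (- K) \<partial>?M) \<longlonglongrightarrow> (\<integral>x. htr K (?k x) \<partial>?M)"
  proof (rule integral_dominated_convergence[where w="\<lambda>_. C"])
    show "(\<lambda>x. htr K (?k x)) \<in> borel_measurable ?M" using measurable_compose[OF km measurable_htr[OF K]] .
    show "AE x in ?M. (\<lambda>n. max (Hmin n (?k x)) (- K)) \<longlonglongrightarrow> htr K (?k x)"
      by (intro AE_I2 Hmin_tendsto_htr kp K)
    show "AE x in ?M. norm (max (Hmin n (?k x)) (- K)) \<le> C" for n
      using bd by (intro AE_I2) simp
  qed (use mm in auto)
  have le: "ent \<mu> \<le> ereal (\<integral>x. max (Hmin n (?k x)) (- K) \<partial>?M)" for n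
  proof (cases "integrable ?M (\<lambda>x. Hmin n (?k x))")
    case True
    have "(\<integral>x. Hmin n (?k x) \<partial>?M) \<le> (\<integral>x. max (Hmin n (?k x)) (- K) \<partial>?M)"
      using mm bd by (intro integral_mono True integrable_const_bound[where B=C]) auto
    then show ?thesis using entropy_le_integral_Hmin[OF \<mu>, of n] by (meson ereal_less_eq(3) order_trans)
  next
    case False
    have "(\<lambda>x. Hmin n (?k x)) \<in> borel_measurable ?M" using km by measurable
    moreover have "\<exists>C. \<forall>x. \<bar>Hmin n (?k x)\<bar> \<le> C" using Hmin_bounded[of n] kp by blast
    ultimately have "integrable ?M (\<lambda>x. Hmin n (?k x))"
      using integrable_const_bound[of "\<lambda>x. Hmin n (?k x)"] by auto
    with False show ?thesis by simp
  qed
  have "ent \<mu> \<le> ereal (\<integral>x. htr K (?k x) \<partial>?M)"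
    by (rule LIMSEQ_le_const[OF tendsto_ereal[OF lim]]) (use le in auto)
  also have "(\<integral>x. htr K (?k x) \<partial>?M) = (\<integral>\<nu>. htr K \<nu> \<partial>choquet_measure \<mu>)"
    by (simp add: choquet_measure_eq[OF \<mu>] integral_distr[OF km measurable_htr[OF K]])
  finally show ?thesis .
qed

end

section \<open>Sandwich theorem\<close>

definition sublinear :: "('x::real_vector \<Rightarrow> real) \<Rightarrow> bool"
  where "sublinear p \<longleftrightarrow> (\<forall>x y. p (x + y) \<le> p x + p y) \<and> (\<forall>c>0. \<forall>x. p (c *\<^sub>R x) \<le> c * p x)"

lemma sublinear_zero:
  assumes "sublinear p"
  shows "p 0 = 0"
proof -
  have "p 0 \<le> 1 / 2 * p 0"
    using assms[unfolded sublinear_def, THEN conjunct2, rule_format, of "1/2" 0] by simp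
  moreover have "p 0 \<le> p 0 + p 0"
    using assms[unfolded sublinear_def, THEN conjunct1, rule_format, of 0 0] by simp
  ultimately show ?thesis by linarith
qed

text \<open>Closure of the family under sums and scaling, up to domination, makes the infimum
  sublinear; \<open>zero_le\<close>, used at x + (-x), makes it finite. The lemma serves the
  minimality argument, the bounds of chains and the sandwich functional alike.\<close>

lemma sublinear_INF:
  fixes F :: "'x::real_vector \<Rightarrow> 'i \<Rightarrow> real"
  assumes ne: "I \<noteq> {}"
    and add_ex: "\<forall>x y. \<forall>i\<in>I. \<forall>j\<in>I. \<exists>k\<in>I. F (x + y) k \<le> F x i + F y j"
    and scale_ex: "\<forall>c>0. \<forall>x. \<forall>i\<in>I. \<exists>k\<in>I. F (c *\<^sub>R x) k \<le> c * F x i"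
    and zero_le: "\<forall>i\<in>I. 0 \<le> F 0 i"
  shows "sublinear (\<lambda>x. INF i\<in>I. F x i)" and "i \<in> I \<Longrightarrow> (INF i\<in>I. F x i) \<le> F x i"
proof -
  note add = add_ex[rule_format] and scale = scale_ex[rule_format] and zero = zero_le[rule_format]
  obtain j where j: "j \<in> I" using ne by blast
  have bdd: "bdd_below (F x ` I)" for x
  proof (rule bdd_belowI2)
    fix i assume i: "i \<in> I"
    obtain k where k: "k \<in> I" "F (x + - x) k \<le> F x i + F (- x) j" using add[OF i j] by blast
    with zero[OF k(1)] show "- F (- x) j \<le> F x i" by simp
  qed
  show le: "(INF i\<in>I. F x i) \<le> F x i" if "i \<in> I" for x i
    by (rule cINF_lower[OF bdd that])
  show "sublinear (\<lambda>x. INF i\<in>I. F x i)"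
    unfolding sublinear_def
  proof (intro conjI allI impI)
    fix x y
    have "(INF i\<in>I. F (x + y) i) - F x i \<le> (INF i\<in>I. F y i)" if i: "i \<in> I" for i
    proof (rule cINF_greatest[OF ne])
      fix j assume "j \<in> I"
      then obtain k where k: "k \<in> I" "F (x + y) k \<le> F x i + F y j" using add[OF i] by blast
      then show "(INF i\<in>I. F (x + y) i) - F x i \<le> F y j" using le[OF k(1), of "x + y"] by simp
    qed
    then have "(INF i\<in>I. F (x + y) i) - (INF i\<in>I. F y i) \<le> (INF i\<in>I. F x i)"
      by (intro cINF_greatest[OF ne]) (simp add: algebra_simps)
    then show "(INF i\<in>I. F (x + y) i) \<le> (INF i\<in>I. F x i) + (INF i\<in>I. F y i)" by simp
  next
    fix c :: real and x assume c: "0 < c"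
    have "(INF i\<in>I. F (c *\<^sub>R x) i) / c \<le> (INF i\<in>I. F x i)"
    proof (rule cINF_greatest[OF ne])
      fix i assume "i \<in> I"
      then obtain k where k: "k \<in> I" "F (c *\<^sub>R x) k \<le> c * F x i" using scale[OF c] by blast
      then have "(INF i\<in>I. F (c *\<^sub>R x) i) \<le> c * F x i" using le[OF k(1), of "c *\<^sub>R x"] by simp
      then show "(INF i\<in>I. F (c *\<^sub>R x) i) / c \<le> F x i" using c by (simp add: field_simps)
    qed
    then show "(INF i\<in>I. F (c *\<^sub>R x) i) \<le> c * (INF i\<in>I. F x i)" using c by (simp add: field_simps)
  qed
qed

lemma minimal_sublinear_is_linear:
  assumes p: "sublinear p" and min: "\<And>q. sublinear q \<Longrightarrow> (\<And>x. q x \<le> p x) \<Longrightarrow> q = p"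
  shows "linear p"
proof -
  have sub: "p (x + y) \<le> p x + p y" and scale: "0 < c \<Longrightarrow> p (c *\<^sub>R x) \<le> c * p x" for x y c
    using p by (auto simp: sublinear_def)
  have scale_eq: "p (c *\<^sub>R x) = c * p x" if c: "0 < c" for c x
  proof (rule antisym)
    show "p (c *\<^sub>R x) \<le> c * p x" by (rule scale[OF c])
    have "p ((1 / c) *\<^sub>R (c *\<^sub>R x)) \<le> 1 / c * p (c *\<^sub>R x)" using c by (intro scale) simp
    then show "c * p x \<le> p (c *\<^sub>R x)" using c by (simp add: field_simps)
  qed
  have add_ge: "p x + p y \<le> p (x + y)" for x y
  proof -
    \<comment> \<open>The infimum over t \<ge> 0 is sublinear and, by t = 0, below p, so it equals p
      by minimality. The term t = 1 then yields superadditivity.\<close>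
    define F where "F x t = p (x + t *\<^sub>R y) - t * p y" for x t
    have ne: "{0::real..} \<noteq> {}" by auto
    have F1: "\<exists>k\<in>{0..}. F (x + x') k \<le> F x i + F x' j" if "i \<in> {0..}" "j \<in> {0..}" for x x' i j
    proof
      have "p ((x + i *\<^sub>R y) + (x' + j *\<^sub>R y)) \<le> p (x + i *\<^sub>R y) + p (x' + j *\<^sub>R y)" by (rule sub)
      then show "F (x + x') (i + j) \<le> F x i + F x' j" by (simp add: F_def algebra_simps)
    qed (use that in auto)
    have F2: "\<exists>k\<in>{0..}. F (c *\<^sub>R x) k \<le> c * F x i" if "0 < c" "i \<in> {0..}" for c x i
    proof
      have "p (c *\<^sub>R (x + i *\<^sub>R y)) \<le> c * p (x + i *\<^sub>R y)" by (rule scale[OF that(1)])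
      then show "F (c *\<^sub>R x) (c * i) \<le> c * F x i" by (simp add: F_def algebra_simps)
    qed (use that in auto)
    have F3: "\<forall>i\<in>{0..}. 0 \<le> F 0 i"
    proof
      fix i :: real assume "i \<in> {0..}"
      then show "0 \<le> F 0 i" using scale_eq[of i y] sublinear_zero[OF p] by (cases "i = 0") (auto simp: F_def)
    qed
    have F1': "\<forall>x x'. \<forall>i\<in>{0..}. \<forall>j\<in>{0..}. \<exists>k\<in>{0..}. F (x + x') k \<le> F x i + F x' j" by (intro allI ballI F1)
    have F2': "\<forall>c>0. \<forall>x. \<forall>i\<in>{0..}. \<exists>k\<in>{0..}. F (c *\<^sub>R x) k \<le> c * F x i" by (intro allI impI ballI F2)
    note sI = sublinear_INF[OF ne F1' F2' F3]
    have "(\<lambda>x. INF i\<in>{0..}. F x i) = p"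
    proof (rule min)
      show "sublinear (\<lambda>x. INF i\<in>{0..}. F x i)" by (rule sI(1))
      show "(INF i\<in>{0..}. F x i) \<le> p x" for x using sI(2)[of 0 x] by (simp add: F_def)
    qed
    then have "p x = (INF i\<in>{0..}. F x i)" by (rule fun_cong[symmetric])
    also have "\<dots> \<le> F x 1" by (rule sI(2)[of 1 x, OF atLeast_iff[THEN iffD2, OF zero_le_one]])
    finally show ?thesis by (simp add: F_def)
  qed
  have add: "p (x + y) = p x + p y" for x y using sub add_ge by (rule antisym)
  have neg: "p (- x) = - p x" for x using add[of x "- x"] sublinear_zero[OF p] by simp
  show ?thesis
  proof (rule linearI)
    show "p (c *\<^sub>R x) = c *\<^sub>R p x" for c x
    proof (cases "0 < c")
      case False
      then show ?thesis
        using scale_eq[of "- c" x] neg[of "c *\<^sub>R x"] sublinear_zero[OF p] by (cases "c = 0") auto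
    qed (simp add: scale_eq)
  qed (rule add)
qed

text \<open>Zorn's lemma on the sublinear functionals below q, ordered downwards: a chain is bounded
  by its pointwise infimum, and a minimal element is linear.\<close>

lemma linear_below_sublinear:
  fixes q :: "'x::real_vector \<Rightarrow> real"
  assumes q: "sublinear q"
  shows "\<exists>l. linear l \<and> (\<forall>x. l x \<le> q x)"
proof -
  define A where "A = {p. sublinear p \<and> (\<forall>x. p x \<le> q x)}"
  define R where "R p p' \<longleftrightarrow> (\<forall>x. p' x \<le> p x)" for p p' :: "'x \<Rightarrow> real"
  have "\<exists>m\<in>A. \<forall>p\<in>A. R m p \<longrightarrow> p = m"
  proof (rule predicate_Zorn)
    show "partial_order_on A (relation_of R A)"
    proof (rule partial_order_on_relation_ofI)
      show "R a b \<Longrightarrow> R b c \<Longrightarrow> R a c" for a b c unfolding R_def by (meson order_trans)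
      show "R a b \<Longrightarrow> R b a \<Longrightarrow> a = b" for a b unfolding R_def by (intro ext antisym) auto
    qed (simp add: R_def)
    fix C assume C: "C \<in> Chains (relation_of R A)"
    have CA: "p \<in> A" if "p \<in> C" for p using C that unfolding Chains_def relation_of_def by auto
    have lin: "R p p' \<or> R p' p" if "p \<in> C" "p' \<in> C" for p p'
      using C that unfolding Chains_def relation_of_def by blast
    show "\<exists>u\<in>A. \<forall>a\<in>C. R a u"
    proof (cases "C = {}")
      case True
      then show ?thesis using q by (auto simp: A_def)
    next
      case False
      have F1: "\<exists>k\<in>C. k (x + y) \<le> i x + j y" if "i \<in> C" "j \<in> C" for x y i j
      proof -
        have sub: "i (x + y) \<le> i x + i y" "j (x + y) \<le> j x + j y"
          using CA that by (auto simp: A_def sublinear_def)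
        show ?thesis using lin[OF that]
        proof
          assume "R i j"
          then have "j x \<le> i x" by (simp add: R_def)
          then show ?thesis using sub that by (intro bexI[of _ j]) auto
        next
          assume "R j i"
          then have "i y \<le> j y" by (simp add: R_def)
          then show ?thesis using sub that by (intro bexI[of _ i]) auto
        qed
      qed
      have F2: "\<exists>k\<in>C. k (c *\<^sub>R x) \<le> c * i x" if "0 < c" "i \<in> C" for c x i
        using CA[OF that(2)] that by (intro bexI[of _ i]) (auto simp: A_def sublinear_def)
      have F3: "0 \<le> i 0" if "i \<in> C" for i using CA[OF that] by (simp add: A_def sublinear_zero)
      have sI1: "sublinear (\<lambda>x. INF p\<in>C. p x)"
        by (rule sublinear_INF(1)[of C "\<lambda>x p. p x"]) (intro False allI impI ballI F1 F2 F3; assumption)+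
      have sI2: "(INF p\<in>C. p x) \<le> a x" if "a \<in> C" for a x
        by (rule sublinear_INF(2)[of C "\<lambda>x p. p x", OF False _ _ _ that]) (intro allI impI ballI F1 F2 F3; assumption)+
      have "R a (\<lambda>x. INF p\<in>C. p x)" if "a \<in> C" for a
        unfolding R_def using sI2[OF that] by blast
      moreover have "(\<lambda>x. INF p\<in>C. p x) \<in> A"
      proof -
        obtain p where p: "p \<in> C" using False by blast
        have "(INF p\<in>C. p x) \<le> q x" for x
          using sI2[OF p, of x] CA[OF p] by (auto simp: A_def intro: order_trans)
        then show ?thesis using sI1 by (simp add: A_def)
      qed
      ultimately show ?thesis by (intro bexI[of _ "\<lambda>x. INF p\<in>C. p x"]) simp_all
    qed
  qed
  then obtain l where l: "l \<in> A" "\<And>p. p \<in> A \<Longrightarrow> R l p \<Longrightarrow> p = l" by blast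
  have "linear l"
  proof (rule minimal_sublinear_is_linear)
    show "sublinear l" using l(1) by (simp add: A_def)
    show "p = l" if "sublinear p" "\<And>x. p x \<le> l x" for p
    proof (rule l(2))
      show "p \<in> A" using that l(1) unfolding A_def by (auto intro: order_trans)
      show "R l p" using that(2) by (simp add: R_def)
    qed
  qed
  with l(1) show ?thesis by (auto simp: A_def)
qed

text \<open>\<open>G\<close> plays the role of the hypograph of a concave function below p. The gap
  is made homogeneous: a times the difference of p(w + z/a) and t, minimised over a > 0 and the
  points (w, t) of \<open>G\<close>, is sublinear in z. A linear functional below it is the common
  slope.\<close>

theorem convex_concave_sandwich:
  fixes p :: "'x::real_normed_vector \<Rightarrow> real" and G :: "('x \<times> real) set"
  assumes G: "convex G" "G \<noteq> {}" and cv: "convex_on UNIV p" and ct: "continuous_on UNIV p"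
    and le: "\<And>w t. (w, t) \<in> G \<Longrightarrow> t \<le> p w"
  shows "\<exists>(x :: 'x \<Rightarrow>\<^sub>L real) c. (\<forall>w t. (w, t) \<in> G \<longrightarrow> t \<le> pr x w + c) \<and>
    (\<forall>z. pr x z + c \<le> p z)"
proof -
  define F where "F z k = fst k * (p (fst (snd k) + (1 / fst k) *\<^sub>R z) - snd (snd k))" for z and k :: "real \<times> 'x \<times> real"
  define I where "I = {0::real<..} \<times> G"
  obtain w0 t0 where wt0: "(w0, t0) \<in> G" using G(2) by auto
  have ne: "I \<noteq> {}" using wt0 by (auto simp: I_def intro: exI[of _ "1::real"])
  have F1: "\<exists>k\<in>I. F (x + y) k \<le> F x i + F y j" if ij: "i \<in> I" "j \<in> I" for x y :: 'x and i j
  proof -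
    obtain a w t b w' t' where i: "i = (a, w, t)" and j: "j = (b, w', t')" by (metis prod.exhaust)
    have ab: "a > 0" "b > 0" and g: "(w, t) \<in> G" "(w', t') \<in> G" using ij by (auto simp: I_def i j)
    define s where "s = a + b"
    have s: "s > 0" "a / s + b / s = 1" "0 \<le> a / s" "0 \<le> b / s"
      using ab by (auto simp: s_def add_divide_distrib[symmetric])
    define W where "W = (a / s) *\<^sub>R w + (b / s) *\<^sub>R w'"
    define T where "T = (a / s) * t + (b / s) * t'"
    have WT: "(W, T) \<in> G" using convexD[OF G(1) g s(3,4,2)] by (simp add: W_def T_def)
    have "(a / s) *\<^sub>R (w + (1 / a) *\<^sub>R x) + (b / s) *\<^sub>R (w' + (1 / b) *\<^sub>R y) = W + (1 / s) *\<^sub>R (x + y)"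
      using ab by (simp add: W_def algebra_simps)
    moreover have "p ((a / s) *\<^sub>R (w + (1 / a) *\<^sub>R x) + (b / s) *\<^sub>R (w' + (1 / b) *\<^sub>R y))
      \<le> (a / s) * p (w + (1 / a) *\<^sub>R x) + (b / s) * p (w' + (1 / b) *\<^sub>R y)"
      using cv s unfolding convex_on_def by blast
    ultimately have "s * p (W + (1 / s) *\<^sub>R (x + y)) \<le> s * ((a / s) * p (w + (1 / a) *\<^sub>R x) + (b / s) * p (w' + (1 / b) *\<^sub>R y))"
      using s(1) by (intro mult_left_mono) auto
    moreover have "s * T = a * t + b * t'" using s(1) by (simp add: T_def algebra_simps)
    moreover have "s * ((a / s) * p (w + (1 / a) *\<^sub>R x) + (b / s) * p (w' + (1 / b) *\<^sub>R y)) = a * p (w + (1 / a) *\<^sub>R x) + b * p (w' + (1 / b) *\<^sub>R y)"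
      using s(1) by (simp add: algebra_simps)
    ultimately have "F (x + y) (s, W, T) \<le> F x i + F y j"
      by (simp add: F_def i j right_diff_distrib)
    then show ?thesis using s(1) WT by (intro bexI[of _ "(s, W, T)"]) (auto simp: I_def)
  qed
  have F2: "\<exists>k\<in>I. F (c *\<^sub>R x) k \<le> c * F x i" if "0 < c" "i \<in> I" for c and x :: 'x and i
  proof (rule bexI)
    show "F (c *\<^sub>R x) (c * fst i, snd i) \<le> c * F x i" using that(1) by (simp add: F_def)
    show "(c * fst i, snd i) \<in> I" using that by (auto simp: I_def)
  qed
  have F3: "\<forall>i\<in>I. 0 \<le> F (0 :: 'x) i" using le by (auto simp: F_def I_def)
  have F1': "\<forall>x y. \<forall>i\<in>I. \<forall>j\<in>I. \<exists>k\<in>I. F (x + y) k \<le> F x i + F y j" by (intro allI ballI F1)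
  have F2': "\<forall>c>0. \<forall>x. \<forall>i\<in>I. \<exists>k\<in>I. F (c *\<^sub>R x) k \<le> c * F x i" by (intro allI impI ballI F2)
  note sI = sublinear_INF[OF ne F1' F2' F3]
  obtain l where l: "linear l" "\<And>z. l z \<le> (INF i\<in>I. F z i)" using linear_below_sublinear[OF sI(1)] by blast
  have key: "l z \<le> p (w + z) - t" if "(w, t) \<in> G" for z w t
  proof -
    have "l z \<le> F z (1, w, t)"
      using l(2)[of z] sI(2)[of "(1, w, t)" z] that by (auto simp: I_def intro: order_trans)
    then show ?thesis by (simp add: F_def)
  qed
  have bl: "bounded_linear l"
  proof -
    \<comment> \<open>Continuity of p at one point \<open>w0\<close> bounds l from above on a ball,
      and linearity turns this into a bound on the norm.\<close>
    obtain d where d: "d > 0" "\<And>z. dist z w0 < d \<Longrightarrow> dist (p z) (p w0) < 1"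
      using ct[unfolded continuous_on_iff, rule_format, of w0 1] by auto
    define B where "B = p w0 + 1 - t0"
    have B: "l z \<le> B" if "norm z < d" for z
      using key[OF wt0, of z] d(2)[of "w0 + z"] that by (auto simp: dist_norm B_def)
    have K: "\<bar>l z\<bar> \<le> norm z * (2 * B / d)" for z
    proof (cases "z = 0")
      case True
      then show ?thesis using linear_0[OF l(1)] by simp
    next
      case False
      define c where "c = d / (2 * norm z)"
      have c: "c > 0" using d(1) False by (simp add: c_def)
      have "norm (c *\<^sub>R z) < d" using d(1) False by (simp add: c_def)
      then have "c * l z \<le> B" "- (c * l z) \<le> B"
        using B[of "c *\<^sub>R z"] B[of "- (c *\<^sub>R z)"] by (simp_all add: linear_scale[OF l(1)] linear_neg[OF l(1)])
      then have "c * \<bar>l z\<bar> \<le> B" by (simp add: abs_if)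
      then have "\<bar>l z\<bar> \<le> B / c" using c by (simp add: field_simps)
      also have "\<dots> = norm z * (2 * B / d)" using d(1) False by (simp add: c_def)
      finally show ?thesis .
    qed
    show ?thesis
      by (rule bounded_linear_intro[where K="2 * B / d"]) (use K in \<open>simp_all add: linear_add[OF l(1)] linear_scale[OF l(1)]\<close>)
  qed
  define x where "x = Blinfun l"
  have x: "pr x = l" unfolding x_def by (rule bounded_linear_Blinfun_apply[OF bl])
  \<comment> \<open>Every t - l w is below every p z - l z, so the supremum of the former is an
    intercept that lies between the two.\<close>
  define c where "c = (SUP g\<in>G. snd g - l (fst g))"
  have up: "t - l w \<le> p z - l z" if "(w, t) \<in> G" for w t z
    using key[OF that, of "z - w"] by (simp add: linear_diff[OF l(1)])
  have bdd: "bdd_above ((\<lambda>g. snd g - l (fst g)) ` G)"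
    by (rule bdd_aboveI2[where M="p 0 - l 0"]) (use up[of _ _ 0] in auto)
  have 1: "t \<le> l w + c" if "(w, t) \<in> G" for w t
    using cSUP_upper[OF that bdd] by (simp add: c_def)
  have 2: "l z + c \<le> p z" for z
  proof -
    have "c \<le> p z - l z" unfolding c_def by (rule cSUP_least[OF G(2)]) (use up[of _ _ z] in auto)
    then show ?thesis by simp
  qed
  show ?thesis using 1 2 by (intro exI[of _ x] exI[of _ c]) (simp add: x)
qed

lemma subgradient_exists:
  fixes p :: "'x::real_normed_vector \<Rightarrow> real"
  assumes "convex_on UNIV p" "continuous_on UNIV p"
  shows "\<exists>x :: 'x \<Rightarrow>\<^sub>L real. \<forall>z. p w + (pr x z - pr x w) \<le> p z"
proof -
  obtain x :: "'x \<Rightarrow>\<^sub>L real" and c where x: "p w \<le> pr x w + c" "\<And>z. pr x z + c \<le> p z"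
    using convex_concave_sandwich[of "{(w, p w)}", OF convex_singleton _ assms] by auto
  have "p w + (pr x z - pr x w) \<le> p z" for z
    using x(1) x(2)[of z] by linarith
  then show ?thesis by blast
qed

section \<open>The potentials induced by the self-interactions\<close>

lemma to_MS_combination:
  fixes \<mu> \<nu> :: "'a::metric_space CSigma_dual"
  shows "to_MS (a *\<^sub>R \<mu> + b *\<^sub>R \<nu>) = a *\<^sub>R to_MS \<mu> + b *\<^sub>R to_MS \<nu>"
  by (rule bmeas_eqI)
    (simp add: apply_to_MS plus_bmeas.rep_eq scaleR_bmeas.rep_eq blinfun.add_left blinfun.scaleR_left)

context symbolic_space
begin

lemma theta_combination:
  assumes "linear \<theta>"
  shows "\<theta> (to_MS (a *\<^sub>R \<mu> + b *\<^sub>R \<nu>)) = a *\<^sub>R \<theta> (to_MS \<mu>) + b *\<^sub>R \<theta> (to_MS (\<nu> :: 'a CSigma_dual))"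
  by (simp add: to_MS_combination linear_add[OF assms] linear_scale[OF assms])

text \<open>Probability functionals give elements of norm at most 1, and weak* convergence is
  pointwise convergence on the unit ball; this is the convergence for which
  \<open>sigma_normal\<close> is stated.\<close>

lemma theta_wlim:
  fixes u :: "nat \<Rightarrow> 'a CSigma_dual"
  assumes \<theta>: "sigma_normal \<theta>" and u: "\<And>n. u n \<in> PP" "wlim u \<mu>"
  shows "(\<lambda>n. \<theta> (to_MS (u n))) \<longlonglongrightarrow> \<theta> (to_MS \<mu>)"
proof -
  have "norm (to_MS (u n)) \<le> 1" for n
    unfolding norm_bmeas_def
  proof (rule cSUP_least)
    fix f :: "'a CSigma unit_ball"
    show "\<bar>apply_bmeas (to_MS (u n)) f\<bar> \<le> 1"
      using prob_abs_le[OF u(1), of n "ball_vec f"] ball_vec[of f] by (simp add: apply_to_MS)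
  qed simp
  then have "bounded (range (\<lambda>n. to_MS (u n)))" by (auto simp: bounded_iff)
  moreover have "\<forall>s. (\<lambda>n. apply_bmeas (to_MS (u n)) s) \<longlonglongrightarrow> apply_bmeas (to_MS \<mu>) s"
    using u(2) by (simp add: apply_to_MS wlim_def)
  ultimately show ?thesis using \<theta> unfolding sigma_normal_def by blast
qed

definition dirac :: "(nat \<Rightarrow> 'a) \<Rightarrow> 'a CSigma_dual"
  where "dirac x = func_of (return borel x)"

lemma borel_prob_return: "borel_prob (return borel (x :: nat \<Rightarrow> 'a))"
  by (simp add: borel_prob_def prob_space_return)

lemma dirac_prob: "dirac x \<in> PP"
  unfolding dirac_def by (rule func_of_prob[OF borel_prob_return])

lemma apply_dirac: "pr (dirac x) f = app f x"
  unfolding dirac_def apply_func_of[OF borel_prob_return]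
  by (rule integral_return) simp_all

text \<open>The only candidate is read off at point masses. The probability functionals at which it
  is correct form a weak*-closed convex set containing all point masses. A function separating some
  \<mu> from this set would be at most c at every point and yet have integral above c.\<close>

lemma Theta:
  fixes \<theta>m :: "'a MS \<Rightarrow> 'x::real_normed_vector" and \<theta>p :: "'a MS \<Rightarrow> 'y::real_normed_vector"
  assumes lin: "linear \<theta>m" "linear \<theta>p" and sn: "sigma_normal \<theta>m" "sigma_normal \<theta>p"
    and \<mu>: "\<mu> \<in> PP"
  shows "pr \<mu> (Theta \<theta>m \<theta>p ym yp) = pr yp (\<theta>p (to_MS \<mu>)) - pr ym (\<theta>m (to_MS \<mu>))"
proof -
  define L where "L \<mu> = pr yp (\<theta>p (to_MS \<mu>)) - pr ym (\<theta>m (to_MS \<mu>))" for \<mu> :: "'a CSigma_dual"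
  have L_comb: "L (a *\<^sub>R \<mu> + b *\<^sub>R \<nu>) = a * L \<mu> + b * L \<nu>" for a b \<mu> \<nu>
    by (simp add: L_def theta_combination lin blinfun.add_right blinfun.scaleR_right algebra_simps)
  have L_wlim: "(\<lambda>n. L (u n)) \<longlonglongrightarrow> L \<nu>" if "\<And>n. u n \<in> PP" "wlim u \<nu>" for u \<nu>
    unfolding L_def using that sn by (intro tendsto_diff blinfun.tendsto theta_wlim tendsto_const)
  have "continuous_on UNIV (\<lambda>z. L (dirac z))"
  proof (rule continuous_on_sequentiallyI)
    fix s :: "nat \<Rightarrow> nat \<Rightarrow> 'a" and z assume s: "s \<longlonglongrightarrow> z"
    show "(\<lambda>n. L (dirac (s n))) \<longlonglongrightarrow> L (dirac z)"
    proof (rule L_wlim)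
      show "wlim (\<lambda>n. dirac (s n)) (dirac z)"
        unfolding wlim_def apply_dirac
        by (intro allI continuous_on_tendsto_compose[OF continuous_on_apply_bcontfun s UNIV_I]) simp
    qed (rule dirac_prob)
  qed
  note ap = apply_Bcontfun_Sigma[OF this]
  define \<Theta> :: "'a CSigma" where "\<Theta> = Bcontfun (\<lambda>z. L (dirac z))"
  have L_dirac: "L (dirac z) = app \<Theta> z" for z by (simp add: \<Theta>_def ap)
  define K where "K = {\<nu> \<in> PP. L \<nu> = pr \<nu> \<Theta>}"
  have dK: "dirac z \<in> K" for z by (simp add: K_def dirac_prob L_dirac apply_dirac)
  have all: "\<mu> \<in> K" if \<mu>: "\<mu> \<in> PP" for \<mu>
  proof (rule ccontr)
    assume not: "\<mu> \<notin> K"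
    have K1: "K \<subseteq> PP" by (auto simp: K_def)
    have K2: "convex K"
      using prob_convex unfolding convex_def K_def by (auto simp: L_comb blinfun.add_left blinfun.scaleR_left)
    have K3: "K \<noteq> {}" using dK by blast
    have K4: "\<nu> \<in> K" if u: "\<And>n. u n \<in> K" "wlim u \<nu>" for u \<nu>
    proof -
      have up: "\<And>n. u n \<in> PP" and ue: "\<And>n. L (u n) = pr (u n) \<Theta>"
        using u(1) by (auto simp: K_def)
      have "(\<lambda>n. pr (u n) \<Theta>) \<longlonglongrightarrow> L \<nu>" using L_wlim[OF up u(2)] by (simp add: ue)
      moreover have "(\<lambda>n. pr (u n) \<Theta>) \<longlonglongrightarrow> pr \<nu> \<Theta>" using u(2) by (simp add: wlim_def)
      ultimately have "L \<nu> = pr \<nu> \<Theta>" by (rule LIMSEQ_unique)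
      then show ?thesis using prob_closed[OF up u(2)] by (simp add: K_def)
    qed
    have "\<exists>f c. (\<forall>\<nu>\<in>K. pr \<nu> f \<le> c) \<and> c < pr \<mu> f"
      by (rule weak_star_separation[OF K1 K2 K3 _ not]) (use K4 in blast)
    then obtain f c where f: "\<And>\<nu>. \<nu> \<in> K \<Longrightarrow> pr \<nu> f \<le> c" "c < pr \<mu> f" by blast
    have "pr \<mu> f \<le> pr \<mu> (cst c)"
      using f(1)[OF dK] by (intro prob_mono \<mu>) (simp add: apply_dirac const_bcontfun.rep_eq)
    then show False using f(2) prob_const[OF \<mu>] by simp
  qed
  have "Theta \<theta>m \<theta>p ym yp = \<Theta>"
    unfolding Theta_def
  proof (rule the_equality)
    show "\<forall>\<mu>\<in>PP. pr yp (\<theta>p (to_MS \<mu>)) - pr ym (\<theta>m (to_MS \<mu>)) = pr \<mu> \<Theta>"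
      using all by (simp add: K_def L_def)
    fix \<Psi> assume \<Psi>: "\<forall>\<mu>\<in>PP. pr yp (\<theta>p (to_MS \<mu>)) - pr ym (\<theta>m (to_MS \<mu>)) = pr \<mu> \<Psi>"
    show "\<Psi> = \<Theta>"
    proof (rule bcontfun_eqI)
      fix z
      show "app \<Psi> z = app \<Theta> z"
        using \<Psi>[rule_format, OF dirac_prob, of z] L_dirac[of z] by (simp add: apply_dirac L_def)
    qed
  qed
  then show ?thesis using all[OF \<mu>] by (simp add: K_def L_def)
qed

end

section \<open>The variational problems\<close>

context symbolic_space
begin

lemma is_choquet_choquet_measure:
  "\<mu> \<in> PT \<Longrightarrow> is_choquet_measure \<mu> (choquet_measure \<mu>)" for \<mu> :: "'a CSigma_dual"
  by (simp add: choquet_measure_eq is_choquet_erg_comp)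

lemma wlim_continuous_bounded:
  fixes g :: "'a CSigma_dual \<Rightarrow> real"
  assumes g: "\<And>u \<mu>. (\<And>n. u n \<in> PT) \<Longrightarrow> wlim u \<mu> \<Longrightarrow> (\<lambda>n. g (u n)) \<longlonglongrightarrow> g \<mu>"
  shows "\<exists>B>0. \<forall>\<nu>\<in>PT. \<bar>g \<nu>\<bar> \<le> B"
proof (rule ccontr)
  assume *: "\<not> ?thesis"
  have "\<forall>n. \<exists>\<nu>. \<nu> \<in> PT \<and> real (Suc n) < \<bar>g \<nu>\<bar>"
  proof (rule allI, rule ccontr)
    fix n
    assume "\<not> (\<exists>\<nu>. \<nu> \<in> PT \<and> real (Suc n) < \<bar>g \<nu>\<bar>)"
    then have "\<exists>B>0. \<forall>\<nu>\<in>PT. \<bar>g \<nu>\<bar> \<le> B"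
      by (intro exI[of _ "real (Suc n)"]) (auto simp: not_less)
    with * show False by simp
  qed
  from choice[OF this] obtain u :: "nat \<Rightarrow> 'a CSigma_dual"
    where u: "\<And>n. u n \<in> PT" "\<And>n. real (Suc n) < \<bar>g (u n)\<bar>" by blast
  obtain r \<mu> where r: "strict_mono (r :: nat \<Rightarrow> nat)" "\<mu> \<in> PT" "wlim (\<lambda>n. u (r n)) \<mu>"
    using that by (rule invariant_seq_compact[OF u(1)])
  have "(\<lambda>n. g (u (r n))) \<longlonglongrightarrow> g \<mu>" by (rule g[OF u(1) r(3)])
  then have "Bseq (\<lambda>n. g (u (r n)))" by (rule convergentI[THEN convergent_imp_Bseq])
  then obtain B where B: "\<And>n. \<bar>g (u (r n))\<bar> \<le> B" by (auto simp: Bseq_def)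
  obtain n where "B < real n" using reals_Archimedean2 by blast
  moreover have "n \<le> r n" by (rule seq_suble[OF r(1)])
  ultimately show False using u(2)[of "r n"] B[of n] by simp
qed

lemma choquet_integrable:
  fixes g :: "'a CSigma_dual \<Rightarrow> real"
  assumes \<mu>: "\<mu> \<in> PT" and g: "g \<in> borel_measurable inv_borel"
    and B: "\<And>\<nu>. \<nu> \<in> PT \<Longrightarrow> \<bar>g \<nu>\<bar> \<le> B"
  shows "integrable (choquet_measure \<mu>) g"
proof -
  note ch = choquet_props[OF is_choquet_choquet_measure[OF \<mu>]]
  interpret prob_space "choquet_measure \<mu>" by (rule ch(1))
  show ?thesis
  proof (rule integrable_const_bound)
    show "AE \<nu> in choquet_measure \<mu>. norm (g \<nu>) \<le> B" using B ch(3) by (intro AE_I2) auto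
    show "g \<in> borel_measurable (choquet_measure \<mu>)" using g measurable_cong_sets[OF ch(2) refl] by blast
  qed
qed

lemma choquet_measure_ergodic:
  assumes \<nu>: "\<nu> \<in> PE"
  shows "choquet_measure \<nu> = return inv_borel (\<nu> :: 'a CSigma_dual)"
proof (rule choquet_measureI)
  have \<nu>i: "\<nu> \<in> space inv_borel" using \<nu> by (simp add: space_inv_borel ergodic_functionals_def)
  show "is_choquet_measure \<nu> (return inv_borel \<nu>)"
    unfolding is_choquet_measure_def
  proof (intro conjI allI)
    show "prob_space (return inv_borel \<nu>)" by (rule prob_space_return[OF \<nu>i])
    show "emeasure (return inv_borel \<nu>) PE = 1"
      using \<nu> by (simp add: emeasure_return[OF ergodic_measurable])
    show "pr \<nu> f = (\<integral>\<nu>. pr \<nu> f \<partial>return inv_borel \<nu>)" for f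
      by (rule integral_return[symmetric, OF \<nu>i measurable_eval])
  qed (simp_all add: space_inv_borel[unfolded inv_borel_def] inv_borel_def)
qed

text \<open>For the potential 0 the g-measure is the Bernoulli measure with marginal m, and its
  entropy is 0.\<close>

lemma finite_entropy_exists: "\<exists>\<mu>\<in>PT. ent (\<mu> :: 'a CSigma_dual) \<noteq> - \<infinity>"
proof -
  have e: "expf (0 :: 'a CSigma) = cst 1" by (rule bcontfun_eqI) (simp add: const_bcontfun.rep_eq)
  interpret holder_exponent m \<eta> 1 by standard auto
  interpret g_function m \<eta> 1 0 0 by standard (simp_all add: e transfer_op_const)
  have "ereal 0 \<le> ent g_measure" using entropy_g_measure by (simp add: blinfun.zero_right)
  then have "ent g_measure \<noteq> - \<infinity>" by auto
  with g_measure_invariant show ?thesis by blast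
qed

end

section \<open>The variational problem for an abstract weak*-continuous interaction\<close>

locale variational = symbolic_space m \<eta> for m :: "'a::metric_space measure" and \<eta> +
  fixes f :: "'a CSigma_dual \<Rightarrow> real"
  assumes f_wlim: "(\<And>n. u n \<in> PT) \<Longrightarrow> wlim u \<mu> \<Longrightarrow> (\<lambda>n. f (u n)) \<longlonglongrightarrow> f \<mu>"
begin

definition pres :: "'a CSigma_dual \<Rightarrow> ereal"
  where "pres \<nu> = ent \<nu> + ereal (f \<nu>)"

definition fint :: "'a CSigma_dual \<Rightarrow> real"
  where "fint \<mu> = (\<integral>\<nu>. f \<nu> \<partial>choquet_measure \<mu>)"

definition flat :: "'a CSigma_dual \<Rightarrow> ereal"
  where "flat \<mu> = ereal (fint \<mu>) + ent \<mu>"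

definition fbound :: real
  where "fbound = (SOME B. B > 0 \<and> (\<forall>\<nu>\<in>PT. \<bar>f \<nu>\<bar> \<le> B))"

lemma fbound: "0 < fbound" "\<nu> \<in> PT \<Longrightarrow> \<bar>f \<nu>\<bar> \<le> fbound"
proof -
  have "\<exists>B>0. \<forall>\<nu>\<in>PT. \<bar>f \<nu>\<bar> \<le> B"
    by (rule wlim_continuous_bounded) (rule f_wlim)
  from someI_ex[OF this] show "0 < fbound" "\<nu> \<in> PT \<Longrightarrow> \<bar>f \<nu>\<bar> \<le> fbound"
    by (auto simp: fbound_def)
qed

lemma f_measurable [measurable]: "f \<in> borel_measurable inv_borel"
  by (rule seq_continuous_measurable) (rule f_wlim)

lemma pres_usc:
  assumes u: "\<And>n. u n \<in> PT" "wlim u \<mu>" and l: "(\<lambda>n. pres (u n)) \<longlonglongrightarrow> l"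
  shows "l \<le> pres \<mu>"
proof -
  have fl: "(\<lambda>n. ereal (- f (u n))) \<longlonglongrightarrow> ereal (- f \<mu>)"
    by (intro tendsto_ereal tendsto_minus f_wlim u)
  have "(\<lambda>n. pres (u n) + ereal (- f (u n))) \<longlonglongrightarrow> l + ereal (- f \<mu>)"
    by (intro tendsto_add_ereal_general1 l fl) auto
  moreover have "pres \<nu> + ereal (- f \<nu>) = ent \<nu>" for \<nu>
    unfolding pres_def by (cases "ent \<nu>") auto
  ultimately have "(\<lambda>n. ent (u n)) \<longlonglongrightarrow> l + ereal (- f \<mu>)" by simp
  then have "l + ereal (- f \<mu>) \<le> ent \<mu>"
    by (rule entropy_usc[OF invariant_prob[OF u(1)] u(2)])
  then show ?thesis unfolding pres_def by (cases l; cases "ent \<mu>") auto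
qed

text \<open>Upper semicontinuity and compactness give a maximiser. Its value is real:
  \<open>finite_entropy_exists\<close> excludes -\<infinity>, and nonpositive entropy excludes
  \<infinity>.\<close>

lemma pres_max_exists:
  "\<exists>s. (\<forall>\<nu>\<in>PT. pres \<nu> \<le> ereal s) \<and> (\<exists>\<nu>\<in>PT. pres \<nu> = ereal s)"
proof -
  obtain \<mu>0 where \<mu>0: "\<mu>0 \<in> PT" "ent \<mu>0 \<noteq> - \<infinity>"
    using finite_entropy_exists by blast
  obtain \<mu> where \<mu>: "\<mu> \<in> PT" "\<And>\<nu>. \<nu> \<in> PT \<Longrightarrow> pres \<nu> \<le> pres \<mu>"
  proof (rule usc_attains_max[of invariant_functionals pres])
    show "PT \<noteq> ({} :: 'a CSigma_dual set)" using \<mu>0 by blast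
    show "\<exists>r \<mu>. strict_mono (r :: nat \<Rightarrow> nat) \<and> \<mu> \<in> PT \<and> wlim (\<lambda>n. u (r n)) \<mu>"
      if "\<And>n. u n \<in> PT" for u :: "nat \<Rightarrow> 'a CSigma_dual"
      by (rule invariant_seq_compact_ex[OF that])
    show "l \<le> pres \<mu>" if "\<And>n. u n \<in> PT" "wlim u \<mu>" "(\<lambda>n. pres (u n)) \<longlonglongrightarrow> l" for u \<mu> l
      by (rule pres_usc[OF that])
  qed (rule that)
  have "pres \<mu>0 \<noteq> - \<infinity>" using \<mu>0(2) by (cases "ent \<mu>0") (auto simp: pres_def)
  then have "pres \<mu> \<noteq> - \<infinity>" using \<mu>(2)[OF \<mu>0(1)] by auto
  moreover have "pres \<mu> \<noteq> \<infinity>"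
    using entropy_nonpos[OF invariant_prob[OF \<mu>(1)]] by (cases "ent \<mu>") (auto simp: pres_def)
  ultimately obtain s where "pres \<mu> = ereal s" by (cases "pres \<mu>") auto
  with \<mu> show ?thesis by (intro exI[of _ s] conjI ballI bexI[of _ \<mu>]) auto
qed

definition smax :: real
  where "smax = (SOME s. (\<forall>\<nu>\<in>PT. pres \<nu> \<le> ereal s) \<and> (\<exists>\<nu>\<in>PT. pres \<nu> = ereal s))"

lemma smax: "\<nu> \<in> PT \<Longrightarrow> pres \<nu> \<le> ereal smax" "\<exists>\<nu>\<in>PT. pres \<nu> = ereal smax"
  using someI_ex[OF pres_max_exists] unfolding smax_def[symmetric] by blast+

definition MP :: "'a CSigma_dual set"
  where "MP = {\<nu> \<in> PT. pres \<nu> = ereal smax}"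

lemma MP_closed:
  assumes u: "\<And>n. u n \<in> PT" "wlim u \<mu>" "(\<lambda>n. pres (u n)) \<longlonglongrightarrow> ereal smax"
  shows "\<mu> \<in> MP"
proof -
  have \<mu>: "\<mu> \<in> PT" by (rule invariant_closed[OF u(1,2)])
  have "ereal smax \<le> pres \<mu>" by (rule pres_usc[OF u])
  with smax(1)[OF \<mu>] \<mu> show ?thesis by (simp add: MP_def antisym)
qed

lemma MP_inv: "MP \<subseteq> PT" by (auto simp: MP_def)

lemma MP_seq_closed:
  assumes "\<And>n. u n \<in> MP" "wlim u \<mu>"
  shows "\<mu> \<in> MP"
  by (rule MP_closed) (use assms in \<open>auto simp: MP_def\<close>)

lemma Sup_pres: "Sup (pres ` PT) = ereal smax"
proof (rule antisym)
  show "Sup (pres ` PT) \<le> ereal smax" by (rule SUP_least) (rule smax(1))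
  obtain \<nu> where "\<nu> \<in> PT" "pres \<nu> = ereal smax" using smax(2) by blast
  then show "ereal smax \<le> Sup (pres ` PT)" by (metis SUP_upper)
qed

lemma generalized_maximizers_pres: "generalized_maximizers pres = MP"
proof (intro equalityI subsetI)
  fix \<mu> assume "\<mu> \<in> generalized_maximizers pres"
  then obtain u where "\<And>n. u n \<in> PT" "wlim u \<mu>" "(\<lambda>n. pres (u n)) \<longlonglongrightarrow> ereal smax"
    by (auto simp: generalized_maximizers_def limitin_weak_star_iff Sup_pres)
  then show "\<mu> \<in> MP" by (rule MP_closed)
next
  fix \<mu> assume "\<mu> \<in> MP"
  then show "\<mu> \<in> generalized_maximizers pres"
    unfolding generalized_maximizers_def limitin_weak_star_iff Sup_pres
    by (auto simp: MP_def intro!: exI[of _ "\<lambda>_. \<mu>"] wlim_const)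
qed

text \<open>Truncating the entropy far below the relevant level makes the pressure a bounded function
  without changing it near its maximum.\<close>

definition trlevel :: real
  where "trlevel = max 0 (fbound - smax + 1)"

definition trunc :: "'a CSigma_dual \<Rightarrow> real"
  where "trunc \<nu> = f \<nu> + htr trlevel \<nu>"

lemma trlevel: "0 \<le> trlevel" "fbound - smax + 1 \<le> trlevel"
  by (simp_all add: trlevel_def)

text \<open>A truncated pressure above smax - 1 forces the truncated entropy above smax - 1 -
  fbound, which is at least -trlevel; the truncation is then inactive.\<close>

lemma trunc_pres:
  assumes \<nu>: "\<nu> \<in> PT" and t: "smax - 1 < trunc \<nu>"
  shows "pres \<nu> = ereal (trunc \<nu>)"
proof -
  have "- trlevel < htr trlevel \<nu>"
    using t fbound(2)[OF \<nu>] trlevel(2) unfolding trunc_def by linarith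
  then have "ereal (- trlevel) < max (ent \<nu>) (ereal (- trlevel))"
    by (simp add: htr(1)[OF invariant_prob[OF \<nu>] trlevel(1), symmetric])
  then have "ereal (htr trlevel \<nu>) = ent \<nu>"
    unfolding htr(1)[OF invariant_prob[OF \<nu>] trlevel(1)] by (simp add: max_def split: if_splits)
  then show ?thesis by (simp add: pres_def trunc_def add.commute flip: plus_ereal.simps(1))
qed

lemma trunc_le: "\<nu> \<in> PT \<Longrightarrow> trunc \<nu> \<le> smax"
  using smax(1)[of \<nu>] trunc_pres[of \<nu>] by (cases "smax - 1 < trunc \<nu>") auto

lemma trunc_MP: "\<nu> \<in> PT \<Longrightarrow> trunc \<nu> = smax \<Longrightarrow> \<nu> \<in> MP"
  using trunc_pres[of \<nu>] by (simp add: MP_def)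

lemma trunc_bound:
  assumes "\<nu> \<in> PT"
  shows "\<bar>trunc \<nu>\<bar> \<le> fbound + trlevel"
  using fbound(2)[OF assms] htr(2,3)[OF invariant_prob[OF assms] trlevel(1)] trlevel(1)
  unfolding trunc_def by linarith

lemma measurable_trunc [measurable]: "trunc \<in> borel_measurable inv_borel"
  unfolding trunc_def using measurable_htr[OF trlevel(1)] by measurable

lemma integrable_f: "\<mu> \<in> PT \<Longrightarrow> integrable (choquet_measure \<mu>) f"
  by (rule choquet_integrable[OF _ f_measurable fbound(2)])

lemma integrable_trunc: "\<mu> \<in> PT \<Longrightarrow> integrable (choquet_measure \<mu>) trunc"
  by (rule choquet_integrable[OF _ measurable_trunc trunc_bound])

lemma integrable_htr: "\<mu> \<in> PT \<Longrightarrow> integrable (choquet_measure \<mu>) (htr trlevel)"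
proof (rule choquet_integrable[OF _ measurable_htr[OF trlevel(1)]])
  show "\<bar>htr trlevel \<nu>\<bar> \<le> trlevel" if "\<nu> \<in> PT" for \<nu>
    using htr(2,3)[OF invariant_prob[OF that] trlevel(1)] by (simp add: abs_le_iff)
qed

lemma flat_le_trunc:
  assumes \<mu>: "\<mu> \<in> PT"
  shows "flat \<mu> \<le> ereal (\<integral>\<nu>. trunc \<nu> \<partial>choquet_measure \<mu>)"
proof -
  have "(\<integral>\<nu>. trunc \<nu> \<partial>choquet_measure \<mu>) = fint \<mu> + (\<integral>\<nu>. htr trlevel \<nu> \<partial>choquet_measure \<mu>)"
    unfolding trunc_def fint_def by (rule Bochner_Integration.integral_add[OF integrable_f[OF \<mu>] integrable_htr[OF \<mu>]])
  then show ?thesis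
    using add_left_mono[OF entropy_le_choquet_integral[OF \<mu> trlevel(1)], of "ereal (fint \<mu>)"] by (simp add: flat_def)
qed

lemma integral_trunc_le:
  assumes \<mu>: "\<mu> \<in> PT"
  shows "(\<integral>\<nu>. trunc \<nu> \<partial>choquet_measure \<mu>) \<le> smax"
proof -
  note ch = choquet_props[OF is_choquet_choquet_measure[OF \<mu>]]
  interpret prob_space "choquet_measure \<mu>" by (rule ch(1))
  show ?thesis by (rule integral_le_const[OF integrable_trunc[OF \<mu>]]) (use ch(3) trunc_le in auto)
qed

lemma flat_le: "\<mu> \<in> PT \<Longrightarrow> flat \<mu> \<le> ereal smax"
  using flat_le_trunc[of \<mu>] integral_trunc_le[of \<mu>] by (meson ereal_less_eq(3) order_trans)

lemma flat_maxD:
  assumes \<mu>: "\<mu> \<in> PT" and eq: "flat \<mu> = ereal smax"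
  shows "AE \<nu> in choquet_measure \<mu>. \<nu> \<in> MP"
proof -
  note ch = choquet_props[OF is_choquet_choquet_measure[OF \<mu>]]
  interpret prob_space "choquet_measure \<mu>" by (rule ch(1))
  have "(\<integral>\<nu>. trunc \<nu> \<partial>choquet_measure \<mu>) = smax"
    using flat_le_trunc[OF \<mu>] integral_trunc_le[OF \<mu>] by (simp add: eq)
  then have "(\<integral>\<nu>. smax - trunc \<nu> \<partial>choquet_measure \<mu>) = 0"
    using integrable_trunc[OF \<mu>] by (simp add: prob_space)
  moreover have "AE \<nu> in choquet_measure \<mu>. 0 \<le> smax - trunc \<nu>"
    using trunc_le ch(3) by (intro AE_I2) simp
  ultimately have "AE \<nu> in choquet_measure \<mu>. smax - trunc \<nu> = 0"
    using integral_nonneg_eq_0_iff_AE[of "choquet_measure \<mu>" "\<lambda>\<nu>. smax - trunc \<nu>"] integrable_trunc[OF \<mu>] by simp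
  moreover have "AE \<nu> in choquet_measure \<mu>. \<nu> \<in> PT" using ch(3) by (intro AE_I2) simp
  ultimately show ?thesis by eventually_elim (simp add: trunc_MP)
qed

text \<open>Here the entropy has to be bounded from below, and this is the elementary direction: for
  each test function the integral against \<mu> is the average of the integrals against the
  components, and almost every one of these is at least smax - f.\<close>

lemma flat_maxI:
  assumes \<mu>: "\<mu> \<in> PT" and ae: "AE \<nu> in choquet_measure \<mu>. \<nu> \<in> MP"
  shows "flat \<mu> = ereal smax"
proof (rule antisym)
  show "flat \<mu> \<le> ereal smax" by (rule flat_le[OF \<mu>])
  note ch = choquet_props[OF is_choquet_choquet_measure[OF \<mu>]]
  interpret prob_space "choquet_measure \<mu>" by (rule ch(1))
  have "ereal (smax - fint \<mu>) \<le> ent \<mu>"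
  proof (rule entropy_greatest[OF invariant_prob[OF \<mu>]])
    fix \<phi> assume \<phi>: "pos_fn \<phi>"
    have int: "integrable (choquet_measure \<mu>) (\<lambda>\<nu>. pr \<nu> (ell \<phi>))"
      by (rule choquet_integrable[OF \<mu> measurable_eval prob_abs_le[OF invariant_prob]])
    have "(\<integral>\<nu>. smax - f \<nu> \<partial>choquet_measure \<mu>) \<le> (\<integral>\<nu>. pr \<nu> (ell \<phi>) \<partial>choquet_measure \<mu>)"
    proof (rule integral_mono_AE)
      show "AE \<nu> in choquet_measure \<mu>. smax - f \<nu> \<le> pr \<nu> (ell \<phi>)"
        using ae
      proof eventually_elim
        case (elim \<nu>)
        then have \<nu>: "\<nu> \<in> PT" and "ent \<nu> + ereal (f \<nu>) = ereal smax"
          by (auto simp: MP_def pres_def)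
        then have "ent \<nu> = ereal (smax - f \<nu>)" by (cases "ent \<nu>") auto
        then show ?case using entropy_le[OF invariant_prob[OF \<nu>] \<phi>] by simp
      qed
    qed (use int integrable_f[OF \<mu>] in auto)
    then show "ereal (smax - fint \<mu>) \<le> ereal (pr \<mu> (ell \<phi>))"
      using integrable_f[OF \<mu>] by (simp add: ch(5)[of "ell \<phi>"] fint_def prob_space)
  qed
  then show "ereal smax \<le> flat \<mu>" unfolding flat_def by (cases "ent \<mu>") auto
qed

lemma flat_ergodic:
  assumes \<nu>: "\<nu> \<in> PE"
  shows "flat \<nu> = pres \<nu>"
proof -
  have "\<nu> \<in> space inv_borel" using \<nu> by (simp add: space_inv_borel ergodic_functionals_def)
  then have "fint \<nu> = f \<nu>"
    unfolding fint_def choquet_measure_ergodic[OF \<nu>] by (rule integral_return[OF _ f_measurable])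
  then show ?thesis by (simp add: flat_def pres_def add.commute)
qed

text \<open>The approximants are ergodic so that \<open>flat\<close> equals \<open>pres\<close>
  along them; along other sequences converging to \<mu>, \<open>fint\<close> need not converge to
  \<open>f \<mu>\<close>.\<close>

lemma MP_approx:
  assumes \<mu>: "\<mu> \<in> MP"
  shows "\<exists>u. (\<forall>n. u n \<in> PE) \<and> wlim u \<mu> \<and> (\<lambda>n. flat (u n)) \<longlonglongrightarrow> ereal smax"
proof -
  have \<mu>i: "\<mu> \<in> PT" and p: "pres \<mu> = ereal smax" using \<mu> by (auto simp: MP_def)
  then obtain k where k: "ent \<mu> = ereal k" "k + f \<mu> = smax"
    unfolding pres_def by (cases "ent \<mu>") auto
  then have "ent \<mu> \<noteq> - \<infinity>" by simp
  then obtain u where u: "\<And>n. u n \<in> PE" "\<And>n. ent \<mu> \<le> ent (u n)" "wlim u \<mu>"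
    using that by (rule entropy_dense_ergodic[OF \<mu>i])
  have ui: "u n \<in> PT" for n using u(1)[of n] by (simp add: ergodic_functionals_def)
  have "(\<lambda>n. flat (u n)) \<longlonglongrightarrow> ereal smax"
  proof (rule tendsto_sandwich)
    show "\<forall>\<^sub>F n in sequentially. ereal (k + f (u n)) \<le> flat (u n)"
    proof (intro always_eventually allI)
      show "ereal (k + f (u n)) \<le> flat (u n)" for n
        using add_right_mono[OF u(2)[of n], of "ereal (f (u n))"] by (simp add: flat_ergodic[OF u(1)] pres_def k)
    qed
    show "\<forall>\<^sub>F n in sequentially. flat (u n) \<le> ereal smax" by (intro always_eventually allI flat_le ui)
    have "(\<lambda>n. k + f (u n)) \<longlonglongrightarrow> k + f \<mu>" by (intro tendsto_add tendsto_const f_wlim ui u(3))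
    then show "(\<lambda>n. ereal (k + f (u n))) \<longlonglongrightarrow> ereal smax" by (simp add: k)
  qed simp
  with u show ?thesis by (intro exI[of _ u] conjI allI)
qed

lemma Sup_flat: "Sup (flat ` PT) = ereal smax"
proof (rule antisym)
  show "Sup (flat ` PT) \<le> ereal smax" by (rule SUP_least) (rule flat_le)
  obtain \<nu> where "\<nu> \<in> MP" using smax(2) by (auto simp: MP_def)
  from MP_approx[OF this] obtain u where u: "\<And>n. u n \<in> PE" "(\<lambda>n. flat (u n)) \<longlonglongrightarrow> ereal smax"
    by blast
  show "ereal smax \<le> Sup (flat ` PT)"
    by (rule LIMSEQ_le_const2[OF u(2)]) (use u(1) in \<open>auto simp: ergodic_functionals_def intro!: SUP_upper\<close>)
qed

section \<open>Maximizers and generalized maximizers of the flat functional\<close>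

definition EF :: "'a CSigma_dual set"
  where "EF = generalized_maximizers flat"

definition MF :: "'a CSigma_dual set"
  where "MF = maximizers flat"

lemma EF_iff: "\<mu> \<in> EF \<longleftrightarrow> \<mu> \<in> PT \<and>
  (\<exists>u. (\<forall>n. u n \<in> PT) \<and> wlim u \<mu> \<and> (\<lambda>n. flat (u n)) \<longlonglongrightarrow> ereal smax)"
  by (simp add: EF_def generalized_maximizers_def limitin_weak_star_iff Sup_flat)

lemma MF_iff: "\<mu> \<in> MF \<longleftrightarrow> \<mu> \<in> PT \<and> flat \<mu> = ereal smax"
  by (simp add: MF_def maximizers_def Sup_flat)

lemma MP_subset_EF: "MP \<subseteq> EF"
proof
  fix \<mu> assume \<mu>: "\<mu> \<in> MP"
  from MP_approx[OF this] obtain u where u: "\<forall>n. u n \<in> PE" "wlim u \<mu>" "(\<lambda>n. flat (u n)) \<longlonglongrightarrow> ereal smax"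
    by blast
  have "\<forall>n. u n \<in> PT" using u(1) by (simp add: ergodic_functionals_def)
  with u(2,3) \<mu> MP_inv show "\<mu> \<in> EF" unfolding EF_iff by (intro conjI exI[of _ u]) auto
qed

lemma MF_subset_EF: "MF \<subseteq> EF"
  by (auto simp: EF_iff MF_iff intro!: exI[of _ "\<lambda>_. _"] wlim_const)

text \<open>\<open>f\<close> is a continuous function on the compact image of \<open>coords\<close>.
  Tietze's theorem extends it to a bounded continuous function of all sequences, the form that
  \<open>choquet_integral_coords\<close> accepts.\<close>

lemma f_eq_cylindrical: "\<exists>H :: (nat \<Rightarrow> real) \<Rightarrow>\<^sub>C real. \<forall>\<nu>\<in>PT. app H (coords \<nu>) = f \<nu>"
proof -
  let ?inv = "PT :: 'a CSigma_dual set"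
  define c where "c x = (THE \<nu>. \<nu> \<in> ?inv \<and> coords \<nu> = x)" for x
  have c: "c (coords \<nu>) = \<nu>" if "\<nu> \<in> ?inv" for \<nu>
    unfolding c_def using that coords_inj[OF invariant_prob invariant_prob] by (intro the_equality) auto
  have cont: "continuous_on (coords ` ?inv) (\<lambda>x. f (c x))"
    unfolding continuous_on_sequentially o_def
  proof (intro allI ballI impI)
    fix x y assume y: "y \<in> coords ` ?inv" and "(\<forall>n. x n \<in> coords ` ?inv) \<and> x \<longlonglongrightarrow> y"
    then have x: "\<And>n. x n \<in> coords ` ?inv" "x \<longlonglongrightarrow> y" by auto
    have i: "c (x n) \<in> ?inv" and e: "coords (c (x n)) = x n" for n using x(1)[of n] c by auto
    have ey: "coords (c y) = y" using y c by auto
    have "wlim (\<lambda>n. c (x n)) (c y)" using x(2) wlim_coords_iff[OF invariant_prob[OF i]] by (simp add: e ey)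
    then show "(\<lambda>n. f (c (x n))) \<longlonglongrightarrow> f (c y)" by (rule f_wlim[OF i])
  qed
  have cl: "closed (coords ` ?inv)" by (rule closed_coords_image) auto
  obtain g where g: "continuous_on UNIV g" "\<And>x. x \<in> coords ` ?inv \<Longrightarrow> g x = f (c x)" "\<And>x. x \<in> UNIV \<Longrightarrow> norm (g x) \<le> fbound"
  proof (rule Tietze[OF cont, of UNIV fbound])
    show "closedin (top_of_set UNIV) (coords ` ?inv)" using cl by simp
    show "0 \<le> fbound" using fbound(1) by simp
    show "norm (f (c x)) \<le> fbound" if "x \<in> coords ` ?inv" for x using that fbound(2) c by auto
  qed (rule that)
  have "g \<in> bcontfun" using g(1,3) by (auto simp: bcontfun_def bounded_iff)
  then show ?thesis using g(2) c by (intro exI[of _ "Bcontfun g"]) (auto simp: Bcontfun_inverse)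
qed

text \<open>\<open>fint \<rho>\<close> is the limit of \<open>pr \<rho> (cyl H N)\<close>, which is
  linear in \<open>\<rho>\<close>.\<close>

lemma fint_combination:
  assumes \<mu>: "\<mu> \<in> PT" and \<nu>: "\<nu> \<in> PT" and ab: "0 \<le> a" "0 \<le> b" "a + b = 1"
  shows "fint (a *\<^sub>R \<mu> + b *\<^sub>R \<nu>) = a * fint \<mu> + b * fint \<nu>"
proof -
  obtain H :: "(nat \<Rightarrow> real) \<Rightarrow>\<^sub>C real" where H: "\<And>\<nu>. \<nu> \<in> PT \<Longrightarrow> app H (coords \<nu>) = f \<nu>"
    using f_eq_cylindrical by blast
  have lim: "(\<lambda>N. pr \<rho> (cyl H N)) \<longlonglongrightarrow> fint \<rho>" if \<rho>: "\<rho> \<in> PT" for \<rho>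
  proof -
    note ch = is_choquet_choquet_measure[OF \<rho>]
    have "(\<integral>\<nu>. app H (coords \<nu>) \<partial>choquet_measure \<rho>) = fint \<rho>"
      unfolding fint_def by (rule Bochner_Integration.integral_cong) (simp_all add: choquet_props(3)[OF ch] H)
    then show ?thesis using choquet_integral_coords[OF ch, of H] by simp
  qed
  have "a *\<^sub>R \<mu> + b *\<^sub>R \<nu> \<in> PT" by (rule convexD[OF invariant_convex \<mu> \<nu> ab])
  from lim[OF this] have "(\<lambda>N. a * pr \<mu> (cyl H N) + b * pr \<nu> (cyl H N)) \<longlonglongrightarrow> fint (a *\<^sub>R \<mu> + b *\<^sub>R \<nu>)"
    by (simp add: blinfun.add_left blinfun.scaleR_left)
  moreover have "(\<lambda>N. a * pr \<mu> (cyl H N) + b * pr \<nu> (cyl H N)) \<longlonglongrightarrow> a * fint \<mu> + b * fint \<nu>"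
    by (intro tendsto_intros lim \<mu> \<nu>)
  ultimately show ?thesis by (rule LIMSEQ_unique)
qed

lemma flat_concave:
  assumes \<mu>: "\<mu> \<in> PT" and \<nu>: "\<nu> \<in> PT" and ab: "0 \<le> a" "0 \<le> b" "a + b = 1"
    and c: "ereal c \<le> flat \<mu>" "ereal c \<le> flat \<nu>"
  shows "ereal c \<le> flat (a *\<^sub>R \<mu> + b *\<^sub>R \<nu>)"
proof -
  have *: "ereal (c - fint \<rho>) \<le> ent \<rho> \<longleftrightarrow> ereal c \<le> flat \<rho>" for \<rho>
    unfolding flat_def by (cases "ent \<rho>") auto
  have "ereal (a * (c - fint \<mu>) + b * (c - fint \<nu>)) \<le> ent (a *\<^sub>R \<mu> + b *\<^sub>R \<nu>)"
    using c by (intro entropy_concave invariant_prob \<mu> \<nu> ab) (simp_all add: *)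
  moreover have "a * (c - fint \<mu>) + b * (c - fint \<nu>) = c - fint (a *\<^sub>R \<mu> + b *\<^sub>R \<nu>)"
  proof -
    have "a * c + b * c = c" using ab(3) by (simp flip: distrib_right)
    then show ?thesis by (simp add: fint_combination[OF \<mu> \<nu> ab] algebra_simps)
  qed
  ultimately show ?thesis by (simp add: *)
qed

lemma MF_convex: "convex MF"
  unfolding convex_def
proof (intro ballI allI impI)
  fix \<mu> \<nu> and a b :: real assume "\<mu> \<in> MF" "\<nu> \<in> MF" and ab: "0 \<le> a" "0 \<le> b" "a + b = 1"
  then have i: "\<mu> \<in> PT" "\<nu> \<in> PT" "flat \<mu> = ereal smax" "flat \<nu> = ereal smax"
    by (auto simp: MF_iff)
  have c: "a *\<^sub>R \<mu> + b *\<^sub>R \<nu> \<in> PT" by (rule convexD[OF invariant_convex i(1,2) ab])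
  have "ereal smax \<le> flat (a *\<^sub>R \<mu> + b *\<^sub>R \<nu>)" by (rule flat_concave[OF i(1,2) ab]) (simp_all add: i)
  with flat_le[OF c] c show "a *\<^sub>R \<mu> + b *\<^sub>R \<nu> \<in> MF" by (simp add: MF_iff antisym)
qed

definition superlevel :: "nat \<Rightarrow> 'a CSigma_dual set"
  where "superlevel n = {\<nu> \<in> PT. ereal (smax - inverse (real (Suc n))) \<le> flat \<nu>}"

lemma superlevel_prob: "superlevel n \<subseteq> PP"
  by (auto simp: superlevel_def invariant_prob)

text \<open>In this form closedness is immediate, and convexity follows from that of the superlevel
  sets of the concave \<open>flat\<close>.\<close>

lemma EF_eq: "EF = (\<Inter>n. weak_star closure_of superlevel n)"
proof (intro equalityI subsetI)
  fix \<mu> assume "\<mu> \<in> EF"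
  then obtain u where u: "\<forall>n. u n \<in> PT" "wlim u \<mu>" "(\<lambda>n. flat (u n)) \<longlonglongrightarrow> ereal smax"
    by (auto simp: EF_iff)
  have "\<mu> \<in> weak_star closure_of superlevel n" for n
  proof -
    have "ereal (smax - inverse (real (Suc n))) < ereal smax" by simp
    from order_tendstoD(1)[OF u(3) this] obtain N where N: "\<And>k. N \<le> k \<Longrightarrow> ereal (smax - inverse (real (Suc n))) < flat (u k)"
      by (auto simp: eventually_sequentially)
    have "\<forall>k. u (k + N) \<in> superlevel n" using u(1) N by (auto simp: superlevel_def less_imp_le)
    moreover have "wlim (\<lambda>k. u (k + N)) \<mu>" by (rule wlim_subseq[OF u(2)]) (simp add: strict_mono_def)
    ultimately show ?thesis unfolding weak_star_closure_iff[OF superlevel_prob]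
      by (intro exI[of _ "\<lambda>k. u (k + N)"] conjI)
  qed
  then show "\<mu> \<in> (\<Inter>n. weak_star closure_of superlevel n)" by blast
next
  fix \<mu> assume "\<mu> \<in> (\<Inter>n. weak_star closure_of superlevel n)"
  then have cl: "\<mu> \<in> weak_star closure_of superlevel n" for n by blast
  have "\<forall>n. \<exists>v. v \<in> superlevel n \<and> (\<forall>j<n. \<bar>pr v (dense_fn j) - pr \<mu> (dense_fn j)\<bar> < inverse (real (Suc n)))"
  proof
    fix n
    obtain u where u: "\<forall>k. u k \<in> superlevel n" "wlim u \<mu>"
      using cl[of n] unfolding weak_star_closure_iff[OF superlevel_prob] by blast
    have "\<forall>\<^sub>F k in sequentially. \<bar>pr (u k) (dense_fn j) - pr \<mu> (dense_fn j)\<bar> < inverse (real (Suc n))" for j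
      using tendstoD[of "\<lambda>k. pr (u k) (dense_fn j)" _ sequentially "inverse (real (Suc n))"] u(2)
      by (simp add: wlim_def dist_real_def)
    then have "\<forall>\<^sub>F k in sequentially. \<forall>j\<in>{..<n}. \<bar>pr (u k) (dense_fn j) - pr \<mu> (dense_fn j)\<bar> < inverse (real (Suc n))"
      by (intro eventually_ball_finite) auto
    then obtain k where "\<forall>j\<in>{..<n}. \<bar>pr (u k) (dense_fn j) - pr \<mu> (dense_fn j)\<bar> < inverse (real (Suc n))"
      by (auto simp: eventually_sequentially)
    with u(1) show "\<exists>v. v \<in> superlevel n \<and> (\<forall>j<n. \<bar>pr v (dense_fn j) - pr \<mu> (dense_fn j)\<bar> < inverse (real (Suc n)))"
      by (intro exI[of _ "u k"]) auto
  qed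
  from choice[OF this] obtain v where v: "\<And>n. v n \<in> superlevel n"
    "\<And>n j. j < n \<Longrightarrow> \<bar>pr (v n) (dense_fn j) - pr \<mu> (dense_fn j)\<bar> < inverse (real (Suc n))"
    by blast
  have vi: "v n \<in> PT" and vf: "ereal (smax - inverse (real (Suc n))) \<le> flat (v n)" for n
    using v(1)[of n] by (auto simp: superlevel_def)
  have "wlim v \<mu>"
    by (rule wlim_of_close[OF invariant_prob[OF vi], where C=1]) (use v(2) in \<open>auto intro: less_imp_le\<close>)
  moreover have "(\<lambda>n. flat (v n)) \<longlonglongrightarrow> ereal smax"
  proof (rule tendsto_sandwich)
    show "\<forall>\<^sub>F n in sequentially. ereal (smax - inverse (real (Suc n))) \<le> flat (v n)" using vf by (intro always_eventually allI)
    show "\<forall>\<^sub>F n in sequentially. flat (v n) \<le> ereal smax" by (intro always_eventually allI flat_le vi)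
    have "(\<lambda>n. smax - inverse (real (Suc n))) \<longlonglongrightarrow> smax - 0" by (intro tendsto_diff tendsto_const LIMSEQ_inverse_real_of_nat)
    then show "(\<lambda>n. ereal (smax - inverse (real (Suc n)))) \<longlonglongrightarrow> ereal smax" by simp
  qed simp
  ultimately show "\<mu> \<in> EF"
    unfolding EF_iff using vi invariant_closed[of v \<mu>] by (intro conjI exI[of _ v]) auto
qed

lemma EF_closed: "closedin weak_star EF"
  unfolding EF_eq by (intro closedin_INT) auto

lemma closure_of_convex:
  fixes X :: "'a CSigma_dual set"
  assumes X: "X \<subseteq> PP" "convex X"
  shows "convex (weak_star closure_of X)"
  unfolding convex_def
proof (intro ballI allI impI)
  fix \<mu> \<nu> and a b :: real assume "\<mu> \<in> weak_star closure_of X" "\<nu> \<in> weak_star closure_of X" and ab: "0 \<le> a" "0 \<le> b" "a + b = 1"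
  then obtain u v where u: "\<forall>n. u n \<in> X" "wlim u \<mu>" and v: "\<forall>n. v n \<in> X" "wlim v \<nu>"
    unfolding weak_star_closure_iff[OF X(1)] by blast
  have "\<forall>n. a *\<^sub>R u n + b *\<^sub>R v n \<in> X" using u(1) v(1) by (intro allI convexD[OF X(2) _ _ ab]) auto
  moreover have "wlim (\<lambda>n. a *\<^sub>R u n + b *\<^sub>R v n) (a *\<^sub>R \<mu> + b *\<^sub>R \<nu>)"
    using u(2) v(2) unfolding wlim_def blinfun.add_left blinfun.scaleR_left by (intro allI tendsto_add tendsto_scaleR tendsto_const) auto
  ultimately show "a *\<^sub>R \<mu> + b *\<^sub>R \<nu> \<in> weak_star closure_of X"
    unfolding weak_star_closure_iff[OF X(1)] by (intro exI[of _ "\<lambda>n. a *\<^sub>R u n + b *\<^sub>R v n"] conjI)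
qed

lemma EF_convex: "convex EF"
  unfolding EF_eq
proof (rule convex_INT)
  fix n
  have "convex (superlevel n)"
    unfolding convex_def
  proof (intro ballI allI impI)
    fix \<mu> \<nu> and a b :: real assume "\<mu> \<in> superlevel n" "\<nu> \<in> superlevel n" and ab: "0 \<le> a" "0 \<le> b" "a + b = 1"
    then show "a *\<^sub>R \<mu> + b *\<^sub>R \<nu> \<in> superlevel n"
      unfolding superlevel_def by (auto intro!: flat_concave convexD[OF invariant_convex])
  qed
  then show "convex (weak_star closure_of superlevel n)" by (rule closure_of_convex[OF superlevel_prob])
qed

definition coMP :: "'a CSigma_dual set"
  where "coMP = weak_star closure_of (convex hull MP)"

lemma hull_MP: "convex hull MP \<subseteq> PT"
  by (rule hull_minimal[where S=convex, OF MP_inv invariant_convex])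

lemma hull_MP_prob: "convex hull MP \<subseteq> PP"
  using hull_MP by (auto simp: invariant_prob)

lemma coMP_subset_EF: "coMP \<subseteq> EF"
  unfolding coMP_def
  by (intro closure_of_minimal EF_closed hull_minimal[where S=convex] MP_subset_EF EF_convex)

lemma coMP_inv: "coMP \<subseteq> PT"
  using coMP_subset_EF by (auto simp: EF_iff)

lemma coMP_seq_closed:
  assumes u: "\<And>n. u n \<in> coMP" "wlim u \<nu>"
  shows "\<nu> \<in> coMP"
proof -
  have "coMP \<subseteq> PP" using coMP_inv invariant_prob by blast
  then have "\<nu> \<in> weak_star closure_of coMP" using u by (subst weak_star_closure_iff) auto
  then show ?thesis unfolding coMP_def by simp
qed

text \<open>A point outside the hull is separated from it by \<phi>, with a level c' strictly in
  between. Adding a small multiple of \<phi> - c' to the truncated pressure keeps it at most smax,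
  since otherwise violators would accumulate at a maximiser with \<phi> at least c'. Averaging over
  components carries the perturbed bound to \<open>flat\<close>, whose values near \<mu> are then
  bounded away from smax.\<close>

lemma EF_subset_coMP: "EF \<subseteq> coMP"
proof (rule subsetI, rule ccontr)
  fix \<mu> assume "\<mu> \<in> EF" and not: "\<mu> \<notin> coMP"
  then obtain u where u: "\<forall>n. u n \<in> PT" "wlim u \<mu>" "(\<lambda>n. flat (u n)) \<longlonglongrightarrow> ereal smax"
    by (auto simp: EF_iff)
  have sub: "MP \<subseteq> coMP"
    unfolding coMP_def by (rule order_trans[OF hull_subset closure_of_subset]) (simp add: strong_operator_topology_topspace)
  have K1: "coMP \<subseteq> PP" using coMP_inv invariant_prob by blast
  have K2: "convex coMP" unfolding coMP_def by (rule closure_of_convex[OF hull_MP_prob convex_convex_hull])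
  have K3: "coMP \<noteq> {}" using smax(2) sub by (auto simp: MP_def)
  have "\<exists>\<phi> c. (\<forall>\<nu>\<in>coMP. pr \<nu> \<phi> \<le> c) \<and> c < pr \<mu> \<phi>"
    by (rule weak_star_separation[OF K1 K2 K3 _ not]) (use coMP_seq_closed in blast)
  then obtain \<phi> c where c: "\<And>\<nu>. \<nu> \<in> coMP \<Longrightarrow> pr \<nu> \<phi> \<le> c" "c < pr \<mu> \<phi>" by blast
  define c' where "c' = (c + pr \<mu> \<phi>) / 2"
  have c': "c < c'" "c' < pr \<mu> \<phi>" using c(2) by (auto simp: c'_def field_simps)
  have "\<exists>k. \<forall>\<nu>\<in>PT. trunc \<nu> + inverse (real (Suc k)) * (pr \<nu> \<phi> - c') \<le> smax"
  proof (rule ccontr)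
    assume *: "\<not> ?thesis"
    then have "\<forall>k. \<exists>\<nu>. \<nu> \<in> PT \<and> smax < trunc \<nu> + inverse (real (Suc k)) * (pr \<nu> \<phi> - c')"
      by (metis linorder_not_le)
    from choice[OF this] obtain v where v: "\<And>k. v k \<in> PT"
      "\<And>k. smax < trunc (v k) + inverse (real (Suc k)) * (pr (v k) \<phi> - c')" by blast
    obtain r \<nu> where r: "strict_mono (r :: nat \<Rightarrow> nat)" "\<nu> \<in> PT" "wlim (\<lambda>n. v (r n)) \<nu>"
      using that by (rule invariant_seq_compact[OF v(1)])
    have ge: "c' \<le> pr (v k) \<phi>" for k
    proof (rule ccontr)
      assume "\<not> ?thesis"
      then have "inverse (real (Suc k)) * (pr (v k) \<phi> - c') \<le> 0" by (intro mult_nonneg_nonpos) auto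
      with v(2)[of k] trunc_le[OF v(1), of k] show False by linarith
    qed
    have tr: "(\<lambda>k. trunc (v k)) \<longlonglongrightarrow> smax"
    proof (rule tendsto_sandwich)
      define D where "D = norm \<phi> + \<bar>c'\<bar>"
      show "\<forall>\<^sub>F k in sequentially. smax - inverse (real (Suc k)) * D \<le> trunc (v k)"
      proof (intro always_eventually allI)
        fix k
        have "inverse (real (Suc k)) * (pr (v k) \<phi> - c') \<le> inverse (real (Suc k)) * D"
          using prob_abs_le[OF invariant_prob[OF v(1)], of k \<phi>] by (intro mult_left_mono) (auto simp: D_def)
        with v(2)[of k] show "smax - inverse (real (Suc k)) * D \<le> trunc (v k)" by linarith
      qed
      show "\<forall>\<^sub>F k in sequentially. trunc (v k) \<le> smax" by (intro always_eventually allI trunc_le v(1))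
      have "(\<lambda>k. smax - inverse (real (Suc k)) * D) \<longlonglongrightarrow> smax - 0 * D"
        by (intro tendsto_diff tendsto_mult tendsto_const LIMSEQ_inverse_real_of_nat)
      then show "(\<lambda>k. smax - inverse (real (Suc k)) * D) \<longlonglongrightarrow> smax" by simp
    qed simp
    have "\<nu> \<in> MP"
    proof (rule MP_closed[OF v(1) r(3)])
      have tr': "(\<lambda>n. trunc (v (r n))) \<longlonglongrightarrow> smax" using LIMSEQ_subseq_LIMSEQ[OF tr r(1)] by (simp add: o_def)
      have "\<forall>\<^sub>F n in sequentially. smax - 1 < trunc (v (r n))" by (rule order_tendstoD(1)[OF tr']) simp
      then have "\<forall>\<^sub>F n in sequentially. ereal (trunc (v (r n))) = pres (v (r n))"
        by eventually_elim (simp add: trunc_pres v(1))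
      then show "(\<lambda>n. pres (v (r n))) \<longlonglongrightarrow> ereal smax"
        by (rule Lim_transform_eventually[OF tendsto_ereal[OF tr']])
    qed
    then have "pr \<nu> \<phi> \<le> c" using sub c(1) by blast
    moreover have "c' \<le> pr \<nu> \<phi>"
      by (rule LIMSEQ_le_const[of "\<lambda>n. pr (v (r n)) \<phi>"]) (use r(3) ge in \<open>auto simp: wlim_def\<close>)
    ultimately show False using c'(1) by simp
  qed
  then obtain k where k: "\<And>\<nu>. \<nu> \<in> PT \<Longrightarrow> trunc \<nu> + inverse (real (Suc k)) * (pr \<nu> \<phi> - c') \<le> smax" by blast
  define t where "t = inverse (real (Suc k))"
  have t: "t > 0" by (simp add: t_def)
  have le: "flat \<nu> \<le> ereal (smax - t * (pr \<nu> \<phi> - c'))" if \<nu>: "\<nu> \<in> PT" for \<nu>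
  proof -
    note ch = choquet_props[OF is_choquet_choquet_measure[OF \<nu>]]
    interpret prob_space "choquet_measure \<nu>" by (rule ch(1))
    have int: "integrable (choquet_measure \<nu>) (\<lambda>\<nu>. pr \<nu> \<phi>)"
      by (rule choquet_integrable[OF \<nu> measurable_eval prob_abs_le[OF invariant_prob]])
    have "(\<integral>\<rho>. trunc \<rho> + t * (pr \<rho> \<phi> - c') \<partial>choquet_measure \<nu>) \<le> smax"
      by (rule integral_le_const) (use integrable_trunc[OF \<nu>] int k ch(3) in \<open>auto simp: t_def\<close>)
    then have "(\<integral>\<rho>. trunc \<rho> \<partial>choquet_measure \<nu>) + t * ((\<integral>\<rho>. pr \<rho> \<phi> \<partial>choquet_measure \<nu>) - c') \<le> smax"
      using integrable_trunc[OF \<nu>] int by (simp add: prob_space)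
    then have "(\<integral>\<rho>. trunc \<rho> \<partial>choquet_measure \<nu>) \<le> smax - t * (pr \<nu> \<phi> - c')"
      by (simp add: ch(5)[of \<phi>])
    then show ?thesis using flat_le_trunc[OF \<nu>] by (meson ereal_less_eq(3) order_trans)
  qed
  have "ereal smax \<le> ereal (smax - t * (pr \<mu> \<phi> - c'))"
  proof (rule LIMSEQ_le[OF u(3)])
    show "(\<lambda>n. ereal (smax - t * (pr (u n) \<phi> - c'))) \<longlonglongrightarrow> ereal (smax - t * (pr \<mu> \<phi> - c'))"
      using u(2) by (intro tendsto_ereal tendsto_diff tendsto_mult tendsto_const) (auto simp: wlim_def)
    show "\<exists>N. \<forall>n\<ge>N. flat (u n) \<le> ereal (smax - t * (pr (u n) \<phi> - c'))" using le u(1) by blast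
  qed
  then have "t * (pr \<mu> \<phi> - c') \<le> 0" by simp
  moreover have "0 < t * (pr \<mu> \<phi> - c')" using t c'(2) by simp
  ultimately show False by simp
qed

lemma EF_eq_coMP: "EF = coMP"
  using EF_subset_coMP coMP_subset_EF by (rule equalityI)

lemma hull_ergodic_subset_MF: "convex hull (MP \<inter> PE) \<subseteq> MF"
proof (rule hull_minimal[where S=convex])
  show "MP \<inter> PE \<subseteq> MF" by (auto simp: MF_iff MP_def flat_ergodic)
qed (rule MF_convex)

text \<open>The Choquet measures of the \<open>u n\<close> are carried by \<open>MP\<close>, whose
  image under \<open>coords\<close> is compact, so their images have a limit carried by the same
  compact set. Pulled back, it has barycenter \<mu>; as \<open>MP\<close> consists of ergodic
  functionals, it is the Choquet measure of \<mu>.\<close>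

lemma MF_closed:
  fixes u :: "nat \<Rightarrow> 'a CSigma_dual"
  assumes erg: "MP \<subseteq> PE" and u: "\<And>n. u n \<in> MF" and lim: "wlim u \<mu>"
  shows "\<mu> \<in> MF"
proof -
  have ui: "u n \<in> PT" and uf: "flat (u n) = ereal smax" for n using u[of n] by (auto simp: MF_iff)
  have \<mu>: "\<mu> \<in> PT" by (rule invariant_closed[OF ui lim])
  note ch = choquet_props[OF is_choquet_choquet_measure[OF ui]]
  define M where "M n = distr (choquet_measure (u n)) borel coords" for n
  define K where "K = coords ` MP"
  have K: "compact K" unfolding K_def by (rule compact_coords_image[OF MP_inv]) (rule MP_seq_closed)
  have Kb: "K \<in> sets borel" using compact_imp_closed[OF K] by (rule borel_closed)
  have mc: "coords \<in> borel_measurable (choquet_measure (u n))" for n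
    using measurable_coords measurable_cong_sets[OF ch(2) refl] by blast
  have M: "borel_prob (M n)" for n
    unfolding borel_prob_def M_def using prob_space.prob_space_distr[OF ch(1) mc] by simp
  have MK: "emeasure (M n) K = 1" for n
  proof -
    interpret prob_space "choquet_measure (u n)" by (rule ch(1))
    have "AE \<nu> in choquet_measure (u n). \<nu> \<in> coords -` K \<inter> space (choquet_measure (u n))"
      using flat_maxD[OF ui uf] AE_space by eventually_elim (auto simp: K_def)
    then have "emeasure (choquet_measure (u n)) (coords -` K \<inter> space (choquet_measure (u n))) = 1"
      using measurable_sets[OF mc Kb] by (simp add: emeasure_eq_1_AE)
    then show ?thesis by (simp add: M_def emeasure_distr[OF mc Kb])
  qed
  have "\<exists>r N. strict_mono (r :: nat \<Rightarrow> nat) \<and> borel_prob N \<and> emeasure N K = 1 \<and>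
    (\<forall>f :: (nat \<Rightarrow> real) \<Rightarrow>\<^sub>C real. (\<lambda>n. \<integral>x. app f x \<partial>M (r n)) \<longlonglongrightarrow> (\<integral>x. app f x \<partial>N))"
  proof (rule prokhorov_compact[OF K M MK])
    fix r :: "nat \<Rightarrow> nat" and N :: "(nat \<Rightarrow> real) measure"
    assume *: "strict_mono r" "borel_prob N" "emeasure N K = 1"
      "\<And>f :: (nat \<Rightarrow> real) \<Rightarrow>\<^sub>C real. (\<lambda>n. \<integral>x. app f x \<partial>M (r n)) \<longlonglongrightarrow> (\<integral>x. app f x \<partial>N)"
    show ?thesis by (rule exI[of _ r], rule exI[of _ N]) (intro conjI allI *)
  qed
  then obtain r N where r: "strict_mono (r :: nat \<Rightarrow> nat)" and N: "borel_prob N" and NK: "emeasure N K = 1"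
    and cv: "\<And>f :: (nat \<Rightarrow> real) \<Rightarrow>\<^sub>C real. (\<lambda>n. \<integral>x. app f x \<partial>M (r n)) \<longlonglongrightarrow> (\<integral>x. app f x \<partial>N)"
    by blast
  interpret N: prob_space N using N by (simp add: borel_prob_def)
  have sN: "sets N = sets borel" using N by (simp add: borel_prob_def)
  obtain \<nu>0 where \<nu>0: "\<nu>0 \<in> MP" using smax(2) by (auto simp: MP_def)
  \<comment> \<open>The inverse of \<open>coords\<close> on \<open>K\<close>. Off \<open>K\<close>,
    a null set of \<open>N\<close>, the default \<open>\<nu>0\<close> keeps all values in
    \<open>MP\<close>.\<close>
  define c where "c x = (if x \<in> K then (THE \<nu>. \<nu> \<in> MP \<and> coords \<nu> = x) else \<nu>0)" for x
  have c_coords: "c (coords \<nu>) = \<nu>" if "\<nu> \<in> MP" for \<nu>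
  proof -
    have "(THE \<nu>'. \<nu>' \<in> MP \<and> coords \<nu>' = coords \<nu>) = \<nu>"
      using that MP_inv coords_inj[OF invariant_prob invariant_prob] by (intro the_equality) auto
    then show ?thesis using that by (simp add: c_def K_def)
  qed
  have cMP: "c x \<in> MP" for x
  proof (cases "x \<in> K")
    case True
    then show ?thesis using c_coords by (auto simp: K_def)
  qed (simp add: c_def \<nu>0)
  have coords_c: "coords (c x) = (if x \<in> K then x else coords \<nu>0)" for x
    using c_coords by (auto simp: K_def) (simp add: c_def K_def)
  have ci: "c x \<in> PT" for x using cMP MP_inv by blast
  have cm: "c \<in> N \<rightarrow>\<^sub>M inv_borel"
  proof (rule measurable_into_inv_borel[OF ci])
    have "(\<lambda>x :: nat \<Rightarrow> real. if x \<in> K then x else coords \<nu>0) \<in> borel_measurable borel"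
      using Kb by (intro measurable_If_set) auto
    then show "(\<lambda>x. coords (c x)) \<in> borel_measurable N" by (simp add: coords_c borel_prob_measurable[OF N])
  qed
  have em: "(\<lambda>x. pr (c x) \<phi>) \<in> borel_measurable borel" for \<phi>
    using measurable_compose[OF cm measurable_eval] by (simp add: borel_prob_measurable[OF N])
  define \<xi> where "\<xi> = distr N inv_borel c"
  have bary_dense: "pr \<mu> (dense_fn j) = (\<integral>x. pr (c x) (dense_fn j) \<partial>N)" for j
  proof -
    define B where "B = norm (dense_fn j)"
    have B: "0 \<le> B" by (simp add: B_def)
    \<comment> \<open>The j-th coordinate, clipped to be bounded. On coordinates of invariant
      functionals the clipping is inactive.\<close>
    define H :: "(nat \<Rightarrow> real) \<Rightarrow>\<^sub>C real" where "H = Bcontfun (\<lambda>x. max (- B) (min B (x j)))"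
    have Hc: "(\<lambda>x :: nat \<Rightarrow> real. max (- B) (min B (x j))) \<in> bcontfun"
    proof -
      have "continuous_on UNIV (\<lambda>x :: nat \<Rightarrow> real. max (- B) (min B (x j)))"
        by (intro continuous_intros continuous_on_product_coordinates)
      moreover have "norm (max (- B) (min B (x j))) \<le> B" for x :: "nat \<Rightarrow> real" using B by (auto simp: abs_le_iff)
      ultimately show ?thesis unfolding bcontfun_def bounded_iff by auto
    qed
    have H: "app H x = max (- B) (min B (x j))" for x unfolding H_def Bcontfun_inverse[OF Hc] ..
    have Hcoords: "app H (coords \<nu>) = pr \<nu> (dense_fn j)" if "\<nu> \<in> PT" for \<nu>
      using prob_abs_le[OF invariant_prob[OF that], of "dense_fn j"] by (auto simp: H coords_def B_def abs_le_iff)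
    have "(\<integral>x. app H x \<partial>M n) = pr (u n) (dense_fn j)" for n
    proof -
      have "(\<integral>x. app H x \<partial>M n) = (\<integral>\<nu>. app H (coords \<nu>) \<partial>choquet_measure (u n))"
        unfolding M_def by (rule integral_distr[OF mc measurable_bcontfun])
      also have "\<dots> = (\<integral>\<nu>. pr \<nu> (dense_fn j) \<partial>choquet_measure (u n))"
        by (rule Bochner_Integration.integral_cong) (simp_all add: ch(3) Hcoords)
      finally show ?thesis by (simp add: ch(5)[of n "dense_fn j"])
    qed
    then have 1: "(\<lambda>n. pr (u (r n)) (dense_fn j)) \<longlonglongrightarrow> (\<integral>x. app H x \<partial>N)" using cv[of H] by simp
    have "(\<lambda>n. pr (u (r n)) (dense_fn j)) \<longlonglongrightarrow> pr \<mu> (dense_fn j)"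
      using wlim_subseq[OF lim r] by (simp add: wlim_def)
    from LIMSEQ_unique[OF this 1] have "pr \<mu> (dense_fn j) = (\<integral>x. app H x \<partial>N)" .
    also have "\<dots> = (\<integral>x. pr (c x) (dense_fn j) \<partial>N)"
    proof (rule integral_cong_AE)
      show "app H \<in> borel_measurable N" by (simp add: borel_prob_measurable[OF N] measurable_bcontfun)
      show "(\<lambda>x. pr (c x) (dense_fn j)) \<in> borel_measurable N" using em by (simp add: borel_prob_measurable[OF N])
      have "AE x in N. x \<in> K" using NK Kb by (intro N.AE_prob_1) (simp add: N.emeasure_eq_measure)
      then show "AE x in N. app H x = pr (c x) (dense_fn j)"
      proof eventually_elim
        case (elim x)
        then have "coords (c x) = x" by (simp add: coords_c)
        then show ?case using Hcoords[OF ci, of x] by simp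
      qed
    qed
    finally show ?thesis .
  qed
  have int: "integrable N (\<lambda>x. pr (c x) \<phi>)" for \<phi>
    by (rule borel_prob_integrable_bounded[OF N em]) (rule prob_abs_le[OF invariant_prob[OF ci]])
  have bary: "pr \<mu> \<phi> = (\<integral>x. pr (c x) \<phi> \<partial>N)" for \<phi>
  proof -
    have "\<bar>pr \<mu> \<phi> - (\<integral>x. pr (c x) \<phi> \<partial>N)\<bar> \<le> 0 + e" if e: "0 < e" for e
    proof -
      obtain j where j: "norm (\<phi> - dense_fn j) < e / 2" using dense_fn[of "e / 2" \<phi>] e by auto
      have "\<bar>pr \<mu> \<phi> - pr \<mu> (dense_fn j)\<bar> \<le> e / 2"
        using prob_close[OF invariant_prob[OF \<mu>], of \<phi> "dense_fn j"] j by linarith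
      moreover have "\<bar>(\<integral>x. pr (c x) \<phi> \<partial>N) - (\<integral>x. pr (c x) (dense_fn j) \<partial>N)\<bar> \<le> e / 2"
      proof (rule borel_prob_integral_close[OF N int int])
        have "\<bar>pr (c x) \<phi> - pr (c x) (dense_fn j)\<bar> \<le> e / 2" for x
          using prob_close[OF invariant_prob[OF ci], of x \<phi> "dense_fn j"] j by linarith
        then show "AE x in N. \<bar>pr (c x) \<phi> - pr (c x) (dense_fn j)\<bar> \<le> e / 2" by simp
      qed
      ultimately show ?thesis using bary_dense[of j] by linarith
    qed
    then have "\<bar>pr \<mu> \<phi> - (\<integral>x. pr (c x) \<phi> \<partial>N)\<bar> \<le> 0" by (rule field_le_epsilon)
    then show ?thesis by simp
  qed
  have "choquet_measure \<mu> = \<xi>"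
  proof (rule choquet_measureI)
    show "is_choquet_measure \<mu> \<xi>"
      unfolding is_choquet_measure_def
    proof (intro conjI allI)
      show "prob_space \<xi>" unfolding \<xi>_def by (rule N.prob_space_distr[OF cm])
      show "emeasure \<xi> PE = 1"
        unfolding \<xi>_def emeasure_distr[OF cm ergodic_measurable]
        using cMP erg N.emeasure_space_1 by (simp add: vimage_def subset_iff)
      show "pr \<mu> \<phi> = (\<integral>\<nu>. pr \<nu> \<phi> \<partial>\<xi>)" for \<phi>
        unfolding \<xi>_def integral_distr[OF cm measurable_eval] by (rule bary)
    qed (simp_all add: \<xi>_def space_inv_borel[unfolded inv_borel_def] inv_borel_def)
  qed
  moreover have "AE \<nu> in \<xi>. \<nu> \<in> MP"
  proof -
    have "MP \<in> sets inv_borel" by (rule seq_closed_measurable[OF MP_inv]) (rule MP_seq_closed)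
    then have "{\<nu> \<in> space inv_borel. \<nu> \<in> MP} \<in> sets inv_borel" by measurable
    then show ?thesis unfolding \<xi>_def using cMP by (subst AE_distr_iff[OF cm]) auto
  qed
  ultimately have "AE \<nu> in choquet_measure \<mu>. \<nu> \<in> MP" by (simp only:)
  from flat_maxI[OF \<mu> this] \<mu> show ?thesis by (simp add: MF_iff)
qed

lemma EF_eq_MF:
  assumes erg: "MP \<subseteq> PE"
  shows "EF = MF"
proof (rule equalityI[OF _ MF_subset_EF])
  have "MP \<inter> PE = MP" using erg by blast
  then have hull: "convex hull MP \<subseteq> MF" using hull_ergodic_subset_MF by simp
  show "EF \<subseteq> MF"
  proof
    fix \<mu> assume "\<mu> \<in> EF"
    then have "\<mu> \<in> weak_star closure_of (convex hull MP)" by (simp only: EF_eq_coMP coMP_def)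
    then obtain u where u: "\<forall>n. u n \<in> convex hull MP" "wlim u \<mu>"
      unfolding weak_star_closure_iff[OF hull_MP_prob] by (elim exE conjE)
    show "\<mu> \<in> MF" by (rule MF_closed[OF erg subsetD[OF hull spec[OF u(1)]] u(2)])
  qed
qed

end

section \<open>The given self-interactions as an instance and the Hoelder case\<close>

locale self_interaction = symbolic_space m \<eta> for m :: "'a::metric_space measure" and \<eta> +
  fixes \<theta>m :: "'a MS \<Rightarrow> 'x::real_normed_vector" and \<theta>p :: "'a MS \<Rightarrow> 'y::real_normed_vector"
    and gm :: "'x \<Rightarrow> real" and gp :: "'y \<Rightarrow> real"
  assumes lin: "linear \<theta>m" "linear \<theta>p" and sn: "sigma_normal \<theta>m" "sigma_normal \<theta>p"
    and cv: "convex_on UNIV gm" "convex_on UNIV gp"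
    and ct: "continuous_on UNIV gm" "continuous_on UNIV gp"
begin

definition energy :: "'a CSigma_dual \<Rightarrow> real"
  where "energy \<nu> = gp (\<theta>p (to_MS \<nu>)) - gm (\<theta>m (to_MS \<nu>))"

lemma interaction_wlim:
  fixes u :: "nat \<Rightarrow> 'a CSigma_dual"
  assumes u: "\<And>n. u n \<in> PT" "wlim u \<mu>"
  shows "(\<lambda>n. gm (\<theta>m (to_MS (u n)))) \<longlonglongrightarrow> gm (\<theta>m (to_MS \<mu>))" "(\<lambda>n. gp (\<theta>p (to_MS (u n)))) \<longlonglongrightarrow> gp (\<theta>p (to_MS \<mu>))"
  using theta_wlim[OF sn(1) invariant_prob[OF u(1)] u(2)] theta_wlim[OF sn(2) invariant_prob[OF u(1)] u(2)]
  by (auto intro: continuous_on_tendsto_compose[OF ct(1)] continuous_on_tendsto_compose[OF ct(2)])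

sublocale variational m \<eta> energy
  by standard (unfold energy_def, intro tendsto_diff interaction_wlim)

lemma pressure_eq: "pressure_fn m \<theta>m \<theta>p gm gp = pres"
proof
  show "pressure_fn m \<theta>m \<theta>p gm gp \<nu> = pres \<nu>" for \<nu>
    by (cases "ent \<nu>") (simp_all add: pressure_fn_def pres_def energy_def)
qed

text \<open>Each of the two interactions is weak*-continuous by itself, hence bounded and
  integrable, so the two integrals may be merged into one; restricting them to ergodic functionals
  changes nothing, as the Choquet measure is carried by these.\<close>

lemma F_flat_eq:
  assumes \<mu>: "\<mu> \<in> PT"
  shows "F_flat m \<theta>m \<theta>p gm gp \<mu> = flat \<mu>"
proof -
  note ch = choquet_props[OF is_choquet_choquet_measure[OF \<mu>]]
  have int: "integrable (choquet_measure \<mu>) g"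
    if g: "\<And>u \<nu>. (\<And>n. u n \<in> PT) \<Longrightarrow> wlim u \<nu> \<Longrightarrow> (\<lambda>n. g (u n)) \<longlonglongrightarrow> g \<nu>" for g :: "'a CSigma_dual \<Rightarrow> real"
  proof -
    have "\<exists>B>0. \<forall>\<nu>\<in>PT. \<bar>g \<nu>\<bar> \<le> B" by (rule wlim_continuous_bounded) (rule g)
    then obtain B where B: "\<And>\<nu>. \<nu> \<in> PT \<Longrightarrow> \<bar>g \<nu>\<bar> \<le> B" by blast
    have "g \<in> borel_measurable inv_borel" by (rule seq_continuous_measurable) (rule g)
    then show ?thesis by (rule choquet_integrable[OF \<mu> _ B])
  qed
  have i: "integrable (choquet_measure \<mu>) (\<lambda>\<nu>. gm (\<theta>m (to_MS \<nu>)))" "integrable (choquet_measure \<mu>) (\<lambda>\<nu>. gp (\<theta>p (to_MS \<nu>)))"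
    by (rule int, rule interaction_wlim, assumption+)+
  have set: "(LINT \<nu>:PE|choquet_measure \<mu>. g \<nu>) = (\<integral>\<nu>. g \<nu> \<partial>choquet_measure \<mu>)"
    if g: "integrable (choquet_measure \<mu>) g" for g :: "'a CSigma_dual \<Rightarrow> real"
    unfolding set_lebesgue_integral_def
  proof (rule integral_cong_AE)
    have "PE \<in> sets (choquet_measure \<mu>)" using ergodic_measurable by (simp add: ch(2))
    then show "(\<lambda>\<nu>. indicat_real PE \<nu> *\<^sub>R g \<nu>) \<in> borel_measurable (choquet_measure \<mu>)"
      using borel_measurable_integrable[OF g] by measurable
    show "AE \<nu> in choquet_measure \<mu>. indicat_real PE \<nu> *\<^sub>R g \<nu> = g \<nu>"
      using ch(4) by eventually_elim simp
  qed (rule borel_measurable_integrable[OF g])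
  have "fint \<mu> = (\<integral>\<nu>. gp (\<theta>p (to_MS \<nu>)) \<partial>choquet_measure \<mu>) - (\<integral>\<nu>. gm (\<theta>m (to_MS \<nu>)) \<partial>choquet_measure \<mu>)"
    unfolding fint_def energy_def by (rule Bochner_Integration.integral_diff[OF i(2,1)])
  then show ?thesis by (simp add: F_flat_def flat_def set i)
qed

text \<open>A subgradient of \<open>g\<^sub>+\<close> at a maximiser linearises the convex part of the pressure from below;
  the sandwich theorem then separates the resulting concave functional from \<open>g\<^sub>-\<close>.\<close>

lemma maximizer_equilibrium:
  assumes \<mu>: "\<mu> \<in> MP"
  shows "\<exists>x y. \<forall>\<nu>\<in>PT. ent \<nu> + ereal (pr \<nu> (Theta \<theta>m \<theta>p x y)) \<le>
    ent \<mu> + ereal (pr \<mu> (Theta \<theta>m \<theta>p x y))"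
proof -
  let ?a = "\<lambda>\<nu>. \<theta>p (to_MS \<nu>)" let ?b = "\<lambda>\<nu>. \<theta>m (to_MS \<nu>)"
  have \<mu>i: "\<mu> \<in> PT" and p: "pres \<mu> = ereal smax" using \<mu> by (auto simp: MP_def)
  then obtain k where k: "ent \<mu> = ereal k" "k + energy \<mu> = smax"
    unfolding pres_def by (cases "ent \<mu>") auto
  obtain y :: "'y \<Rightarrow>\<^sub>L real" where y: "\<And>z. gp (?a \<mu>) + (pr y z - pr y (?a \<mu>)) \<le> gp z"
    using subgradient_exists[OF cv(2) ct(2), of "?a \<mu>"] by blast
  \<comment> \<open>The constant for which \<open>gm\<close> plus T lies above \<open>G\<close> and
    touches it at the point given by \<open>\<mu>\<close>.\<close>
  define T where "T = k + pr y (?a \<mu>) - gm (?b \<mu>)"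
  \<comment> \<open>The hypograph, over the values of \<open>\<theta>m\<close>, of the entropy plus
    the linearised convex part. Concavity of the entropy and linearity of both maps make it convex,
    so the separation takes place in the space of \<open>gm\<close>.\<close>
  define G where "G = {(w, t). \<exists>\<nu>\<in>PT. w = ?b \<nu> \<and> ereal (t - pr y (?a \<nu>)) \<le> ent \<nu>}"
  have G_le: "t \<le> gm w + T" if wt: "(w, t) \<in> G" for w t
  proof -
    obtain \<nu> where \<nu>: "\<nu> \<in> PT" "w = ?b \<nu>" "ereal (t - pr y (?a \<nu>)) \<le> ent \<nu>"
      using wt by (auto simp: G_def)
    have "ereal (t - pr y (?a \<nu>)) + ereal (energy \<nu>) \<le> ereal smax"
      using add_right_mono[OF \<nu>(3), of "ereal (energy \<nu>)"] smax(1)[OF \<nu>(1)] unfolding pres_def by (rule order_trans)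
    then have "t - pr y (?a \<nu>) + energy \<nu> \<le> k + energy \<mu>" using k(2) by simp
    then show ?thesis using y[of "?a \<nu>"] unfolding energy_def T_def \<nu>(2) by linarith
  qed
  have G_convex: "convex G"
    unfolding convex_def
  proof (intro ballI allI impI)
    fix g g' and a b :: real assume g: "g \<in> G" "g' \<in> G" and ab: "0 \<le> a" "0 \<le> b" "a + b = 1"
    obtain w t w' t' where eq: "g = (w, t)" "g' = (w', t')" by (cases g; cases g')
    obtain \<nu> where \<nu>: "\<nu> \<in> PT" "w = ?b \<nu>" "ereal (t - pr y (?a \<nu>)) \<le> ent \<nu>"
      using g(1) by (auto simp: G_def eq)
    obtain \<rho> where \<rho>: "\<rho> \<in> PT" "w' = ?b \<rho>" "ereal (t' - pr y (?a \<rho>)) \<le> ent \<rho>"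
      using g(2) by (auto simp: G_def eq)
    let ?s = "a *\<^sub>R \<nu> + b *\<^sub>R \<rho>"
    have "ereal (a * (t - pr y (?a \<nu>)) + b * (t' - pr y (?a \<rho>))) \<le> ent ?s"
      by (rule entropy_concave[OF invariant_prob[OF \<nu>(1)] invariant_prob[OF \<rho>(1)] ab \<nu>(3) \<rho>(3)])
    moreover have "a * (t - pr y (?a \<nu>)) + b * (t' - pr y (?a \<rho>)) = (a * t + b * t') - pr y (?a ?s)"
      by (simp add: theta_combination[OF lin(2)] blinfun.add_right blinfun.scaleR_right algebra_simps)
    moreover have "a *\<^sub>R w + b *\<^sub>R w' = ?b ?s" by (simp add: theta_combination[OF lin(1)] \<nu>(2) \<rho>(2))
    moreover have "?s \<in> PT" by (rule convexD[OF invariant_convex \<nu>(1) \<rho>(1) ab])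
    ultimately show "a *\<^sub>R g + b *\<^sub>R g' \<in> G" unfolding G_def eq by (auto intro!: bexI[of _ ?s])
  qed
  have "(?b \<mu>, k + pr y (?a \<mu>)) \<in> G" using \<mu>i k by (auto simp: G_def)
  then have ne: "G \<noteq> {}" by blast
  have "convex_on UNIV (\<lambda>z. gm z + T)" by (intro convex_on_add cv(1)) (simp add: convex_on_def flip: distrib_right)
  moreover have "continuous_on UNIV (\<lambda>z. gm z + T)" by (intro continuous_intros ct(1))
  ultimately have "\<exists>(x :: 'x \<Rightarrow>\<^sub>L real) c. (\<forall>w t. (w, t) \<in> G \<longrightarrow> t \<le> pr x w + c) \<and>
    (\<forall>z. pr x z + c \<le> gm z + T)"
    by (rule convex_concave_sandwich[OF G_convex ne]) (rule G_le)
  then obtain x :: "'x \<Rightarrow>\<^sub>L real" and c where x: "\<And>w t. (w, t) \<in> G \<Longrightarrow> t \<le> pr x w + c"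
    "\<And>z. pr x z + c \<le> gm z + T" by blast
  have "ent \<nu> + ereal (pr \<nu> (Theta \<theta>m \<theta>p x y)) \<le>
    ent \<mu> + ereal (pr \<mu> (Theta \<theta>m \<theta>p x y))" if \<nu>: "\<nu> \<in> PT" for \<nu>
  proof (cases "ent \<nu>")
    case (real h)
    have "(?b \<nu>, h + pr y (?a \<nu>)) \<in> G" using \<nu> real by (auto simp: G_def)
    \<comment> \<open>The sandwich is tight at \<open>\<mu>\<close>: by the choice of
      \<open>T\<close>, the upper bound there is exactly k plus the y-part at
      \<open>\<mu>\<close>.\<close>
    from x(1)[OF this] x(2)[of "?b \<mu>"] show ?thesis
      by (simp add: Theta[OF lin sn invariant_prob] \<nu> \<mu>i real k(1) T_def)
  qed (use entropy_nonpos[OF invariant_prob[OF \<nu>]] in auto)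
  then show ?thesis by blast
qed

text \<open>The exponent depends on the maximiser through its functionals x and y, so the Hoelder
  setting is entered separately for each maximiser.\<close>

lemma MP_ergodic:
  assumes hol: "holder_type \<eta> \<theta>m \<theta>p"
  shows "MP \<subseteq> PE"
proof
  fix \<mu> assume \<mu>: "\<mu> \<in> MP"
  obtain x y where xy: "\<forall>\<nu>\<in>PT. ent \<nu> + ereal (pr \<nu> (Theta \<theta>m \<theta>p x y)) \<le>
    ent \<mu> + ereal (pr \<mu> (Theta \<theta>m \<theta>p x y))"
    using maximizer_equilibrium[OF \<mu>] by blast
  obtain \<alpha> where \<alpha>: "\<alpha> \<in> {0<..1}" "Theta \<theta>m \<theta>p x y \<in> holder_functions \<eta> \<alpha>"
    using hol unfolding holder_type_def by blast
  interpret holder_exponent m \<eta> \<alpha> by standard (use \<alpha> in auto)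
  obtain C where "hol C (Theta \<theta>m \<theta>p x y)"
    using \<alpha>(2) unfolding holder_functions_def hol_def gauge_def by blast
  then show "\<mu> \<in> PE"
    by (rule equilibrium_ergodic) (use xy \<mu> MP_inv in \<open>auto simp: equilibrium_def\<close>)
qed

end

lemma maximizers_cong:
  assumes "\<And>\<mu>. \<mu> \<in> PT \<Longrightarrow> \<Phi> \<mu> = \<Psi> \<mu>"
  shows "maximizers \<Phi> = maximizers \<Psi>" "generalized_maximizers \<Phi> = generalized_maximizers \<Psi>"
proof -
  have S: "\<Phi> ` PT = \<Psi> ` PT" using assms by (rule image_cong[OF refl])
  show "maximizers \<Phi> = maximizers \<Psi>"
    unfolding maximizers_def S by (intro Collect_cong conj_cong refl) (simp only: assms)
  have e: "(\<lambda>n. \<Phi> (u n)) = (\<lambda>n. \<Psi> (u n))" if "\<forall>n. u n \<in> PT" for u :: "nat \<Rightarrow> _"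
    by (rule ext, rule assms) (rule spec[OF that])
  show "generalized_maximizers \<Phi> = generalized_maximizers \<Psi>"
    unfolding generalized_maximizers_def S by (intro Collect_cong conj_cong refl ex_cong1) (simp only: e simp_thms)
qed

theorem corollary2p22:
  fixes m :: "'a::metric_space measure"
    and \<eta> :: real
    and \<theta>m :: "'a MS \<Rightarrow> 'x::real_normed_vector"
    and \<theta>p :: "'a MS \<Rightarrow> 'y::real_normed_vector"
    and gm :: "'x \<Rightarrow> real"
    and gp :: "'y \<Rightarrow> real"
  assumes "compact (UNIV :: 'a set)"
    and "\<forall>x y :: 'a. dist x y \<le> 1" and "\<exists>x y :: 'a. dist x y = 1"
    and "prob_space m" and "sets m = sets borel"
    and "\<forall>U. open U \<and> U \<noteq> {} \<longrightarrow> emeasure m U > 0"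
    and "0 < \<eta>" and "\<eta> < 1"
    and "linear \<theta>m" and "sigma_normal \<theta>m"
    and "linear \<theta>p" and "sigma_normal \<theta>p"
    and "continuous_on UNIV gm" and "convex_on UNIV gm"
    and "\<exists>R0>0. \<forall>R\<ge>R0. {x. norm x \<le> R \<and> conjugate gm x < \<infinity>} \<noteq> {} \<and>
      closedin weak_star {x. norm x \<le> R \<and> conjugate gm x < \<infinity>}"
    and "minimal_linear_growth (onorm \<theta>m) (conjugate gm)"
    and "continuous_on UNIV gp" and "convex_on UNIV gp"
    and "\<forall>B. bounded B \<longrightarrow> bounded (gp ` B)"
    and "range (conjugate gp) \<subseteq> range ereal"
    and "minimal_linear_growth (onorm \<theta>p) (conjugate gp)"
  shows "let P = pressure_fn m \<theta>m \<theta>p gm gp; F = F_flat m \<theta>m \<theta>p gm gp in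
    convex hull (generalized_maximizers P \<inter> ergodic_functionals) \<subseteq> maximizers F \<and>
    maximizers F \<subseteq> weak_star closure_of (convex hull (generalized_maximizers P)) \<and>
    weak_star closure_of (convex hull (generalized_maximizers P)) = generalized_maximizers F \<and>
    (holder_type \<eta> \<theta>m \<theta>p \<longrightarrow> generalized_maximizers F = maximizers F)"
proof -
  interpret self_interaction m \<eta> \<theta>m \<theta>p gm gp
  proof (rule self_interaction.intro)
    show "symbolic_space m \<eta>"
      by (rule symbolic_space.intro)
        (rule assms assms(2)[rule_format] assms(6)[rule_format], (intro conjI; assumption)?)+
    show "self_interaction_axioms \<theta>m \<theta>p gm gp"
      by (rule self_interaction_axioms.intro) (rule assms)+
  qed
  have F: "maximizers (F_flat m \<theta>m \<theta>p gm gp) = MF" "generalized_maximizers (F_flat m \<theta>m \<theta>p gm gp) = EF"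
    unfolding MF_def EF_def by (rule maximizers_cong[OF F_flat_eq], assumption)+
  show ?thesis
    unfolding Let_def F pressure_eq generalized_maximizers_pres coMP_def[symmetric]
    using hull_ergodic_subset_MF MF_subset_EF EF_eq_MF[OF MP_ergodic]
    by (intro conjI impI) (simp_all only: EF_eq_coMP)
qed

end
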